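(* Assume the following. (1) For every $i\in I$ there is a probability measure $\mu_i$ on $E_i$ such that for all $h\in\mathcal A_i$ and all $x_i\in E_i$, $\lim_{t\to\infty}\frac1t\int_0^t h(X_s)\,ds=\mu_i(h)$ $\mathbf P_{x_i}$-almost surely. (2) For every $t\ge 0$ and $x\in E$, the family $\big(\frac1n\int_0^{nt}b(X_s)\,ds\big)_{n\ge1}$ is uniformly integrable under $\mathbf P_x$. (3) For all $j\in I$, $y\in\mathbb R^d$, $x_j\in E_j$ and $S>0$, $\ \sup_{t>0}\mathbf E_{x_j}\Big[\Big|\frac1S\int_t^{t+S}F_j(y,X_{ns})\,ds-\bar F_j(y)\Big|\Big]\to0$ as $n\to\infty$. (4) For all $j\in I$, $M_j:=\sup_{x\in E_j}|F_j(0,x)|<\infty$. (5) For all $j\in I$, $L_j:=\sup_{x\in E_j}\|F_j(\cdot,x)\|_{\mathrm{Lip}}<\infty$. Let $z\in\mathbb R^d$, $i\in I$, $x_i\in E_i$ and $T>0$. Then for all $\varphi\in C_b^1(\mathbb R^d)$ and all $k\ge1$, $$\mathbf E_{x_i}\big[\varphi(\mathbf Z_T^{n,z})\,\mathbf 1_{\{T\le\tau_k^n\}}\big]\underset{n\to\infty}{\longrightarrow}\mathbf E_{x_i}\big[\varphi(\bar{\mathbf Z}_T^{z})\,\mathbf 1_{\{T\le\tau_k\}}\big].$$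
   Context: State space. $(I,\mathcal I)$ is a measurable space, $(E_i,\mathcal E_i)_{i\in I}$ are measurable spaces, $E=\bigsqcup_{i\in I}E_i$ has the $\sigma$-algebra of sets $S$ with $S\cap E_i\in\mathcal E_i$ for all $i$, and $\phi:E\to I$ is the index map, $\phi(x)=i$ iff $x\in E_i$. All maps and kernels below are implicitly measurable so that the objects are well defined. Base process. $X=(X_t)_{t\ge0}$ is a progressively measurable $E$-valued process with a family of laws $(\mathbf P_x)_{x\in E}$ ($X$ starts from $x$ under $\mathbf P_x$), not necessarily Markov, with $\mathbf P_{x}(X_t\in E_i\ \forall t\ge0)=1$ for all $i\in I$, $x\in E_i$. Data. $G:\mathbb R_+\to[0,1]$ is an absolutely continuous cumulative distribution function; $b:E\to[0,\infty)$ is measurable with $\int_{0+}b(X_t)\,dt<\infty$ $\mathbf P_x$-a.s. for all $x$; $\pi$ is a probability transition kernel from $E$ to $E$. Accelerated process. For $n\ge1$, the process $\mathbf X^n$ on $E\cup\{\Delta\}$ ($\Delta$ a cemetery) with transition times $0=\tau_0^n<\tau_1^n<\cdots$ is built by piecing out: given $\mathbf X^n_{\tau_k^n}=y$, and independently of the past, $(\mathbf X^n_{\tau_k^n+t})_{0\le t<\tau_{k+1}^n-\tau_k^n}$ is distributed as $(X_{nt})_{0\le t<\sigma^n}$ under $\mathbf P_y$, where $\sigma^n=\inf\{t\ge0: G(\int_0^t b(X_{ns})\,ds)\ge U\}$ with $U$ uniform on $[0,1]$ independent of $X$ ($\inf\emptyset=\infty$); at time $\tau_{k+1}^n<\infty$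 the new position is drawn from $\pi(\mathbf X^n_{\tau_{k+1}^n-},\cdot)$, where $\mathbf X^n_{\tau_{k+1}^n-}$ is the position $X_{n\sigma^n}$ reached by that piece. The process is sent to $\Delta$ at $\tau_\infty^n=\lim_k\tau_k^n$. Set $\mathbf I_t^n=\phi(\mathbf X_t^n)$. Under $\mathbf P_x$, $\mathbf X^n$ starts from $x$. Slow equation. $(F_i)_{i\in I}$ are measurable functions $\mathbb R^d\times E\to\mathbb R^d$; $\mathbf Z^{n,z}$ is the continuous adapted solution (up to $\tau_\infty^n$) of $\frac{d}{dt}\mathbf Z_t^{n,z}=F_{\mathbf I_t^n}(\mathbf Z_t^{n,z},\mathbf X_t^n)$, $\mathbf Z_0^{n,z}=z$ (integral form). Limit. $\mathcal A_i$ is the set of $f\in L^1(\mu_i)$ with $\mathbf P_x(\int_0^t|f(X_s)|\,ds<\infty)=1$ for all $x\in E_i$, $t\ge0$; $\mu_i(h)=\int h\,d\mu_i$; $\bar F_i(z)=\int_{E_i}F_i(z,x)\,\mu_i(dx)$. The limiting index process $(\mathbf I_t)$ is an $I$-valued pure jump semi-Markov process with transition times $0=\tau_0<\tau_1<\cdots$: given $\mathbf I_{\tau_k}=j$ and independently of the past, $\tau_{k+1}-\tau_k$ is distributed as $\inf\{t>0:G(t\mu_j(b))\ge U\}$, $U$ uniform on $[0,1]$ ($=\infty$ if $\mu_j(b)=0$), and, if $\mu_j(b)>0$, independently the next state has law $P(j,J)=\int_{E_j}\frac{\mu_j(dx)}{\mu_j(b)}b(x)\,\pi(x,\phi^{-1}(J))$,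 $J\in\mathcal I$. It is sent to a cemetery at $\tau_\infty=\lim_k\tau_k$. Under $\mathbf P_x$, $\mathbf I_0=\phi(x)$. $\bar{\mathbf Z}^z$ solves (up to $\tau_\infty$) $\frac{d}{dt}\bar{\mathbf Z}_t^z=\bar F_{\mathbf I_t}(\bar{\mathbf Z}_t^z)$, $\bar{\mathbf Z}_0^z=z$. $C_b^1(\mathbb R^d)$: bounded $C^1$ real functions with bounded gradient. $\|\cdot\|_{\mathrm{Lip}}$ is the Lipschitz constant. *)

theory Defs
  imports "HOL-Probability.Probability"
begin

text \<open>
  The disjoint union \<open>E\<close> is the union of the carriers \<open>space (fibre D i)\<close>; the field
  \<open>index_map\<close> is \<open>\<phi>\<close>, and requiring it to be \<open>i\<close> on the \<open>i\<close>-th carrier makes the union disjoint.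
  The process is indexed by all reals, but only its values at nonnegative times are used.
\<close>

record ('i, 'e, 'w) accel_data =
  index_space :: "'i measure"
  fibre :: "'i \<Rightarrow> 'e measure"
  index_map :: "'e \<Rightarrow> 'i"
  base_space :: "'w measure"
  base_filt :: "real \<Rightarrow> 'w measure"
  base_proc :: "real \<Rightarrow> 'w \<Rightarrow> 'e"
  base_law :: "'e \<Rightarrow> 'w measure"
  clock_cdf :: "real \<Rightarrow> real"
  rate :: "'e \<Rightarrow> real"
  jump :: "'e \<Rightarrow> 'e measure"

definition state_space :: "('i, 'e, 'w) accel_data \<Rightarrow> 'e measure" where
  "state_space D =
     (let E = (\<Union>i\<in>space (index_space D). space (fibre D i))
      in sigma E {S. S \<subseteq> E \<and>
           (\<forall>i\<in>space (index_space D). S \<inter> space (fibre D i) \<in> sets (fibre D i))})"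

definition progressively_measurable ::
    "(real \<Rightarrow> 'w measure) \<Rightarrow> 'e measure \<Rightarrow> (real \<Rightarrow> 'w \<Rightarrow> 'e) \<Rightarrow> bool" where
  "progressively_measurable \<F> E X \<longleftrightarrow>
     (\<forall>t\<ge>0. (\<lambda>(s, w). X s w) \<in> restrict_space borel {0..t} \<Otimes>\<^sub>M \<F> t \<rightarrow>\<^sub>M E)"

definition abs_cont_cdf :: "(real \<Rightarrow> real) \<Rightarrow> bool" where
  "abs_cont_cdf G \<longleftrightarrow>
     (\<exists>N. real_distribution N \<and> absolutely_continuous lborel N \<and> measure N {..<0} = 0 \<and>
          (\<forall>t\<ge>0. G t = cdf N t))"

definition accel_setting :: "('i, 'e, 'w) accel_data \<Rightarrow> bool" where
  "accel_setting D \<longleftrightarrow>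
     (\<forall>i\<in>space (index_space D). \<forall>x\<in>space (fibre D i). index_map D x = i) \<and>
     filtration (space (base_space D)) (base_filt D) \<and>
     (\<forall>t. subalgebra (base_space D) (base_filt D t)) \<and>
     progressively_measurable (base_filt D) (state_space D) (base_proc D) \<and>
     base_law D \<in> state_space D \<rightarrow>\<^sub>M prob_algebra (base_space D) \<and>
     (\<forall>x\<in>space (state_space D). AE w in base_law D x. base_proc D 0 w = x) \<and>
     (\<forall>i\<in>space (index_space D). \<forall>x\<in>space (fibre D i).
        AE w in base_law D x. \<forall>t\<ge>0. base_proc D t w \<in> space (fibre D i)) \<and>
     abs_cont_cdf (clock_cdf D) \<and>
     rate D \<in> borel_measurable (state_space D) \<and>
     (\<forall>x\<in>space (state_space D). 0 \<le> rate D x) \<and>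
     (\<forall>x\<in>space (state_space D). AE w in base_law D x. \<exists>\<epsilon>>0.
        (\<integral>\<^sup>+s\<in>{0..\<epsilon>}. ennreal (rate D (base_proc D s w)) \<partial>lborel) < \<infinity>) \<and>
     jump D \<in> state_space D \<rightarrow>\<^sub>M prob_algebra (state_space D)"


subsection \<open>Piecing out\<close>

text \<open>
  Both processes are realised on sequences of steps. A step is drawn from a kernel applied to the
  current state and \<open>post\<close> reads the new state off the step; the law of the whole sequence is the
  Ionescu-Tulcea measure.
\<close>

definition state_before :: "('a \<Rightarrow> 's) \<Rightarrow> 's \<Rightarrow> (nat \<Rightarrow> 'a) \<Rightarrow> nat \<Rightarrow> 's" where
  "state_before post s h k = (case k of 0 \<Rightarrow> s | Suc j \<Rightarrow> post (h j))"

definition chain_law ::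
    "'a measure \<Rightarrow> ('s \<Rightarrow> 'a measure) \<Rightarrow> ('a \<Rightarrow> 's) \<Rightarrow> 's \<Rightarrow> (nat \<Rightarrow> 'a) measure" where
  "chain_law N K post s =
     projective_family.lim UNIV
       (Ionescu_Tulcea.CI (\<lambda>k h. K (state_before post s h k)) (\<lambda>_. N)) (\<lambda>_. N)"

definition unif01 :: "real measure" where
  "unif01 = uniform_measure lborel {0..1}"


subsection \<open>The accelerated process\<close>

text \<open>The cumulated rate may be infinite, where the distribution function takes the value 1.\<close>

definition clock_cdf_ext :: "('i, 'e, 'w) accel_data \<Rightarrow> ennreal \<Rightarrow> real" where
  "clock_cdf_ext D a = (if a = \<infinity> then 1 else clock_cdf D (enn2real a))"

definition accel_hold :: "('i, 'e, 'w) accel_data \<Rightarrow> nat \<Rightarrow> 'w \<Rightarrow> real \<Rightarrow> ennreal" where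
  "accel_hold D n w u =
     Inf (ennreal ` {t. 0 \<le> t \<and>
       u \<le> clock_cdf_ext D
             (\<integral>\<^sup>+s\<in>{0..t}. ennreal (rate D (base_proc D (real n * s) w)) \<partial>lborel)})"

text \<open>
  A step \<open>(w, u, y)\<close> consists of the base path driving the piece, the uniform variable that stops
  it, and the position after the jump. If the piece is never stopped, \<open>y\<close> is irrelevant.
\<close>

definition accel_step_space :: "('i, 'e, 'w) accel_data \<Rightarrow> ('w \<times> real \<times> 'e) measure" where
  "accel_step_space D = base_space D \<Otimes>\<^sub>M borel \<Otimes>\<^sub>M state_space D"

definition accel_step ::
    "('i, 'e, 'w) accel_data \<Rightarrow> nat \<Rightarrow> 'e \<Rightarrow> ('w \<times> real \<times> 'e) measure" where
  "accel_step D n y = do {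
     w \<leftarrow> base_law D y;
     u \<leftarrow> unif01;
     y' \<leftarrow> (if accel_hold D n w u < \<infinity>
           then jump D (base_proc D (real n * enn2real (accel_hold D n w u)) w)
           else return (state_space D) y);
     return (accel_step_space D) (w, u, y')
   }"

definition accel_law ::
    "('i, 'e, 'w) accel_data \<Rightarrow> nat \<Rightarrow> 'e \<Rightarrow> (nat \<Rightarrow> 'w \<times> real \<times> 'e) measure" where
  "accel_law D n = chain_law (accel_step_space D) (accel_step D n) (\<lambda>(w, u, y). y)"

definition accel_time ::
    "('i, 'e, 'w) accel_data \<Rightarrow> nat \<Rightarrow> nat \<Rightarrow> (nat \<Rightarrow> 'w \<times> real \<times> 'e) \<Rightarrow> ennreal" where
  "accel_time D n k h = (\<Sum>j<k. case h j of (w, u, y) \<Rightarrow> accel_hold D n w u)"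

definition accel_lifetime ::
    "('i, 'e, 'w) accel_data \<Rightarrow> nat \<Rightarrow> (nat \<Rightarrow> 'w \<times> real \<times> 'e) \<Rightarrow> ennreal" where
  "accel_lifetime D n h = (SUP k. accel_time D n k h)"

text \<open>\<open>None\<close> is the cemetery; the \<open>k\<close> below is the number of jumps made by time \<open>t\<close>.\<close>

definition accel_proc ::
    "('i, 'e, 'w) accel_data \<Rightarrow> nat \<Rightarrow> real \<Rightarrow> (nat \<Rightarrow> 'w \<times> real \<times> 'e) \<Rightarrow> 'e option" where
  "accel_proc D n t h =
     (if ennreal t < accel_lifetime D n h
      then let k = (LEAST k. ennreal t < accel_time D n (Suc k) h)
           in Some (base_proc D (real n * (t - enn2real (accel_time D n k h))) (fst (h k)))
      else None)"

definition accel_index ::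
    "('i, 'e, 'w) accel_data \<Rightarrow> nat \<Rightarrow> real \<Rightarrow> (nat \<Rightarrow> 'w \<times> real \<times> 'e) \<Rightarrow> 'i option" where
  "accel_index D n t h = map_option (index_map D) (accel_proc D n t h)"


subsection \<open>The limiting index process\<close>

definition mean_rate :: "('i, 'e, 'w) accel_data \<Rightarrow> ('i \<Rightarrow> 'e measure) \<Rightarrow> 'i \<Rightarrow> real" where
  "mean_rate D \<mu> j = (\<integral>x. rate D x \<partial>\<mu> j)"

definition limit_kernel :: "('i, 'e, 'w) accel_data \<Rightarrow> ('i \<Rightarrow> 'e measure) \<Rightarrow> 'i \<Rightarrow> 'i measure" where
  "limit_kernel D \<mu> j =
     measure_of (space (index_space D)) (sets (index_space D))
       (\<lambda>J. \<integral>\<^sup>+x. ennreal (rate D x / mean_rate D \<mu> j) *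
               emeasure (jump D x) (index_map D -` J \<inter> space (state_space D)) \<partial>\<mu> j)"

definition limit_hold ::
    "('i, 'e, 'w) accel_data \<Rightarrow> ('i \<Rightarrow> 'e measure) \<Rightarrow> 'i \<Rightarrow> real \<Rightarrow> ennreal" where
  "limit_hold D \<mu> j u = Inf (ennreal ` {t. 0 < t \<and> u \<le> clock_cdf D (t * mean_rate D \<mu> j)})"

definition limit_step ::
    "('i, 'e, 'w) accel_data \<Rightarrow> ('i \<Rightarrow> 'e measure) \<Rightarrow> 'i \<Rightarrow> (real \<times> 'i) measure" where
  "limit_step D \<mu> j =
     unif01 \<Otimes>\<^sub>M (if mean_rate D \<mu> j > 0 then limit_kernel D \<mu> j else return (index_space D) j)"

definition limit_law ::
    "('i, 'e, 'w) accel_data \<Rightarrow> ('i \<Rightarrow> 'e measure) \<Rightarrow> 'i \<Rightarrow> (nat \<Rightarrow> real \<times> 'i) measure" where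
  "limit_law D \<mu> = chain_law (borel \<Otimes>\<^sub>M index_space D) (limit_step D \<mu>) snd"

definition limit_time ::
    "('i, 'e, 'w) accel_data \<Rightarrow> ('i \<Rightarrow> 'e measure) \<Rightarrow> 'i \<Rightarrow> nat \<Rightarrow> (nat \<Rightarrow> real \<times> 'i) \<Rightarrow> ennreal" where
  "limit_time D \<mu> i k h = (\<Sum>j<k. limit_hold D \<mu> (state_before snd i h j) (fst (h j)))"

definition limit_lifetime ::
    "('i, 'e, 'w) accel_data \<Rightarrow> ('i \<Rightarrow> 'e measure) \<Rightarrow> 'i \<Rightarrow> (nat \<Rightarrow> real \<times> 'i) \<Rightarrow> ennreal" where
  "limit_lifetime D \<mu> i h = (SUP k. limit_time D \<mu> i k h)"

definition limit_index ::
    "('i, 'e, 'w) accel_data \<Rightarrow> ('i \<Rightarrow> 'e measure) \<Rightarrow> 'i \<Rightarrow> real \<Rightarrow> (nat \<Rightarrow> real \<times> 'i) \<Rightarrow> 'i option" where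
  "limit_index D \<mu> i t h =
     (if ennreal t < limit_lifetime D \<mu> i h
      then Some (state_before snd i h (LEAST k. ennreal t < limit_time D \<mu> i (Suc k) h))
      else None)"


subsection \<open>The slow equations\<close>

definition solves_until ::
    "(real \<Rightarrow> 'v \<Rightarrow> 'v) \<Rightarrow> 'v \<Rightarrow> ennreal \<Rightarrow> (real \<Rightarrow> 'v::euclidean_space) \<Rightarrow> bool" where
  "solves_until f z \<tau> Z \<longleftrightarrow>
     continuous_on {t. 0 \<le> t \<and> ennreal t < \<tau>} Z \<and>
     (\<forall>t\<ge>0. ennreal t < \<tau> \<longrightarrow>
        set_integrable lborel {0..t} (\<lambda>s. f s (Z s)) \<and>
        Z t = z + (LBINT s:{0..t}. f s (Z s)))"

text \<open>
  Solutions are only required to be random variables at each time, not to be adapted to a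
  particular filtration. Up to indistinguishability the solution is unique, so the adapted
  solution is among (and agrees with) those considered here.
\<close>

definition slow_solution ::
    "('i, 'e, 'w) accel_data \<Rightarrow> ('i \<Rightarrow> real^'d \<Rightarrow> 'e \<Rightarrow> real^'d) \<Rightarrow> nat \<Rightarrow> 'e \<Rightarrow> real^'d \<Rightarrow>
     (real \<Rightarrow> (nat \<Rightarrow> 'w \<times> real \<times> 'e) \<Rightarrow> real^'d) \<Rightarrow> bool" where
  "slow_solution D F n x z Z \<longleftrightarrow>
     (\<forall>t\<ge>0. Z t \<in> borel_measurable (accel_law D n x)) \<and>
     (AE h in accel_law D n x.
        solves_until (\<lambda>s v. F (the (accel_index D n s h)) v (the (accel_proc D n s h)))
          z (accel_lifetime D n h) (\<lambda>t. Z t h))"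

definition avg_drift :: "('i \<Rightarrow> 'e measure) \<Rightarrow> ('i \<Rightarrow> real^'d \<Rightarrow> 'e \<Rightarrow> real^'d) \<Rightarrow> 'i \<Rightarrow> real^'d \<Rightarrow> real^'d" where
  "avg_drift \<mu> F i z = (\<integral>x. F i z x \<partial>\<mu> i)"

definition avg_solution ::
    "('i, 'e, 'w) accel_data \<Rightarrow> ('i \<Rightarrow> 'e measure) \<Rightarrow> ('i \<Rightarrow> real^'d \<Rightarrow> 'e \<Rightarrow> real^'d) \<Rightarrow> 'i \<Rightarrow> real^'d \<Rightarrow>
     (real \<Rightarrow> (nat \<Rightarrow> real \<times> 'i) \<Rightarrow> real^'d) \<Rightarrow> bool" where
  "avg_solution D \<mu> F i z Z \<longleftrightarrow>
     (\<forall>t\<ge>0. Z t \<in> borel_measurable (limit_law D \<mu> i)) \<and>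
     (AE h in limit_law D \<mu> i.
        solves_until (\<lambda>s v. avg_drift \<mu> F (the (limit_index D \<mu> i s h)) v)
          z (limit_lifetime D \<mu> i h) (\<lambda>t. Z t h))"


subsection \<open>Notions used in the hypotheses and the conclusion\<close>

definition ergodic_class :: "('i, 'e, 'w) accel_data \<Rightarrow> ('i \<Rightarrow> 'e measure) \<Rightarrow> 'i \<Rightarrow> ('e \<Rightarrow> real) set" where
  "ergodic_class D \<mu> i =
     {f. integrable (\<mu> i) f \<and>
         (\<forall>x\<in>space (fibre D i). \<forall>t\<ge>0. AE w in base_law D x.
            (\<integral>\<^sup>+s\<in>{0..t}. ennreal \<bar>f (base_proc D s w)\<bar> \<partial>lborel) < \<infinity>)}"

text \<open>
  Uniform integrability is stated for \<open>[0, \<infinity>]\<close>-valued variables, so that no finiteness has to be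
  presupposed.
\<close>

definition uniformly_integrable :: "'a measure \<Rightarrow> 'n set \<Rightarrow> ('n \<Rightarrow> 'a \<Rightarrow> ennreal) \<Rightarrow> bool" where
  "uniformly_integrable M A f \<longleftrightarrow>
     (\<forall>n\<in>A. f n \<in> borel_measurable M) \<and>
     ((\<lambda>K::real. SUP n\<in>A. \<integral>\<^sup>+w\<in>{w. ennreal K < f n w}. f n w \<partial>M) \<longlongrightarrow> 0) at_top"

definition C1_bounded :: "(real^'d \<Rightarrow> real) \<Rightarrow> bool" where
  "C1_bounded f \<longleftrightarrow>
     bounded (range f) \<and>
     (\<exists>g. (\<forall>z. (f has_derivative (\<lambda>v. g z \<bullet> v)) (at z)) \<and> continuous_on UNIV g \<and> bounded (range g))"

end

theory Submission
  imports Defs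
begin

text \<open>
  Why the theorem holds. Let \<open>f\<close> be the test function. A piece of either process that starts with the slow variable at \<open>v\<close>
  and with time \<open>r\<close> still to run either lasts until that time, or it ends before, in which case a new piece starts with
  a new slow value, less time and a new state. Splitting the event \<open>T \<le> \<tau>\<^sub>k\<close> according to the piece that contains \<open>T\<close>
  and conditioning on one piece after the other turns both expectations into finite sums
  \<open>\<Sum>l<k. (J\<^bsup>l\<^esup> S) ((z, T), x)\<close>, where \<open>S\<close> (the stop operator) integrates \<open>f\<close> over the pieces that last, and \<open>J\<close>
  (the jump operator) integrates a function of the situation after the jump over the pieces that end
  (\<open>pieced_expectation\<close>). It therefore suffices that the operators of the accelerated process
  converge to those of the limiting one. Since \<open>J\<close> is iterated, the mode of convergence has to be preserved by \<open>J\<close>;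
  continuous convergence is: \<open>h\<^sub>n(q\<^sub>n) \<rightarrow> h(q)\<close> whenever \<open>q\<^sub>n \<rightarrow> q\<close>, for every fixed state of the fast process.

  Fix a path \<open>X\<close> of the fast process in the fibre of \<open>j\<close> and let \<open>Y\<^sub>n s\<close> be its position at time \<open>n s\<close>, with rate \<open>b\<close>.
  The clock that ends the piece has a density \<open>g\<close>. With \<open>A\<^sub>n t\<close> for the integral of \<open>b (Y\<^sub>n s)\<close> over \<open>[0, t]\<close>, substitution
  in the clock shows that the piece survives \<open>t\<close> with probability \<open>1 - G (A\<^sub>n t)\<close>, and that, given the path, the jump
  operator is the integral of
  \<open>g (A\<^sub>n t) \<cdot> b (Y\<^sub>n t) \<cdot> \<Phi>\<^sub>n ((Z\<^sub>n t, r - t), Y\<^sub>n t)\<close> over \<open>[0, r]\<close>, where \<open>\<Phi>\<^sub>n\<close> averages over the jump kernel and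
  \<open>Z\<^sub>n\<close> is the slow variable driven by the path (\<open>inner_mean_stop\<close>, \<open>inner_mean_jump\<close>).

  Ergodicity now enters almost surely along the path, for countably many functions at once. It yields \<open>A\<^sub>n t \<rightarrow> t \<mu>\<^sub>j(b)\<close>,
  the averaging principle \<open>Z\<^sub>n \<rightarrow> Z\<close> uniformly on bounded intervals (\<open>flow_averaging\<close>), and the convergence of integrals
  of \<open>b (Y\<^sub>n t) \<cdot> H\<^sub>n (p\<^sub>n t, Y\<^sub>n t)\<close> along uniformly converging parameters \<open>p\<^sub>n\<close> (\<open>moving_average_tendsto\<close>). The last one needs
  \<open>H\<^sub>n\<close> to converge only for each fixed state: the oscillation of \<open>H\<^sub>m\<close>, \<open>m \<ge> N\<close>, over parameters at distance
  \<open>1 / (N + 1)\<close> is a function of the state, so ergodicity applies to it as well, and its mean tends to 0. As the density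
  \<open>g\<close> is merely integrable, it is first replaced by continuous functions that are close to it in \<open>L\<^sup>1\<close>; since \<open>b (Y\<^sub>n t) dt\<close> is
  carried to Lebesgue measure by \<open>A\<^sub>n\<close>, the error is uniform in \<open>n\<close> (\<open>weighted_limit\<close>). Dominated convergence over the
  paths finishes the proof.

  Ergodicity is usable for \<open>b\<close> because uniform integrability of the time averages of \<open>b\<close> makes \<open>b\<close> integrable
  under \<open>\<mu>\<^sub>j\<close> (\<open>integrable_rate\<close>).
\<close>

section \<open>Differential equations with a measurable Lipschitz field\<close>

text \<open>
  The bounds are only required for almost every nonnegative time, because the field is a function of a merely measurable
  path. One constant serves both as growth bound at 0 and as Lipschitz constant.
\<close>

definition lipschitz_field :: "real \<Rightarrow> (real \<Rightarrow> 'v \<Rightarrow> 'v::euclidean_space) \<Rightarrow> bool" where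
  "lipschitz_field L d \<longleftrightarrow> 0 \<le> L \<and> (\<lambda>(s, v). d s v) \<in> borel \<Otimes>\<^sub>M borel \<rightarrow>\<^sub>M borel \<and>
     (AE s in lborel. 0 \<le> s \<longrightarrow>
        norm (d s 0) \<le> L \<and> (\<forall>v v'. norm (d s v - d s v') \<le> L * norm (v - v')))"

definition solves_on :: "(real \<Rightarrow> 'v \<Rightarrow> 'v::euclidean_space) \<Rightarrow> 'v \<Rightarrow> real \<Rightarrow> (real \<Rightarrow> 'v) \<Rightarrow> bool" where
  "solves_on d z T x \<longleftrightarrow> continuous_on {0..T} x \<and>
     (\<forall>t\<in>{0..T}. x t = z + (LBINT s:{0..t}. d s (x s)))"

primrec picard :: "(real \<Rightarrow> 'v \<Rightarrow> 'v::euclidean_space) \<Rightarrow> 'v \<Rightarrow> nat \<Rightarrow> real \<Rightarrow> 'v" where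
  "picard d z 0 = (\<lambda>t. z)"
| "picard d z (Suc m) = (\<lambda>t. z + (LBINT s:{0..t}. d s (picard d z m s)))"

text \<open>
  The flow is defined as a limit of Picard iterates, rather than by a choice among solutions, so that it is visibly measurable
  in whatever parameters the field depends on.
\<close>

definition flow :: "(real \<Rightarrow> 'v \<Rightarrow> 'v::euclidean_space) \<Rightarrow> 'v \<Rightarrow> real \<Rightarrow> 'v" where
  "flow d z t = lim (\<lambda>m. picard d z m t)"

lemma solves_on_continuous: "solves_on d z T x \<Longrightarrow> continuous_on {0..T} x"
  unfolding solves_on_def by (rule conjunct1)

lemma solves_on_eq: "solves_on d z T x \<Longrightarrow> t \<in> {0..T} \<Longrightarrow> x t = z + (LBINT s:{0..t}. d s (x s))"
  unfolding solves_on_def by (rule bspec[OF conjunct2])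

lemma solves_on_residual:
  "solves_on d z T x \<Longrightarrow> t \<in> {0..T} \<Longrightarrow> x t - z - (LBINT s:{0..t}. d s (x s)) = 0"
  unfolding solves_on_def by (metis add_diff_cancel_left' diff_diff_eq diff_self)

lemma lborel_set_integral_split:
  fixes f :: "real \<Rightarrow> 'v::euclidean_space"
  assumes "set_integrable lborel {a..t} f" "a \<le> s" "s \<le> t"
  shows "(LBINT r:{a..t}. f r) = (LBINT r:{a..s}. f r) + (LBINT r:{s..t}. f r)"
proof -
  have i1: "set_integrable lborel {a..s} f" and i2: "set_integrable lborel {s..t} f"
    using assms by (auto intro: set_integrable_subset)
  have "(LBINT r:{a..s} \<union> {s..t}. f r) = (LBINT r:{a..s}. f r) + (LBINT r:{s..t}. f r)"
  proof (rule set_integral_Un_AE)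
    show "AE r in lborel. \<not> (r \<in> {a..s} \<and> r \<in> {s..t})"
      using AE_lborel_singleton[of s] by eventually_elim auto
  qed (use i1 i2 in auto)
  moreover have "{a..s} \<union> {s..t} = {a..t}" using assms by auto
  ultimately show ?thesis by simp
qed

lemma integrable_Icc_const:
  "integrable lborel (\<lambda>r. indicator {s..t::real} r *\<^sub>R (c::'v::euclidean_space))"
  by (intro integrable_scaleR_left integrable_real_indicator) (auto simp: emeasure_lborel_Icc_eq)

lemma set_integral_norm_le_const:
  fixes f :: "real \<Rightarrow> 'v::euclidean_space"
  assumes "AE r in lborel. r \<in> {s..t} \<longrightarrow> norm (f r) \<le> B" "s \<le> t"
    and f: "set_integrable lborel {s..t} f"
  shows "norm (LBINT r:{s..t}. f r) \<le> B * (t - s)"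
proof -
  have "norm (LBINT r:{s..t}. f r) \<le> (LBINT r:{s..t}. norm (f r))"
    by (rule set_integral_norm_bound[OF f])
  also have "\<dots> \<le> (LBINT r:{s..t}. B)"
    unfolding set_lebesgue_integral_def
  proof (rule integral_mono_AE)
    show "integrable lborel (\<lambda>r. indicator {s..t} r *\<^sub>R norm (f r))"
      using set_integrable_norm[OF f] by (simp add: set_integrable_def)
    show "AE r in lborel. indicator {s..t} r *\<^sub>R norm (f r) \<le> indicator {s..t} r *\<^sub>R B"
      using assms(1) by eventually_elim (auto simp: indicator_def)
  qed (rule integrable_Icc_const)
  also have "\<dots> = B * (t - s)"
    using assms by (simp add: set_lebesgue_integral_def)
  finally show ?thesis .
qed

lemma set_integral_exp:
  fixes l :: real
  assumes "0 < l" "0 \<le> t"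
  shows "(LBINT s:{0..t}. exp (l * s)) = (exp (l * t) - 1) / l"
    and "set_integrable lborel {0..t} (\<lambda>s. exp (l * s))"
proof -
  have "(LBINT s. exp (l * s) * indicator {0..t} s) = exp (l * t) / l - exp (l * 0) / l"
    by (rule integral_FTC_Icc_real) (use assms in \<open>auto intro!: derivative_eq_intros continuous_intros\<close>)
  then show "(LBINT s:{0..t}. exp (l * s)) = (exp (l * t) - 1) / l"
    by (simp add: set_lebesgue_integral_def diff_divide_distrib mult.commute)
  show "set_integrable lborel {0..t} (\<lambda>s. exp (l * s))"
    by (rule borel_integrable_atLeastAtMost') (intro continuous_intros)
qed

text \<open>
  The factor 2 comes from the weight \<open>exp (- 2 L t)\<close>: at a maximum of the weighted function the integral term uses up at
  most half of the left hand side.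
\<close>

lemma gronwall:
  fixes v :: "real \<Rightarrow> real"
  assumes L: "0 \<le> L" and e: "0 \<le> e" and v: "continuous_on {0..T} v"
    and bnd: "\<And>t. t \<in> {0..T} \<Longrightarrow> v t \<le> e + L * (LBINT s:{0..t}. v s)"
    and t: "t \<in> {0..T}"
  shows "v t \<le> 2 * e * exp (2 * L * t)"
proof (cases "L = 0")
  case True
  with bnd[OF t] e show ?thesis by simp
next
  case False
  with L have Lp: "0 < L" by simp
  define w where "w s = exp (- (2 * L * s)) * v s" for s
  have "continuous_on {0..T} w"
    unfolding w_def by (intro continuous_intros v)
  then obtain t0 where t0: "t0 \<in> {0..T}" and max: "\<And>s. s \<in> {0..T} \<Longrightarrow> w s \<le> w t0"
    using continuous_attains_sup[of "{0..T}" w] t by auto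
  \<comment> \<open>the claim is that the maximal weighted value is at most 2 e\<close>
  define S where "S = w t0"
  have v_le: "v s \<le> S * exp (2 * L * s)" if "s \<in> {0..T}" for s
    using max[OF that] by (simp add: w_def S_def exp_minus field_simps)
  have "S \<le> 2 * e"
  proof (cases "S \<le> 0")
    case False
    have "(LBINT s:{0..t0}. v s) \<le> (LBINT s:{0..t0}. S * exp (2 * L * s))"
    proof (rule set_integral_mono)
      show "set_integrable lborel {0..t0} v"
        by (rule borel_integrable_atLeastAtMost') (use v t0 in \<open>auto intro: continuous_on_subset\<close>)
      show "set_integrable lborel {0..t0} (\<lambda>s. S * exp (2 * L * s))"
        using set_integral_exp(2)[of "2 * L" t0] Lp t0 by auto
    qed (use v_le t0 in auto)
    also have "\<dots> = S * ((exp (2 * L * t0) - 1) / (2 * L))"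
      using set_integral_exp(1)[of "2 * L" t0] Lp t0 by simp
    finally have "v t0 \<le> e + L * (S * ((exp (2 * L * t0) - 1) / (2 * L)))"
      using bnd[OF t0] Lp by (smt (verit) mult_left_mono)
    also have "\<dots> = e + S / 2 * exp (2 * L * t0) - S / 2"
      using Lp by (simp add: field_simps)
    also have "\<dots> \<le> e * exp (2 * L * t0) + S / 2 * exp (2 * L * t0)"
    proof -
      have "1 \<le> exp (2 * L * t0)" using Lp t0 by simp
      then have "e * 1 \<le> e * exp (2 * L * t0)" using e by (intro mult_left_mono) auto
      then show ?thesis using False by simp
    qed
    finally have "S * exp (2 * L * t0) \<le> (e + S / 2) * exp (2 * L * t0)"
      by (simp add: S_def w_def exp_minus field_simps)
    then show ?thesis by simp
  qed (use e in auto)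
  then have "S * exp (2 * L * t) \<le> 2 * e * exp (2 * L * t)" by (rule mult_right_mono) simp
  with v_le[OF t] show ?thesis by linarith
qed

context
  fixes L :: real and d :: "real \<Rightarrow> 'v \<Rightarrow> 'v::euclidean_space"
  assumes d: "lipschitz_field L d"
begin

lemma field_L_nonneg: "0 \<le> L"
  and field_measurable: "(\<lambda>(s, v). d s v) \<in> borel \<Otimes>\<^sub>M borel \<rightarrow>\<^sub>M borel"
  and field_lipschitz: "AE s in lborel. 0 \<le> s \<longrightarrow> (\<forall>v v'. norm (d s v - d s v') \<le> L * norm (v - v'))"
  using d by (auto simp: lipschitz_field_def)

lemma field_growth: "AE s in lborel. 0 \<le> s \<longrightarrow> (\<forall>v. norm (d s v) \<le> L * (1 + norm v))"
proof -
  have "AE s in lborel. 0 \<le> s \<longrightarrow>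
        norm (d s 0) \<le> L \<and> (\<forall>v v'. norm (d s v - d s v') \<le> L * norm (v - v'))"
    using d by (auto simp: lipschitz_field_def)
  then show ?thesis
  proof eventually_elim
    case (elim s)
    show ?case
    proof (intro impI allI)
      fix v assume "0 \<le> s"
      then have "norm (d s 0) \<le> L" "norm (d s v - d s 0) \<le> L * norm (v - 0)" using elim by blast+
      then show "norm (d s v) \<le> L * (1 + norm v)"
        using norm_triangle_ineq2[of "d s v" "d s 0"] by (simp add: algebra_simps)
    qed
  qed
qed

lemma field_bounded_along:
  assumes "\<And>s. s \<in> {a..T} \<Longrightarrow> norm (x s) \<le> B" "0 \<le> a"
  shows "AE s in lborel. s \<in> {a..T} \<longrightarrow> norm (d s (x s)) \<le> L * (1 + B)"
  using field_growth
proof eventually_elim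
  case (elim s)
  show ?case
  proof
    assume s: "s \<in> {a..T}"
    then have "norm (d s (x s)) \<le> L * (1 + norm (x s))" using elim assms(2) by auto
    also have "\<dots> \<le> L * (1 + B)"
      using assms(1)[OF s] field_L_nonneg by (intro mult_left_mono) auto
    finally show "norm (d s (x s)) \<le> L * (1 + B)" .
  qed
qed

lemma field_integrable:
  assumes x: "continuous_on {0..T} x"
  shows "set_integrable lborel {0..T} (\<lambda>s. d s (x s))"
proof -
  have "bounded (x ` {0..T})"
    using x by (intro compact_imp_bounded compact_continuous_image) auto
  then obtain B where "\<forall>y\<in>x ` {0..T}. norm y \<le> B"
    unfolding bounded_iff by blast
  then have B: "\<And>s. s \<in> {0..T} \<Longrightarrow> norm (x s) \<le> B" by blast
  have [measurable]: "(\<lambda>s. indicator {0..T} s *\<^sub>R x s) \<in> borel_measurable borel"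
    using x by (intro borel_measurable_continuous_on_indicator) auto
  note field_measurable[measurable]
  have "(\<lambda>s. indicator {0..T} s *\<^sub>R d s (indicator {0..T} s *\<^sub>R x s)) \<in> borel_measurable borel"
    by measurable
  also have "(\<lambda>s. indicator {0..T} s *\<^sub>R d s (indicator {0..T} s *\<^sub>R x s)) =
      (\<lambda>s. indicator {0..T} s *\<^sub>R d s (x s))"
    by (auto simp: indicator_def)
  finally have meas: "(\<lambda>s. indicator {0..T} s *\<^sub>R d s (x s)) \<in> borel_measurable lborel" by simp
  show ?thesis
    unfolding set_integrable_def
  proof (rule Bochner_Integration.integrable_bound[OF _ meas])
    show "integrable lborel (\<lambda>s. indicator {0..T} s *\<^sub>R (L * (1 + B)))"
      by (rule integrable_Icc_const)
    show "AE s in lborel. norm (indicator {0..T} s *\<^sub>R d s (x s)) \<le> norm (indicator {0..T} s *\<^sub>R (L * (1 + B)))"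
      using field_bounded_along[of 0 T x B, OF B] by (auto simp: indicator_def)
  qed
qed

lemma field_integral_continuous:
  assumes x: "continuous_on {0..T} x" and B: "\<And>s. s \<in> {0..T} \<Longrightarrow> norm (x s) \<le> B"
    and st: "0 \<le> s" "s \<le> t" "t \<le> T"
  shows "norm ((LBINT s:{0..t}. d s (x s)) - (LBINT r:{0..s}. d r (x r))) \<le> L * (1 + B) * (t - s)"
proof -
  have int: "set_integrable lborel {0..t} (\<lambda>s. d s (x s))"
    by (rule field_integrable) (use x st in \<open>auto intro: continuous_on_subset\<close>)
  have "(LBINT s:{0..t}. d s (x s)) - (LBINT r:{0..s}. d r (x r)) = (LBINT r:{s..t}. d r (x r))"
    using lborel_set_integral_split[OF int st(1,2)] by simp
  also have "norm \<dots> \<le> L * (1 + B) * (t - s)"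
  proof (rule set_integral_norm_le_const)
    show "AE r in lborel. r \<in> {s..t} \<longrightarrow> norm (d r (x r)) \<le> L * (1 + B)"
      by (rule field_bounded_along) (use B st in auto)
    show "set_integrable lborel {s..t} (\<lambda>s. d s (x s))"
      using int st by (auto intro: set_integrable_subset)
  qed (use st in auto)
  finally show ?thesis .
qed

lemma field_integral_continuous_on:
  assumes x: "continuous_on {0..T} x"
  shows "continuous_on {0..T} (\<lambda>t. LBINT s:{0..t}. d s (x s))"
proof -
  have "bounded (x ` {0..T})"
    using x by (intro compact_imp_bounded compact_continuous_image) auto
  then obtain B' where "\<forall>y\<in>x ` {0..T}. norm y \<le> B'"
    unfolding bounded_iff by blast
  then have B': "\<And>s. s \<in> {0..T} \<Longrightarrow> norm (x s) \<le> B'" by blast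
  define B where "B = max 0 B'"
  have B: "0 \<le> B" "\<And>s. s \<in> {0..T} \<Longrightarrow> norm (x s) \<le> B"
    using B' by (fastforce simp: B_def)+
  have "(L * (1 + B))-lipschitz_on {0..T} (\<lambda>t. LBINT s:{0..t}. d s (x s))"
  proof (rule lipschitz_onI)
    fix s t assume "s \<in> {0..T}" "t \<in> {0..T}"
    then show "dist (LBINT r:{0..s}. d r (x r)) (LBINT r:{0..t}. d r (x r)) \<le> L * (1 + B) * dist s t"
      using field_integral_continuous[OF x B(2), of s t] field_integral_continuous[OF x B(2), of t s]
      by (cases "s \<le> t") (auto simp: dist_norm norm_minus_commute)
  qed (use field_L_nonneg B in auto)
  then show ?thesis by (rule lipschitz_on_continuous_on)
qed

lemma field_integral_diff_le:
  assumes x: "continuous_on {0..T} x" and x': "continuous_on {0..T} x'" and t: "t \<in> {0..T}"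
  shows "norm ((LBINT s:{0..t}. d s (x s)) - (LBINT s:{0..t}. d s (x' s)))
    \<le> L * (LBINT s:{0..t}. norm (x s - x' s))"
proof -
  have c: "continuous_on {0..t} x" "continuous_on {0..t} x'"
    using x x' t by (auto intro: continuous_on_subset)
  note i = c[THEN field_integrable]
  have "norm ((LBINT s:{0..t}. d s (x s)) - (LBINT s:{0..t}. d s (x' s))) =
      norm (LBINT s:{0..t}. d s (x s) - d s (x' s))"
    using i by simp
  also have "\<dots> \<le> (LBINT s:{0..t}. norm (d s (x s) - d s (x' s)))"
    using i by (intro set_integral_norm_bound) auto
  also have "\<dots> \<le> (LBINT s:{0..t}. L * norm (x s - x' s))"
    unfolding set_lebesgue_integral_def
  proof (rule integral_mono_AE)
    show "integrable lborel (\<lambda>s. indicator {0..t} s *\<^sub>R norm (d s (x s) - d s (x' s)))"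
      using set_integrable_norm[OF set_integral_diff(1)[OF i]] by (simp add: set_integrable_def)
    have "set_integrable lborel {0..t} (\<lambda>s. L * norm (x s - x' s))"
      by (intro borel_integrable_atLeastAtMost' continuous_intros c)
    then show "integrable lborel (\<lambda>s. indicator {0..t} s *\<^sub>R (L * norm (x s - x' s)))"
      by (simp add: set_integrable_def)
    show "AE s in lborel. indicator {0..t} s *\<^sub>R norm (d s (x s) - d s (x' s))
        \<le> indicator {0..t} s *\<^sub>R (L * norm (x s - x' s))"
      using field_lipschitz by eventually_elim (auto simp: indicator_def)
  qed
  also have "\<dots> = L * (LBINT s:{0..t}. norm (x s - x' s))" by simp
  finally show ?thesis .
qed

text \<open>
  Residual 0 gives uniqueness and continuous dependence on the initial value; in the averaging principle the
  averaged solution has a small residual for the fast equation.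
\<close>

lemma solution_stability:
  assumes x: "solves_on d z T x" and x': "continuous_on {0..T} x'" and e: "0 \<le> e"
    and approx: "\<And>t. t \<in> {0..T} \<Longrightarrow> norm (x' t - z' - (LBINT s:{0..t}. d s (x' s))) \<le> e"
    and t: "t \<in> {0..T}"
  shows "norm (x t - x' t) \<le> 2 * (norm (z - z') + e) * exp (2 * L * t)"
proof (rule gronwall[OF field_L_nonneg _ _ _ t])
  have xc: "continuous_on {0..T} x" using x by (simp add: solves_on_def)
  show "continuous_on {0..T} (\<lambda>t. norm (x t - x' t))"
    by (intro continuous_intros xc x')
  fix t assume t: "t \<in> {0..T}"
  have "x t = z + (LBINT s:{0..t}. d s (x s))" by (rule solves_on_eq[OF x t])
  then have "x t - x' t = (z - z') + ((LBINT s:{0..t}. d s (x s)) - (LBINT s:{0..t}. d s (x' s)))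
      - (x' t - z' - (LBINT s:{0..t}. d s (x' s)))" by simp
  then have "norm (x t - x' t) \<le> norm (z - z')
      + norm ((LBINT s:{0..t}. d s (x s)) - (LBINT s:{0..t}. d s (x' s)))
      + norm (x' t - z' - (LBINT s:{0..t}. d s (x' s)))"
    by (metis (no_types, lifting) norm_triangle_ineq norm_triangle_ineq4 add_right_mono order_trans)
  also have "\<dots> \<le> norm (z - z') + L * (LBINT s:{0..t}. norm (x s - x' s)) + e"
    using field_integral_diff_le[OF xc x' t] approx[OF t] by simp
  finally show "norm (x t - x' t) \<le> norm (z - z') + e + L * (LBINT s:{0..t}. norm (x s - x' s))"
    by simp
qed (use e in auto)

lemma picard_continuous: "continuous_on {0..T} (picard d z m)"
proof (induction m)
  case (Suc m)
  then show ?case by (auto intro!: continuous_intros field_integral_continuous_on)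
qed auto

text \<open>
  The weight \<open>exp ((2 L + 1) t)\<close> makes the Picard operator a contraction with factor 1/2, since \<open>L / (2 L + 1) \<le> 1 / 2\<close>.
  Hence the iterates converge on every bounded interval without any restriction on its length.
\<close>

lemma picard_step:
  assumes t: "0 \<le> t"
  shows "norm (picard d z (Suc m) t - picard d z m t)
    \<le> L * (1 + norm z) * exp ((2 * L + 1) * t) * (1 / 2) ^ m"
  using t
proof (induction m arbitrary: t)
  case 0
  have "norm (LBINT s:{0..t}. d s z) \<le> L * (1 + norm z) * (t - 0)"
    by (rule set_integral_norm_le_const)
      (use 0 field_bounded_along[of 0 t "\<lambda>_. z" "norm z"] field_integrable[of t "\<lambda>_. z"] in auto)
  also have "\<dots> \<le> L * (1 + norm z) * exp ((2 * L + 1) * t)"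
  proof (rule mult_left_mono)
    have "t \<le> exp t" using exp_ge_add_one_self[of t] by linarith
    also have "\<dots> \<le> exp ((2 * L + 1) * t)" using field_L_nonneg 0 by (simp add: algebra_simps)
    finally show "t - 0 \<le> exp ((2 * L + 1) * t)" by simp
  qed (use field_L_nonneg in auto)
  finally show ?case by simp
next
  case (Suc m)
  let ?B = "L * (1 + norm z)" and ?l = "2 * L + 1"
  have l: "0 < ?l" using field_L_nonneg by simp
  have "norm (picard d z (Suc (Suc m)) t - picard d z (Suc m) t)
     = norm ((LBINT s:{0..t}. d s (picard d z (Suc m) s)) - (LBINT s:{0..t}. d s (picard d z m s)))"
    by simp
  also have "\<dots> \<le> L * (LBINT s:{0..t}. norm (picard d z (Suc m) s - picard d z m s))"
    by (rule field_integral_diff_le[OF picard_continuous picard_continuous, of t t]) (use Suc.prems in simp)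
  also have "\<dots> \<le> L * (LBINT s:{0..t}. ?B * (1 / 2) ^ m * exp (?l * s))"
  proof (intro mult_left_mono set_integral_mono)
    show "set_integrable lborel {0..t} (\<lambda>s. norm (picard d z (Suc m) s - picard d z m s))"
      by (intro borel_integrable_atLeastAtMost' continuous_on_norm continuous_on_diff picard_continuous)
    show "set_integrable lborel {0..t} (\<lambda>s. ?B * (1 / 2) ^ m * exp (?l * s))"
      by (intro borel_integrable_atLeastAtMost' continuous_intros)
    show "norm (picard d z (Suc m) s - picard d z m s) \<le> ?B * (1 / 2) ^ m * exp (?l * s)"
      if "s \<in> {0..t}" for s
      using Suc.IH[of s] that by (simp add: mult_ac)
  qed (rule field_L_nonneg)
  also have "\<dots> = L * (?B * (1 / 2) ^ m * ((exp (?l * t) - 1) / ?l))"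
    using set_integral_exp(1)[OF l Suc.prems] by simp
  also have "\<dots> = ?B * (1 / 2) ^ m * (L / ?l * (exp (?l * t) - 1))" by simp
  also have "\<dots> \<le> ?B * (1 / 2) ^ m * (1 / 2 * exp (?l * t))"
  proof (intro mult_left_mono mult_mono)
    show "L / ?l \<le> 1 / 2" using l by (simp add: field_simps)
  qed (use l Suc.prems field_L_nonneg in auto)
  finally show ?case by (simp add: mult_ac)
qed

lemma picard_cauchy:
  assumes t: "0 \<le> t" and k: "m \<le> k"
  shows "norm (picard d z k t - picard d z m t)
    \<le> L * (1 + norm z) * exp ((2 * L + 1) * t) * (2 * (1 / 2) ^ m - 2 * (1 / 2) ^ k)"
  using k
proof (induction k rule: dec_induct)
  case (step k)
  let ?C = "L * (1 + norm z) * exp ((2 * L + 1) * t)"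
  have "norm (picard d z (Suc k) t - picard d z m t)
      \<le> norm (picard d z (Suc k) t - picard d z k t) + norm (picard d z k t - picard d z m t)"
    using norm_triangle_ineq[of "picard d z (Suc k) t - picard d z k t" "picard d z k t - picard d z m t"]
    by (simp del: picard.simps)
  also have "\<dots> \<le> ?C * (1 / 2) ^ k + ?C * (2 * (1 / 2) ^ m - 2 * (1 / 2) ^ k)"
    by (intro add_mono picard_step[OF t] step.IH)
  also have "\<dots> = ?C * (2 * (1 / 2) ^ m - 2 * (1 / 2) ^ Suc k)" by (simp add: algebra_simps)
  finally show ?case .
qed simp

lemma picard_tendsto_flow:
  assumes t: "0 \<le> t"
  shows "(\<lambda>m. picard d z m t) \<longlonglongrightarrow> flow d z t"
    and "norm (flow d z t - picard d z m t) \<le> L * (1 + norm z) * exp ((2 * L + 1) * t) * (2 * (1 / 2) ^ m)"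
proof -
  let ?C = "L * (1 + norm z) * exp ((2 * L + 1) * t)"
  have C: "0 \<le> ?C" using field_L_nonneg by simp
  have le: "norm (picard d z k t - picard d z m t) \<le> ?C * (2 * (1 / 2) ^ m)" if "m \<le> k" for k m
  proof -
    have "norm (picard d z k t - picard d z m t) \<le> ?C * (2 * (1 / 2) ^ m - 2 * (1 / 2) ^ k)"
      by (rule picard_cauchy[OF t that])
    also have "\<dots> \<le> ?C * (2 * (1 / 2) ^ m)" using C by (intro mult_left_mono) auto
    finally show ?thesis .
  qed
  have "Cauchy (\<lambda>m. picard d z m t)"
  proof (rule CauchyI')
    fix e :: real assume e: "0 < e"
    have "(\<lambda>m. ?C * (2 * (1 / 2) ^ m)) \<longlonglongrightarrow> ?C * (2 * 0)"
      by (intro tendsto_intros LIMSEQ_realpow_zero) auto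
    then have "eventually (\<lambda>m. ?C * (2 * (1 / 2) ^ m) < e) sequentially"
      using order_tendstoD(2)[of _ "?C * (2 * 0)" sequentially e] e by simp
    then obtain M where "\<And>m. M \<le> m \<Longrightarrow> ?C * (2 * (1 / 2) ^ m) < e"
      by (auto simp: eventually_sequentially)
    then show "\<exists>M. \<forall>m\<ge>M. \<forall>n>m. dist (picard d z m t) (picard d z n t) < e"
    proof (intro exI[of _ M] allI impI)
      fix m n assume "M \<le> m" "m < n"
      then show "dist (picard d z m t) (picard d z n t) < e"
        using le[of m n] \<open>\<And>m. M \<le> m \<Longrightarrow> ?C * (2 * (1 / 2) ^ m) < e\<close>[of m]
        by (simp add: dist_norm norm_minus_commute)
    qed
  qed
  then show lim: "(\<lambda>m. picard d z m t) \<longlonglongrightarrow> flow d z t"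
    unfolding flow_def by (simp add: Cauchy_convergent_iff convergent_LIMSEQ_iff)
  have "(\<lambda>k. norm (picard d z k t - picard d z m t)) \<longlonglongrightarrow> norm (flow d z t - picard d z m t)"
    by (intro tendsto_intros lim)
  then show "norm (flow d z t - picard d z m t) \<le> ?C * (2 * (1 / 2) ^ m)"
    by (rule LIMSEQ_le_const2) (use le in auto)
qed

lemma flow_solves: "solves_on d z T (flow d z)"
proof (cases "0 \<le> T")
  case True
  let ?D = "L * (1 + norm z) * exp ((2 * L + 1) * T)"
  have D: "0 \<le> ?D" using field_L_nonneg by simp
  have le: "norm (flow d z t - picard d z m t) \<le> ?D * (2 * (1 / 2) ^ m)" if "t \<in> {0..T}" for t m
  proof -
    have "L * (1 + norm z) * exp ((2 * L + 1) * t) * (2 * (1 / 2) ^ m) \<le> ?D * (2 * (1 / 2) ^ m)"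
      using that field_L_nonneg by (intro mult_right_mono mult_left_mono) auto
    moreover have "0 \<le> t" using that by simp
    ultimately show ?thesis using picard_tendsto_flow(2)[of t z m] by linarith
  qed
  have D0: "(\<lambda>m. ?D * (2 * (1 / 2) ^ m)) \<longlonglongrightarrow> ?D * (2 * 0)"
    by (intro tendsto_intros LIMSEQ_realpow_zero) auto
  have cont: "continuous_on {0..T} (flow d z)"
  proof (rule uniform_limit_theorem[where f = "picard d z" and F = sequentially])
    show "uniform_limit {0..T} (picard d z) (flow d z) sequentially"
    proof (rule uniform_limitI)
      fix e :: real assume "0 < e"
      then have "eventually (\<lambda>m. ?D * (2 * (1 / 2) ^ m) < e) sequentially"
        using order_tendstoD(2)[OF D0, of e] by simp
      then show "\<forall>\<^sub>F n in sequentially. \<forall>x\<in>{0..T}. dist (picard d z n x) (flow d z x) < e"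
      proof eventually_elim
        case (elim m)
        show ?case
        proof
          fix t assume "t \<in> {0..T}"
          from le[OF this, of m] elim show "dist (picard d z m t) (flow d z t) < e"
            by (simp only: dist_norm norm_minus_commute[of "picard d z m t"])
        qed
      qed
    qed
  qed (use picard_continuous in auto)
  show ?thesis
    unfolding solves_on_def
  proof (intro conjI cont ballI)
    fix t assume t: "t \<in> {0..T}"
    have "(\<lambda>m. (LBINT s:{0..t}. d s (picard d z m s)) - (LBINT s:{0..t}. d s (flow d z s))) \<longlonglongrightarrow> 0"
    proof (rule Lim_null_comparison)
      show "(\<lambda>m. L * (t * (?D * (2 * (1 / 2) ^ m)))) \<longlonglongrightarrow> 0"
        using tendsto_mult_left[OF tendsto_mult_left[OF D0, of t], of L] by simp
      show "\<forall>\<^sub>F m in sequentially. norm ((LBINT s:{0..t}. d s (picard d z m s)) - (LBINT s:{0..t}. d s (flow d z s)))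
           \<le> L * (t * (?D * (2 * (1 / 2) ^ m)))"
      proof (rule always_eventually, rule)
        fix m
        have "norm ((LBINT s:{0..t}. d s (picard d z m s)) - (LBINT s:{0..t}. d s (flow d z s)))
            \<le> L * (LBINT s:{0..t}. norm (picard d z m s - flow d z s))"
          by (rule field_integral_diff_le[OF picard_continuous cont t])
        also have "\<dots> \<le> L * (LBINT s:{0..t}. ?D * (2 * (1 / 2) ^ m))"
        proof (intro mult_left_mono set_integral_mono field_L_nonneg)
          have "continuous_on {0..t} (flow d z)" using cont t by (auto intro: continuous_on_subset)
          then show "set_integrable lborel {0..t} (\<lambda>s. norm (picard d z m s - flow d z s))"
            by (intro borel_integrable_atLeastAtMost' continuous_on_norm continuous_on_diff picard_continuous)
          show "set_integrable lborel {0..t} (\<lambda>s. ?D * (2 * (1 / 2) ^ m))"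
            by (rule borel_integrable_atLeastAtMost') (intro continuous_intros)
          show "norm (picard d z m s - flow d z s) \<le> ?D * (2 * (1 / 2) ^ m)" if "s \<in> {0..t}" for s
            using le[of s m] that t by (auto simp: norm_minus_commute)
        qed
        also have "(LBINT s:{0..t}. ?D * (2 * (1 / 2) ^ m)) = t * (?D * (2 * (1 / 2) ^ m))"
          using t by (simp add: set_lebesgue_integral_def)
        finally show "norm ((LBINT s:{0..t}. d s (picard d z m s)) - (LBINT s:{0..t}. d s (flow d z s)))
           \<le> L * (t * (?D * (2 * (1 / 2) ^ m)))" .
      qed
    qed
    then have "(\<lambda>m. LBINT s:{0..t}. d s (picard d z m s)) \<longlonglongrightarrow> (LBINT s:{0..t}. d s (flow d z s))"
      by (rule LIM_zero_cancel)
    then have "(\<lambda>m. picard d z (Suc m) t) \<longlonglongrightarrow> z + (LBINT s:{0..t}. d s (flow d z s))"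
      by (auto intro: tendsto_intros)
    moreover have "(\<lambda>m. picard d z (Suc m) t) \<longlonglongrightarrow> flow d z t"
      using picard_tendsto_flow(1)[of t z] t by (intro LIMSEQ_Suc) auto
    ultimately show "flow d z t = z + (LBINT s:{0..t}. d s (flow d z s))"
      using LIMSEQ_unique by blast
  qed
next
  case False
  then have e: "{0..T} = {}" by simp
  show ?thesis
    unfolding solves_on_def
  proof (rule conjI)
    show "continuous_on {0..T} (flow d z)" by (simp only: e continuous_on_empty)
    show "\<forall>t\<in>{0..T}. flow d z t = z + (LBINT s:{0..t}. d s (flow d z s))"
      by (rule ballI) (simp only: e empty_iff)
  qed
qed

lemma flow_continuous: "continuous_on {0..T} (flow d z)"
  by (rule solves_on_continuous[OF flow_solves])

lemma flow_unique:
  assumes x: "solves_on d z T x" and t: "t \<in> {0..T}"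
  shows "x t = flow d z t"
proof -
  have "norm (x t - flow d z t) \<le> 2 * (norm (z - z) + 0) * exp (2 * L * t)"
  proof (rule solution_stability[OF x flow_continuous order_refl _ t])
    show "norm (flow d z r - z - (LBINT s:{0..r}. d s (flow d z s))) \<le> 0" if "r \<in> {0..T}" for r
      by (subst solves_on_residual[OF flow_solves that]) simp
  qed
  then show ?thesis by simp
qed

lemma flow_initial_stability:
  assumes t: "0 \<le> t"
  shows "norm (flow d z t - flow d z' t) \<le> 2 * norm (z - z') * exp (2 * L * t)"
proof -
  have "norm (flow d z t - flow d z' t) \<le> 2 * (norm (z - z') + 0) * exp (2 * L * t)"
  proof (rule solution_stability[OF flow_solves flow_continuous order_refl])
    show "norm (flow d z' r - z' - (LBINT s:{0..r}. d s (flow d z' s))) \<le> 0" if "r \<in> {0..t}" for r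
      by (subst solves_on_residual[OF flow_solves that]) simp
  qed (use t in simp)
  then show ?thesis by simp
qed

lemma flow_0: "flow d z 0 = z"
proof -
  have "flow d z 0 = z + (LBINT s:{0..0}. d s (flow d z s))"
    by (rule solves_on_eq[OF flow_solves, where T = 0]) simp
  also have "(LBINT s:{0..0}. d s (flow d z s)) = 0"
    using set_integral_norm_le_const[of 0 0 "\<lambda>s. d s (flow d z s)"
        "norm (d 0 (flow d z 0))"] field_integrable[OF flow_continuous[of 0 z]] by auto
  finally show ?thesis by simp
qed

end

lemma flow_measurable:
  fixes d :: "'x \<Rightarrow> real \<Rightarrow> 'v \<Rightarrow> 'v::euclidean_space"
  assumes d [measurable]: "(\<lambda>((x, s), v). d x s v) \<in> (M \<Otimes>\<^sub>M borel) \<Otimes>\<^sub>M borel \<rightarrow>\<^sub>M borel"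
  shows "(\<lambda>((x, z), t). flow (d x) z t) \<in> (M \<Otimes>\<^sub>M borel) \<Otimes>\<^sub>M borel \<rightarrow>\<^sub>M borel"
proof -
  have "(\<lambda>((x, z), t). picard (d x) z m t) \<in> (M \<Otimes>\<^sub>M borel) \<Otimes>\<^sub>M borel \<rightarrow>\<^sub>M borel" for m
  proof (induction m)
    case (Suc m)
    have [measurable]: "(\<lambda>q. picard (d (fst (fst (fst q)))) (snd (fst (fst q))) m (snd q))
        \<in> ((M \<Otimes>\<^sub>M borel) \<Otimes>\<^sub>M borel) \<Otimes>\<^sub>M borel \<rightarrow>\<^sub>M borel"
    proof -
      have "(\<lambda>q. (fst (fst q), snd q))
          \<in> ((M \<Otimes>\<^sub>M borel) \<Otimes>\<^sub>M borel) \<Otimes>\<^sub>M borel \<rightarrow>\<^sub>M (M \<Otimes>\<^sub>M borel) \<Otimes>\<^sub>M borel"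
        by measurable
      from measurable_compose[OF this Suc] show ?thesis by (simp add: split_beta')
    qed
    have "(\<lambda>q. ((fst (fst (fst q)), snd q), picard (d (fst (fst (fst q)))) (snd (fst (fst q))) m (snd q)))
        \<in> ((M \<Otimes>\<^sub>M borel) \<Otimes>\<^sub>M borel) \<Otimes>\<^sub>M borel \<rightarrow>\<^sub>M (M \<Otimes>\<^sub>M borel) \<Otimes>\<^sub>M borel"
      by measurable
    from measurable_compose[OF this d]
    have [measurable]: "(\<lambda>q. d (fst (fst (fst q))) (snd q)
          (picard (d (fst (fst (fst q)))) (snd (fst (fst q))) m (snd q)))
        \<in> ((M \<Otimes>\<^sub>M borel) \<Otimes>\<^sub>M borel) \<Otimes>\<^sub>M borel \<rightarrow>\<^sub>M borel"
      by (simp add: split_beta')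
    have [measurable]: "(\<lambda>q. indicat_real {0..snd (fst q)} (snd q :: real))
        \<in> ((M \<Otimes>\<^sub>M borel) \<Otimes>\<^sub>M borel) \<Otimes>\<^sub>M borel \<rightarrow>\<^sub>M borel"
      unfolding indicator_def atLeastAtMost_iff by measurable
    have "(\<lambda>(p, s). indicator {0..snd p} s *\<^sub>R
          d (fst (fst p)) s (picard (d (fst (fst p))) (snd (fst p)) m s))
        \<in> ((M \<Otimes>\<^sub>M borel) \<Otimes>\<^sub>M borel) \<Otimes>\<^sub>M borel \<rightarrow>\<^sub>M borel"
      unfolding split_beta' by measurable
    then have "(\<lambda>(p, s). indicator {0..snd p} s *\<^sub>R
          d (fst (fst p)) s (picard (d (fst (fst p))) (snd (fst p)) m s))
        \<in> ((M \<Otimes>\<^sub>M borel) \<Otimes>\<^sub>M borel) \<Otimes>\<^sub>M lborel \<rightarrow>\<^sub>M borel"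
      by (subst measurable_cong_sets[OF sets_pair_measure_cong[OF refl sets_lborel] refl])
    then have int: "(\<lambda>p. \<integral>s. indicator {0..snd p} s *\<^sub>R
          d (fst (fst p)) s (picard (d (fst (fst p))) (snd (fst p)) m s) \<partial>lborel)
        \<in> (M \<Otimes>\<^sub>M borel) \<Otimes>\<^sub>M borel \<rightarrow>\<^sub>M borel"
      by (rule lborel.borel_measurable_lebesgue_integral)
    have "(\<lambda>p. snd (fst p) + (\<integral>s. indicator {0..snd p} s *\<^sub>R
        d (fst (fst p)) s (picard (d (fst (fst p))) (snd (fst p)) m s) \<partial>lborel))
      \<in> (M \<Otimes>\<^sub>M borel) \<Otimes>\<^sub>M borel \<rightarrow>\<^sub>M borel"
      by (rule borel_measurable_add[OF _ int]) measurable
    then show ?case by (simp add: set_lebesgue_integral_def split_beta')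
  qed (simp add: split_beta')
  then have [measurable]: "(\<lambda>p. picard (d (fst (fst p))) (snd (fst p)) m (snd p))
      \<in> (M \<Otimes>\<^sub>M borel) \<Otimes>\<^sub>M borel \<rightarrow>\<^sub>M borel" for m
    by (simp add: split_beta')
  have "(\<lambda>p. lim (\<lambda>m. picard (d (fst (fst p))) (snd (fst p)) m (snd p)))
      \<in> (M \<Otimes>\<^sub>M borel) \<Otimes>\<^sub>M borel \<rightarrow>\<^sub>M borel"
    by (rule borel_measurable_lim_metric) measurable
  then show ?thesis by (simp add: flow_def split_beta')
qed


section \<open>Chains of steps drawn from a kernel\<close>

locale markov_chain =
  fixes S :: "'s measure" and N :: "'a measure" and K :: "'s \<Rightarrow> 'a measure" and post :: "'a \<Rightarrow> 's"
  assumes K [measurable]: "K \<in> S \<rightarrow>\<^sub>M prob_algebra N"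
    and post [measurable]: "post \<in> N \<rightarrow>\<^sub>M S"
begin

lemma K_prob: "s \<in> space S \<Longrightarrow> prob_space (K s)"
  and K_sets: "s \<in> space S \<Longrightarrow> sets (K s) = sets N"
  and K_space: "s \<in> space S \<Longrightarrow> space (K s) = space N"
  using measurable_space[OF K] by (auto simp: space_prob_algebra dest: sets_eq_imp_space_eq)

lemma K_subprob [measurable]: "K \<in> S \<rightarrow>\<^sub>M subprob_algebra N"
  using K by (rule measurable_prob_algebraD)

lemma state_before_measurable:
  assumes "s \<in> space S" "{0..<k} \<subseteq> I"
  shows "(\<lambda>h. state_before post s h k) \<in> PiM I (\<lambda>_. N) \<rightarrow>\<^sub>M S"
proof (cases k)
  case (Suc j)
  then have [measurable]: "(\<lambda>h. h j) \<in> PiM I (\<lambda>_. N) \<rightarrow>\<^sub>M N"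
    using assms by (intro measurable_component_singleton) auto
  show ?thesis unfolding Suc state_before_def by simp
qed (use assms in \<open>simp add: state_before_def\<close>)

lemma state_before_restrict: "j \<le> k \<Longrightarrow> state_before post s (restrict h {0..<k}) j = state_before post s h j"
  by (cases j) (auto simp: state_before_def)

lemma ionescu_tulcea:
  assumes s: "s \<in> space S"
  shows "Ionescu_Tulcea (\<lambda>k h. K (state_before post s h k)) (\<lambda>_. N)"
proof (rule Ionescu_Tulcea.intro)
  note [measurable] = state_before_measurable[OF s]
  show "(\<lambda>h. K (state_before post s h k)) \<in> PiM {0..<k} (\<lambda>_. N) \<rightarrow>\<^sub>M subprob_algebra N" for k
    by (rule measurable_compose[OF state_before_measurable[OF s] K_subprob]) simp
  show "prob_space (K (state_before post s h k))" if "h \<in> space (PiM {0..<k} (\<lambda>_. N))" for k h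
    by (rule K_prob[OF measurable_space[OF state_before_measurable[OF s order_refl] that]])
qed

abbreviation chain :: "'s \<Rightarrow> (nat \<Rightarrow> 'a) measure" where
  "chain \<equiv> chain_law N K post"

lemma sets_chain:
  assumes s: "s \<in> space S"
  shows "sets (chain s) = sets (PiM UNIV (\<lambda>_. N))"
proof -
  interpret Ionescu_Tulcea "\<lambda>k h. K (state_before post s h k)" "\<lambda>_. N"
    by (rule ionescu_tulcea[OF s])
  show ?thesis by (simp add: chain_law_def)
qed

lemma space_chain: "s \<in> space S \<Longrightarrow> space (chain s) = space (PiM UNIV (\<lambda>_. N))"
  by (rule sets_eq_imp_space_eq[OF sets_chain])

lemma prob_chain:
  assumes s: "s \<in> space S"
  shows "prob_space (chain s)"
proof -
  interpret Ionescu_Tulcea "\<lambda>k h. K (state_before post s h k)" "\<lambda>_. N"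
    by (rule ionescu_tulcea[OF s])
  have "prob_space (distr PF.lim (PiM {} (\<lambda>_. N)) (\<lambda>x. restrict x {}))"
    by (subst distr_lim) (auto intro: PF.prob_space_P)
  then show ?thesis
    unfolding chain_law_def
    by (rule prob_space_distrD[rotated]) (simp add: measurable_cong_sets[OF PF.sets_lim refl] measurable_restrict_subset)
qed

lemma state_before_in_space:
  assumes "s \<in> space S" "h \<in> space (chain s)"
  shows "state_before post s h k \<in> space S"
  using measurable_space[OF state_before_measurable[of s k UNIV]] assms by (simp add: space_chain)

text \<open>
  Conditioning of step \<open>j\<close> on the steps before it. The finite-dimensional laws of the Ionescu-Tulcea measure are
  iterated kernels, and \<open>f\<close> sees only the first \<open>j\<close> steps and the next one.
\<close>

lemma nn_integral_chain_Suc: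
  assumes s: "s \<in> space S"
    and f: "(\<lambda>(h, a). f h a) \<in> borel_measurable (PiM {0..<j} (\<lambda>_. N) \<Otimes>\<^sub>M N)"
  shows "(\<integral>\<^sup>+h. f (restrict h {0..<j}) (h j) \<partial>chain s) =
    (\<integral>\<^sup>+h. (\<integral>\<^sup>+a. f (restrict h {0..<j}) a \<partial>K (state_before post s h j)) \<partial>chain s)"
proof -
  interpret Ionescu_Tulcea "\<lambda>k h. K (state_before post s h k)" "\<lambda>_. N"
    by (rule ionescu_tulcea[OF s])
  let ?P = "\<lambda>k::nat. PiM {0..<k} (\<lambda>_. N)"
  let ?C = "\<lambda>k. C 0 k (\<lambda>_. undefined)"
  have u: "(\<lambda>_. undefined) \<in> space (?P 0)" by (auto simp: space_PiM PiE_def extensional_def)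
  have distr: "distr (chain s) (?P k) (\<lambda>h. restrict h {0..<k}) = ?C k" for k
  proof -
    have "up_to {0..<k} = k" unfolding up_to_def by (rule Least_equality) (auto simp: not_less)
    then have "CI {0..<k} = distr (?C k) (?P k) (\<lambda>f. restrict f {0..<k})" by (simp add: CI_def)
    also have "\<dots> = ?C k" using distr_C[of k k "\<lambda>_. undefined" 0] u by simp
    finally show ?thesis unfolding chain_law_def by (subst distr_lim) auto
  qed
  have restr: "(\<lambda>h. restrict h {0..<k}) \<in> chain s \<rightarrow>\<^sub>M ?P k" for k
    by (simp add: measurable_cong_sets[OF sets_chain[OF s] refl] measurable_restrict_subset)
  have int: "(\<integral>\<^sup>+h. g (restrict h {0..<k}) \<partial>chain s) = (\<integral>\<^sup>+h. g h \<partial>?C k)"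
    if "g \<in> borel_measurable (?P k)" for g k
    unfolding distr[symmetric] by (rule nn_integral_distr[OF restr, symmetric]) (simp add: that)
  define g where "g h = f (restrict h {0..<j}) (h j)" for h :: "nat \<Rightarrow> 'a"
  have "(\<lambda>h. (restrict h {0..<j}, h j)) \<in> ?P (Suc j) \<rightarrow>\<^sub>M ?P j \<Otimes>\<^sub>M N"
    by (intro measurable_Pair measurable_restrict_subset measurable_component_singleton) auto
  from measurable_compose[OF this f] have g: "g \<in> borel_measurable (?P (Suc j))" by (simp add: g_def[abs_def])
  have fK: "(\<lambda>h. \<integral>\<^sup>+a. f h a \<partial>K (state_before post s h j)) \<in> borel_measurable (?P j)"
    by (rule nn_integral_measurable_subprob_algebra2[OF f P])
  have rr: "restrict (restrict h {0..<Suc j}) {0..<j} = restrict h {0..<j}" for h :: "nat \<Rightarrow> 'a"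
    by (auto simp: restrict_def fun_eq_iff)
  have "(\<integral>\<^sup>+h. f (restrict h {0..<j}) (h j) \<partial>chain s) = (\<integral>\<^sup>+h. g (restrict h {0..<Suc j}) \<partial>chain s)"
    unfolding g_def rr by simp
  also have "\<dots> = (\<integral>\<^sup>+h. g h \<partial>?C (Suc j))" by (rule int[OF g])
  also have "\<dots> = (\<integral>\<^sup>+h. (\<integral>\<^sup>+h'. g h' \<partial>eP j h) \<partial>?C j)"
    using measurable_eP[of j] by (simp, subst nn_integral_bind[OF g]) (auto simp: measurable_cong_sets[OF sets_C[OF u]])
  also have "\<dots> = (\<integral>\<^sup>+h. (\<integral>\<^sup>+a. f h a \<partial>K (state_before post s h j)) \<partial>?C j)"
  proof (intro nn_integral_cong)
    fix h assume "h \<in> space (?C j)"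
    then have h: "h \<in> space (?P j)" using space_C[OF u, of j] by simp
    have "(\<integral>\<^sup>+h'. g h' \<partial>eP j h) = (\<integral>\<^sup>+a. g (h(j := a)) \<partial>K (state_before post s h j))"
      by (rule nn_integral_eP[OF h g])
    also have "\<dots> = (\<integral>\<^sup>+a. f h a \<partial>K (state_before post s h j))"
    proof (intro nn_integral_cong)
      fix a
      have "restrict (h(j := a)) {0..<j} = h"
        using h by (auto simp: space_PiM PiE_def extensional_def restrict_def fun_eq_iff)
      then show "g (h(j := a)) = f h a" by (simp add: g_def)
    qed
    finally show "(\<integral>\<^sup>+h'. g h' \<partial>eP j h) = (\<integral>\<^sup>+a. f h a \<partial>K (state_before post s h j))" .
  qed
  also have "\<dots> = (\<integral>\<^sup>+h. (\<integral>\<^sup>+a. f (restrict h {0..<j}) a \<partial>K (state_before post s (restrict h {0..<j}) j)) \<partial>chain s)"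
    by (rule int[OF fK, symmetric])
  also have "\<dots> = (\<integral>\<^sup>+h. (\<integral>\<^sup>+a. f (restrict h {0..<j}) a \<partial>K (state_before post s h j)) \<partial>chain s)"
    by (simp add: state_before_restrict)
  finally show ?thesis .
qed

lemma integral_kernel_bounded:
  assumes f: "(\<lambda>(x, a). f x a) \<in> borel_measurable (M \<Otimes>\<^sub>M N)" and g: "g \<in> M \<rightarrow>\<^sub>M S"
    and bnd: "\<And>x a. \<bar>f x a\<bar> \<le> (B::real)"
  shows "(\<lambda>x. \<integral>a. f x a \<partial>K (g x)) \<in> borel_measurable M"
    and "x \<in> space M \<Longrightarrow> \<bar>\<integral>a. f x a \<partial>K (g x)\<bar> \<le> B"
    and "x \<in> space M \<Longrightarrow> integrable (K (g x)) (f x)"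
proof -
  have int: "integrable (K (g x)) (f x)" if x: "x \<in> space M" for x
  proof -
    interpret prob_space "K (g x)" using measurable_space[OF g x] by (rule K_prob)
    have "f x \<in> borel_measurable N" using measurable_compose[OF measurable_Pair1'[OF x] f] by simp
    then have "f x \<in> borel_measurable (K (g x))"
      using measurable_cong_sets[OF K_sets[OF measurable_space[OF g x]] refl] by blast
    then show ?thesis by (rule integrable_const_bound[where B = B, rotated]) (use bnd in auto)
  qed
  show "x \<in> space M \<Longrightarrow> integrable (K (g x)) (f x)" by (rule int)
  show "\<bar>\<integral>a. f x a \<partial>K (g x)\<bar> \<le> B" if x: "x \<in> space M"
  proof -
    interpret prob_space "K (g x)" using measurable_space[OF g x] by (rule K_prob)
    have "\<bar>\<integral>a. f x a \<partial>K (g x)\<bar> \<le> (\<integral>a. \<bar>f x a\<bar> \<partial>K (g x))" by (rule integral_abs_bound)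
    also have "\<dots> \<le> (\<integral>a. B \<partial>K (g x))"
      by (intro integral_mono integrable_abs int x) (use bnd in auto)
    finally show ?thesis by (simp add: prob_space)
  qed
  have [measurable]: "g \<in> M \<rightarrow>\<^sub>M S" by fact
  have "(\<lambda>x. distr (K (g x)) (borel :: real measure) (f x)) \<in> M \<rightarrow>\<^sub>M subprob_algebra borel"
    by (rule measurable_distr2[OF f]) measurable
  then have m: "(\<lambda>x. \<integral>r. r \<partial>distr (K (g x)) (borel :: real measure) (f x)) \<in> borel_measurable M"
    by (rule measurable_compose[OF _ integral_measurable_subprob_algebra]) simp
  have "(\<integral>r. r \<partial>distr (K (g x)) (borel :: real measure) (f x)) = (\<integral>a. f x a \<partial>K (g x))" if "x \<in> space M" for x
    using borel_measurable_integrable[OF int[OF that]] by (simp add: integral_distr)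
  then show "(\<lambda>x. \<integral>a. f x a \<partial>K (g x)) \<in> borel_measurable M"
    using m by (simp cong: measurable_cong)
qed

lemma integral_chain_Suc:
  assumes s: "s \<in> space S"
    and f: "(\<lambda>(h, a). f h a) \<in> borel_measurable (PiM {0..<j} (\<lambda>_. N) \<Otimes>\<^sub>M N)"
    and bnd: "\<And>h a. \<bar>f h a\<bar> \<le> (B::real)"
  shows "(\<integral>h. f (restrict h {0..<j}) (h j) \<partial>chain s) =
    (\<integral>h. (\<integral>a. f (restrict h {0..<j}) a \<partial>K (state_before post s h j)) \<partial>chain s)"
proof -
  interpret L: prob_space "chain s" by (rule prob_chain[OF s])
  let ?P = "PiM {0..<j} (\<lambda>_. N)"
  have B: "0 \<le> B" using bnd[of "\<lambda>_. undefined" undefined] by linarith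
  have restr: "(\<lambda>h. restrict h {0..<j}) \<in> chain s \<rightarrow>\<^sub>M ?P"
    by (simp add: measurable_cong_sets[OF sets_chain[OF s] refl] measurable_restrict_subset)
  have comp: "(\<lambda>h. h j) \<in> chain s \<rightarrow>\<^sub>M N"
    by (simp add: measurable_cong_sets[OF sets_chain[OF s] refl] measurable_component_singleton)
  note st = state_before_measurable[OF s order_refl, of j]
  \<comment> \<open>a shift by the bound reduces the claim to nonnegative functions\<close>
  define g where "g h a = f h a + B" for h a
  have gm: "(\<lambda>(h, a). g h a) \<in> borel_measurable (?P \<Otimes>\<^sub>M N)"
    using f by (simp add: g_def split_beta')
  have g0: "0 \<le> g h a" and gB: "\<bar>g h a\<bar> \<le> 2 * B" for h a
    using bnd[of h a] by (auto simp: g_def abs_le_iff)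
  note kf = integral_kernel_bounded[OF f st bnd] and kg = integral_kernel_bounded[OF gm st gB]
  have mf: "(\<lambda>h. f (restrict h {0..<j}) (h j)) \<in> borel_measurable (chain s)"
    using measurable_compose[OF measurable_Pair[OF restr comp] f] by simp
  have mg: "(\<lambda>h. g (restrict h {0..<j}) (h j)) \<in> borel_measurable (chain s)"
    using measurable_compose[OF measurable_Pair[OF restr comp] gm] by simp
  have if': "integrable (chain s) (\<lambda>h. f (restrict h {0..<j}) (h j))"
    by (rule L.integrable_const_bound[where B = B, OF _ mf]) (use bnd in auto)
  have mKf: "(\<lambda>h. \<integral>a. f (restrict h {0..<j}) a \<partial>K (state_before post s h j)) \<in> borel_measurable (chain s)"
    using measurable_compose[OF restr kf(1)] by (simp add: state_before_restrict)
  have mKg: "(\<lambda>h. \<integral>a. g (restrict h {0..<j}) a \<partial>K (state_before post s h j)) \<in> borel_measurable (chain s)"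
    using measurable_compose[OF restr kg(1)] by (simp add: state_before_restrict)
  have rs: "restrict h {0..<j} \<in> space ?P" if "h \<in> space (chain s)" for h
    using measurable_space[OF restr that] .
  have ikf: "integrable (chain s) (\<lambda>h. \<integral>a. f (restrict h {0..<j}) a \<partial>K (state_before post s h j))"
    by (rule L.integrable_const_bound[where B = B, OF AE_I2 mKf])
      (use kf(2)[OF rs] in \<open>simp add: state_before_restrict\<close>)
  have gf: "(\<integral>a. g (restrict h {0..<j}) a \<partial>K (state_before post s h j))
      = (\<integral>a. f (restrict h {0..<j}) a \<partial>K (state_before post s h j)) + B"
    if h: "h \<in> space (chain s)" for h
  proof -
    interpret prob_space "K (state_before post s h j)" by (rule K_prob[OF state_before_in_space[OF s h]])
    show ?thesis
      using kf(3)[OF rs[OF h]] by (simp add: g_def state_before_restrict prob_space)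
  qed
  have "(\<integral>h. g (restrict h {0..<j}) (h j) \<partial>chain s)
      = enn2real (\<integral>\<^sup>+h. ennreal (g (restrict h {0..<j}) (h j)) \<partial>chain s)"
    by (rule integral_eq_nn_integral[OF mg]) (use g0 in auto)
  also have "(\<integral>\<^sup>+h. ennreal (g (restrict h {0..<j}) (h j)) \<partial>chain s)
     = (\<integral>\<^sup>+h. (\<integral>\<^sup>+a. ennreal (g (restrict h {0..<j}) a) \<partial>K (state_before post s h j)) \<partial>chain s)"
    using gm by (intro nn_integral_chain_Suc[OF s]) (simp add: split_beta')
  also have "\<dots> = (\<integral>\<^sup>+h. ennreal (\<integral>a. g (restrict h {0..<j}) a \<partial>K (state_before post s h j)) \<partial>chain s)"
    using kg(3)[OF rs] by (intro nn_integral_cong nn_integral_eq_integral) (use g0 in \<open>auto simp: state_before_restrict\<close>)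
  also have "enn2real \<dots> = (\<integral>h. (\<integral>a. g (restrict h {0..<j}) a \<partial>K (state_before post s h j)) \<partial>chain s)"
    by (rule integral_eq_nn_integral[OF mKg, symmetric]) (use g0 in \<open>auto intro: integral_nonneg_AE\<close>)
  also have "\<dots> = (\<integral>h. (\<integral>a. f (restrict h {0..<j}) a \<partial>K (state_before post s h j)) + B \<partial>chain s)"
    by (intro Bochner_Integration.integral_cong refl gf)
  also have "\<dots> = (\<integral>h. (\<integral>a. f (restrict h {0..<j}) a \<partial>K (state_before post s h j)) \<partial>chain s) + B"
    using ikf by (simp add: L.prob_space)
  also have "(\<integral>h. g (restrict h {0..<j}) (h j) \<partial>chain s) = (\<integral>h. f (restrict h {0..<j}) (h j) \<partial>chain s) + B"
    unfolding g_def using if' by (subst Bochner_Integration.integral_add) (auto simp: L.prob_space)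
  finally show ?thesis by (simp only: add_right_cancel)
qed

lemma AE_chain:
  assumes s: "s \<in> space S" and P [measurable]: "Measurable.pred (S \<Otimes>\<^sub>M N) (\<lambda>(s, a). P s a)"
    and ae: "\<And>s. s \<in> space S \<Longrightarrow> AE a in K s. P s a"
  shows "AE h in chain s. \<forall>j::nat. P (state_before post s h j) (h j)"
  unfolding AE_all_countable
proof
  fix j :: nat
  interpret L: prob_space "chain s" by (rule prob_chain[OF s])
  let ?Q = "PiM {0..<j} (\<lambda>_. N)"
  define f :: "(nat \<Rightarrow> 'a) \<Rightarrow> 'a \<Rightarrow> ennreal" where "f h a = (if P (state_before post s h j) a then 0 else 1)" for h a
  have st [measurable]: "(\<lambda>h. state_before post s h j) \<in> ?Q \<rightarrow>\<^sub>M S"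
    by (rule state_before_measurable[OF s order_refl])
  have "(\<lambda>p. (state_before post s (fst p) j, snd p)) \<in> ?Q \<Otimes>\<^sub>M N \<rightarrow>\<^sub>M S \<Otimes>\<^sub>M N" by measurable
  from measurable_compose[OF this P]
  have [measurable]: "Measurable.pred (?Q \<Otimes>\<^sub>M N) (\<lambda>p. P (state_before post s (fst p) j) (snd p))" by simp
  have f: "(\<lambda>(h, a). f h a) \<in> borel_measurable (?Q \<Otimes>\<^sub>M N)"
    unfolding f_def split_beta' by measurable
  have "(\<integral>\<^sup>+h. f (restrict h {0..<j}) (h j) \<partial>chain s)
      = (\<integral>\<^sup>+h. (\<integral>\<^sup>+a. f (restrict h {0..<j}) a \<partial>K (state_before post s h j)) \<partial>chain s)"
    by (rule nn_integral_chain_Suc[OF s f])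
  also have "\<dots> = (\<integral>\<^sup>+h. 0 \<partial>chain s)"
  proof (intro nn_integral_cong)
    fix h assume h: "h \<in> space (chain s)"
    have "(\<integral>\<^sup>+a. f (restrict h {0..<j}) a \<partial>K (state_before post s h j))
        = (\<integral>\<^sup>+a. 0 \<partial>K (state_before post s h j))"
      using ae[OF state_before_in_space[OF s h, of j]]
      by (intro nn_integral_cong_AE) (auto simp: f_def state_before_restrict)
    then show "(\<integral>\<^sup>+a. f (restrict h {0..<j}) a \<partial>K (state_before post s h j)) = 0" by simp
  qed
  finally have zero: "(\<integral>\<^sup>+h. f (restrict h {0..<j}) (h j) \<partial>chain s) = 0" by simp
  have restr: "(\<lambda>h. restrict h {0..<j}) \<in> chain s \<rightarrow>\<^sub>M ?Q"
    by (simp add: measurable_cong_sets[OF sets_chain[OF s] refl] measurable_restrict_subset)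
  have comp: "(\<lambda>h. h j) \<in> chain s \<rightarrow>\<^sub>M N"
    by (simp add: measurable_cong_sets[OF sets_chain[OF s] refl] measurable_component_singleton)
  have "(\<lambda>h. f (restrict h {0..<j}) (h j)) \<in> borel_measurable (chain s)"
    using measurable_compose[OF measurable_Pair[OF restr comp] f] by simp
  from nn_integral_0_iff_AE[OF this] zero
  have "AE h in chain s. f (restrict h {0..<j}) (h j) = 0" by simp
  then show "AE h in chain s. P (state_before post s h j) (h j)"
    by eventually_elim (auto simp: f_def state_before_restrict split: if_splits)
qed

text \<open>
  Payoffs are bounded only at genuine states; truncating at \<open>B\<close> does not change them there and makes them bounded
  everywhere.
\<close>

lemma kernel_integral_on:
  assumes f: "(\<lambda>(x, a). f x a) \<in> borel_measurable (M \<Otimes>\<^sub>M N)" and g: "g \<in> M \<rightarrow>\<^sub>M S"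
    and bnd: "\<And>x a. x \<in> space M \<Longrightarrow> a \<in> space N \<Longrightarrow> \<bar>f x a\<bar> \<le> (B::real)" and B: "0 \<le> B"
  shows "(\<lambda>x. \<integral>a. f x a \<partial>K (g x)) \<in> borel_measurable M"
    and "x \<in> space M \<Longrightarrow> \<bar>\<integral>a. f x a \<partial>K (g x)\<bar> \<le> B"
    and "x \<in> space M \<Longrightarrow> integrable (K (g x)) (f x)"
proof -
  define f' where "f' x a = max (- B) (min B (f x a))" for x a
  have f': "(\<lambda>(x, a). f' x a) \<in> borel_measurable (M \<Otimes>\<^sub>M N)"
    using f unfolding f'_def split_beta' by measurable
  have b': "\<bar>f' x a\<bar> \<le> B" for x a using B by (auto simp: f'_def)
  have eq: "f' x a = f x a" if "x \<in> space M" "a \<in> space (K (g x))" for x a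
    using bnd[OF that(1), of a] that K_space[OF measurable_space[OF g that(1)]] by (auto simp: f'_def)
  have "(\<integral>a. f' x a \<partial>K (g x)) = (\<integral>a. f x a \<partial>K (g x))" if "x \<in> space M" for x
    using eq[OF that] by (intro Bochner_Integration.integral_cong) auto
  moreover have "integrable (K (g x)) (f' x) \<longleftrightarrow> integrable (K (g x)) (f x)" if "x \<in> space M" for x
    using eq[OF that] by (intro Bochner_Integration.integrable_cong) auto
  moreover note integral_kernel_bounded[OF f' g b']
  ultimately show "(\<lambda>x. \<integral>a. f x a \<partial>K (g x)) \<in> borel_measurable M"
    "x \<in> space M \<Longrightarrow> \<bar>\<integral>a. f x a \<partial>K (g x)\<bar> \<le> B"
    "x \<in> space M \<Longrightarrow> integrable (K (g x)) (f x)"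
    by (simp_all cong: measurable_cong)
qed

end


section \<open>The slow variable along a chain of pieces\<close>

lemma lborel_set_integral_shift:
  fixes f :: "real \<Rightarrow> 'v::euclidean_space"
  shows "(LBINT r:{t..t + s}. f r) = (LBINT r:{0..s}. f (t + r))"
proof -
  have "(LBINT r:{t..t + s}. f r) = (\<integral>r. indicator {t..t + s} (t + 1 * r) *\<^sub>R f (t + 1 * r) \<partial>lborel)"
    unfolding set_lebesgue_integral_def
    by (subst lborel_integral_real_affine[where c = 1 and t = t]) auto
  also have "\<dots> = (LBINT r:{0..s}. f (t + r))"
    unfolding set_lebesgue_integral_def
    by (intro Bochner_Integration.integral_cong) (auto simp: indicator_def)
  finally show ?thesis .
qed

text \<open>
  A phase \<open>(v, r)\<close> consists of the slow variable and the time left. A remaining time 0 marks that the horizon was reached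
  within the current piece or an earlier one; it stays 0 afterwards.
\<close>

definition advance :: "(real \<Rightarrow> 'v \<Rightarrow> 'v::euclidean_space) \<Rightarrow> ennreal \<Rightarrow> 'v \<times> real \<Rightarrow> 'v \<times> real" where
  "advance d \<sigma> p = (flow d (fst p) (enn2real \<sigma>),
     if \<sigma> < ennreal (snd p) then snd p - enn2real \<sigma> else 0)"

context
  fixes \<sigma> \<tau> :: "nat \<Rightarrow> ennreal" and d :: "nat \<Rightarrow> real \<Rightarrow> 'v \<Rightarrow> 'v::euclidean_space"
    and drv :: "real \<Rightarrow> 'v \<Rightarrow> 'v" and x :: "real \<Rightarrow> 'v" and z :: 'v and q :: "nat \<Rightarrow> 'v \<times> real" and T :: real
  assumes pos: "\<And>j. 0 < \<sigma> j" and fields: "\<And>j. \<exists>L. lipschitz_field L (d j)"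
    and \<tau>_def: "\<And>j. \<tau> j = (\<Sum>i<j. \<sigma> i)"
    and drv: "\<And>j t v. 0 \<le> t \<Longrightarrow> \<tau> j \<le> ennreal t \<Longrightarrow> ennreal t < \<tau> (Suc j) \<Longrightarrow>
      drv t v = d j (t - enn2real (\<tau> j)) v"
    and x: "solves_until drv z (SUP j. \<tau> j) x"
    and q0: "q 0 = (z, T)" and qS: "\<And>j. q (Suc j) = advance (d j) (\<sigma> j) (q j)"
    and T: "0 < T"
begin

lemma tau_Suc: "\<tau> (Suc j) = \<tau> j + \<sigma> j"
  by (simp add: \<tau>_def add.commute)

lemma tau_less_life:
  assumes "\<tau> j < \<infinity>" shows "\<tau> j < (SUP j. \<tau> j)"
proof -
  have "\<tau> j < \<tau> (Suc j)"
    using assms pos[of j] ennreal_add_left_cancel_less[of "\<tau> j" 0 "\<sigma> j"] by (simp add: tau_Suc less_top)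
  also have "\<tau> (Suc j) \<le> (SUP j. \<tau> j)" by (rule SUP_upper) simp
  finally show ?thesis .
qed

lemma tau_real:
  assumes "\<tau> j < ennreal T"
  shows "0 \<le> enn2real (\<tau> j)" "\<tau> j = ennreal (enn2real (\<tau> j))" "enn2real (\<tau> j) < T"
proof -
  from assms obtain t where "\<tau> j = ennreal t" "0 \<le> t" by (cases "\<tau> j") auto
  with assms T show "0 \<le> enn2real (\<tau> j)" "\<tau> j = ennreal (enn2real (\<tau> j))" "enn2real (\<tau> j) < T"
    by (auto simp: ennreal_less_iff)
qed

text \<open>
  A solution of the concatenated equation, restarted at the beginning of a piece, solves the equation of that piece, so
  uniqueness identifies it with the flow. The end of the piece is included by continuity.
\<close>

lemma piece_follows_flow:
  assumes j: "\<tau> j < \<infinity>" and u: "0 \<le> u" "ennreal (enn2real (\<tau> j) + u) \<le> \<tau> (Suc j)"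
  shows "x (enn2real (\<tau> j) + u) = flow (d j) (x (enn2real (\<tau> j))) u"
proof -
  define t where "t = enn2real (\<tau> j)"
  have t: "0 \<le> t" "\<tau> j = ennreal t" using j by (auto simp: t_def)
  obtain L where L: "lipschitz_field L (d j)" using fields by blast
  have live: "ennreal (t + s) < (SUP j. \<tau> j)" if "0 \<le> s" "s \<le> u" for s
  proof -
    have "ennreal (t + s) \<le> \<tau> (Suc j)"
      using u that t(1) order_trans[OF ennreal_leI[of "t + s" "t + u"]] by (simp add: t_def)
    moreover have "(SUP j. \<tau> j) \<ge> \<tau> (Suc j)" by (rule SUP_upper) simp
    moreover have "\<tau> (Suc j) < \<infinity> \<Longrightarrow> \<tau> (Suc j) < (SUP j. \<tau> j)" by (rule tau_less_life)
    ultimately show ?thesis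
      by (metis ennreal_less_top infinity_ennreal_def order_le_less_trans order_less_le_trans top.not_eq_extremum)
  qed
  have cont: "continuous_on {t. 0 \<le> t \<and> ennreal t < (SUP j. \<tau> j)} x"
    and int: "\<And>t. 0 \<le> t \<Longrightarrow> ennreal t < (SUP j. \<tau> j) \<Longrightarrow> set_integrable lborel {0..t} (\<lambda>s. drv s (x s))"
    and eq: "\<And>t. 0 \<le> t \<Longrightarrow> ennreal t < (SUP j. \<tau> j) \<Longrightarrow> x t = z + (LBINT s:{0..t}. drv s (x s))"
    using x unfolding solves_until_def by blast+
  have "solves_on (d j) (x t) u (\<lambda>s. x (t + s))"
    unfolding solves_on_def
  proof (intro conjI ballI)
    show "continuous_on {0..u} (\<lambda>s. x (t + s))"
    proof (rule continuous_on_compose2[OF cont])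
      show "(\<lambda>s. t + s) ` {0..u} \<subseteq> {t. 0 \<le> t \<and> ennreal t < (SUP j. \<tau> j)}"
      proof (rule image_subsetI)
        fix s assume "s \<in> {0..u}"
        then show "t + s \<in> {t. 0 \<le> t \<and> ennreal t < (SUP j. \<tau> j)}"
          using live[of s] t(1) by (simp only: mem_Collect_eq atLeastAtMost_iff add_nonneg_nonneg simp_thms)
      qed
    qed (intro continuous_intros)
    fix s assume s: "s \<in> {0..u}"
    have "x (t + s) = z + (LBINT r:{0..t + s}. drv r (x r))"
      using s live t by (intro eq) auto
    also have "(LBINT r:{0..t + s}. drv r (x r)) = (LBINT r:{0..t}. drv r (x r)) + (LBINT r:{t..t + s}. drv r (x r))"
      using s live t by (intro lborel_set_integral_split int) auto
    also have "z + \<dots> = x t + (LBINT r:{t..t + s}. drv r (x r))"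
      using eq[of t] live[of 0] u t by simp
    also have "(LBINT r:{t..t + s}. drv r (x r)) = (LBINT r:{0..s}. drv (t + r) (x (t + r)))"
      by (rule lborel_set_integral_shift)
    also have "\<dots> = (LBINT r:{0..s}. d j r (x (t + r)))"
      unfolding set_lebesgue_integral_def
    proof (rule integral_discrete_difference[where X = "{s}"])
      fix r assume "r \<in> space lborel" "r \<notin> {s}"
      show "indicator {0..s} r *\<^sub>R drv (t + r) (x (t + r)) = indicator {0..s} r *\<^sub>R d j r (x (t + r))"
      proof (cases "r \<in> {0..s}")
        case True
        with \<open>r \<notin> {s}\<close> have r: "0 \<le> r" "r < s" by auto
        have "ennreal (t + r) < ennreal (t + u)" using r s t by (intro ennreal_lessI) auto
        then have "ennreal (t + r) < \<tau> (Suc j)" using u by (simp add: t_def)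
        then have "drv (t + r) (x (t + r)) = d j (t + r - enn2real (\<tau> j)) (x (t + r))"
          using r t by (intro drv) (auto intro: ennreal_leI)
        then show ?thesis by (simp add: t_def)
      qed simp
    qed auto
    finally show "x (t + s) = x t + (LBINT r:{0..s}. d j r (x (t + r)))" .
  qed
  from flow_unique[OF L this, of u] u show ?thesis by (simp add: t_def)
qed

text \<open>
  The phases, which are computed step by step from the pieces alone, are the positions of the solution at the transition
  times. Hence the law of the solution at the horizon depends on the chain only.
\<close>

lemma phase_of_solution:
  "(\<tau> j < ennreal T \<longrightarrow> q j = (x (enn2real (\<tau> j)), T - enn2real (\<tau> j))) \<and>
   (ennreal T \<le> \<tau> j \<longrightarrow> snd (q j) = 0)"
proof (induction j)
  case 0
  have "x 0 = z"
  proof -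
    have "(0::ennreal) < \<sigma> 0" by (rule pos)
    also have "\<sigma> 0 = \<tau> (Suc 0)" by (simp add: \<tau>_def)
    also have "\<tau> (Suc 0) \<le> (SUP j. \<tau> j)" by (rule SUP_upper) simp
    finally have "x 0 = z + (LBINT s:{0..0}. drv s (x s))" and
      "set_integrable lborel {0..0} (\<lambda>s. drv s (x s))"
      using x by (auto simp: solves_until_def)
    moreover have "(LBINT s:{0..0}. drv s (x s)) = 0"
      unfolding set_lebesgue_integral_def
      by (subst integral_discrete_difference[where X = "{0}" and g = "\<lambda>_. 0"]) auto
    ultimately show ?thesis by simp
  qed
  then show ?case using T by (simp add: \<tau>_def q0)
next
  case (Suc j)
  have mono: "\<tau> j \<le> \<tau> (Suc j)" by (simp add: tau_Suc)
  show ?case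
  proof (cases "\<tau> j < ennreal T")
    case False
    then have "ennreal T \<le> \<tau> (Suc j)" "snd (q j) = 0" using mono Suc by auto
    then have "\<not> \<tau> (Suc j) < ennreal T" "snd (q j) = 0" by (auto simp: not_less)
    then show ?thesis by (simp add: qS advance_def)
  next
    case True
    then have q: "q j = (x (enn2real (\<tau> j)), T - enn2real (\<tau> j))" using Suc by simp
    define t where "t = enn2real (\<tau> j)"
    have t: "0 \<le> t" "\<tau> j = ennreal t" "t < T"
      using tau_real[OF True] by (auto simp: t_def)
    have iff: "\<sigma> j < ennreal (T - t) \<longleftrightarrow> \<tau> (Suc j) < ennreal T"
    proof -
      have "ennreal T = ennreal t + ennreal (T - t)" using t by (simp flip: ennreal_plus)
      then show ?thesis by (simp add: tau_Suc t(2))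
    qed
    show ?thesis
    proof (cases "\<tau> (Suc j) < ennreal T")
      case False
      then show ?thesis using iff by (simp add: qS advance_def q flip: t_def)
    next
      case less: True
      then have "\<sigma> j < \<infinity>" using iff by (auto intro: order_less_trans)
      then have s: "\<sigma> j = ennreal (enn2real (\<sigma> j))" by (simp add: less_top)
      define s where "s = enn2real (\<sigma> j)"
      have s: "0 \<le> s" "\<sigma> j = ennreal s" using s by (auto simp: s_def)
      have ts: "\<tau> (Suc j) = ennreal (t + s)" using t s by (simp add: tau_Suc)
      have "x (t + s) = flow (d j) (x t) s"
      proof (rule piece_follows_flow[of j s, folded t_def])
        show "\<tau> j < \<infinity>" by (simp add: t(2))
        show "0 \<le> s" by (rule s(1))
        show "ennreal (t + s) \<le> \<tau> (Suc j)" by (simp only: ts order_refl)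
      qed
      moreover have "enn2real (\<tau> (Suc j)) = t + s" unfolding ts using t s by (intro enn2real_ennreal) simp
      moreover have "\<not> ennreal T \<le> \<tau> (Suc j)" using less by (simp add: not_le)
      ultimately show ?thesis
        using less iff t s by (simp add: qS advance_def q flip: t_def s_def)
    qed
  qed
qed

lemma terminal_value:
  assumes "\<tau> j < ennreal T" "ennreal T \<le> \<tau> (Suc j)"
  shows "x T = flow (d j) (fst (q j)) (snd (q j))"
proof -
  have q: "q j = (x (enn2real (\<tau> j)), T - enn2real (\<tau> j))" using phase_of_solution assms by simp
  have "x (enn2real (\<tau> j) + (T - enn2real (\<tau> j))) = flow (d j) (x (enn2real (\<tau> j))) (T - enn2real (\<tau> j))"
  proof (rule piece_follows_flow)
    show "\<tau> j < \<infinity>" using assms(1) by (rule order_less_trans) simp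
    show "0 \<le> T - enn2real (\<tau> j)" using tau_real(3)[OF assms(1)] by simp
    show "ennreal (enn2real (\<tau> j) + (T - enn2real (\<tau> j))) \<le> \<tau> (Suc j)" using assms(2) by simp
  qed
  then show ?thesis by (simp add: q)
qed

lemma alive_iff: "0 < snd (q j) \<longleftrightarrow> \<tau> j < ennreal T"
proof (cases "\<tau> j < ennreal T")
  case True
  then have "enn2real (\<tau> j) < T" by (rule tau_real)
  with True phase_of_solution[of j] show ?thesis by simp
qed (use phase_of_solution[of j] in auto)

lemma last_piece_iff:
  assumes "\<tau> j < ennreal T"
  shows "ennreal (snd (q j)) \<le> \<sigma> j \<longleftrightarrow> ennreal T \<le> \<tau> (Suc j)"
proof -
  have q: "q j = (x (enn2real (\<tau> j)), T - enn2real (\<tau> j))" using phase_of_solution assms by simp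
  define t where "t = enn2real (\<tau> j)"
  have t: "0 \<le> t" "\<tau> j = ennreal t" "t < T"
    using tau_real[OF assms] by (auto simp: t_def)
  have "ennreal T = ennreal t + ennreal (T - t)" using t by (simp flip: ennreal_plus)
  moreover have "snd (q j) = T - t" by (simp add: q t_def)
  ultimately show ?thesis by (simp add: tau_Suc t(2))
qed

text \<open>
  The horizon \<open>T\<close> lies in at most one of the first \<open>k\<close> pieces, and in exactly one of them iff \<open>T \<le> \<tau> k\<close>. The summand of a
  piece is nonzero only if that piece has been entered before \<open>T\<close> and lasts up to \<open>T\<close>.
\<close>

lemma payoff_decomposition:
  fixes \<phi> :: "'v \<Rightarrow> real"
  shows "\<phi> (x T) * of_bool (ennreal T \<le> \<tau> k) =
    (\<Sum>j<k. if 0 < snd (q j)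
       then (if ennreal (snd (q j)) \<le> \<sigma> j then \<phi> (flow (d j) (fst (q j)) (snd (q j))) else 0) else 0)"
proof (induction k)
  case 0
  then show ?case using T by (simp add: \<tau>_def)
next
  case (Suc k)
  have mono: "\<tau> k \<le> \<tau> (Suc k)" by (simp add: tau_Suc)
  show ?case
  proof (cases "\<tau> k < ennreal T")
    case True
    then have "\<not> ennreal T \<le> \<tau> k" by simp
    then have "(\<Sum>j<k. if 0 < snd (q j)
       then (if ennreal (snd (q j)) \<le> \<sigma> j then \<phi> (flow (d j) (fst (q j)) (snd (q j))) else 0) else 0) = 0"
      using Suc by simp
    then show ?thesis
      using True alive_iff[of k] last_piece_iff[of k] terminal_value[of k] by simp
  next
    case False
    then have "ennreal T \<le> \<tau> k" by simp
    with mono have "ennreal T \<le> \<tau> (Suc k)" by (rule order_trans[rotated])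
    with \<open>ennreal T \<le> \<tau> k\<close> False show ?thesis using Suc alive_iff[of k] by simp
  qed
qed

end

lemma alive_advance: "0 < snd (advance d \<sigma> p) \<longleftrightarrow> \<sigma> < ennreal (snd p)"
proof (cases "\<sigma> < ennreal (snd p)")
  case True
  then obtain r where "\<sigma> = ennreal r" "0 \<le> r" by (cases \<sigma>) auto
  with True show ?thesis by (auto simp: advance_def ennreal_less_iff)
qed (simp add: advance_def)

text \<open>
  Almost every step has a positive length and a Lipschitz field. The set \<open>good\<close> is a measurable set of such
  steps, which the two conditions alone need not be.
\<close>

locale pieced_chain = markov_chain S N K post
  for S :: "'s measure" and N :: "'a measure" and K :: "'s \<Rightarrow> 'a measure" and post :: "'a \<Rightarrow> 's" +
  fixes hold :: "'s \<Rightarrow> 'a \<Rightarrow> ennreal" and drift :: "'s \<Rightarrow> 'a \<Rightarrow> real \<Rightarrow> 'v \<Rightarrow> 'v::euclidean_space"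
    and good :: "'s \<Rightarrow> 'a \<Rightarrow> bool"
  assumes hold: "(\<lambda>(s, a). hold s a) \<in> borel_measurable (S \<Otimes>\<^sub>M N)"
    and drift: "(\<lambda>((p, t), v). drift (fst p) (snd p) t v) \<in> ((S \<Otimes>\<^sub>M N) \<Otimes>\<^sub>M borel) \<Otimes>\<^sub>M borel \<rightarrow>\<^sub>M borel"
    and good: "Measurable.pred (S \<Otimes>\<^sub>M N) (\<lambda>(s, a). good s a)"
    and good_AE: "\<And>s. s \<in> space S \<Longrightarrow> AE a in K s. good s a"
    and good_hold: "\<And>s a. good s a \<Longrightarrow> 0 < hold s a"
    and good_drift: "\<And>s a. s \<in> space S \<Longrightarrow> a \<in> space N \<Longrightarrow> good s a \<Longrightarrow> \<exists>L. lipschitz_field L (drift s a)"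
begin

abbreviation phase :: "('v \<times> real) measure" where
  "phase \<equiv> borel \<Otimes>\<^sub>M borel"

lemma advance_measurable:
  "(\<lambda>x. advance (drift (snd (fst x)) (snd x)) (hold (snd (fst x)) (snd x)) (fst (fst x)))
    \<in> (phase \<Otimes>\<^sub>M S) \<Otimes>\<^sub>M N \<rightarrow>\<^sub>M phase" (is ?adv)
  "(\<lambda>x. hold (snd (fst x)) (snd x)) \<in> borel_measurable ((phase \<Otimes>\<^sub>M S) \<Otimes>\<^sub>M N)" (is ?hold)
  "(\<lambda>x. flow (drift (snd (fst x)) (snd x)) (fst (fst (fst x))) (snd (fst (fst x))))
    \<in> borel_measurable ((phase \<Otimes>\<^sub>M S) \<Otimes>\<^sub>M N)" (is ?fl)
proof -
  let ?X = "(phase \<Otimes>\<^sub>M S) \<Otimes>\<^sub>M N"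
  note fm = flow_measurable[OF drift]
  have sn: "(\<lambda>x. (snd (fst x), snd x)) \<in> ?X \<rightarrow>\<^sub>M S \<Otimes>\<^sub>M N" by measurable
  from measurable_compose[OF sn hold] show hm: ?hold by simp
  have fl: "(\<lambda>x. flow (drift (snd (fst x)) (snd x)) (fst (fst (fst x))) (g x)) \<in> borel_measurable ?X"
    if [measurable]: "g \<in> borel_measurable ?X" for g
  proof -
    have "(\<lambda>x. (((snd (fst x), snd x), fst (fst (fst x))), g x)) \<in> ?X \<rightarrow>\<^sub>M ((S \<Otimes>\<^sub>M N) \<Otimes>\<^sub>M borel) \<Otimes>\<^sub>M borel"
      by measurable
    from measurable_compose[OF this fm] show ?thesis by simp
  qed
  show ?fl by (rule fl) measurable
  note [measurable] = hm
  have [measurable]: "(\<lambda>x. flow (drift (snd (fst x)) (snd x)) (fst (fst (fst x))) (enn2real (hold (snd (fst x)) (snd x))))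
      \<in> borel_measurable ?X"
    by (rule fl) measurable
  show ?adv unfolding advance_def by measurable
qed

text \<open>
  A piece that lasts exactly as long as the remaining time counts as stopped at the horizon, in accordance with the
  event \<open>T \<le> \<tau> k\<close>.
\<close>

definition stop_payoff :: "('v \<Rightarrow> real) \<Rightarrow> 'v \<times> real \<Rightarrow> 's \<Rightarrow> 'a \<Rightarrow> real" where
  "stop_payoff \<phi> p s a = (if ennreal (snd p) \<le> hold s a then \<phi> (flow (drift s a) (fst p) (snd p)) else 0)"

definition jump_payoff :: "('v \<times> real \<Rightarrow> 's \<Rightarrow> real) \<Rightarrow> 'v \<times> real \<Rightarrow> 's \<Rightarrow> 'a \<Rightarrow> real" where
  "jump_payoff f p s a =
     (if hold s a < ennreal (snd p) then f (advance (drift s a) (hold s a) p) (post a) else 0)"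

definition stop_op :: "('v \<Rightarrow> real) \<Rightarrow> 'v \<times> real \<Rightarrow> 's \<Rightarrow> real" where
  "stop_op \<phi> p s = (\<integral>a. stop_payoff \<phi> p s a \<partial>K s)"

definition jump_op :: "('v \<times> real \<Rightarrow> 's \<Rightarrow> real) \<Rightarrow> 'v \<times> real \<Rightarrow> 's \<Rightarrow> real" where
  "jump_op f p s = (\<integral>a. jump_payoff f p s a \<partial>K s)"

text \<open>
  Bounded measurable functions of phase and state. This class is preserved by both operators with the same bound, which
  supplies the dominating constant throughout.
\<close>

definition payoff_fun :: "real \<Rightarrow> ('v \<times> real \<Rightarrow> 's \<Rightarrow> real) \<Rightarrow> bool" where
  "payoff_fun B f \<longleftrightarrow> (\<lambda>(p, s). f p s) \<in> borel_measurable (phase \<Otimes>\<^sub>M S) \<and> (\<forall>p. \<forall>s\<in>space S. \<bar>f p s\<bar> \<le> B) \<and> 0 \<le> B"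

lemma payoff_fun_bound: "payoff_fun B f \<Longrightarrow> s \<in> space S \<Longrightarrow> \<bar>f p s\<bar> \<le> B"
  unfolding payoff_fun_def by blast

lemma stop_payoff_measurable:
  assumes [measurable]: "\<phi> \<in> borel_measurable borel"
  shows "(\<lambda>(x, a). stop_payoff \<phi> (fst x) (snd x) a) \<in> borel_measurable ((phase \<Otimes>\<^sub>M S) \<Otimes>\<^sub>M N)"
proof -
  note [measurable] = advance_measurable
  show ?thesis unfolding stop_payoff_def split_beta' by measurable
qed

lemma jump_payoff_measurable:
  assumes f: "(\<lambda>(p, s). f p s) \<in> borel_measurable (phase \<Otimes>\<^sub>M S)"
  shows "(\<lambda>(x, a). jump_payoff f (fst x) (snd x) a) \<in> borel_measurable ((phase \<Otimes>\<^sub>M S) \<Otimes>\<^sub>M N)"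
proof -
  note [measurable] = advance_measurable
  have "(\<lambda>x. (advance (drift (snd (fst x)) (snd x)) (hold (snd (fst x)) (snd x)) (fst (fst x)), post (snd x)))
      \<in> (phase \<Otimes>\<^sub>M S) \<Otimes>\<^sub>M N \<rightarrow>\<^sub>M phase \<Otimes>\<^sub>M S" by measurable
  from measurable_compose[OF this f]
  have [measurable]: "(\<lambda>x. f (advance (drift (snd (fst x)) (snd x)) (hold (snd (fst x)) (snd x)) (fst (fst x))) (post (snd x)))
      \<in> borel_measurable ((phase \<Otimes>\<^sub>M S) \<Otimes>\<^sub>M N)" by simp
  show ?thesis unfolding jump_payoff_def split_beta' by measurable
qed

lemma space_phase: "space phase = UNIV" by (simp add: space_pair_measure)

lemma stop_op_payoff_fun:
  assumes \<phi>: "\<phi> \<in> borel_measurable borel" and B: "\<And>v. \<bar>\<phi> v\<bar> \<le> B"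
  shows "payoff_fun B (stop_op \<phi>)"
proof -
  have B0: "0 \<le> B" using B[of 0] by linarith
  have b: "\<bar>stop_payoff \<phi> (fst x) (snd x) a\<bar> \<le> B" for x a using B B0 by (simp add: stop_payoff_def)
  note k = kernel_integral_on[OF stop_payoff_measurable[OF \<phi>] measurable_snd b B0]
  show ?thesis
    unfolding payoff_fun_def stop_op_def
    using k(1) k(2)[of "(p, s)" for p s] B0 by (auto simp: space_pair_measure split_beta')
qed

lemma jump_op_payoff_fun:
  assumes f: "payoff_fun B f"
  shows "payoff_fun B (jump_op f)"
proof -
  have fm: "(\<lambda>(p, s). f p s) \<in> borel_measurable (phase \<Otimes>\<^sub>M S)" and B0: "0 \<le> B"
    using f by (auto simp: payoff_fun_def)
  have b: "\<bar>jump_payoff f (fst x) (snd x) a\<bar> \<le> B" if "x \<in> space (phase \<Otimes>\<^sub>M S)" "a \<in> space N" for x a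
    using payoff_fun_bound[OF f measurable_space[OF post that(2)]] B0 by (simp add: jump_payoff_def)
  note k = kernel_integral_on[OF jump_payoff_measurable[OF fm] measurable_snd b B0]
  show ?thesis
    unfolding payoff_fun_def jump_op_def
    using k(1) k(2)[of "(p, s)" for p s] B0 by (auto simp: space_pair_measure split_beta')
qed

lemma jump_op_funpow_payoff_fun: "payoff_fun B f \<Longrightarrow> payoff_fun B ((jump_op ^^ j) f)"
  by (induction j) (auto intro: jump_op_payoff_fun)

primrec phase_before :: "'s \<Rightarrow> 'v \<times> real \<Rightarrow> (nat \<Rightarrow> 'a) \<Rightarrow> nat \<Rightarrow> 'v \<times> real" where
  "phase_before s p h 0 = p"
| "phase_before s p h (Suc j) =
    advance (drift (state_before post s h j) (h j)) (hold (state_before post s h j) (h j)) (phase_before s p h j)"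

lemma phase_before_restrict: "j \<le> k \<Longrightarrow> phase_before s p (restrict h {0..<k}) j = phase_before s p h j"
  by (induction j) (auto simp: state_before_restrict)

lemma phase_before_measurable:
  assumes s: "s \<in> space S"
  shows "{0..<k} \<subseteq> I \<Longrightarrow> (\<lambda>h. phase_before s p h k) \<in> PiM I (\<lambda>_. N) \<rightarrow>\<^sub>M phase"
proof (induction k)
  case 0
  then show ?case by (simp add: space_phase)
next
  case (Suc j)
  have [measurable]: "(\<lambda>h. h j) \<in> PiM I (\<lambda>_. N) \<rightarrow>\<^sub>M N"
    using Suc.prems by (intro measurable_component_singleton) auto
  have [measurable]: "(\<lambda>h. phase_before s p h j) \<in> PiM I (\<lambda>_. N) \<rightarrow>\<^sub>M phase"
    "(\<lambda>h. state_before post s h j) \<in> PiM I (\<lambda>_. N) \<rightarrow>\<^sub>M S"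
    using Suc.prems by (auto intro!: Suc.IH state_before_measurable[OF s])
  have "(\<lambda>h. ((phase_before s p h j, state_before post s h j), h j))
      \<in> PiM I (\<lambda>_. N) \<rightarrow>\<^sub>M (phase \<Otimes>\<^sub>M S) \<Otimes>\<^sub>M N" by measurable
  from measurable_compose[OF this advance_measurable(1)] show ?case by simp
qed

lemma expectation_step:
  assumes s: "s \<in> space S"
    and \<psi>: "(\<lambda>(x, a). \<psi> (fst x) (snd x) a) \<in> borel_measurable ((phase \<Otimes>\<^sub>M S) \<Otimes>\<^sub>M N)"
    and bnd: "\<And>p s a. s \<in> space S \<Longrightarrow> a \<in> space N \<Longrightarrow> \<bar>\<psi> p s a\<bar> \<le> (B::real)" and B: "0 \<le> B"
  shows "(\<lambda>h. \<psi> (phase_before s p h j) (state_before post s h j) (h j)) \<in> borel_measurable (chain s)"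
    and "(\<integral>h. \<psi> (phase_before s p h j) (state_before post s h j) (h j) \<partial>chain s) =
    (\<integral>h. (\<integral>a. \<psi> (phase_before s p h j) (state_before post s h j) a \<partial>K (state_before post s h j)) \<partial>chain s)"
proof -
  let ?P = "PiM {0..<j} (\<lambda>_. N)"
  have m: "(\<lambda>h. ((phase_before s p h j, state_before post s h j), h j))
      \<in> PiM UNIV (\<lambda>_. N) \<rightarrow>\<^sub>M (phase \<Otimes>\<^sub>M S) \<Otimes>\<^sub>M N"
    by (intro measurable_Pair phase_before_measurable[OF s] state_before_measurable[OF s]
        measurable_component_singleton) auto
  from measurable_compose[OF m \<psi>]
  show "(\<lambda>h. \<psi> (phase_before s p h j) (state_before post s h j) (h j)) \<in> borel_measurable (chain s)"
    by (simp add: measurable_cong_sets[OF sets_chain[OF s] refl])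
  \<comment> \<open>truncation changes nothing at genuine states and steps\<close>
  define \<psi>' where "\<psi>' h a = max (- B) (min B (\<psi> (phase_before s p h j) (state_before post s h j) a))" for h a
  have [measurable]: "(\<lambda>h. phase_before s p h j) \<in> ?P \<rightarrow>\<^sub>M phase" "(\<lambda>h. state_before post s h j) \<in> ?P \<rightarrow>\<^sub>M S"
    by (intro phase_before_measurable[OF s] state_before_measurable[OF s] order_refl)+
  have "(\<lambda>x. ((phase_before s p (fst x) j, state_before post s (fst x) j), snd x))
      \<in> ?P \<Otimes>\<^sub>M N \<rightarrow>\<^sub>M (phase \<Otimes>\<^sub>M S) \<Otimes>\<^sub>M N" by measurable
  from measurable_compose[OF this \<psi>]
  have \<psi>': "(\<lambda>(h, a). \<psi>' h a) \<in> borel_measurable (?P \<Otimes>\<^sub>M N)"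
    unfolding \<psi>'_def split_beta' by simp
  have eq: "\<psi>' (restrict h {0..<j}) a = \<psi> (phase_before s p h j) (state_before post s h j) a"
    if "h \<in> space (chain s)" "a \<in> space N" for h a
    using bnd[OF state_before_in_space[OF s that(1), of j] that(2), of "phase_before s p h j"]
    by (auto simp: \<psi>'_def phase_before_restrict state_before_restrict)
  have hj: "h j \<in> space N" if "h \<in> space (chain s)" for h
    using that by (auto simp: space_chain[OF s] space_PiM PiE_def)
  have "(\<integral>h. \<psi> (phase_before s p h j) (state_before post s h j) (h j) \<partial>chain s)
      = (\<integral>h. \<psi>' (restrict h {0..<j}) (h j) \<partial>chain s)"
    by (intro Bochner_Integration.integral_cong refl eq[symmetric] hj)
  also have "\<dots> = (\<integral>h. (\<integral>a. \<psi>' (restrict h {0..<j}) a \<partial>K (state_before post s h j)) \<partial>chain s)"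
    by (rule integral_chain_Suc[OF s \<psi>', where B = B]) (use B in \<open>auto simp: \<psi>'_def\<close>)
  also have "\<dots> = (\<integral>h. (\<integral>a. \<psi> (phase_before s p h j) (state_before post s h j) a \<partial>K (state_before post s h j)) \<partial>chain s)"
    by (intro Bochner_Integration.integral_cong refl eq) (simp_all add: K_space[OF state_before_in_space[OF s]])
  finally show "(\<integral>h. \<psi> (phase_before s p h j) (state_before post s h j) (h j) \<partial>chain s) = \<dots>" .
qed

text \<open>
  Conditioning on the last of the \<open>j\<close> steps replaces \<open>f\<close> by \<open>jump_op f\<close> and leaves \<open>j - 1\<close> steps.
\<close>

lemma expectation_alive:
  assumes s: "s \<in> space S" and T: "0 < T"
  shows "payoff_fun B f \<Longrightarrow>
    (\<integral>h. (if 0 < snd (phase_before s (z, T) h j)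
            then f (phase_before s (z, T) h j) (state_before post s h j) else 0) \<partial>chain s)
      = (jump_op ^^ j) f (z, T) s"
proof (induction j arbitrary: f)
  case 0
  interpret L: prob_space "chain s" by (rule prob_chain[OF s])
  show ?case using T by (simp add: L.prob_space state_before_def)
next
  case (Suc j)
  have fm: "(\<lambda>(p, s). f p s) \<in> borel_measurable (phase \<Otimes>\<^sub>M S)" and B0: "0 \<le> B"
    using Suc.prems by (auto simp: payoff_fun_def)
  have b: "\<bar>jump_payoff f p s a\<bar> \<le> B" if "s \<in> space S" "a \<in> space N" for p s a
    using payoff_fun_bound[OF Suc.prems measurable_space[OF post that(2)]] B0 by (simp add: jump_payoff_def)
  have "(\<integral>h. (if 0 < snd (phase_before s (z, T) h (Suc j))
            then f (phase_before s (z, T) h (Suc j)) (state_before post s h (Suc j)) else 0) \<partial>chain s)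
     = (\<integral>h. jump_payoff f (phase_before s (z, T) h j) (state_before post s h j) (h j) \<partial>chain s)"
    by (intro Bochner_Integration.integral_cong refl) (simp add: alive_advance jump_payoff_def state_before_def)
  also have "\<dots> = (\<integral>h. jump_op f (phase_before s (z, T) h j) (state_before post s h j) \<partial>chain s)"
    unfolding jump_op_def by (rule expectation_step(2)[OF s jump_payoff_measurable[OF fm] b B0])
  also have "\<dots> = (\<integral>h. (if 0 < snd (phase_before s (z, T) h j)
            then jump_op f (phase_before s (z, T) h j) (state_before post s h j) else 0) \<partial>chain s)"
    by (intro Bochner_Integration.integral_cong refl) (simp add: jump_op_def jump_payoff_def ennreal_neg not_less)
  also have "\<dots> = (jump_op ^^ j) (jump_op f) (z, T) s"
    by (rule Suc.IH[OF jump_op_payoff_fun[OF Suc.prems]])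
  also have "\<dots> = (jump_op ^^ Suc j) f (z, T) s" by (simp add: funpow_swap1)
  finally show ?case .
qed

text \<open>
  The equation to be solved is prescribed by \<open>drv\<close> only on the pieces, and no relation between \<open>Z\<close> and the chain is presupposed
  beyond it. This makes the result apply to the accelerated and to the limiting process alike.
\<close>

theorem pieced_expectation:
  fixes Z :: "real \<Rightarrow> (nat \<Rightarrow> 'a) \<Rightarrow> 'v" and \<tau> :: "(nat \<Rightarrow> 'a) \<Rightarrow> nat \<Rightarrow> ennreal"
  assumes s: "s \<in> space S" and T: "0 < T"
    and \<phi>: "\<phi> \<in> borel_measurable borel" and B: "\<And>v. \<bar>\<phi> v\<bar> \<le> B"
    and Z: "Z T \<in> borel_measurable (chain s)"
    and sol: "AE h in chain s. solves_until (drv h) z (SUP j. \<tau> h j) (\<lambda>t. Z t h)"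
    and \<tau>: "\<And>h j. \<tau> h j = (\<Sum>i<j. hold (state_before post s h i) (h i))"
    and drv: "\<And>h j t v. (\<And>i. 0 < hold (state_before post s h i) (h i)) \<Longrightarrow>
      0 \<le> t \<Longrightarrow> \<tau> h j \<le> ennreal t \<Longrightarrow> ennreal t < \<tau> h (Suc j) \<Longrightarrow>
      drv h t v = drift (state_before post s h j) (h j) (t - enn2real (\<tau> h j)) v"
  shows "(\<integral>h. \<phi> (Z T h) * indicator {h. ennreal T \<le> \<tau> h k} h \<partial>chain s) =
    (\<Sum>j<k. (jump_op ^^ j) (stop_op \<phi>) (z, T) s)"
proof -
  interpret L: prob_space "chain s" by (rule prob_chain[OF s])
  let ?q = "\<lambda>h j. phase_before s (z, T) h j" and ?s = "\<lambda>h j. state_before post s h j"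
  have B0: "0 \<le> B" using B[of 0] by linarith
  have b: "\<bar>stop_payoff \<phi> p s a\<bar> \<le> B" for p s a using B B0 by (simp add: stop_payoff_def)
  \<comment> \<open>pieces that start after the horizon contribute nothing\<close>
  define \<psi> where "\<psi> p s a = (if 0 < snd p then stop_payoff \<phi> p s a else 0)" for p s a
  have b\<psi>: "\<bar>\<psi> p s a\<bar> \<le> B" for p s a using b B0 by (simp add: \<psi>_def)
  have \<psi>m: "(\<lambda>(x, a). \<psi> (fst x) (snd x) a) \<in> borel_measurable ((phase \<Otimes>\<^sub>M S) \<Otimes>\<^sub>M N)"
  proof -
    have [measurable]: "(\<lambda>x. stop_payoff \<phi> (fst (fst x)) (snd (fst x)) (snd x)) \<in> borel_measurable ((phase \<Otimes>\<^sub>M S) \<Otimes>\<^sub>M N)"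
      using stop_payoff_measurable[OF \<phi>] by (simp add: split_beta')
    show ?thesis unfolding \<psi>_def split_beta' by measurable
  qed
  have \<tau>m: "(\<lambda>h. \<tau> h k) \<in> borel_measurable (chain s)"
    unfolding \<tau>
  proof (rule borel_measurable_sum)
    fix i assume "i \<in> {..<k}"
    have "(\<lambda>h. (?s h i, h i)) \<in> PiM UNIV (\<lambda>_. N) \<rightarrow>\<^sub>M S \<Otimes>\<^sub>M N"
      by (intro measurable_Pair state_before_measurable[OF s] measurable_component_singleton) auto
    from measurable_compose[OF this hold]
    show "(\<lambda>h. hold (?s h i) (h i)) \<in> borel_measurable (chain s)"
      by (simp add: measurable_cong_sets[OF sets_chain[OF s] refl])
  qed
  have "AE h in chain s. \<forall>j. good (?s h j) (h j)"
    by (rule AE_chain[OF s good good_AE])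
  then have eq: "AE h in chain s. \<phi> (Z T h) * indicator {h. ennreal T \<le> \<tau> h k} h
      = (\<Sum>j<k. \<psi> (?q h j) (?s h j) (h j))"
    using sol AE_space
  proof eventually_elim
    case (elim h)
    have hj: "h j \<in> space N" for j
      using elim(3) by (auto simp: space_chain[OF s] space_PiM PiE_def)
    have pos: "0 < hold (?s h j) (h j)" for j using elim(1) by (auto intro: good_hold)
    have fields: "\<exists>L. lipschitz_field L (drift (?s h j) (h j))" for j
      using elim(1) by (auto intro!: good_drift state_before_in_space[OF s elim(3)] hj)
    have "\<phi> (Z T h) * of_bool (ennreal T \<le> \<tau> h k) = (\<Sum>j<k. if 0 < snd (?q h j)
       then (if ennreal (snd (?q h j)) \<le> hold (?s h j) (h j)
         then \<phi> (flow (drift (?s h j) (h j)) (fst (?q h j)) (snd (?q h j))) else 0) else 0)"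
      by (rule payoff_decomposition[where \<sigma> = "\<lambda>j. hold (?s h j) (h j)" and \<tau> = "\<tau> h"
            and d = "\<lambda>j. drift (?s h j) (h j)" and q = "?q h" and x = "\<lambda>t. Z t h", OF pos fields \<tau> drv[OF pos] elim(2) _ _ T])
        auto
    then show ?case
      unfolding \<psi>_def stop_payoff_def indicator_def of_bool_def mem_Collect_eq .
  qed
  note \<psi>h = expectation_step(1)[OF s \<psi>m b\<psi> B0]
  have "(\<integral>h. \<phi> (Z T h) * indicator {h. ennreal T \<le> \<tau> h k} h \<partial>chain s)
      = (\<integral>h. (\<Sum>j<k. \<psi> (?q h j) (?s h j) (h j)) \<partial>chain s)"
  proof (rule integral_cong_AE[OF _ _ eq])
    note [measurable] = Z \<phi> \<tau>m
    show "(\<lambda>h. \<phi> (Z T h) * indicator {h. ennreal T \<le> \<tau> h k} h) \<in> borel_measurable (chain s)"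
      unfolding indicator_def mem_Collect_eq by measurable
  qed (intro borel_measurable_sum \<psi>h)
  also have "\<dots> = (\<Sum>j<k. \<integral>h. \<psi> (?q h j) (?s h j) (h j) \<partial>chain s)"
    by (intro Bochner_Integration.integral_sum L.integrable_const_bound[where B = B] \<psi>h AE_I2) (simp add: b\<psi>)
  also have "\<dots> = (\<Sum>j<k. (jump_op ^^ j) (stop_op \<phi>) (z, T) s)"
  proof (rule sum.cong[OF refl])
    fix j
    have "(\<integral>h. \<psi> (?q h j) (?s h j) (h j) \<partial>chain s)
        = (\<integral>h. (\<integral>a. \<psi> (?q h j) (?s h j) a \<partial>K (?s h j)) \<partial>chain s)"
      by (rule expectation_step(2)[OF s \<psi>m b\<psi> B0])
    also have "\<dots> = (\<integral>h. (if 0 < snd (?q h j) then stop_op \<phi> (?q h j) (?s h j) else 0) \<partial>chain s)"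
      by (intro Bochner_Integration.integral_cong refl) (simp add: \<psi>_def stop_op_def)
    also have "\<dots> = (jump_op ^^ j) (stop_op \<phi>) (z, T) s"
      by (rule expectation_alive[OF s T stop_op_payoff_fun[OF \<phi> B]])
    finally show "(\<integral>h. \<psi> (?q h j) (?s h j) (h j) \<partial>chain s) = (jump_op ^^ j) (stop_op \<phi>) (z, T) s" .
  qed
  finally show ?thesis .
qed

end


section \<open>Time averages along moving parameters\<close>

text \<open>
  Ergodicity along a family of paths, in the form in which it is used: over every interval, including integrability.
\<close>

definition averages :: "(nat \<Rightarrow> real \<Rightarrow> 'e) \<Rightarrow> ('e \<Rightarrow> real) \<Rightarrow> real \<Rightarrow> bool" where
  "averages Y h c \<longleftrightarrow> (\<forall>t\<ge>0. (\<forall>n. set_integrable lborel {0..t} (\<lambda>s. h (Y n s))) \<and>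
     (\<lambda>n. LBINT s:{0..t}. h (Y n s)) \<longlonglongrightarrow> t * c)"

lemma averages_interval:
  assumes "averages Y h c" "0 \<le> s" "s \<le> t"
  shows "set_integrable lborel {s..t} (\<lambda>r. h (Y n r))"
    and "(\<lambda>n. LBINT r:{s..t}. h (Y n r)) \<longlonglongrightarrow> (t - s) * c"
proof -
  have i: "set_integrable lborel {0..t} (\<lambda>r. h (Y n r))" for n
    using assms by (auto simp: averages_def)
  show "set_integrable lborel {s..t} (\<lambda>r. h (Y n r))"
    by (rule set_integrable_subset[OF i]) (use assms in auto)
  have "(LBINT r:{s..t}. h (Y n r)) = (LBINT r:{0..t}. h (Y n r)) - (LBINT r:{0..s}. h (Y n r))" for n
    using lborel_set_integral_split[OF i assms(2,3), of n] by simp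
  moreover have "(\<lambda>n. (LBINT r:{0..t}. h (Y n r)) - (LBINT r:{0..s}. h (Y n r))) \<longlonglongrightarrow> t * c - s * c"
    using assms by (intro tendsto_diff) (auto simp: averages_def)
  ultimately show "(\<lambda>n. LBINT r:{s..t}. h (Y n r)) \<longlonglongrightarrow> (t - s) * c"
    by (simp add: left_diff_distrib)
qed

lemma averages_const: "averages Y (\<lambda>_. 1) 1"
  unfolding averages_def using integrable_Icc_const[of 0 _ "1::real"]
  by (auto simp: set_integrable_def set_lebesgue_integral_def)

text \<open>
  A Polya type argument: the increments of \<open>f n\<close> are dominated by those of functions that converge to a linear one, so it is
  enough to control \<open>f n\<close> on a fine grid.
\<close>

lemma dominated_increments_uniform:
  fixes f :: "nat \<Rightarrow> real \<Rightarrow> 'v::real_normed_vector"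
  assumes f: "\<And>t. t \<in> {0..T} \<Longrightarrow> (\<lambda>n. f n t) \<longlonglongrightarrow> g t"
    and B: "\<And>t. t \<in> {0..T} \<Longrightarrow> (\<lambda>n. B n t) \<longlonglongrightarrow> c * t"
    and le: "\<And>n s t. 0 \<le> s \<Longrightarrow> s \<le> t \<Longrightarrow> t \<le> T \<Longrightarrow> norm (f n t - f n s) \<le> B n t - B n s"
    and e: "0 < (e::real)"
  shows "\<forall>\<^sub>F n in sequentially. \<forall>t\<in>{0..T}. norm (f n t - g t) < e"
proof (cases "0 \<le> T")
  case False then show ?thesis by simp
next
  case T: True
  have g_le: "norm (g t - g s) \<le> c * (t - s)" if "0 \<le> s" "s \<le> t" "t \<le> T" for s t
  proof (rule LIMSEQ_le)
    show "(\<lambda>n. norm (f n t - f n s)) \<longlonglongrightarrow> norm (g t - g s)"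
      using that by (intro tendsto_intros f) auto
    show "(\<lambda>n. B n t - B n s) \<longlonglongrightarrow> c * (t - s)"
      using that by (auto simp: right_diff_distrib intro!: tendsto_diff B)
  qed (use le that in auto)
  have c0: "0 \<le> c" if "0 < T"
  proof -
    have "0 \<le> c * (T - 0)" using g_le[of 0 T] that by (meson norm_ge_zero order_trans order_refl less_imp_le)
    then show ?thesis using that by (simp add: zero_le_mult_iff)
  qed
  obtain M' :: nat where M': "4 * \<bar>c\<bar> * (T + 1) / e < real M'" using reals_Archimedean2 by blast
  define M where "M = Suc M'"
  have M0: "0 < M" and M: "4 * \<bar>c\<bar> * (T + 1) / e < real M" using M' by (auto simp: M_def)
  define h where "h = T / real M"
  have h0: "0 \<le> h" using T by (simp add: h_def)
  have ch: "\<bar>c\<bar> * h < e / 4"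
  proof -
    have "4 * \<bar>c\<bar> * (T + 1) < real M * e" using M e by (simp add: field_simps)
    moreover have "4 * \<bar>c\<bar> * T \<le> 4 * \<bar>c\<bar> * (T + 1)" by (intro mult_left_mono) auto
    ultimately show ?thesis using M0 by (simp add: h_def field_simps)
  qed
  have grid: "real l * h \<in> {0..T}" if "l \<le> M" for l
  proof -
    have "real l * h \<le> real M * h" using that h0 by (intro mult_right_mono) auto
    moreover have "real M * h = T" using M0 by (simp add: h_def)
    moreover have "0 \<le> real l * h" using h0 by simp
    ultimately show ?thesis by simp
  qed
  have "\<forall>\<^sub>F n in sequentially. \<forall>l\<in>{..M}. norm (f n (real l * h) - g (real l * h)) < e / 4 \<and>
      \<bar>B n (real l * h) - c * (real l * h)\<bar> < e / 16"
  proof (intro eventually_ball_finite ballI eventually_conj)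
    fix l assume l: "l \<in> {..M}"
    show "\<forall>\<^sub>F n in sequentially. norm (f n (real l * h) - g (real l * h)) < e / 4"
      using tendstoD[OF f[OF grid[of l]], of "e / 4"] l e by (simp add: dist_norm)
    show "\<forall>\<^sub>F n in sequentially. \<bar>B n (real l * h) - c * (real l * h)\<bar> < e / 16"
      using tendstoD[OF B[OF grid[of l]], of "e / 16"] l e by (simp add: dist_real_def)
  qed simp
  then show ?thesis
  proof eventually_elim
    case (elim n)
    show ?case
    proof
      fix t assume t: "t \<in> {0..T}"
      obtain l where l: "l < M" "real l * h \<le> t" "t \<le> real (Suc l) * h"
      proof (cases "T = 0")
        case True
        then show ?thesis using that[of 0] M0 t by (simp add: h_def)
      next
        case False
        then have hp: "0 < h" using T M0 by (simp add: h_def)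
        show ?thesis
        proof (cases "t = T")
          case True
          have "T = real (Suc (M - 1)) * h" using M0 by (simp add: h_def)
          then show ?thesis using that[of "M - 1"] M0 True h0 by (simp add: algebra_simps)
        next
          case False
          define l where "l = nat \<lfloor>t / h\<rfloor>"
          have th: "0 \<le> t / h" using t h0 by simp
          have r: "real l \<le> t / h" "t / h < real l + 1" using th by (auto simp: l_def)
          then have "real l * h \<le> t" "t < (real l + 1) * h" using hp by (auto simp: field_simps)
          moreover have "l < M"
          proof -
            have "real l * h \<le> t" using r(1) hp by (simp add: field_simps)
            also have "t < T" using t \<open>t \<noteq> T\<close> by simp
            also have "T = real M * h" using M0 by (simp add: h_def)
            finally have "real l * h < real M * h" .
            with hp show ?thesis by (simp add: mult_less_cancel_right)
          qed
          ultimately show ?thesis using that[of l] by (simp add: add.commute)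
        qed
      qed
      let ?s = "real l * h" and ?u = "real (Suc l) * h"
      have su: "?s \<in> {0..T}" "?u \<in> {0..T}" using grid[of l] grid[of "Suc l"] l(1) by auto
      have ll: "l \<in> {..M}" "Suc l \<in> {..M}" using l by auto
      have "norm (f n t - f n ?s) \<le> B n t - B n ?s" using l su t by (intro le) auto
      moreover have "0 \<le> B n ?u - B n t"
        by (rule order_trans[OF norm_ge_zero le]) (use l t su in auto)
      moreover have "B n ?u - B n ?s < c * h + e / 8"
        using elim[THEN bspec, OF ll(1)] elim[THEN bspec, OF ll(2)] by (auto simp: algebra_simps abs_if split: if_splits)
      ultimately have 1: "norm (f n t - f n ?s) < e / 4 + e / 8"
        using ch h0 by (smt (verit) mult_right_mono abs_ge_self)
      have "norm (g t - g ?s) \<le> c * (t - ?s)" using l su t by (intro g_le) auto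
      also have "\<dots> \<le> \<bar>c\<bar> * h"
        using l by (intro mult_mono) (auto simp: algebra_simps)
      finally have 2: "norm (g t - g ?s) < e / 4" using ch by simp
      have "f n t - g t = (f n t - f n ?s) + (f n ?s - g ?s) - (g t - g ?s)" by simp
      then have "norm (f n t - g t) \<le> norm (f n t - f n ?s) + norm (f n ?s - g ?s) + norm (g t - g ?s)"
        by (metis (no_types, lifting) norm_triangle_ineq norm_triangle_ineq4 add_right_mono order_trans)
      then show "norm (f n t - g t) < e" using 1 2 elim[THEN bspec, OF ll(1)] e by linarith
    qed
  qed
qed

text \<open>
  Index sequences need not be increasing; in particular the notion passes to subsequences and to other scales tending
  to infinity.
\<close>

definition continuously_converges :: "(nat \<Rightarrow> 'p::topological_space \<Rightarrow> real) \<Rightarrow> ('p \<Rightarrow> real) \<Rightarrow> bool" where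
  "continuously_converges f g \<longleftrightarrow>
     (\<forall>m q q'. filterlim m at_top sequentially \<longrightarrow> q \<longlonglongrightarrow> q' \<longrightarrow> (\<lambda>k. f (m k) (q k)) \<longlonglongrightarrow> g q')"

lemma continuously_converges_pointwise:
  assumes "continuously_converges f g" shows "(\<lambda>i. f i q) \<longlonglongrightarrow> g q"
proof -
  have "filterlim (\<lambda>i::nat. i) at_top sequentially" by (rule filterlim_ident)
  moreover have "(\<lambda>_::nat. q) \<longlonglongrightarrow> q" by simp
  ultimately show ?thesis using assms unfolding continuously_converges_def by blast
qed

text \<open>
  A diagonal argument: along \<open>q k \<rightarrow> x\<close> an index \<open>m k\<close> can be chosen for which \<open>f (m k) (q k)\<close> is as close to \<open>g (q k)\<close> as
  desired.
\<close>

lemma continuously_converges_limit_continuous: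
  fixes g :: "'p::metric_space \<Rightarrow> real"
  assumes cc: "continuously_converges f g"
  shows "continuous_on S g"
proof (rule continuous_on_subset[of UNIV])
  show "continuous_on UNIV g"
  proof (rule continuous_at_imp_continuous_on, rule ballI)
    fix x :: 'p
    show "isCont g x"
      unfolding continuous_at_sequentially
    proof (intro allI impI)
      fix q assume q: "q \<longlonglongrightarrow> x"
      have "\<exists>m\<ge>k. dist (f m (q k)) (g (q k)) < 1 / real (Suc k)" for k
      proof -
        have "(\<lambda>i. f i (q k)) \<longlonglongrightarrow> g (q k)"
          by (rule continuously_converges_pointwise[OF cc])
        then have "\<forall>\<^sub>F i in sequentially. dist (f i (q k)) (g (q k)) < 1 / real (Suc k)"
          by (rule tendstoD) simp
        then obtain N where "\<forall>i\<ge>N. dist (f i (q k)) (g (q k)) < 1 / real (Suc k)"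
          by (auto simp: eventually_sequentially)
        then show ?thesis by (intro exI[of _ "max k N"]) auto
      qed
      then obtain m where m: "\<And>k. k \<le> m k" "\<And>k. dist (f (m k) (q k)) (g (q k)) < 1 / real (Suc k)" by metis
      have "filterlim m at_top sequentially"
        by (rule filterlim_at_top_mono[OF filterlim_ident]) (use m in auto)
      with cc q have 1: "(\<lambda>k. f (m k) (q k)) \<longlonglongrightarrow> g x" unfolding continuously_converges_def by blast
      have "(\<lambda>k. f (m k) (q k) - g (q k)) \<longlonglongrightarrow> 0"
        by (rule Lim_null_comparison[OF _ LIMSEQ_inverse_real_of_nat])
          (use m(2) in \<open>auto simp: dist_real_def inverse_eq_divide intro!: always_eventually less_imp_le\<close>)
      from tendsto_diff[OF 1 this] show "(g \<circ> q) \<longlonglongrightarrow> g x" by (simp add: comp_def)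
    qed
  qed
qed simp

text \<open>
  A fixed countable dense set turns the oscillation below into a countable supremum, hence into a measurable function of
  the state when \<open>f\<close> and \<open>g\<close> depend on one.
\<close>

definition dense_points :: "'p::euclidean_space set" where
  "dense_points = (SOME D. countable D \<and> (\<forall>U. open U \<longrightarrow> U \<noteq> {} \<longrightarrow> (\<exists>d\<in>D. d \<in> U)))"

lemma dense_points: "countable (dense_points :: 'p::euclidean_space set)"
  "open (U :: 'p set) \<Longrightarrow> U \<noteq> {} \<Longrightarrow> \<exists>d\<in>dense_points. d \<in> U"
proof -
  have "\<exists>D :: 'p set. countable D \<and> (\<forall>U. open U \<longrightarrow> U \<noteq> {} \<longrightarrow> (\<exists>d\<in>D. d \<in> U))"
    by (rule countable_dense_setE) blast
  from someI_ex[OF this]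
  show "countable (dense_points :: 'p set)" "open (U :: 'p set) \<Longrightarrow> U \<noteq> {} \<Longrightarrow> \<exists>d\<in>dense_points. d \<in> U"
    unfolding dense_points_def by blast+
qed

text \<open>
  Index and distance are coupled through the same \<open>N\<close>, so that a single limit \<open>N \<rightarrow> \<infinity>\<close> describes continuous convergence
  uniformly on the ball of radius \<open>R\<close>.
\<close>

definition osc_index :: "real \<Rightarrow> nat \<Rightarrow> (nat \<times> 'p::euclidean_space \<times> 'p) set" where
  "osc_index R N = {(m, q, q'). N \<le> m \<and> q \<in> dense_points \<and> q' \<in> dense_points \<and>
     norm q < R \<and> norm q' < R \<and> dist q q' < 1 / real (Suc N)}"

definition osc :: "(nat \<Rightarrow> 'p::euclidean_space \<Rightarrow> real) \<Rightarrow> ('p \<Rightarrow> real) \<Rightarrow> real \<Rightarrow> nat \<Rightarrow> real" where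
  "osc f g R N = (SUP i\<in>osc_index R N. case i of (m, q, q') \<Rightarrow> \<bar>f m q - g q'\<bar>)"

lemma countable_osc_index: "countable (osc_index R N :: (nat \<times> 'p::euclidean_space \<times> 'p) set)"
  by (rule countable_subset[of _ "UNIV \<times> dense_points \<times> dense_points"])
    (auto simp: osc_index_def intro!: countable_SIGMA dense_points)

lemma osc_index_nonempty: "0 < R \<Longrightarrow> osc_index R N \<noteq> ({} :: (nat \<times> 'p::euclidean_space \<times> 'p) set)"
proof -
  assume "0 < R"
  then obtain d :: 'p where "d \<in> dense_points" "d \<in> ball 0 R" using dense_points(2)[of "ball 0 R"] by auto
  then have "(N, d, d) \<in> osc_index R N" by (auto simp: osc_index_def)
  then show ?thesis by blast
qed

context
  fixes f :: "nat \<Rightarrow> 'p::euclidean_space \<Rightarrow> real" and g :: "'p \<Rightarrow> real" and R C :: real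
  assumes cc: "continuously_converges f g" and fc: "\<And>m. continuous_on UNIV (f m)"
    and bnd: "\<And>m q. norm q < R \<Longrightarrow> \<bar>f m q\<bar> \<le> C" and R: "0 < R"
begin

lemma limit_bound: "norm q < R \<Longrightarrow> \<bar>g q\<bar> \<le> C"
proof -
  assume q: "norm q < R"
  have "(\<lambda>i. f i q) \<longlonglongrightarrow> g q"
    by (rule continuously_converges_pointwise[OF cc])
  from tendsto_rabs[OF this] show "\<bar>g q\<bar> \<le> C" by (rule LIMSEQ_le_const2) (use bnd[OF q] in auto)
qed

lemma osc_terms_bound: "i \<in> osc_index R N \<Longrightarrow> (case i of (m, q, q') \<Rightarrow> \<bar>f m q - g q'\<bar>) \<le> 2 * C"
proof -
  assume i: "i \<in> osc_index R N"
  obtain m q q' where [simp]: "i = (m, q, q')" by (cases i)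
  have "\<bar>f m q\<bar> \<le> C" "\<bar>g q'\<bar> \<le> C" using i by (auto simp: osc_index_def intro: bnd limit_bound)
  then show ?thesis by simp
qed

lemma osc_bdd: "bdd_above ((\<lambda>i. case i of (m, q, q') \<Rightarrow> \<bar>f m q - g q'\<bar>) ` osc_index R N)"
  using osc_terms_bound by (auto intro!: bdd_aboveI)

lemma osc_nonneg: "0 \<le> osc f g R N"
proof -
  obtain i :: "nat \<times> 'p \<times> 'p" where i: "i \<in> osc_index R N" using osc_index_nonempty[OF R] by blast
  have "0 \<le> (case i of (m, q, q') \<Rightarrow> \<bar>f m q - g q'\<bar>)" by (simp split: prod.split)
  also have "\<dots> \<le> osc f g R N" unfolding osc_def by (rule cSUP_upper[OF i osc_bdd])
  finally show ?thesis .
qed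

lemma osc_le: "osc f g R N \<le> 2 * C"
  unfolding osc_def by (rule cSUP_least[OF osc_index_nonempty[OF R] osc_terms_bound])

text \<open>
  By continuity of \<open>f m\<close> and \<open>g\<close>, the supremum over dense points bounds all points: the set on which the bound fails is
  open, hence it would contain a pair of dense points.
\<close>

lemma osc_upper:
  assumes m: "N \<le> m" and q: "norm q < R" "norm q' < R" "dist q q' < 1 / real (Suc N)"
  shows "\<bar>f m q - g q'\<bar> \<le> osc f g R N"
proof (rule ccontr)
  assume "\<not> ?thesis"
  then have less: "osc f g R N < \<bar>f m q - g q'\<bar>" by simp
  let ?U = "{x. norm (fst x) < R \<and> norm (snd x) < R \<and> dist (fst x) (snd x) < 1 / real (Suc N) \<and>
    osc f g R N < \<bar>f m (fst x) - g (snd x)\<bar>}"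
  have [continuous_intros]: "continuous_on UNIV (\<lambda>x. f m (fst x))" "continuous_on UNIV (\<lambda>x. g (snd x))"
    by (auto intro!: continuous_on_compose2[OF fc] continuous_on_compose2[OF continuously_converges_limit_continuous[OF cc]] continuous_intros)
  have "open ?U"
    by (intro open_Collect_conj open_Collect_less continuous_intros)
  moreover have "(q, q') \<in> ?U" using q less by simp
  ultimately obtain A B where AB: "open A" "open B" "(q, q') \<in> A \<times> B" "A \<times> B \<subseteq> ?U"
    by (rule open_prod_elim)
  obtain d where d: "d \<in> dense_points" "d \<in> A" using dense_points(2)[OF AB(1)] AB(3) by blast
  obtain d' where d': "d' \<in> dense_points" "d' \<in> B" using dense_points(2)[OF AB(2)] AB(3) by blast
  have "(d, d') \<in> ?U" using AB(4) d d' by blast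
  then have i: "(m, d, d') \<in> osc_index R N" and l: "osc f g R N < \<bar>f m d - g d'\<bar>"
    using m d d' by (auto simp: osc_index_def)
  have "\<bar>f m d - g d'\<bar> \<le> osc f g R N"
    unfolding osc_def using cSUP_upper[OF i osc_bdd] by simp
  with l show False by simp
qed

text \<open>
  If the oscillations did not vanish, then compactness of the ball would give indices \<open>m \<rightarrow> \<infinity>\<close> and points \<open>q\<close>, \<open>q'\<close> with a
  common limit for which \<open>f m q - g q'\<close> stays away from 0.
\<close>

lemma osc_tendsto: "(\<lambda>N. osc f g R N) \<longlonglongrightarrow> 0"
proof (rule ccontr)
  assume "\<not> ?thesis"
  then obtain e where e: "0 < e" "\<not> (\<forall>\<^sub>F N in sequentially. dist (osc f g R N) 0 < e)"
    by (auto simp: tendsto_iff)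
  have "\<exists>N\<ge>K. \<exists>m q q'. (m, q, q') \<in> osc_index R N \<and> e / 2 < \<bar>f m q - g q'\<bar>" for K
  proof -
    obtain N where N: "K \<le> N" "\<not> dist (osc f g R N) 0 < e" using e(2) by (auto simp: eventually_sequentially)
    then have "e / 2 < osc f g R N" using osc_nonneg[of N] e(1) by (auto simp: dist_real_def)
    then obtain i where "i \<in> osc_index R N" "e / 2 < (case i of (m, q, q') \<Rightarrow> \<bar>f m q - g q'\<bar>)"
      unfolding osc_def using less_cSUP_iff[OF osc_index_nonempty[OF R] osc_bdd] by blast
    then show ?thesis using N(1) by (cases i) auto
  qed
  then obtain N m q q' where *: "\<And>K. K \<le> N K" "\<And>K. (m K, q K, q' K) \<in> osc_index R (N K)"
      "\<And>K. e / 2 < \<bar>f (m K) (q K) - g (q' K)\<bar>" by metis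
  have "\<forall>K. q K \<in> cball 0 R" using *(2) by (auto simp: osc_index_def intro: less_imp_le)
  then obtain a r where a: "strict_mono r" "(q \<circ> r) \<longlonglongrightarrow> a"
    using compact_cball[of 0 R, unfolded compact_def] by blast
  have mr: "filterlim (m \<circ> r) at_top sequentially"
  proof (rule filterlim_at_top_mono[OF filterlim_ident])
    show "\<forall>\<^sub>F K in sequentially. K \<le> (m \<circ> r) K"
    proof (rule always_eventually, rule)
      fix K
      have "K \<le> r K" using a(1) by (rule seq_suble)
      also have "\<dots> \<le> N (r K)" by (rule *(1))
      also have "\<dots> \<le> m (r K)" using *(2)[of "r K"] by (auto simp: osc_index_def)
      finally show "K \<le> (m \<circ> r) K" by simp
    qed
  qed
  have "(\<lambda>K. dist ((q' \<circ> r) K) ((q \<circ> r) K)) \<longlonglongrightarrow> 0"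
  proof (rule tendsto_sandwich[OF _ _ tendsto_const LIMSEQ_inverse_real_of_nat])
    show "\<forall>\<^sub>F K in sequentially. dist ((q' \<circ> r) K) ((q \<circ> r) K) \<le> inverse (real (Suc K))"
    proof (rule always_eventually, rule)
      fix K
      have "K \<le> N (r K)" using seq_suble[OF a(1), of K] *(1)[of "r K"] by linarith
      then have "1 / real (Suc (N (r K))) \<le> inverse (real (Suc K))" by (simp add: field_simps)
      with *(2)[of "r K"] show "dist ((q' \<circ> r) K) ((q \<circ> r) K) \<le> inverse (real (Suc K))"
        by (simp add: osc_index_def dist_commute)
    qed
  qed simp
  then have "(\<lambda>K. (q' \<circ> r) K - (q \<circ> r) K) \<longlonglongrightarrow> 0"
    unfolding dist_norm by (rule tendsto_norm_zero_cancel)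
  with a(2) have a': "(q' \<circ> r) \<longlonglongrightarrow> a" by (rule Lim_transform)
  have 1: "(\<lambda>K. f ((m \<circ> r) K) ((q \<circ> r) K)) \<longlonglongrightarrow> g a"
    using cc mr a(2) unfolding continuously_converges_def by blast
  have "isCont g a" using continuously_converges_limit_continuous[OF cc, of UNIV] by (simp add: continuous_on_eq_continuous_at)
  then have 2: "(\<lambda>K. g ((q' \<circ> r) K)) \<longlonglongrightarrow> g a" by (rule isCont_tendsto_compose[OF _ a'])
  have "(\<lambda>K. \<bar>f ((m \<circ> r) K) ((q \<circ> r) K) - g ((q' \<circ> r) K)\<bar>) \<longlonglongrightarrow> \<bar>g a - g a\<bar>"
    by (intro tendsto_intros 1 2)
  then have "(\<lambda>K. \<bar>f ((m \<circ> r) K) ((q \<circ> r) K) - g ((q' \<circ> r) K)\<bar>) \<longlonglongrightarrow> 0" by simp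
  then have "\<forall>\<^sub>F K in sequentially. \<bar>f ((m \<circ> r) K) ((q \<circ> r) K) - g ((q' \<circ> r) K)\<bar> < e / 2"
    using e(1) by (intro order_tendstoD(2)) auto
  then obtain K where "\<bar>f ((m \<circ> r) K) ((q \<circ> r) K) - g ((q' \<circ> r) K)\<bar> < e / 2"
    by (auto simp: eventually_sequentially)
  then show False using *(3)[of "r K"] by simp
qed

end

lemma osc_borel_measurable:
  assumes [measurable]: "\<And>n u. H n u \<in> borel_measurable M" "\<And>u. G u \<in> borel_measurable M"
    and cc: "\<And>y. y \<in> space M \<Longrightarrow> continuously_converges (\<lambda>n u. H n u y) (\<lambda>u. G u y)"
    and c: "\<And>n y. y \<in> space M \<Longrightarrow> continuous_on UNIV (\<lambda>u. H n u y)"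
    and b: "\<And>n u y. norm u < R \<Longrightarrow> y \<in> space M \<Longrightarrow> \<bar>H n u y\<bar> \<le> C" and R: "0 < R"
  shows "(\<lambda>y. osc (\<lambda>n u. H n u y) (\<lambda>u. G u y) R N) \<in> borel_measurable M"
  unfolding osc_def
proof (rule borel_measurable_cSUP[OF countable_osc_index])
  show "(\<lambda>y. case i of (m, u, u') \<Rightarrow> \<bar>H m u y - G u' y\<bar>) \<in> borel_measurable M" for i
    by (cases i) (simp, measurable)
  show "bdd_above ((\<lambda>i. case i of (m, u, u') \<Rightarrow> \<bar>H m u y - G u' y\<bar>) ` osc_index R N)" if "y \<in> space M" for y
    by (rule osc_bdd[OF cc[OF that] c[OF that] b[OF _ that] R])
qed

text \<open>
  \<open>Y n\<close> are paths, \<open>b\<close> is a weight, and the parameters \<open>p n\<close> move along the path while \<open>H n\<close> changes with \<open>n\<close>. Ergodicity is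
  assumed only for countably many functions of the state: the weighted oscillations of all orders \<open>N\<close>, and \<open>b\<close> times the limit
  \<open>G\<close> at the parameters \<open>q s\<close> for rational \<open>s\<close>. An almost sure statement can provide all of these at once.
\<close>

locale moving_average =
  fixes M :: "'e measure" and Y :: "nat \<Rightarrow> real \<Rightarrow> 'e" and b :: "'e \<Rightarrow> real"
    and H :: "nat \<Rightarrow> 'p::euclidean_space \<Rightarrow> 'e \<Rightarrow> real" and G :: "'p \<Rightarrow> 'e \<Rightarrow> real"
    and p :: "nat \<Rightarrow> real \<Rightarrow> 'p" and q :: "real \<Rightarrow> 'p" and R C T :: real
  assumes T: "0 \<le> T" and R: "0 < R"
    and Y: "\<And>n s. Y n s \<in> space M"
    and b: "integrable M b" "\<And>y. y \<in> space M \<Longrightarrow> 0 \<le> b y"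
    and H_meas: "\<And>n u. H n u \<in> borel_measurable M" and G_meas: "\<And>u. G u \<in> borel_measurable M"
    and H_cont: "\<And>n y. y \<in> space M \<Longrightarrow> continuous_on UNIV (\<lambda>u. H n u y)"
    and H_conv: "\<And>y. y \<in> space M \<Longrightarrow> continuously_converges (\<lambda>n u. H n u y) (\<lambda>u. G u y)"
    and H_bnd: "\<And>n u y. norm u < R \<Longrightarrow> y \<in> space M \<Longrightarrow> \<bar>H n u y\<bar> \<le> C"
    and q_cont: "continuous_on {0..T} q" and q_bnd: "\<And>t. t \<in> {0..T} \<Longrightarrow> norm (q t) < R"
    and p_bnd: "\<And>t n. t \<in> {0..T} \<Longrightarrow> norm (p n t) < R"
    and p_unif: "\<And>e. 0 < e \<Longrightarrow> \<forall>\<^sub>F n in sequentially. \<forall>t\<in>{0..T}. dist (p n t) (q t) < e"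
    and path_meas: "\<And>n. (\<lambda>s. indicator {0..T} s * H n (p n s) (Y n s)) \<in> borel_measurable borel"
    and av_b: "averages Y b (\<integral>y. b y \<partial>M)"
    and av_osc: "\<And>N. averages Y (\<lambda>y. b y * osc (\<lambda>n u. H n u y) (\<lambda>u. G u y) R N)
      (\<integral>y. b y * osc (\<lambda>n u. H n u y) (\<lambda>u. G u y) R N \<partial>M)"
    and av_G: "\<And>s. s \<in> \<rat> \<Longrightarrow> s \<in> {0..T} \<Longrightarrow> averages Y (\<lambda>y. b y * G (q s) y) (\<integral>y. b y * G (q s) y \<partial>M)"
begin

abbreviation osc_at :: "nat \<Rightarrow> 'e \<Rightarrow> real" where
  "osc_at N y \<equiv> osc (\<lambda>n u. H n u y) (\<lambda>u. G u y) R N"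

lemma C_nonneg: "space M \<noteq> {} \<Longrightarrow> 0 \<le> C"
  using H_bnd[of 0] R by (metis abs_ge_zero all_not_in_conv norm_zero order_trans)

lemma space_nonempty: "space M \<noteq> {}" using Y by blast

lemma G_bnd: "norm u < R \<Longrightarrow> y \<in> space M \<Longrightarrow> \<bar>G u y\<bar> \<le> C"
proof -
  assume u: "norm u < R" and y: "y \<in> space M"
  show ?thesis by (rule limit_bound[OF H_conv[OF y] H_cont[OF y] H_bnd[OF _ y] R u])
qed

lemma osc_measurable: "osc_at N \<in> borel_measurable M"
  by (rule osc_borel_measurable[OF H_meas G_meas H_conv H_cont H_bnd R])

lemma osc_at: assumes y: "y \<in> space M"
  shows "0 \<le> osc_at N y" "osc_at N y \<le> 2 * C" "(\<lambda>N. osc_at N y) \<longlonglongrightarrow> 0"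
    "N \<le> m \<Longrightarrow> norm u < R \<Longrightarrow> norm u' < R \<Longrightarrow> dist u u' < 1 / real (Suc N) \<Longrightarrow> \<bar>H m u y - G u' y\<bar> \<le> osc_at N y"
    "norm u < R \<Longrightarrow> norm u' < R \<Longrightarrow> dist u u' < 1 / real (Suc N) \<Longrightarrow> \<bar>G u y - G u' y\<bar> \<le> osc_at N y"
proof -
  note a = H_conv[OF y] H_cont[OF y] H_bnd[OF _ y] R
  show "0 \<le> osc_at N y" by (rule osc_nonneg[OF a])
  show "osc_at N y \<le> 2 * C" by (rule osc_le[OF a])
  show "(\<lambda>N. osc_at N y) \<longlonglongrightarrow> 0" by (rule osc_tendsto[OF a])
  show up: "\<bar>H m u y - G u' y\<bar> \<le> osc_at N y"
    if "N \<le> m" "norm u < R" "norm u' < R" "dist u u' < 1 / real (Suc N)" for m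
    by (rule osc_upper[OF a that])
  show "\<bar>G u y - G u' y\<bar> \<le> osc_at N y" if "norm u < R" "norm u' < R" "dist u u' < 1 / real (Suc N)"
  proof (rule LIMSEQ_le_const2)
    show "(\<lambda>m. \<bar>H m u y - G u' y\<bar>) \<longlonglongrightarrow> \<bar>G u y - G u' y\<bar>"
      by (intro tendsto_intros continuously_converges_pointwise[OF H_conv[OF y]])
    show "\<exists>K. \<forall>m\<ge>K. \<bar>H m u y - G u' y\<bar> \<le> osc_at N y" using up that by blast
  qed
qed

lemma integrable_weighted:
  assumes "h \<in> borel_measurable M" "\<And>y. y \<in> space M \<Longrightarrow> \<bar>h y\<bar> \<le> K"
  shows "integrable M (\<lambda>y. b y * h y)"
proof (rule Bochner_Integration.integrable_bound[where f = "\<lambda>y. K * b y"])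
  show "integrable M (\<lambda>y. K * b y)" using b by simp
  show "(\<lambda>y. b y * h y) \<in> borel_measurable M" using b assms by measurable
  show "AE y in M. norm (b y * h y) \<le> norm (K * b y)"
  proof (rule AE_I2)
    fix y assume y: "y \<in> space M"
    then have "0 \<le> K" using assms(2)[OF y] by linarith
    then show "norm (b y * h y) \<le> norm (K * b y)"
      using assms(2)[OF y] b(2)[OF y] by (simp add: abs_mult mult.commute[of K] mult_left_mono)
  qed
qed

definition mean_osc :: "nat \<Rightarrow> real" where "mean_osc N = (\<integral>y. b y * osc_at N y \<partial>M)"

definition avg :: "real \<Rightarrow> real" where "avg s = (\<integral>y. b y * G (q s) y \<partial>M)"

lemma integrable_osc: "integrable M (\<lambda>y. b y * osc_at N y)"
  by (rule integrable_weighted[OF osc_measurable, of _ "2 * C"]) (use osc_at in auto)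

lemma integrable_G: "t \<in> {0..T} \<Longrightarrow> integrable M (\<lambda>y. b y * G (q t) y)"
  by (rule integrable_weighted[OF G_meas, of _ C]) (use G_bnd q_bnd in auto)

lemma mean_osc_tendsto: "mean_osc \<longlonglongrightarrow> 0"
proof -
  have "(\<lambda>N. \<integral>y. b y * osc_at N y \<partial>M) \<longlonglongrightarrow> (\<integral>y. 0 \<partial>M)"
  proof (rule integral_dominated_convergence[where w = "\<lambda>y. 2 * C * b y"])
    show "AE y in M. (\<lambda>N. b y * osc_at N y) \<longlonglongrightarrow> 0"
      by (rule AE_I2) (auto intro!: tendsto_mult_right_zero osc_at)
    show "AE y in M. norm (b y * osc_at N y) \<le> 2 * C * b y" for N
    proof (rule AE_I2)
      fix y assume y: "y \<in> space M"
      then have "b y * osc_at N y \<le> b y * (2 * C)" by (intro mult_left_mono osc_at b)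
      then show "norm (b y * osc_at N y) \<le> 2 * C * b y"
        using osc_at(1)[OF y, of N] b(2)[OF y] by (simp add: abs_mult mult.commute)
    qed
  qed (use b integrable_osc in \<open>auto intro: borel_measurable_integrable\<close>)
  then show ?thesis by (simp add: mean_osc_def[abs_def])
qed

lemma avg_diff: 
  assumes "s \<in> {0..T}" "t \<in> {0..T}" "dist (q s) (q t) < 1 / real (Suc N)"
  shows "\<bar>avg s - avg t\<bar> \<le> mean_osc N"
proof -
  have "avg s - avg t = (\<integral>y. b y * G (q s) y - b y * G (q t) y \<partial>M)"
    unfolding avg_def using assms by (intro Bochner_Integration.integral_diff[symmetric] integrable_G)
  also have "\<bar>\<dots>\<bar> \<le> (\<integral>y. \<bar>b y * G (q s) y - b y * G (q t) y\<bar> \<partial>M)" by (rule integral_abs_bound)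
  also have "\<dots> \<le> mean_osc N"
    unfolding mean_osc_def
  proof (rule integral_mono)
    show "integrable M (\<lambda>y. \<bar>b y * G (q s) y - b y * G (q t) y\<bar>)"
      using assms by (intro integrable_abs Bochner_Integration.integrable_diff integrable_G)
    show "integrable M (\<lambda>y. b y * osc_at N y)" by (rule integrable_osc)
    fix y assume y: "y \<in> space M"
    have "\<bar>b y * G (q s) y - b y * G (q t) y\<bar> = b y * \<bar>G (q s) y - G (q t) y\<bar>"
      using b(2)[OF y] by (simp add: abs_mult flip: right_diff_distrib)
    also have "\<dots> \<le> b y * osc_at N y"
      by (intro mult_left_mono osc_at y q_bnd assms b)
    finally show "\<bar>b y * G (q s) y - b y * G (q t) y\<bar> \<le> b y * osc_at N y" .
  qed
  finally show ?thesis .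
qed

lemma avg_continuous: "continuous_on {0..T} avg"
proof (rule continuous_onI)
  fix s e assume s: "s \<in> {0..T}" and e: "(0::real) < e"
  obtain N where N: "mean_osc N < e"
    using order_tendstoD(2)[OF mean_osc_tendsto e] by (auto simp: eventually_sequentially)
  obtain d where d: "0 < d" "\<And>t. t \<in> {0..T} \<Longrightarrow> dist t s < d \<Longrightarrow> dist (q t) (q s) < 1 / real (Suc N)"
    using q_cont[unfolded continuous_on_iff, rule_format, OF s, of "1 / real (Suc N)"] by auto
  then show "\<exists>d>0. \<forall>t\<in>{0..T}. dist t s < d \<longrightarrow> dist (avg t) (avg s) \<le> e"
    using avg_diff[OF _ s] N by (intro exI[of _ d]) (fastforce simp: dist_real_def)
qed

lemma avg_integrable: "0 \<le> s \<Longrightarrow> t \<le> T \<Longrightarrow> set_integrable lborel {s..t} avg"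
  by (rule borel_integrable_atLeastAtMost', rule continuous_on_subset[OF avg_continuous]) auto

lemma path_integrable: 
  assumes "0 \<le> s" "t \<le> T"
  shows "set_integrable lborel {s..t} (\<lambda>r. b (Y n r) * H n (p n r) (Y n r))"
proof (cases "s \<le> t")
  case True
  have bi: "set_integrable lborel {s..t} (\<lambda>r. b (Y n r))"
    by (rule averages_interval[OF av_b]) (use assms True in auto)
  have "set_integrable lborel {s..t} (\<lambda>r. C * b (Y n r))" using bi by simp
  then show ?thesis
  proof (rule set_integrable_bound)
    have [measurable]: "(\<lambda>r. indicator {s..t} r *\<^sub>R b (Y n r)) \<in> borel_measurable lborel"
      using bi unfolding set_integrable_def by (rule borel_measurable_integrable)
    note [measurable] = path_meas
    have "(\<lambda>r. (indicator {s..t} r *\<^sub>R b (Y n r)) * (indicator {0..T} r * H n (p n r) (Y n r))) \<in> borel_measurable lborel"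
      by measurable
    also have "(\<lambda>r. (indicator {s..t} r *\<^sub>R b (Y n r)) * (indicator {0..T} r * H n (p n r) (Y n r)))
        = (\<lambda>r. indicator {s..t} r *\<^sub>R (b (Y n r) * H n (p n r) (Y n r)))"
      using assms by (auto simp: indicator_def)
    finally show "set_borel_measurable lborel {s..t} (\<lambda>r. b (Y n r) * H n (p n r) (Y n r))"
      by (simp add: set_borel_measurable_def)
    show "AE r in lborel. r \<in> {s..t} \<longrightarrow> norm (b (Y n r) * H n (p n r) (Y n r)) \<le> norm (C * b (Y n r))"
    proof (rule AE_I2, rule impI)
      fix r assume r: "r \<in> {s..t}"
      have "\<bar>H n (p n r) (Y n r)\<bar> \<le> C" using r assms by (intro H_bnd p_bnd Y) auto
      then show "norm (b (Y n r) * H n (p n r) (Y n r)) \<le> norm (C * b (Y n r))"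
        using b(2)[OF Y, of n r] C_nonneg[OF space_nonempty] by (simp add: abs_mult mult.commute[of C] mult_left_mono)
    qed
  qed
next
  case False
  then have "{s..t} = {}" by simp
  then show ?thesis by (simp add: set_integrable_def)
qed

text \<open>
  On a short interval the parameter is frozen at its value \<open>q s\<close> at the left end. The error is at most the oscillation of
  order \<open>N\<close> at the visited states, and the time average of the latter is close to its mean \<open>mean_osc N\<close>. The
  left end is rational since ergodicity is available only there.
\<close>

lemma increment:
  assumes st: "0 \<le> s" "s \<le> t" "t \<le> T" "s \<in> \<rat>"
    and close: "\<And>r. r \<in> {s..t} \<Longrightarrow> dist (q r) (q s) < 1 / (2 * real (Suc N))"
    and e: "0 < e"
  shows "\<forall>\<^sub>F n in sequentially. \<bar>(LBINT r:{s..t}. b (Y n r) * H n (p n r) (Y n r)) - (LBINT r:{s..t}. avg r)\<bar>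
    \<le> 2 * (t - s) * mean_osc N + e"
proof -
  have sT: "s \<in> {0..T}" using st by auto
  note oi = averages_interval[OF av_osc st(1,2), folded mean_osc_def] and gi = averages_interval[OF av_G[OF st(4) sT] st(1,2), folded avg_def]
  have 1: "\<forall>\<^sub>F n in sequentially. \<forall>t\<in>{0..T}. dist (p n t) (q t) < 1 / (2 * real (Suc N))"
    by (rule p_unif) simp
  have 2: "\<forall>\<^sub>F n in sequentially. dist (LBINT r:{s..t}. b (Y n r) * osc_at N (Y n r)) ((t - s) * mean_osc N) < e / 2"
    by (rule tendstoD[OF oi(2)]) (use e in simp)
  have 3: "\<forall>\<^sub>F n in sequentially. dist (LBINT r:{s..t}. b (Y n r) * G (q s) (Y n r)) ((t - s) * avg s) < e / 2"
    by (rule tendstoD[OF gi(2)]) (use e in simp)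
  have 4: "\<bar>(t - s) * avg s - (LBINT r:{s..t}. avg r)\<bar> \<le> mean_osc N * (t - s)"
  proof -
    have "(LBINT r:{s..t}. avg s) = (t - s) * avg s"
      using st by (simp add: set_lebesgue_integral_def)
    moreover have ci: "set_integrable lborel {s..t} (\<lambda>r. avg s)"
      using integrable_Icc_const[of s t "avg s"] by (simp add: set_integrable_def)
    ultimately have "(t - s) * avg s - (LBINT r:{s..t}. avg r) = (LBINT r:{s..t}. avg s - avg r)"
      using avg_integrable[OF st(1,3)] by simp
    also have "norm \<dots> \<le> mean_osc N * (t - s)"
    proof (rule set_integral_norm_le_const[OF AE_I2 st(2)])
      show "set_integrable lborel {s..t} (\<lambda>r. avg s - avg r)"
        using avg_integrable[OF st(1,3)] ci by simp
      show "r \<in> {s..t} \<longrightarrow> norm (avg s - avg r) \<le> mean_osc N" for r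
      proof
        assume r: "r \<in> {s..t}"
        have "dist (q s) (q r) < 1 / (2 * real (Suc N))" using close[OF r] by (simp add: dist_commute)
        also have "\<dots> \<le> 1 / real (Suc N)" by (simp add: field_simps)
        finally show "norm (avg s - avg r) \<le> mean_osc N" using avg_diff[OF sT, of r N] r st by simp
      qed
    qed
    finally show ?thesis by simp
  qed
  from 1 2 3 eventually_ge_at_top[of N] show ?thesis
  proof eventually_elim
    case (elim n)
    have "(LBINT r:{s..t}. b (Y n r) * H n (p n r) (Y n r)) - (LBINT r:{s..t}. b (Y n r) * G (q s) (Y n r))
        = (LBINT r:{s..t}. b (Y n r) * H n (p n r) (Y n r) - b (Y n r) * G (q s) (Y n r))"
      by (rule set_integral_diff(2)[symmetric]) (use gi(1) path_integrable[OF st(1,3)] in auto)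
    also have "norm \<dots> \<le> (LBINT r:{s..t}. norm (b (Y n r) * H n (p n r) (Y n r) - b (Y n r) * G (q s) (Y n r)))"
      by (rule set_integral_norm_bound) (use gi(1) path_integrable[OF st(1,3)] in auto)
    also have "\<dots> \<le> (LBINT r:{s..t}. b (Y n r) * osc_at N (Y n r))"
    proof (rule set_integral_mono)
      show "set_integrable lborel {s..t} (\<lambda>r. norm (b (Y n r) * H n (p n r) (Y n r) - b (Y n r) * G (q s) (Y n r)))"
        using gi(1) path_integrable[OF st(1,3)] by (intro set_integrable_norm) auto
      show "set_integrable lborel {s..t} (\<lambda>r. b (Y n r) * osc_at N (Y n r))" by (rule oi(1))
      fix r assume r: "r \<in> {s..t}"
      then have rT: "r \<in> {0..T}" using st by auto
      have "dist (p n r) (q s) \<le> dist (p n r) (q r) + dist (q r) (q s)" by (rule dist_triangle)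
      also have "\<dots> < 1 / (2 * real (Suc N)) + 1 / (2 * real (Suc N))"
        using elim(1) rT close[OF r] by (intro add_strict_mono) auto
      also have "\<dots> = 1 / real (Suc N)" by (simp add: field_simps)
      finally have "\<bar>H n (p n r) (Y n r) - G (q s) (Y n r)\<bar> \<le> osc_at N (Y n r)"
        using elim(4) by (intro osc_at Y p_bnd q_bnd rT sT)
      then have "b (Y n r) * \<bar>H n (p n r) (Y n r) - G (q s) (Y n r)\<bar> \<le> b (Y n r) * osc_at N (Y n r)"
        by (intro mult_left_mono b Y)
      then show "norm (b (Y n r) * H n (p n r) (Y n r) - b (Y n r) * G (q s) (Y n r)) \<le> b (Y n r) * osc_at N (Y n r)"
        using b(2)[OF Y, of n r] by (simp add: abs_mult flip: right_diff_distrib)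
    qed
    also have "\<dots> < (t - s) * mean_osc N + e / 2" using elim(2) unfolding dist_real_def by linarith
    finally have 5: "\<bar>(LBINT r:{s..t}. b (Y n r) * H n (p n r) (Y n r)) - (LBINT r:{s..t}. b (Y n r) * G (q s) (Y n r))\<bar>
        < (t - s) * mean_osc N + e / 2" by simp
    have "mean_osc N * (t - s) = (t - s) * mean_osc N" "2 * (t - s) * mean_osc N = (t - s) * mean_osc N + (t - s) * mean_osc N" by simp_all
    then show ?case using elim(3) 4 5 unfolding dist_real_def by linarith
  qed
qed

text \<open>
  By uniform continuity of \<open>q\<close> the interval splits into finitely many pieces to which the increment estimate applies.
\<close>

lemma moving_average_eps:
  assumes "t \<in> {0..T}" "0 < e"
  shows "\<forall>\<^sub>F n in sequentially. \<bar>(LBINT r:{0..t}. b (Y n r) * H n (p n r) (Y n r)) - (LBINT r:{0..t}. avg r)\<bar>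
    \<le> 2 * t * mean_osc N + e"
proof -
  have "uniformly_continuous_on {0..T} q" by (rule compact_uniformly_continuous[OF q_cont]) simp
  then obtain d where d: "0 < d" "\<And>r s. r \<in> {0..T} \<Longrightarrow> s \<in> {0..T} \<Longrightarrow> dist r s < d \<Longrightarrow>
      dist (q r) (q s) < 1 / (2 * real (Suc N))"
    unfolding uniformly_continuous_on_def
    by (smt (verit, best) dist_commute divide_pos_pos mult_pos_pos of_nat_0_less_iff zero_less_Suc)
  obtain K :: nat where K: "0 < K" "1 / real K < d" using ex_inverse_of_nat_less[OF d(1)] by (auto simp: inverse_eq_divide)
  define w where "w = 1 / real K"
  have w: "0 < w" "w < d" using K by (auto simp: w_def)
  have step: "\<forall>\<^sub>F n in sequentially. \<bar>(LBINT r:{s..t}. b (Y n r) * H n (p n r) (Y n r)) - (LBINT r:{s..t}. avg r)\<bar>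
      \<le> 2 * (t - s) * mean_osc N + e"
    if "0 \<le> s" "s \<le> t" "t \<le> T" "s \<in> \<rat>" "t - s \<le> w" "0 < e" for s t e
  proof (rule increment[OF that(1-4) _ that(6)])
    show "dist (q r) (q s) < 1 / (2 * real (Suc N))" if "r \<in> {s..t}" for r
      by (rule d(2)) (use that \<open>0 \<le> s\<close> \<open>s \<le> t\<close> \<open>t \<le> T\<close> \<open>t - s \<le> w\<close> w in \<open>auto simp: dist_real_def\<close>)
  qed
  have "t \<in> {0..T} \<Longrightarrow> t \<le> real l * w \<Longrightarrow> 0 < e \<Longrightarrow>
    \<forall>\<^sub>F n in sequentially. \<bar>(LBINT r:{0..t}. b (Y n r) * H n (p n r) (Y n r)) - (LBINT r:{0..t}. avg r)\<bar>
    \<le> 2 * t * mean_osc N + e" for l t e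
  proof (induction l arbitrary: t e)
    case 0
    then show ?case using step[of 0 t e] w by simp
  next
    case (Suc l)
    show ?case
    proof (cases "t \<le> real l * w")
      case True
      then show ?thesis using Suc by auto
    next
      case False
      define s where "s = real l * w"
      have "t \<le> s + w" using Suc.prems by (simp add: s_def algebra_simps)
      moreover have "s \<in> \<rat>" by (simp add: s_def w_def)
      ultimately have s: "0 \<le> s" "s \<le> t" "t \<le> T" "s \<in> \<rat>" "t - s \<le> w" "s \<in> {0..T}"
        using False Suc.prems w by (auto simp: s_def)
      have e2: "0 < e / 2" using Suc.prems by simp
      have "\<forall>\<^sub>F n in sequentially. \<bar>(LBINT r:{0..s}. b (Y n r) * H n (p n r) (Y n r)) - (LBINT r:{0..s}. avg r)\<bar>
          \<le> 2 * s * mean_osc N + e / 2"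
        using s e2 by (intro Suc.IH) (auto simp: s_def)
      with step[OF s(1-5) e2] show ?thesis
      proof eventually_elim
        case (elim n)
        have "(LBINT r:{0..t}. b (Y n r) * H n (p n r) (Y n r)) = (LBINT r:{0..s}. b (Y n r) * H n (p n r) (Y n r))
            + (LBINT r:{s..t}. b (Y n r) * H n (p n r) (Y n r))"
          by (rule lborel_set_integral_split[OF path_integrable]) (use s in auto)
        moreover have "(LBINT r:{0..t}. avg r) = (LBINT r:{0..s}. avg r) + (LBINT r:{s..t}. avg r)"
          by (rule lborel_set_integral_split[OF avg_integrable]) (use s in auto)
        moreover have "2 * t * mean_osc N = 2 * s * mean_osc N + 2 * (t - s) * mean_osc N" by (simp add: algebra_simps)
        ultimately show ?case using elim unfolding abs_le_iff by linarith
      qed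
    qed
  qed
  moreover obtain l where "t \<le> real l * w"
    using reals_Archimedean2[of "t / w"] w by (auto simp: field_simps intro: less_imp_le)
  ultimately show ?thesis using assms by blast
qed

text \<open>
  Summing the increments over a fine partition bounds the error by a multiple of \<open>mean_osc N\<close>, and this mean oscillation tends
  to 0 by dominated convergence.
\<close>

theorem moving_average_tendsto:
  assumes t: "t \<in> {0..T}"
  shows "(\<lambda>n. LBINT r:{0..t}. b (Y n r) * H n (p n r) (Y n r)) \<longlonglongrightarrow>
    (LBINT r:{0..t}. \<integral>y. b y * G (q r) y \<partial>M)"
proof (rule tendstoI)
  fix e :: real assume e: "0 < e"
  have "(\<lambda>N. 2 * t * mean_osc N) \<longlonglongrightarrow> 2 * t * 0" by (intro tendsto_intros mean_osc_tendsto)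
  then have "\<forall>\<^sub>F N in sequentially. 2 * t * mean_osc N < e / 2"
    by (rule order_tendstoD) (use e in simp)
  from eventually_happens'[OF sequentially_bot this] obtain N where N: "2 * t * mean_osc N < e / 2" by blast
  have "\<forall>\<^sub>F n in sequentially. \<bar>(LBINT r:{0..t}. b (Y n r) * H n (p n r) (Y n r)) - (LBINT r:{0..t}. avg r)\<bar>
      \<le> 2 * t * mean_osc N + e / 4"
    by (rule moving_average_eps[OF t]) (use e in simp)
  then show "\<forall>\<^sub>F n in sequentially. dist (LBINT r:{0..t}. b (Y n r) * H n (p n r) (Y n r))
      (LBINT r:{0..t}. \<integral>y. b y * G (q r) y \<partial>M) < e"
    by eventually_elim (use N e in \<open>simp add: dist_real_def avg_def\<close>)
qed

end

lemma averaged_field: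
  fixes F :: "'v::euclidean_space \<Rightarrow> 'e \<Rightarrow> 'v"
  assumes M: "prob_space M" and F: "\<And>v. F v \<in> borel_measurable M" and L: "0 \<le> L"
    and lip: "\<And>y v v'. y \<in> space M \<Longrightarrow> norm (F v y - F v' y) \<le> L * norm (v - v')"
    and bnd: "\<And>y. y \<in> space M \<Longrightarrow> norm (F 0 y) \<le> L"
  shows "lipschitz_field L (\<lambda>s v. \<integral>y. F v y \<partial>M)" "integrable M (F v)"
proof -
  interpret prob_space M by (rule M)
  show int: "integrable M (F v)" for v
  proof (rule integrable_const_bound[where B = "L * (1 + norm v)", OF AE_I2 F])
    fix y assume "y \<in> space M"
    from lip[OF this, of v 0] bnd[OF this] norm_triangle_ineq2[of "F v y" "F 0 y"]
    show "norm (F v y) \<le> L * (1 + norm v)" by (simp add: algebra_simps)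
  qed
  have le: "norm ((\<integral>y. F v y \<partial>M) - (\<integral>y. F v' y \<partial>M)) \<le> L * norm (v - v')" for v v'
  proof -
    have "norm ((\<integral>y. F v y \<partial>M) - (\<integral>y. F v' y \<partial>M)) = norm (\<integral>y. F v y - F v' y \<partial>M)"
      using int by simp
    also have "\<dots> \<le> (\<integral>y. norm (F v y - F v' y) \<partial>M)" by (rule integral_norm_bound)
    also have "\<dots> \<le> (\<integral>y. L * norm (v - v') \<partial>M)"
      by (intro integral_mono) (use int lip in auto)
    finally show ?thesis by (simp add: prob_space)
  qed
  have 0: "norm (\<integral>y. F 0 y \<partial>M) \<le> L"
  proof -
    have "norm (\<integral>y. F 0 y \<partial>M) \<le> (\<integral>y. norm (F 0 y) \<partial>M)" by (rule integral_norm_bound)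
    also have "\<dots> \<le> (\<integral>y. L \<partial>M)" by (intro integral_mono) (use int bnd in auto)
    finally show ?thesis by (simp add: prob_space)
  qed
  have "L-lipschitz_on UNIV (\<lambda>v. \<integral>y. F v y \<partial>M)"
    by (rule lipschitz_onI) (use le L in \<open>auto simp: dist_norm\<close>)
  then have [measurable]: "(\<lambda>v. \<integral>y. F v y \<partial>M) \<in> borel_measurable borel"
    by (intro borel_measurable_continuous_onI lipschitz_on_continuous_on)
  show "lipschitz_field L (\<lambda>s v. \<integral>y. F v y \<partial>M)"
    unfolding lipschitz_field_def using L le 0 by (auto simp: split_beta')
qed

text \<open>
  The averaging principle. The averaged solution is inserted into the fast equation, so that the parameter no
  longer depends on \<open>n\<close>; by ergodicity the residual vanishes at each time, and uniformly in time because all increments are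
  bounded by a multiple of the length. Stability of the fast equation then gives the claim.
\<close>

theorem flow_averaging:
  fixes F :: "'v::euclidean_space \<Rightarrow> 'e \<Rightarrow> 'v"
  assumes M: "prob_space M" and Y: "\<And>n s. Y n s \<in> space M"
    and F: "\<And>v. F v \<in> borel_measurable M" and L: "0 \<le> L"
    and lip: "\<And>y v v'. y \<in> space M \<Longrightarrow> norm (F v y - F v' y) \<le> L * norm (v - v')"
    and bnd: "\<And>y. y \<in> space M \<Longrightarrow> norm (F 0 y) \<le> L"
    and field: "\<And>n. lipschitz_field L (\<lambda>s v. F v (Y n s))"
    and zs: "zs \<longlonglongrightarrow> z" and T: "0 \<le> T"
    and R: "\<And>t. t \<in> {0..T} \<Longrightarrow> norm (flow (\<lambda>s v. \<integral>y. F v y \<partial>M) z t) < R"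
    and av_osc: "\<And>e N. e \<in> Basis \<Longrightarrow> averages Y (\<lambda>y. osc (\<lambda>n u. F u y \<bullet> e) (\<lambda>u. F u y \<bullet> e) R N)
        (\<integral>y. osc (\<lambda>n u. F u y \<bullet> e) (\<lambda>u. F u y \<bullet> e) R N \<partial>M)"
    and av_F: "\<And>e s. e \<in> Basis \<Longrightarrow> s \<in> \<rat> \<Longrightarrow> s \<in> {0..T} \<Longrightarrow>
        averages Y (\<lambda>y. F (flow (\<lambda>s v. \<integral>y. F v y \<partial>M) z s) y \<bullet> e)
          (\<integral>y. F (flow (\<lambda>s v. \<integral>y. F v y \<partial>M) z s) y \<bullet> e \<partial>M)"
    and \<epsilon>: "0 < \<epsilon>"
  shows "\<forall>\<^sub>F n in sequentially. \<forall>t\<in>{0..T}.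
    norm (flow (\<lambda>s v. F v (Y n s)) (zs n) t - flow (\<lambda>s v. \<integral>y. F v y \<partial>M) z t) < \<epsilon>"
proof -
  define \<zeta> where "\<zeta> = flow (\<lambda>s v. \<integral>y. F v y \<partial>M) z"
  note af = averaged_field[OF M F L lip bnd]
  have im: "integrable M (F v)" for v by (rule averaged_field(2)[OF M F L lip bnd])
  have zc: "continuous_on {0..T} \<zeta>" unfolding \<zeta>_def by (rule flow_continuous[OF af(1)])
  note R = R[folded \<zeta>_def]
  have R0: "0 < R" using le_less_trans[OF norm_ge_zero R[of 0]] T by simp
  have growth: "norm (F u y) \<le> L * (1 + norm u)" if "y \<in> space M" for u y
    using lip[OF that, of u 0] bnd[OF that] norm_triangle_ineq2[of "F u y" "F 0 y"] by (simp add: algebra_simps)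
  define f where "f n t = (LBINT s:{0..t}. F (\<zeta> s) (Y n s))" for n t
  have fi: "set_integrable lborel {0..t} (\<lambda>s. F (\<zeta> s) (Y n s))" if "t \<in> {0..T}" for n t
    by (rule field_integrable[OF field]) (use that in \<open>auto intro: continuous_on_subset[OF zc]\<close>)
  have f_lim: "(\<lambda>n. f n t) \<longlonglongrightarrow> \<zeta> t - z" if t: "t \<in> {0..T}" for t
    unfolding tendsto_componentwise_iff[of "\<lambda>n. f n t"]
  proof
    fix e :: 'v assume e: "e \<in> Basis"
    interpret moving_average M Y "\<lambda>_. 1" "\<lambda>n u y. F u y \<bullet> e" "\<lambda>u y. F u y \<bullet> e" "\<lambda>n. \<zeta>" \<zeta> R "L * (1 + R)" T
    proof
      interpret prob_space M by (rule M)
      show "integrable M (\<lambda>_. 1 :: real)" by simp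
      have cont: "continuous_on UNIV (\<lambda>u. F u y)" if "y \<in> space M" for y
        by (rule lipschitz_on_continuous_on[of L]) (use lip[OF that] L in \<open>auto intro!: lipschitz_onI simp: dist_norm\<close>)
      then show "continuous_on UNIV (\<lambda>u. F u y \<bullet> e)" if "y \<in> space M" for y
        using that by (intro continuous_intros)
      then have "isCont (\<lambda>u. F u y \<bullet> e) a" if "y \<in> space M" for y a
        using that by (simp add: continuous_on_eq_continuous_at)
      then show "continuously_converges (\<lambda>n u. F u y \<bullet> e) (\<lambda>u. F u y \<bullet> e)" if "y \<in> space M" for y
        using that unfolding continuously_converges_def by (auto intro: isCont_tendsto_compose)
      show "\<bar>F u y \<bullet> e\<bar> \<le> L * (1 + R)" if "norm u < R" "y \<in> space M" for u y
      proof -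
        have "\<bar>F u y \<bullet> e\<bar> \<le> norm (F u y)" using Cauchy_Schwarz_ineq2[of "F u y" e] e by simp
        also have "\<dots> \<le> L * (1 + norm u)" by (rule growth[OF that(2)])
        also have "\<dots> \<le> L * (1 + R)" using that L by (intro mult_left_mono) auto
        finally show ?thesis .
      qed
      show "(\<lambda>s. indicator {0..T} s * (F (\<zeta> s) (Y n s) \<bullet> e)) \<in> borel_measurable borel" for n
      proof -
        have "(\<lambda>s. indicator {0..T} s *\<^sub>R F (\<zeta> s) (Y n s)) \<in> borel_measurable lborel"
          using fi[of T n] T unfolding set_integrable_def by (auto intro: borel_measurable_integrable)
        then have "(\<lambda>s. (indicator {0..T} s *\<^sub>R F (\<zeta> s) (Y n s)) \<bullet> e) \<in> borel_measurable borel"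
          by (intro borel_measurable_inner) auto
        then show ?thesis by simp
      qed
      show "averages Y (\<lambda>_. 1) (\<integral>y. 1 \<partial>M)" using averages_const by (simp add: prob_space)
      show "averages Y (\<lambda>y. 1 * osc (\<lambda>n u. F u y \<bullet> e) (\<lambda>u. F u y \<bullet> e) R N)
          (\<integral>y. 1 * osc (\<lambda>n u. F u y \<bullet> e) (\<lambda>u. F u y \<bullet> e) R N \<partial>M)" for N
        using av_osc[OF e] by simp
      show "averages Y (\<lambda>y. 1 * (F (\<zeta> s) y \<bullet> e)) (\<integral>y. 1 * (F (\<zeta> s) y \<bullet> e) \<partial>M)"
        if "s \<in> \<rat>" "s \<in> {0..T}" for s
        using av_F[OF e that] by (simp add: \<zeta>_def)
    qed (use T R0 Y F R zc in auto)
    have "f n t \<bullet> e = (LBINT s:{0..t}. 1 * (F (\<zeta> s) (Y n s) \<bullet> e))" for n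
      using fi[OF t, of n] unfolding f_def set_lebesgue_integral_def set_integrable_def
      by (subst integral_inner_left[symmetric]) auto
    moreover have "(\<zeta> t - z) \<bullet> e = (LBINT s:{0..t}. \<integral>y. 1 * (F (\<zeta> s) y \<bullet> e) \<partial>M)"
    proof -
      have ti: "set_integrable lborel {0..t} (\<lambda>s. \<integral>y. F (\<zeta> s) y \<partial>M)"
        by (rule field_integrable[OF af(1)]) (use t in \<open>auto intro: continuous_on_subset[OF zc]\<close>)
      have "\<zeta> t = z + (LBINT s:{0..t}. \<integral>y. F (\<zeta> s) y \<partial>M)"
        using solves_on_eq[OF flow_solves[OF af(1)] t] unfolding \<zeta>_def .
      then have "(\<zeta> t - z) \<bullet> e = (LBINT s:{0..t}. \<integral>y. F (\<zeta> s) y \<partial>M) \<bullet> e"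
        by (metis add_diff_cancel_left')
      also have "\<dots> = (LBINT s:{0..t}. (\<integral>y. F (\<zeta> s) y \<partial>M) \<bullet> e)"
        using ti unfolding set_lebesgue_integral_def set_integrable_def
        by (subst integral_inner_left[symmetric]) auto
      also have "\<dots> = (LBINT s:{0..t}. \<integral>y. 1 * (F (\<zeta> s) y \<bullet> e) \<partial>M)"
        by (simp add: im)
      finally show ?thesis .
    qed
    ultimately show "(\<lambda>n. f n t \<bullet> e) \<longlonglongrightarrow> (\<zeta> t - z) \<bullet> e"
      using moving_average_tendsto[OF t] by simp
  qed
  \<comment> \<open>the stability bound below is 4 E exp (2 L T)\<close>
  define E where "E = \<epsilon> / (8 * exp (2 * L * T))"
  have E: "0 < E" using \<epsilon> by (simp add: E_def)
  have "\<forall>\<^sub>F n in sequentially. \<forall>t\<in>{0..T}. norm (f n t - (\<zeta> t - z)) < E"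
  proof (rule dominated_increments_uniform[where B = "\<lambda>n t. L * (1 + R) * t" and c = "L * (1 + R)", OF f_lim _ _ E])
    show "norm (f n t - f n s) \<le> L * (1 + R) * t - L * (1 + R) * s" if "0 \<le> s" "s \<le> t" "t \<le> T" for n s t
      using field_integral_continuous[OF field[of n] zc _ that, of R] R
      by (simp add: f_def right_diff_distrib less_imp_le)
  qed auto
  moreover have "\<forall>\<^sub>F n in sequentially. dist (zs n) z < E" by (rule tendstoD[OF zs E])
  ultimately show ?thesis
  proof eventually_elim
    case (elim n)
    show ?case
    proof
      fix t assume t: "t \<in> {0..T}"
      have "norm (flow (\<lambda>s v. F v (Y n s)) (zs n) t - \<zeta> t) \<le> 2 * (norm (zs n - z) + E) * exp (2 * L * t)"
      proof (rule solution_stability[OF field flow_solves[OF field] zc _ _ t])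
        show "norm (\<zeta> r - z - (LBINT s:{0..r}. F (\<zeta> s) (Y n s))) \<le> E" if "r \<in> {0..T}" for r
          using elim(1)[rule_format, OF that] by (simp add: f_def norm_minus_commute less_imp_le)
      qed (use E in simp)
      also have "\<dots> \<le> 2 * (E + E) * exp (2 * L * T)"
        using elim(2) E L t by (intro mult_mono add_mono) (auto simp: dist_norm intro!: mult_left_mono)
      also have "\<dots> < \<epsilon>" using \<epsilon> by (simp add: E_def)
      finally show "norm (flow (\<lambda>s v. F v (Y n s)) (zs n) t - flow (\<lambda>s v. \<integral>y. F v y \<partial>M) z t) < \<epsilon>"
        by (simp add: \<zeta>_def)
    qed
  qed
qed


section \<open>Clocks driven by a rate\<close>

text \<open>
  Cutting off the values and the argument gives an approximation in \<open>L\<^sup>1\<close> by dominated convergence; a measurable function is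
  an almost everywhere limit of continuous ones, and the same cut-offs make them bounded, with an integrable majorant that does
  not depend on the index.
\<close>

lemma integrable_continuous_approximation:
  fixes g :: "real \<Rightarrow> real"
  assumes g: "integrable lborel g" and e: "0 < e"
  shows "\<exists>c K. continuous_on UNIV c \<and> (\<forall>x. \<bar>c x\<bar> \<le> K) \<and> integrable lborel c \<and> (\<integral>x. \<bar>g x - c x\<bar> \<partial>lborel) < e"
proof -
  define ramp where "ramp K x = max 0 (min 1 (real K + 1 - \<bar>x\<bar>))" for K :: nat and x :: real
  define cut where "cut K y = max (- real K) (min (real K) y)" for K :: nat and y :: real
  have ramp: "0 \<le> ramp K x" "ramp K x \<le> 1" "continuous_on UNIV (ramp K)" for K x
    unfolding ramp_def by (auto intro!: continuous_intros)
  have cut: "\<bar>cut K y\<bar> \<le> \<bar>y\<bar>" "\<bar>cut K y\<bar> \<le> real K" "continuous_on UNIV (cut K)" for K y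
    unfolding cut_def by (auto intro!: continuous_intros)
  have cutm [measurable]: "cut K \<in> borel_measurable borel" "ramp K \<in> borel_measurable borel" for K
    using cut ramp by (auto intro: borel_measurable_continuous_onI)
  have [measurable]: "g \<in> borel_measurable borel" using borel_measurable_integrable[OF g] by simp
  define gK where "gK K x = cut K (g x) * ramp K x" for K x
  have gK_le: "\<bar>gK K x\<bar> \<le> \<bar>g x\<bar>" for K x
    using mult_mono[OF cut(1)[of K "g x"] ramp(2)[of K x]] ramp(1)[of K x] by (simp add: gK_def abs_mult)
  have [measurable]: "gK K \<in> borel_measurable borel" for K unfolding gK_def by measurable
  have igK: "integrable lborel (gK K)" for K
    by (rule Bochner_Integration.integrable_bound[OF g]) (use gK_le in auto)
  have "(\<lambda>K. \<integral>x. \<bar>g x - gK K x\<bar> \<partial>lborel) \<longlonglongrightarrow> (\<integral>x. 0 \<partial>(lborel :: real measure))"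
  proof (rule integral_dominated_convergence[where w = "\<lambda>x. 2 * \<bar>g x\<bar>"])
    show "AE x in lborel. (\<lambda>K. \<bar>g x - gK K x\<bar>) \<longlonglongrightarrow> 0"
    proof (rule AE_I2)
      fix x
      obtain K0 :: nat where K0: "max \<bar>g x\<bar> \<bar>x\<bar> \<le> real K0" using real_arch_simple by blast
      have "gK K x = g x" if "K0 \<le> K" for K
      proof -
        have "real K0 \<le> real K" using that by simp
        then show ?thesis using K0 by (auto simp: gK_def cut_def ramp_def min_def max_def abs_if split: if_splits)
      qed
      then have "\<forall>\<^sub>F K in sequentially. \<bar>g x - gK K x\<bar> = 0"
        unfolding eventually_sequentially by (intro exI[of _ K0]) auto
      then show "(\<lambda>K. \<bar>g x - gK K x\<bar>) \<longlonglongrightarrow> 0" by (rule tendsto_eventually)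
    qed
    show "AE x in lborel. norm \<bar>g x - gK K x\<bar> \<le> 2 * \<bar>g x\<bar>" for K
    proof (rule AE_I2)
      fix x
      have "\<bar>g x - gK K x\<bar> \<le> \<bar>g x\<bar> + \<bar>gK K x\<bar>" by (rule abs_triangle_ineq4)
      then show "norm \<bar>g x - gK K x\<bar> \<le> 2 * \<bar>g x\<bar>" using gK_le[of K x] by simp
    qed
  qed (use g in auto)
  then have "\<forall>\<^sub>F K in sequentially. (\<integral>x. \<bar>g x - gK K x\<bar> \<partial>lborel) < e / 2"
    by (intro order_tendstoD(2)[of _ 0]) (use e in auto)
  from eventually_happens'[OF sequentially_bot this]
  obtain K where K: "(\<integral>x. \<bar>g x - gK K x\<bar> \<partial>lborel) < e / 2" by blast
  have "g \<in> borel_measurable lebesgue" by (rule measurable_completion) simp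
  then have "g measurable_on UNIV" by (rule lebesgue_measurable_imp_measurable_on) simp
  then obtain N h where Nh: "negligible N \<and> (\<forall>n::nat. continuous_on UNIV (h n)) \<and>
      (\<forall>x. x \<notin> N \<longrightarrow> (\<lambda>n. h n x) \<longlonglongrightarrow> (if x \<in> UNIV then g x else 0))"
    unfolding measurable_on_def by blast
  then have N: "negligible N" and h: "\<And>n. continuous_on UNIV (h n)"
    and lim: "\<And>x. x \<notin> N \<Longrightarrow> (\<lambda>n. h n x) \<longlonglongrightarrow> g x"
    by simp_all
  have AEN: "AE x in lborel. x \<notin> N"
  proof -
    have "N \<in> null_sets lebesgue" using N by (simp add: negligible_iff_null_sets)
    then have "AE x in lebesgue. x \<notin> N" by (rule AE_not_in)
    then show ?thesis by (simp add: AE_completion_iff)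
  qed
  \<comment> \<open>the same cut-offs applied to continuous functions that converge to g almost everywhere\<close>
  define c where "c n x = cut K (h n x) * ramp K x" for n x
  have hm [measurable]: "h n \<in> borel_measurable borel" for n using h by (rule borel_measurable_continuous_onI)
  have cc: "continuous_on UNIV (c n)" for n
    unfolding c_def by (intro continuous_intros ramp continuous_on_compose2[OF cut(3) h]) auto
  have [measurable]: "c n \<in> borel_measurable borel" for n using cc by (rule borel_measurable_continuous_onI)
  define w where "w x = real K * indicator {- (real K + 1)..real K + 1} x" for x :: real
  have iw: "integrable lborel w"
    using integrable_Icc_const[of "- (real K + 1)" "real K + 1" "real K"] by (simp add: w_def[abs_def] mult.commute)
  have le_w: "\<bar>cut K y * ramp K x\<bar> \<le> w x" for x y
  proof (cases "x \<in> {- (real K + 1)..real K + 1}")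
    case True
    have "\<bar>cut K y * ramp K x\<bar> \<le> real K * 1"
      using mult_mono[OF cut(2)[of K y] ramp(2)[of K x]] ramp(1)[of K x] by (simp add: abs_mult)
    with True show ?thesis by (simp add: w_def)
  next
    case False
    then have "ramp K x = 0" by (auto simp: ramp_def)
    then show ?thesis by (simp add: w_def)
  qed
  have ic: "integrable lborel (c n)" for n
  proof (rule Bochner_Integration.integrable_bound[OF iw])
    show "AE x in lborel. norm (c n x) \<le> norm (w x)"
      by (rule AE_I2) (use le_w in \<open>simp add: c_def order_trans[OF _ abs_ge_self]\<close>)
  qed simp
  have "(\<lambda>n. \<integral>x. \<bar>gK K x - c n x\<bar> \<partial>lborel) \<longlonglongrightarrow> (\<integral>x. 0 \<partial>(lborel :: real measure))"
  proof (rule integral_dominated_convergence[where w = "\<lambda>x. 2 * w x"])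
    show "AE x in lborel. (\<lambda>n. \<bar>gK K x - c n x\<bar>) \<longlonglongrightarrow> 0"
      using AEN
    proof eventually_elim
      case (elim x)
      have "isCont (cut K) (g x)" using cut(3) by (simp add: continuous_on_eq_continuous_at)
      then have "(\<lambda>n. cut K (h n x)) \<longlonglongrightarrow> cut K (g x)" by (rule isCont_tendsto_compose[OF _ lim[OF elim]])
      then have "(\<lambda>n. \<bar>gK K x - c n x\<bar>) \<longlonglongrightarrow> \<bar>gK K x - cut K (g x) * ramp K x\<bar>"
        unfolding c_def by (intro tendsto_intros)
      then show ?case by (simp add: gK_def)
    qed
    show "AE x in lborel. norm \<bar>gK K x - c n x\<bar> \<le> 2 * w x" for n
    proof (rule AE_I2)
      fix x
      have "\<bar>gK K x - c n x\<bar> \<le> \<bar>gK K x\<bar> + \<bar>c n x\<bar>" by (rule abs_triangle_ineq4)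
      then show "norm \<bar>gK K x - c n x\<bar> \<le> 2 * w x"
        using le_w[of "g x" x] le_w[of "h n x" x] by (simp add: gK_def c_def)
    qed
  qed (use iw in auto)
  then have "\<forall>\<^sub>F n in sequentially. (\<integral>x. \<bar>gK K x - c n x\<bar> \<partial>lborel) < e / 2"
    by (intro order_tendstoD(2)[of _ 0]) (use e in auto)
  from eventually_happens'[OF sequentially_bot this]
  obtain n where n: "(\<integral>x. \<bar>gK K x - c n x\<bar> \<partial>lborel) < e / 2" by blast
  have "(\<integral>x. \<bar>g x - c n x\<bar> \<partial>lborel) \<le> (\<integral>x. \<bar>g x - gK K x\<bar> + \<bar>gK K x - c n x\<bar> \<partial>lborel)"
    by (rule integral_mono) (use g igK ic in auto)
  also have "\<dots> = (\<integral>x. \<bar>g x - gK K x\<bar> \<partial>lborel) + (\<integral>x. \<bar>gK K x - c n x\<bar> \<partial>lborel)"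
    by (rule Bochner_Integration.integral_add) (use g igK ic in auto)
  also have "\<dots> < e" using K n by simp
  finally have "(\<integral>x. \<bar>g x - c n x\<bar> \<partial>lborel) < e" .
  moreover have "\<bar>c n x\<bar> \<le> real K" for x
    using mult_mono[OF cut(2)[of K "h n x"] ramp(2)[of K x]] ramp(1)[of K x] by (simp add: c_def abs_mult)
  ultimately show ?thesis using cc ic by blast
qed

definition cumulated :: "(real \<Rightarrow> real) \<Rightarrow> real \<Rightarrow> real" where
  "cumulated \<beta> t = (LBINT s:{0..t}. \<beta> s)"

definition rate_path :: "(real \<Rightarrow> real) \<Rightarrow> bool" where
  "rate_path \<beta> \<longleftrightarrow> \<beta> \<in> borel_measurable borel \<and> (\<forall>s. 0 \<le> \<beta> s) \<and> (\<forall>t. set_integrable lborel {0..t} \<beta>)"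

lemma cumulated_neg: "t \<le> 0 \<Longrightarrow> cumulated \<beta> t = 0"
proof -
  assume "t \<le> 0"
  then have "{0..t} \<subseteq> {0}" by auto
  then show ?thesis
    unfolding cumulated_def set_lebesgue_integral_def
    by (subst integral_discrete_difference[where X = "{0}" and g = "\<lambda>_. 0"]) (auto simp: indicator_def)
qed

context
  fixes \<beta> :: "real \<Rightarrow> real"
  assumes \<beta>: "rate_path \<beta>"
begin

lemma rate_path_measurable: "\<beta> \<in> borel_measurable borel"
  and rate_path_nonneg: "0 \<le> \<beta> s"
  and rate_path_integrable: "set_integrable lborel {0..t} \<beta>"
  using \<beta> by (auto simp: rate_path_def)

lemma nn_integral_rate_path: "(\<integral>\<^sup>+s. indicator {0..t} s * ennreal (\<beta> s) \<partial>lborel) = ennreal (cumulated \<beta> t)"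
proof -
  have "(\<integral>\<^sup>+s. indicator {0..t} s * ennreal (\<beta> s) \<partial>lborel) = (\<integral>\<^sup>+s. ennreal (indicator {0..t} s *\<^sub>R \<beta> s) \<partial>lborel)"
    by (intro nn_integral_cong) (auto simp: indicator_def)
  also have "\<dots> = ennreal (\<integral>s. indicator {0..t} s *\<^sub>R \<beta> s \<partial>lborel)"
    by (rule nn_integral_eq_integral)
      (use rate_path_integrable[of t] rate_path_nonneg in \<open>auto simp: set_integrable_def\<close>)
  finally show ?thesis by (simp add: cumulated_def set_lebesgue_integral_def)
qed

lemma cumulated_nonneg: "0 \<le> cumulated \<beta> t"
  unfolding cumulated_def set_lebesgue_integral_def
  by (rule integral_nonneg_AE) (use rate_path_nonneg in auto)

lemma cumulated_diff: "0 \<le> s \<Longrightarrow> s \<le> t \<Longrightarrow> cumulated \<beta> t - cumulated \<beta> s = (LBINT r:{s..t}. \<beta> r)"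
  using lborel_set_integral_split[OF rate_path_integrable[of t], of s] by (simp add: cumulated_def)

lemma cumulated_mono: "s \<le> t \<Longrightarrow> cumulated \<beta> s \<le> cumulated \<beta> t"
proof (cases "0 \<le> s")
  case True
  assume "s \<le> t"
  have "0 \<le> (LBINT r:{s..t}. \<beta> r)"
    unfolding set_lebesgue_integral_def by (rule integral_nonneg_AE) (use rate_path_nonneg in auto)
  then show ?thesis using cumulated_diff[OF True \<open>s \<le> t\<close>] by simp
qed (simp add: cumulated_neg cumulated_nonneg)

lemma cumulated_continuous: "continuous_on S (cumulated \<beta>)"
  unfolding cumulated_def
  by (rule continuous_on_subset[OF continuous_on_LBINT]) (use rate_path_integrable in auto)

lemma cumulated_measurable: "cumulated \<beta> \<in> borel_measurable borel"
  by (rule borel_measurable_continuous_onI[OF cumulated_continuous])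

text \<open>
  The set where \<open>cumulated \<beta>\<close> is at most \<open>a\<close> is an interval \<open>[0, c]\<close> with \<open>cumulated \<beta> c = a\<close>, although \<open>cumulated \<beta>\<close> need
  not be strictly increasing.
\<close>

lemma emeasure_cumulated_le:
  assumes t: "0 \<le> t"
  shows "(\<integral>\<^sup>+s. indicator {0..t} s * ennreal (\<beta> s) * indicator {..a} (cumulated \<beta> s) \<partial>lborel)
    = emeasure lborel ({0..cumulated \<beta> t} \<inter> {..a})"
proof -
  let ?A = "cumulated \<beta>"
  consider "a < 0" | "0 \<le> a" "?A t \<le> a" | "0 \<le> a" "a < ?A t" by linarith
  then show ?thesis
  proof cases
    case 1
    then have "indicator {..a} (?A s) = (0::ennreal)" for s
      using cumulated_nonneg[of s] by (auto simp: indicator_def)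
    moreover have "{0..?A t} \<inter> {..a} = {}" using 1 by auto
    ultimately show ?thesis by simp
  next
    case 2
    have "(\<integral>\<^sup>+s. indicator {0..t} s * ennreal (\<beta> s) * indicator {..a} (?A s) \<partial>lborel)
        = (\<integral>\<^sup>+s. indicator {0..t} s * ennreal (\<beta> s) \<partial>lborel)"
      using 2 cumulated_mono by (intro nn_integral_cong) (fastforce simp: indicator_def)
    moreover have "{0..?A t} \<inter> {..a} = {0..?A t}" using 2 by auto
    ultimately show ?thesis using cumulated_nonneg[of t] by (simp add: nn_integral_rate_path)
  next
    case 3
    define Z where "Z = {s \<in> {0..t}. ?A s \<le> a}"
    have "Z = {0..t} \<inter> {s. ?A s \<le> a}" by (auto simp: Z_def)
    moreover have "closed {s. ?A s \<le> a}"
      by (intro closed_Collect_le continuous_intros cumulated_continuous)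
    ultimately have "compact Z" by (simp add: compact_Int_closed)
    moreover have "0 \<in> Z" using 3 t by (simp add: Z_def cumulated_neg)
    ultimately obtain c where c: "c \<in> Z" "\<And>s. s \<in> Z \<Longrightarrow> s \<le> c"
      using compact_attains_sup[of Z] by blast
    obtain c' where c': "c \<le> c'" "c' \<le> t" "?A c' = a"
      using IVT'[of ?A c a t] c(1) 3 cumulated_continuous by (auto simp: Z_def)
    then have "c' \<in> Z" using c(1) by (auto simp: Z_def)
    then have "c' = c" using c(2)[of c'] c'(1) by simp
    then have Ac: "?A c = a" using c' by simp
    have "indicator {0..t} s * ennreal (\<beta> s) * indicator {..a} (?A s) = indicator {0..c} s * ennreal (\<beta> s)" for s
    proof (cases "s \<in> {0..t}")
      case True
      have "?A s \<le> a \<longleftrightarrow> s \<le> c"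
        using c(2)[of s] True cumulated_mono[of s c] Ac by (auto simp: Z_def)
      then show ?thesis using True by (auto simp: indicator_def)
    next
      case False
      then show ?thesis using c(1) by (auto simp: indicator_def Z_def)
    qed
    then have "(\<integral>\<^sup>+s. indicator {0..t} s * ennreal (\<beta> s) * indicator {..a} (?A s) \<partial>lborel) = ennreal a"
      by (simp add: nn_integral_rate_path Ac)
    moreover have "{0..?A t} \<inter> {..a} = {0..a}" using 3 by auto
    ultimately show ?thesis using 3 by simp
  qed
qed

text \<open>
  The substitution \<open>a = cumulated \<beta> s\<close> as an identity of measures: \<open>\<beta> s ds\<close> is carried to Lebesgue measure. Intervals
  \<open>{..a}\<close> determine the measure, and for them the claim is the preceding lemma.
\<close>

lemma distr_cumulated:
  assumes t: "0 \<le> t"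
  shows "distr (density lborel (\<lambda>s. indicator {0..t} s * ennreal (\<beta> s))) borel (cumulated \<beta>)
    = density lborel (indicator {0..cumulated \<beta> t})" (is "?L = ?R")
proof -
  note [measurable] = cumulated_measurable rate_path_measurable
  have eq: "emeasure ?L {..a} = emeasure lborel ({0..cumulated \<beta> t} \<inter> {..a})" for a
  proof -
    have "emeasure ?L {..a} = emeasure (density lborel (\<lambda>s. indicator {0..t} s * ennreal (\<beta> s))) (cumulated \<beta> -` {..a})"
      by (subst emeasure_distr) auto
    also have "\<dots> = (\<integral>\<^sup>+s. indicator {0..t} s * ennreal (\<beta> s) * indicator (cumulated \<beta> -` {..a}) s \<partial>lborel)"
    proof (rule emeasure_density)
      show "cumulated \<beta> -` {..a} \<in> sets lborel"
        using measurable_sets[OF cumulated_measurable, of "{..a}"] by simp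
    qed simp
    also have "\<dots> = emeasure lborel ({0..cumulated \<beta> t} \<inter> {..a})"
      using emeasure_cumulated_le[OF t, of a] by (simp add: indicator_def)
    finally show ?thesis .
  qed
  show ?thesis
  proof (rule measure_eqI_generator_eq[where E = "range atMost" and \<Omega> = UNIV and A = "\<lambda>i. {..real i}"])
    show "Int_stable (range (atMost :: real \<Rightarrow> _))" by (auto simp: Int_stable_def)
    show "sets ?L = sigma_sets UNIV (range atMost)" "sets ?R = sigma_sets UNIV (range atMost)"
      by (simp_all add: borel_eq_atMost)
    show "\<Union> (range (\<lambda>i. {..real i})) = UNIV" using real_arch_simple by auto
    fix X :: "real set" assume "X \<in> range atMost"
    then obtain a where X: "X = {..a}" by auto
    show "emeasure ?L X = emeasure ?R X"
      unfolding X eq by (simp add: emeasure_density nn_integral_indicator flip: indicator_inter_arith)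
  next
    fix i
    have "emeasure ?L {..real i} \<le> emeasure lborel {0..cumulated \<beta> t}"
      unfolding eq by (rule emeasure_mono) auto
    then show "emeasure ?L {..real i} \<noteq> \<infinity>"
      using cumulated_nonneg[of t] by (auto simp: top_unique)
  qed auto
qed

lemma integral_cumulated_substitution:
  fixes f :: "real \<Rightarrow> real"
  assumes f [measurable]: "f \<in> borel_measurable borel" and i: "set_integrable lborel {0..cumulated \<beta> t} f"
  shows "set_integrable lborel {0..t} (\<lambda>s. f (cumulated \<beta> s) * \<beta> s)"
    and "(LBINT s:{0..t}. f (cumulated \<beta> s) * \<beta> s) = (LBINT a:{0..cumulated \<beta> t}. f a)"
proof -
  note [measurable] = cumulated_measurable rate_path_measurable
  have "set_integrable lborel {0..t} (\<lambda>s. f (cumulated \<beta> s) * \<beta> s) \<and>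
    (LBINT s:{0..t}. f (cumulated \<beta> s) * \<beta> s) = (LBINT a:{0..cumulated \<beta> t}. f a)"
  proof (cases "0 \<le> t")
    case True
    let ?D = "density lborel (\<lambda>s. indicator {0..t} s * ennreal (\<beta> s))"
    have D: "?D = density lborel (\<lambda>s. ennreal (indicator {0..t} s * \<beta> s))"
      by (intro density_cong) (auto simp: indicator_def)
    have R: "density lborel (indicator {0..cumulated \<beta> t}) = density lborel (\<lambda>a. ennreal (indicator {0..cumulated \<beta> t} a))"
      by (intro density_cong) (auto simp: indicator_def)
    have b: "AE s in lborel. 0 \<le> indicator {0..t} s * \<beta> s" using rate_path_nonneg by auto
    have "integrable (density lborel (indicator {0..cumulated \<beta> t})) f"
      unfolding R using i by (subst integrable_density) (auto simp: set_integrable_def)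
    then have "integrable (distr ?D borel (cumulated \<beta>)) f" by (simp add: distr_cumulated[OF True])
    then have "integrable ?D (\<lambda>s. f (cumulated \<beta> s))" by (subst (asm) integrable_distr_eq) auto
    then have 1: "integrable lborel (\<lambda>s. (indicator {0..t} s * \<beta> s) *\<^sub>R f (cumulated \<beta> s))"
      unfolding D using b by (subst (asm) integrable_density) auto
    have "(\<integral>s. (indicator {0..t} s * \<beta> s) *\<^sub>R f (cumulated \<beta> s) \<partial>lborel) = (\<integral>s. f (cumulated \<beta> s) \<partial>?D)"
      unfolding D using b by (subst integral_density) auto
    also have "\<dots> = (\<integral>a. f a \<partial>density lborel (indicator {0..cumulated \<beta> t}))"
      unfolding distr_cumulated[OF True, symmetric] by (subst integral_distr) auto
    also have "\<dots> = (\<integral>a. indicator {0..cumulated \<beta> t} a *\<^sub>R f a \<partial>lborel)"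
      unfolding R by (subst integral_density) auto
    finally show ?thesis using 1 by (simp add: set_integrable_def set_lebesgue_integral_def mult_ac)
  next
    case False
    then have e: "{0..t} = {}" and A: "cumulated \<beta> t = 0" by (simp_all add: cumulated_neg)
    have "(LBINT a:{0..cumulated \<beta> t}. f a) = 0"
      unfolding A using cumulated_neg[of 0 f] by (simp only: cumulated_def)
    then show ?thesis
      by (simp only: e) (simp add: set_integrable_def set_lebesgue_integral_def)
  qed
  then show "set_integrable lborel {0..t} (\<lambda>s. f (cumulated \<beta> s) * \<beta> s)"
    "(LBINT s:{0..t}. f (cumulated \<beta> s) * \<beta> s) = (LBINT a:{0..cumulated \<beta> t}. f a)" by auto
qed

text \<open>
  The bound does not depend on \<open>\<beta>\<close>. This is what allows \<open>f\<close> to be replaced by an \<open>L\<^sup>1\<close> approximation simultaneously for all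
  rates.
\<close>

lemma cumulated_weighted_bound:
  fixes f :: "real \<Rightarrow> real"
  assumes f: "integrable lborel f" and \<Phi>: "\<Phi> \<in> borel_measurable borel" "\<And>s. s \<in> {0..t} \<Longrightarrow> \<bar>\<Phi> s\<bar> \<le> C" and C: "0 \<le> C"
  shows "set_integrable lborel {0..t} (\<lambda>s. f (cumulated \<beta> s) * \<beta> s * \<Phi> s)"
    and "\<bar>LBINT s:{0..t}. f (cumulated \<beta> s) * \<beta> s * \<Phi> s\<bar> \<le> C * (\<integral>a. \<bar>f a\<bar> \<partial>lborel)"
proof -
  note [measurable] = cumulated_measurable rate_path_measurable \<Phi>(1)
  have [measurable]: "f \<in> borel_measurable borel" using borel_measurable_integrable[OF f] by simp
  have fi: "set_integrable lborel {0..cumulated \<beta> t} (\<lambda>a. \<bar>f a\<bar>)"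
    unfolding set_integrable_def using f by (intro integrable_mult_indicator integrable_abs) auto
  note sub = integral_cumulated_substitution[of "\<lambda>a. \<bar>f a\<bar>", OF _ fi]
  have int: "set_integrable lborel {0..t} (\<lambda>s. C * (\<bar>f (cumulated \<beta> s)\<bar> * \<beta> s))" using sub(1) by auto
  have le: "norm (f (cumulated \<beta> s) * \<beta> s * \<Phi> s) \<le> C * (\<bar>f (cumulated \<beta> s)\<bar> * \<beta> s)" if "s \<in> {0..t}" for s
  proof -
    have "\<bar>f (cumulated \<beta> s)\<bar> * \<beta> s * \<bar>\<Phi> s\<bar> \<le> \<bar>f (cumulated \<beta> s)\<bar> * \<beta> s * C"
      by (rule mult_left_mono[OF \<Phi>(2)[OF that]]) (simp add: rate_path_nonneg)
    then show ?thesis using rate_path_nonneg[of s] by (simp add: abs_mult mult_ac)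
  qed
  show i: "set_integrable lborel {0..t} (\<lambda>s. f (cumulated \<beta> s) * \<beta> s * \<Phi> s)"
  proof (rule set_integrable_bound[OF int])
    show "set_borel_measurable lborel {0..t} (\<lambda>s. f (cumulated \<beta> s) * \<beta> s * \<Phi> s)"
      unfolding set_borel_measurable_def by measurable
    show "AE s in lborel. s \<in> {0..t} \<longrightarrow> norm (f (cumulated \<beta> s) * \<beta> s * \<Phi> s) \<le> norm (C * (\<bar>f (cumulated \<beta> s)\<bar> * \<beta> s))"
    proof (rule AE_I2, rule impI)
      fix s assume "s \<in> {0..t}"
      from le[OF this] abs_ge_self[of "C * (\<bar>f (cumulated \<beta> s)\<bar> * \<beta> s)"]
      show "norm (f (cumulated \<beta> s) * \<beta> s * \<Phi> s) \<le> norm (C * (\<bar>f (cumulated \<beta> s)\<bar> * \<beta> s))"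
        unfolding real_norm_def by (rule order_trans)
    qed
  qed
  have "\<bar>LBINT s:{0..t}. f (cumulated \<beta> s) * \<beta> s * \<Phi> s\<bar> \<le> (LBINT s:{0..t}. norm (f (cumulated \<beta> s) * \<beta> s * \<Phi> s))"
    using set_integral_norm_bound[OF i] by simp
  also have "\<dots> \<le> (LBINT s:{0..t}. C * (\<bar>f (cumulated \<beta> s)\<bar> * \<beta> s))"
    by (rule set_integral_mono[OF set_integrable_norm[OF i] int le])
  also have "\<dots> = C * (LBINT a:{0..cumulated \<beta> t}. \<bar>f a\<bar>)" using sub(2) by simp
  also have "\<dots> \<le> C * (\<integral>a. \<bar>f a\<bar> \<partial>lborel)"
    unfolding set_lebesgue_integral_def
    using f by (intro mult_left_mono[OF _ C] integral_mono integrable_mult_indicator integrable_abs) (auto simp: indicator_def)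
  finally show "\<bar>LBINT s:{0..t}. f (cumulated \<beta> s) * \<beta> s * \<Phi> s\<bar> \<le> C * (\<integral>a. \<bar>f a\<bar> \<partial>lborel)" .
qed

end

lemma prob_unif01: "prob_space unif01" and sets_unif01: "sets unif01 = sets borel" and space_unif01: "space unif01 = UNIV"
  unfolding unif01_def by (auto intro!: prob_space_uniform_measure)

lemma emeasure_unif01_atMost: "0 \<le> c \<Longrightarrow> c \<le> 1 \<Longrightarrow> emeasure unif01 {..c} = ennreal c"
proof -
  assume c: "0 \<le> c" "c \<le> 1"
  have "{0..1} \<inter> {..c} = {0..c}" using c by auto
  then show ?thesis using c divide_ennreal[of c 1] by (simp add: unif01_def)
qed

lemma AE_unif01_pos: "AE u in unif01. 0 < u"
proof -
  have "emeasure unif01 {..0} = 0" using emeasure_unif01_atMost[of 0] by simp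
  then have "{..0} \<in> null_sets unif01" by (auto simp: sets_unif01)
  then have "AE u in unif01. u \<notin> {..0}" by (rule AE_not_in)
  then show ?thesis by eventually_elim auto
qed

definition hold_time :: "real measure \<Rightarrow> (real \<Rightarrow> real) \<Rightarrow> real \<Rightarrow> ennreal" where
  "hold_time N \<beta> u = Inf (ennreal ` {t. 0 \<le> t \<and> u \<le> cdf N (cumulated \<beta> t)})"

locale clock =
  fixes N :: "real measure" and g :: "real \<Rightarrow> real"
  assumes dist: "real_distribution N" and g_meas: "g \<in> borel_measurable borel" and g_nonneg: "\<And>a. 0 \<le> g a"
    and density: "N = density lborel (\<lambda>a. ennreal (g a))" and neg: "measure N {..<0} = 0"
begin

sublocale N: real_distribution N by (rule dist)

lemma g_integrable: "integrable lborel g" and g_integral: "(\<integral>a. g a \<partial>lborel) = 1"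
proof -
  have "(\<integral>\<^sup>+a. ennreal (g a) \<partial>lborel) = emeasure N UNIV"
    unfolding density using g_meas by (subst emeasure_density) auto
  also have "\<dots> = 1" using N.emeasure_space_1 by simp
  finally have 1: "(\<integral>\<^sup>+a. ennreal (g a) \<partial>lborel) = ennreal 1" by simp
  show "integrable lborel g"
    by (rule integrableI_nonneg) (use g_meas g_nonneg 1 in auto)
  show "(\<integral>a. g a \<partial>lborel) = 1"
    using integral_eq_nn_integral[of g lborel] g_meas g_nonneg 1 by simp
qed

lemma rate_path_g: "rate_path g"
  unfolding rate_path_def set_integrable_def
  using g_meas g_nonneg integrable_mult_indicator[OF _ g_integrable] by auto

lemma cdf_eq: "cdf N t = cumulated g t"
proof (cases "0 \<le> t")
  case True
  have "emeasure N {..t} = emeasure N ({..<0} \<union> {0..t})" using True by (intro arg_cong[where f = "emeasure N"]) auto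
  also have "\<dots> = emeasure N {..<0} + emeasure N {0..t}"
    by (rule plus_emeasure[symmetric]) auto
  also have "emeasure N {..<0} = 0" using neg by (simp add: N.emeasure_eq_measure)
  also have "emeasure N {0..t} = (\<integral>\<^sup>+s. indicator {0..t} s * ennreal (g s) \<partial>lborel)"
    unfolding density using g_meas by (subst emeasure_density) (auto simp: mult.commute)
  also have "\<dots> = ennreal (cumulated g t)" by (rule nn_integral_rate_path[OF rate_path_g])
  finally show ?thesis
    using cumulated_nonneg[OF rate_path_g] by (simp add: cdf_def N.emeasure_eq_measure)
next
  case False
  have "cdf N t \<le> measure N {..<0}" unfolding cdf_def by (rule N.finite_measure_mono) (use False in auto)
  then have "cdf N t = 0" using neg N.cdf_nonneg[of t] by simp
  then show ?thesis using False by (simp add: cumulated_neg)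
qed

lemma cdf_0: "cdf N 0 = 0" by (simp add: cdf_eq cumulated_neg)

lemma cdf_continuous: "continuous_on S (cdf N)"
  using cumulated_continuous[OF rate_path_g] by (simp add: cdf_eq[abs_def])

lemma cdf_mono: "s \<le> t \<Longrightarrow> cdf N s \<le> cdf N t"
  using cumulated_mono[OF rate_path_g] by (simp add: cdf_eq)

context
  fixes \<beta> :: "real \<Rightarrow> real"
  assumes \<beta>: "rate_path \<beta>"
begin

lemma density_substitution:
  "set_integrable lborel {0..t} (\<lambda>s. g (cumulated \<beta> s) * \<beta> s)"
  "(LBINT s:{0..t}. g (cumulated \<beta> s) * \<beta> s) = cdf N (cumulated \<beta> t)"
  using integral_cumulated_substitution[OF \<beta> g_meas rate_path_integrable[OF rate_path_g]]
  by (auto simp: cdf_eq cumulated_def[of g])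

lemma hold_le_iff:
  assumes t: "0 \<le> t"
  shows "hold_time N \<beta> u \<le> ennreal t \<longleftrightarrow> u \<le> cdf N (cumulated \<beta> t)"
proof
  assume "u \<le> cdf N (cumulated \<beta> t)"
  then show "hold_time N \<beta> u \<le> ennreal t"
    unfolding hold_time_def using t by (intro Inf_lower) auto
next
  assume le: "hold_time N \<beta> u \<le> ennreal t"
  have "u \<le> cdf N (cumulated \<beta> (t + 1 / real (Suc k)))" for k
  proof -
    have "hold_time N \<beta> u < ennreal (t + 1 / real (Suc k))"
      using le by (rule le_less_trans) (use t in \<open>auto intro!: ennreal_lessI\<close>)
    then obtain s where s: "0 \<le> s" "u \<le> cdf N (cumulated \<beta> s)" "ennreal s < ennreal (t + 1 / real (Suc k))"
      unfolding hold_time_def Inf_less_iff by auto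
    then have "s \<le> t + 1 / real (Suc k)" by (auto simp: ennreal_less_iff)
    then have "cdf N (cumulated \<beta> s) \<le> cdf N (cumulated \<beta> (t + 1 / real (Suc k)))"
      by (intro cdf_mono cumulated_mono[OF \<beta>])
    with s show ?thesis by simp
  qed
  moreover have "(\<lambda>k. cdf N (cumulated \<beta> (t + 1 / real (Suc k)))) \<longlonglongrightarrow> cdf N (cumulated \<beta> t)"
  proof -
    have "isCont (\<lambda>s. cdf N (cumulated \<beta> s)) t"
      using continuous_on_compose2[OF cdf_continuous cumulated_continuous[OF \<beta>], of UNIV UNIV]
      by (simp add: continuous_on_eq_continuous_at)
    moreover have "(\<lambda>k. t + 1 / real (Suc k)) \<longlonglongrightarrow> t + 0"
      by (intro tendsto_intros LIMSEQ_Suc[OF lim_1_over_n])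
    ultimately show ?thesis by (auto intro: isCont_tendsto_compose)
  qed
  ultimately show "u \<le> cdf N (cumulated \<beta> t)" by (intro LIMSEQ_le_const) auto
qed

lemma hold_measurable: "hold_time N \<beta> \<in> borel_measurable borel"
proof (rule borel_measurableI_le)
  fix y :: ennreal
  show "{u \<in> space borel. hold_time N \<beta> u \<le> y} \<in> sets borel"
  proof (cases y)
    case (real t)
    then have "{u \<in> space borel. hold_time N \<beta> u \<le> y} = {..cdf N (cumulated \<beta> t)}"
      using hold_le_iff[of t] by auto
    then show ?thesis by simp
  qed simp
qed

lemma AE_hold_pos: "AE u in unif01. 0 < hold_time N \<beta> u"
proof -
  have "emeasure unif01 {..0} = 0" using emeasure_unif01_atMost[of 0] by simp
  then have "{..0} \<in> null_sets unif01" by (auto simp: sets_unif01)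
  then have "AE u in unif01. u \<notin> {..0}" by (rule AE_not_in)
  then show ?thesis
  proof eventually_elim
    case (elim u)
    have "\<not> hold_time N \<beta> u \<le> ennreal 0"
      using hold_le_iff[of 0 u] elim by (simp add: cumulated_neg cdf_0)
    then show ?case by (simp add: zero_less_iff_neq_zero)
  qed
qed

text \<open>
  Both measures give \<open>cdf N (cumulated \<beta> t)\<close> to \<open>{..t}\<close>: the holding time is at most \<open>t\<close> iff the uniform variable is at most that
  number, and the integral of the density over \<open>[0, t]\<close> is computed by substitution.
\<close>

lemma distr_hold:
  "distr (density unif01 (indicator {u. hold_time N \<beta> u < \<infinity>})) borel (\<lambda>u. enn2real (hold_time N \<beta> u))
    = density lborel (\<lambda>t. ennreal (indicator {0..} t * (g (cumulated \<beta> t) * \<beta> t)))" (is "?L = ?R")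
proof -
  note [measurable] = hold_measurable g_meas cumulated_measurable[OF \<beta>] rate_path_measurable[OF \<beta>]
  note [measurable_cong] = sets_unif01
  have nn: "0 \<le> g (cumulated \<beta> t) * \<beta> t" for t using g_nonneg rate_path_nonneg[OF \<beta>] by simp
  have fin: "{u. hold_time N \<beta> u < \<infinity>} \<in> sets borel"
    using measurable_sets[OF hold_measurable, of "{..<\<infinity>}"] by (simp add: vimage_def)
  have L: "emeasure ?L {..t} = ennreal (cdf N (cumulated \<beta> t))" for t
  proof -
    have S: "(\<lambda>u. enn2real (hold_time N \<beta> u)) -` {..t} \<in> sets unif01"
      using measurable_sets[of "\<lambda>u. enn2real (hold_time N \<beta> u)" borel borel "{..t}"] by (simp add: sets_unif01)
    have "emeasure ?L {..t} = emeasure (density unif01 (indicator {u. hold_time N \<beta> u < \<infinity>})) ((\<lambda>u. enn2real (hold_time N \<beta> u)) -` {..t})"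
      by (subst emeasure_distr) (auto simp: space_unif01)
    also have "\<dots> = (\<integral>\<^sup>+u. indicator {u. hold_time N \<beta> u < \<infinity>} u * indicator ((\<lambda>u. enn2real (hold_time N \<beta> u)) -` {..t}) u \<partial>unif01)"
      by (rule emeasure_density) (use fin S in auto)
    also have "\<dots> = (\<integral>\<^sup>+u. indicator {..(if 0 \<le> t then cdf N (cumulated \<beta> t) else - 1)} u \<partial>unif01)"
    proof (intro nn_integral_cong_AE)
      show "AE u in unif01. indicator {u. hold_time N \<beta> u < \<infinity>} u * indicator ((\<lambda>u. enn2real (hold_time N \<beta> u)) -` {..t}) u
        = (indicator {..(if 0 \<le> t then cdf N (cumulated \<beta> t) else - 1)} u :: ennreal)"
      proof -
        have "AE u in unif01. 0 \<le> u"
          unfolding unif01_def by (rule AE_uniform_measureI) auto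
        then show ?thesis
        proof eventually_elim
          case (elim u)
          show ?case
          proof (cases "0 \<le> t")
            case True
            have "hold_time N \<beta> u < \<infinity> \<and> enn2real (hold_time N \<beta> u) \<le> t \<longleftrightarrow> hold_time N \<beta> u \<le> ennreal t"
              using True by (cases "hold_time N \<beta> u") (auto simp: top_unique)
            then show ?thesis using True hold_le_iff[OF True, of u] by (auto simp: indicator_def)
          next
            case False
            have "\<not> enn2real (hold_time N \<beta> u) \<le> t" using False enn2real_nonneg[of "hold_time N \<beta> u"] by linarith
            then show ?thesis using False elim by (auto simp: indicator_def)
          qed
        qed
      qed
    qed
    also have "\<dots> = emeasure unif01 {..(if 0 \<le> t then cdf N (cumulated \<beta> t) else - 1)}" by (simp add: sets_unif01)
    also have "\<dots> = ennreal (cdf N (cumulated \<beta> t))"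
    proof (cases "0 \<le> t")
      case True
      then show ?thesis by (simp add: emeasure_unif01_atMost N.cdf_nonneg N.cdf_bounded_prob)
    next
      case False
      have "emeasure unif01 {..- 1} \<le> emeasure unif01 {..0}" by (rule emeasure_mono) (auto simp: sets_unif01)
      then have "emeasure unif01 {..- 1} = 0" using emeasure_unif01_atMost[of 0] by simp
      then show ?thesis using False by (simp add: cumulated_neg cdf_0)
    qed
    finally show ?thesis .
  qed
  have R: "emeasure ?R {..t} = ennreal (cdf N (cumulated \<beta> t))" for t
  proof -
    have "emeasure ?R {..t} = (\<integral>\<^sup>+s. ennreal (indicator {0..} s * (g (cumulated \<beta> s) * \<beta> s)) * indicator {..t} s \<partial>lborel)"
      by (rule emeasure_density) auto
    also have "\<dots> = (\<integral>\<^sup>+s. ennreal (indicator {0..t} s *\<^sub>R (g (cumulated \<beta> s) * \<beta> s)) \<partial>lborel)"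
      by (intro nn_integral_cong) (auto simp: indicator_def)
    also have "\<dots> = ennreal (LBINT s:{0..t}. g (cumulated \<beta> s) * \<beta> s)"
      unfolding set_lebesgue_integral_def
      by (rule nn_integral_eq_integral) (use density_substitution(1)[of t] nn in \<open>auto simp: set_integrable_def\<close>)
    finally show ?thesis by (simp add: density_substitution(2))
  qed
  show ?thesis
  proof (rule measure_eqI_generator_eq[where E = "range atMost" and \<Omega> = UNIV and A = "\<lambda>i. {..real i}"])
    show "Int_stable (range (atMost :: real \<Rightarrow> _))" by (auto simp: Int_stable_def)
    show "sets ?L = sigma_sets UNIV (range atMost)" "sets ?R = sigma_sets UNIV (range atMost)"
      by (simp_all add: borel_eq_atMost)
    show "\<Union> (range (\<lambda>i. {..real i})) = UNIV" using real_arch_simple by auto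
    show "emeasure ?L X = emeasure ?R X" if "X \<in> range atMost" for X
      using that L R by auto
    show "emeasure ?L {..real i} \<noteq> \<infinity>" for i unfolding L by simp
  qed auto
qed

text \<open>
  The holding time has density \<open>g (cumulated \<beta> t) \<beta> t\<close> on the event that it is finite.
\<close>

theorem expectation_at_hold:
  fixes \<Psi> :: "real \<Rightarrow> real"
  assumes [measurable]: "\<Psi> \<in> borel_measurable borel"
  shows "(\<integral>u. (if hold_time N \<beta> u < ennreal r then \<Psi> (enn2real (hold_time N \<beta> u)) else 0) \<partial>unif01)
    = (LBINT t:{0..r}. g (cumulated \<beta> t) * \<beta> t * \<Psi> t)"
proof -
  note [measurable] = hold_measurable g_meas cumulated_measurable[OF \<beta>] rate_path_measurable[OF \<beta>]
  note [measurable_cong] = sets_unif01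
  have nn: "0 \<le> g (cumulated \<beta> t) * \<beta> t" for t using g_nonneg rate_path_nonneg[OF \<beta>] by simp
  have fin [measurable]: "{u. hold_time N \<beta> u < \<infinity>} \<in> sets borel"
    using measurable_sets[OF hold_measurable, of "{..<\<infinity>}"] by (simp add: vimage_def)
  let ?f = "\<lambda>t. indicator {..<r} t * \<Psi> t"
  have D: "density unif01 (indicator {u. hold_time N \<beta> u < \<infinity>}) = density unif01 (\<lambda>u. ennreal (indicator {u. hold_time N \<beta> u < \<infinity>} u))"
    by (intro density_cong) (auto simp: indicator_def)
  have "(\<integral>u. (if hold_time N \<beta> u < ennreal r then \<Psi> (enn2real (hold_time N \<beta> u)) else 0) \<partial>unif01)
      = (\<integral>u. indicator {u. hold_time N \<beta> u < \<infinity>} u *\<^sub>R ?f (enn2real (hold_time N \<beta> u)) \<partial>unif01)"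
  proof (intro Bochner_Integration.integral_cong refl)
    fix u
    show "(if hold_time N \<beta> u < ennreal r then \<Psi> (enn2real (hold_time N \<beta> u)) else 0)
        = indicator {u. hold_time N \<beta> u < \<infinity>} u *\<^sub>R ?f (enn2real (hold_time N \<beta> u))"
      by (cases "hold_time N \<beta> u") (auto simp: indicator_def ennreal_less_iff top_unique)
  qed
  also have "\<dots> = (\<integral>u. ?f (enn2real (hold_time N \<beta> u)) \<partial>density unif01 (indicator {u. hold_time N \<beta> u < \<infinity>}))"
    unfolding D by (subst integral_density) auto
  also have "\<dots> = (\<integral>t. ?f t \<partial>distr (density unif01 (indicator {u. hold_time N \<beta> u < \<infinity>})) borel (\<lambda>u. enn2real (hold_time N \<beta> u)))"
    by (subst integral_distr) auto
  also have "\<dots> = (\<integral>t. (indicator {0..} t * (g (cumulated \<beta> t) * \<beta> t)) *\<^sub>R ?f t \<partial>lborel)"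
    unfolding distr_hold by (subst integral_density) (auto simp: nn)
  also have "\<dots> = (LBINT t:{0..r}. g (cumulated \<beta> t) * \<beta> t * \<Psi> t)"
    unfolding set_lebesgue_integral_def
    by (rule integral_discrete_difference[where X = "{r}"]) (auto simp: indicator_def)
  finally show ?thesis .
qed

lemma expectation_before_hold:
  "(\<integral>u. (if ennreal r \<le> hold_time N \<beta> u then c else 0) \<partial>unif01) = c * (1 - cdf N (cumulated \<beta> r))"
proof -
  interpret U: prob_space unif01 by (rule prob_unif01)
  note [measurable] = hold_measurable
  note [measurable_cong] = sets_unif01
  have "(\<integral>u. (if hold_time N \<beta> u < ennreal r then c else 0) \<partial>unif01) = (LBINT t:{0..r}. g (cumulated \<beta> t) * \<beta> t * c)"
    by (rule expectation_at_hold[of "\<lambda>_. c"]) simp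
  also have "\<dots> = c * cdf N (cumulated \<beta> r)" by (simp add: density_substitution(2))
  finally have 1: "(\<integral>u. (if hold_time N \<beta> u < ennreal r then c else 0) \<partial>unif01) = c * cdf N (cumulated \<beta> r)" .
  have i: "integrable unif01 (\<lambda>u. if hold_time N \<beta> u < ennreal r then c else 0)"
    by (rule U.integrable_const_bound[where B = "\<bar>c\<bar>"]) auto
  have "(\<integral>u. (if ennreal r \<le> hold_time N \<beta> u then c else 0) \<partial>unif01)
      = (\<integral>u. c - (if hold_time N \<beta> u < ennreal r then c else 0) \<partial>unif01)"
    by (intro Bochner_Integration.integral_cong) auto
  also have "\<dots> = c - c * cdf N (cumulated \<beta> r)" using i by (simp add: 1 U.prob_space)
  finally show ?thesis by (simp add: right_diff_distrib)
qed

end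

end

text \<open>
  The density is the Radon-Nikodym derivative; it is made real and nonnegative by changing it on a null set.
\<close>

lemma abs_cont_cdf_clock:
  assumes "abs_cont_cdf G"
  obtains N g where "clock N g" "\<And>t. 0 \<le> t \<Longrightarrow> G t = cdf N t"
proof -
  from assms obtain N where N: "real_distribution N" "absolutely_continuous lborel N" "measure N {..<0} = 0"
      "\<And>t. 0 \<le> t \<Longrightarrow> G t = cdf N t"
    by (auto simp: abs_cont_cdf_def)
  interpret real_distribution N by (rule N)
  obtain f where f: "f \<in> borel_measurable lborel" "density lborel f = N"
    using sigma_finite_measure.Radon_Nikodym[OF lborel.sigma_finite_measure_axioms N(2)] by auto
  have "(\<integral>\<^sup>+x. f x \<partial>lborel) = emeasure N UNIV"
    unfolding f(2)[symmetric] using f(1) by (subst emeasure_density) auto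
  also have "\<dots> = 1" using emeasure_space_1 by simp
  finally have "AE x in lborel. f x \<noteq> \<infinity>"
    by (intro nn_integral_PInf_AE f) simp
  then have "density lborel f = density lborel (\<lambda>a. ennreal (enn2real (f a)))"
    using f(1) by (intro density_cong) (auto simp: less_top elim!: eventually_mono)
  with f N have "clock N (\<lambda>a. enn2real (f a))" by unfold_locales auto
  with N(4) show thesis using that by blast
qed


section \<open>The averaging model\<close>

text \<open>
  The value at \<open>p\<close> is the limit of values at points of a countable dense set close to \<open>p\<close>.
\<close>

lemma caratheodory_measurable:
  fixes f :: "'p::euclidean_space \<Rightarrow> 'x \<Rightarrow> 'v::{second_countable_topology, metric_space}"
  assumes cont: "\<And>x. x \<in> space M \<Longrightarrow> continuous_on UNIV (\<lambda>p. f p x)" and meas: "\<And>p. f p \<in> M \<rightarrow>\<^sub>M borel"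
  shows "(\<lambda>(p, x). f p x) \<in> borel \<Otimes>\<^sub>M M \<rightarrow>\<^sub>M borel"
proof -
  define e where "e = from_nat_into (dense_points :: 'p set)"
  have ne: "(dense_points :: 'p set) \<noteq> {}" using dense_points(2)[of UNIV] by auto
  have dense: "\<exists>i. dist p (e i) < 1 / real (Suc N)" for p N
  proof -
    obtain d where "d \<in> dense_points" "d \<in> ball p (1 / real (Suc N))"
      using dense_points(2)[of "ball p (1 / real (Suc N))"] by auto
    moreover obtain i where "e i = d"
      using from_nat_into_surj[OF dense_points(1) \<open>d \<in> dense_points\<close>] by (auto simp: e_def)
    ultimately show ?thesis by auto
  qed
  define ix where "ix N p = (LEAST i. dist p (e i) < 1 / real (Suc N))" for N p
  have ix: "dist p (e (ix N p)) < 1 / real (Suc N)" for N p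
    unfolding ix_def by (rule LeastI_ex[OF dense])
  have ixm: "ix N \<in> borel \<rightarrow>\<^sub>M count_space UNIV" for N
    unfolding ix_def by measurable
  have "(\<lambda>q. f (e (ix N (fst q))) (snd q)) \<in> borel \<Otimes>\<^sub>M M \<rightarrow>\<^sub>M borel" for N
    by (rule measurable_compose_countable[where f = "\<lambda>i q. f (e i) (snd q)" and g = "\<lambda>q. ix N (fst q)"])
      (use meas ixm in measurable)
  then have "(\<lambda>q. f (fst q) (snd q)) \<in> borel \<Otimes>\<^sub>M M \<rightarrow>\<^sub>M borel"
  proof (rule borel_measurable_LIMSEQ_metric)
    fix q :: "'p \<times> 'x" assume "q \<in> space (borel \<Otimes>\<^sub>M M)"
    then have x: "snd q \<in> space M" by (auto simp: space_pair_measure)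
    have "(\<lambda>N. dist (e (ix N (fst q))) (fst q)) \<longlonglongrightarrow> 0"
    proof (rule tendsto_sandwich[OF _ _ tendsto_const LIMSEQ_inverse_real_of_nat])
      show "\<forall>\<^sub>F N in sequentially. dist (e (ix N (fst q))) (fst q) \<le> inverse (real (Suc N))"
        using ix[of "fst q"] by (auto simp: dist_commute inverse_eq_divide intro!: always_eventually less_imp_le)
    qed simp
    then have "(\<lambda>N. e (ix N (fst q))) \<longlonglongrightarrow> fst q" by (simp add: tendsto_dist_iff[symmetric])
    moreover have "isCont (\<lambda>p. f p (snd q)) (fst q)"
      using cont[OF x] by (simp add: continuous_on_eq_continuous_at)
    ultimately show "(\<lambda>N. f (e (ix N (fst q))) (snd q)) \<longlonglongrightarrow> f (fst q) (snd q)"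
      by (rule isCont_tendsto_compose[rotated])
  qed
  then show ?thesis by (simp add: split_beta')
qed

lemma integral_bind_bounded:
  assumes M': "M' \<in> space (prob_algebra M)" and \<kappa>: "\<kappa> \<in> M \<rightarrow>\<^sub>M prob_algebra L"
    and f: "f \<in> borel_measurable L" and bnd: "\<And>x. \<bar>f x\<bar> \<le> (B::real)"
  shows "(\<integral>x. f x \<partial>(M' \<bind> \<kappa>)) = (\<integral>x. (\<integral>y. f y \<partial>\<kappa> x) \<partial>M')"
    and "(\<lambda>x. \<integral>y. f y \<partial>\<kappa> x) \<in> borel_measurable M"
    and "x \<in> space M \<Longrightarrow> \<bar>\<integral>y. f y \<partial>\<kappa> x\<bar> \<le> B"
proof -
  have sM: "sets M' = sets M" and pM: "prob_space M'" using M' by (auto simp: space_prob_algebra)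
  interpret M': prob_space M' by (rule pM)
  have \<kappa>s: "\<kappa> \<in> M \<rightarrow>\<^sub>M subprob_algebra L" using \<kappa> by (rule measurable_prob_algebraD)
  have p\<kappa>: "prob_space (\<kappa> x)" "sets (\<kappa> x) = sets L" if "x \<in> space M" for x
    using measurable_space[OF \<kappa> that] by (auto simp: space_prob_algebra)
  have int: "integrable (\<kappa> x) f" if "x \<in> space M" for x
  proof -
    interpret prob_space "\<kappa> x" by (rule p\<kappa>[OF that])
    show ?thesis
      using f measurable_cong_sets[OF p\<kappa>(2)[OF that] refl]
      by (intro integrable_const_bound[where B = B]) (use bnd in auto)
  qed
  show m: "(\<lambda>x. \<integral>y. f y \<partial>\<kappa> x) \<in> borel_measurable M"
    by (rule measurable_compose[OF \<kappa>s integral_measurable_subprob_algebra[OF f]])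
  show le: "\<bar>\<integral>y. f y \<partial>\<kappa> x\<bar> \<le> B" if "x \<in> space M" for x
  proof -
    interpret prob_space "\<kappa> x" by (rule p\<kappa>[OF that])
    have "\<bar>\<integral>y. f y \<partial>\<kappa> x\<bar> \<le> (\<integral>y. \<bar>f y\<bar> \<partial>\<kappa> x)" by (rule integral_abs_bound)
    also have "\<dots> \<le> (\<integral>y. B \<partial>\<kappa> x)" by (intro integral_mono integrable_abs int that) (use bnd in auto)
    finally show ?thesis by (simp add: prob_space)
  qed
  have bp: "prob_space (M' \<bind> \<kappa>)" by (rule prob_space_bind'[OF M' \<kappa>])
  interpret b: prob_space "M' \<bind> \<kappa>" by (rule bp)
  have sb: "sets (M' \<bind> \<kappa>) = sets L" by (rule sets_bind'[OF M' \<kappa>])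
  have fb: "f \<in> borel_measurable (M' \<bind> \<kappa>)" using f by (simp add: measurable_cong_sets[OF sb refl])
  have m': "(\<lambda>x. \<integral>y. f y \<partial>\<kappa> x) \<in> borel_measurable M'" using m by (simp add: measurable_cong_sets[OF sM refl])
  have \<kappa>s': "\<kappa> \<in> M' \<rightarrow>\<^sub>M subprob_algebra L" using \<kappa>s by (simp add: measurable_cong_sets[OF sM refl])
  have spM: "space M' = space M" using sM by (rule sets_eq_imp_space_eq)
  define h where "h x = f x + B" for x
  have h0: "0 \<le> h x" for x using bnd[of x] by (simp add: h_def abs_le_iff)
  have hm: "h \<in> borel_measurable L" using f unfolding h_def by measurable
  have hb: "h \<in> borel_measurable (M' \<bind> \<kappa>)" using hm by (simp add: measurable_cong_sets[OF sb refl])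
  have hk: "(\<integral>y. h y \<partial>\<kappa> x) = (\<integral>y. f y \<partial>\<kappa> x) + B" "integrable (\<kappa> x) h" if "x \<in> space M" for x
  proof -
    interpret prob_space "\<kappa> x" by (rule p\<kappa>[OF that])
    show "(\<integral>y. h y \<partial>\<kappa> x) = (\<integral>y. f y \<partial>\<kappa> x) + B" "integrable (\<kappa> x) h"
      using int[OF that] by (simp_all add: h_def[abs_def] prob_space)
  qed
  have if': "integrable (M' \<bind> \<kappa>) f" by (rule b.integrable_const_bound[OF _ fb, where B = B]) (use bnd in auto)
  have ik: "integrable M' (\<lambda>x. \<integral>y. f y \<partial>\<kappa> x)"
    by (rule M'.integrable_const_bound[OF AE_I2 m', where B = B]) (use le spM in auto)
  have mh: "(\<lambda>x. \<integral>y. h y \<partial>\<kappa> x) \<in> borel_measurable M'"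
    using m' by (subst measurable_cong[where g = "\<lambda>x. (\<integral>y. f y \<partial>\<kappa> x) + B"]) (auto simp: hk spM)
  have "(\<integral>x. f x \<partial>(M' \<bind> \<kappa>)) + B = (\<integral>x. h x \<partial>(M' \<bind> \<kappa>))"
    using if' by (simp add: h_def[abs_def] b.prob_space)
  also have "\<dots> = enn2real (\<integral>\<^sup>+x. ennreal (h x) \<partial>(M' \<bind> \<kappa>))"
    by (rule integral_eq_nn_integral[OF hb]) (use h0 in auto)
  also have "(\<integral>\<^sup>+x. ennreal (h x) \<partial>(M' \<bind> \<kappa>)) = (\<integral>\<^sup>+x. \<integral>\<^sup>+y. ennreal (h y) \<partial>\<kappa> x \<partial>M')"
    by (rule nn_integral_bind[OF _ \<kappa>s']) (use hm in measurable)
  also have "\<dots> = (\<integral>\<^sup>+x. ennreal (\<integral>y. h y \<partial>\<kappa> x) \<partial>M')"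
    by (intro nn_integral_cong nn_integral_eq_integral) (use hk(2) spM h0 in auto)
  also have "enn2real \<dots> = (\<integral>x. (\<integral>y. h y \<partial>\<kappa> x) \<partial>M')"
    by (rule integral_eq_nn_integral[OF mh, symmetric]) (use h0 in \<open>auto intro!: integral_nonneg_AE\<close>)
  also have "\<dots> = (\<integral>x. (\<integral>y. f y \<partial>\<kappa> x) + B \<partial>M')"
    by (intro Bochner_Integration.integral_cong) (auto simp: hk spM)
  also have "\<dots> = (\<integral>x. (\<integral>y. f y \<partial>\<kappa> x) \<partial>M') + B" using ik by (simp add: M'.prob_space)
  finally show "(\<integral>x. f x \<partial>(M' \<bind> \<kappa>)) = (\<integral>x. (\<integral>y. f y \<partial>\<kappa> x) \<partial>M')" by simp
qed

lemma lborel_set_integral_scale: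
  fixes h :: "real \<Rightarrow> real"
  assumes c: "0 < c"
  shows "set_integrable lborel {0..t} (\<lambda>s. h (c * s)) \<longleftrightarrow> set_integrable lborel {0..c * t} h"
    and "(LBINT s:{0..t}. h (c * s)) = 1 / c * (LBINT s:{0..c * t}. h s)"
proof -
  have ind: "indicator {0..t} s = (indicator {0..c * t} (c * s) :: real)" for s
    using c by (auto simp: indicator_def zero_le_mult_iff)
  have "(LBINT s:{0..c * t}. h s) = c * (\<integral>s. indicator {0..c * t} (0 + c * s) *\<^sub>R h (0 + c * s) \<partial>lborel)"
    unfolding set_lebesgue_integral_def using c by (subst lborel_integral_real_affine[where c = c and t = 0]) auto
  also have "\<dots> = c * (LBINT s:{0..t}. h (c * s))"
    by (simp add: set_lebesgue_integral_def ind)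
  finally show "(LBINT s:{0..t}. h (c * s)) = 1 / c * (LBINT s:{0..c * t}. h s)" using c by simp
  have "set_integrable lborel {0..c * t} h \<longleftrightarrow> integrable lborel (\<lambda>s. indicator {0..c * t} (0 + c * s) *\<^sub>R h (0 + c * s))"
    unfolding set_integrable_def using c lborel_integrable_real_affine_iff[of c "\<lambda>s. indicator {0..c * t} s *\<^sub>R h s" 0] by simp
  then show "set_integrable lborel {0..t} (\<lambda>s. h (c * s)) \<longleftrightarrow> set_integrable lborel {0..c * t} h"
    by (simp add: set_integrable_def ind)
qed

locale averaging_model =
  fixes D :: "('i, 'e, 'w) accel_data" and \<mu> :: "'i \<Rightarrow> 'e measure"
    and F :: "'i \<Rightarrow> real^'d \<Rightarrow> 'e \<Rightarrow> real^'d"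
  assumes setting: "accel_setting D"
    and F_measurable: "\<And>j. j \<in> space (index_space D) \<Longrightarrow>
      (\<lambda>(y, v). F j y v) \<in> borel \<Otimes>\<^sub>M state_space D \<rightarrow>\<^sub>M borel"
    and mu_prob: "\<And>j. j \<in> space (index_space D) \<Longrightarrow> prob_space (\<mu> j)"
    and mu_sets: "\<And>j. j \<in> space (index_space D) \<Longrightarrow> sets (\<mu> j) = sets (fibre D j)"
    and mu_kernel: "(\<lambda>j. distr (\<mu> j) (state_space D) (\<lambda>v. v))
      \<in> index_space D \<rightarrow>\<^sub>M prob_algebra (state_space D)"
    and ergodic: "\<And>j h v. j \<in> space (index_space D) \<Longrightarrow> h \<in> ergodic_class D \<mu> j \<Longrightarrow>
      v \<in> space (fibre D j) \<Longrightarrow>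
      AE w in base_law D v.
        ((\<lambda>t. 1 / t * (LBINT s:{0..t}. h (base_proc D s w))) \<longlongrightarrow> (\<integral>u. h u \<partial>\<mu> j)) at_top"
    and rate_UI: "\<And>t v. 0 \<le> t \<Longrightarrow> v \<in> space (state_space D) \<Longrightarrow>
      uniformly_integrable (base_law D v) {1..}
        (\<lambda>n w. ennreal (1 / real n) *
          (\<integral>\<^sup>+s\<in>{0..real n * t}. ennreal (rate D (base_proc D s w)) \<partial>lborel))"
    and bounded_at_0: "\<And>j. j \<in> space (index_space D) \<Longrightarrow>
      (SUP v\<in>space (fibre D j). ennreal (norm (F j 0 v))) < \<infinity>"
    and lipschitz: "\<And>j. j \<in> space (index_space D) \<Longrightarrow>
      \<exists>L. \<forall>v\<in>space (fibre D j). L-lipschitz_on UNIV (\<lambda>y. F j y v)"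
begin

abbreviation "\<I> \<equiv> index_space D"
abbreviation "\<E> \<equiv> state_space D"
abbreviation "\<phi> \<equiv> index_map D"
abbreviation "\<Omega> \<equiv> base_space D"
abbreviation "P \<equiv> base_law D"
abbreviation "X \<equiv> base_proc D"

lemma index_map_fibre: "i \<in> space \<I> \<Longrightarrow> x \<in> space (fibre D i) \<Longrightarrow> \<phi> x = i"
  using setting by (auto simp: accel_setting_def)

lemma sets_state_space: "sets \<E> = {S. S \<subseteq> (\<Union>i\<in>space \<I>. space (fibre D i)) \<and>
    (\<forall>i\<in>space \<I>. S \<inter> space (fibre D i) \<in> sets (fibre D i))}"
  and space_state_space: "space \<E> = (\<Union>i\<in>space \<I>. space (fibre D i))"
proof -
  let ?E = "\<Union>i\<in>space \<I>. space (fibre D i)"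
  let ?A = "{S. S \<subseteq> ?E \<and> (\<forall>i\<in>space \<I>. S \<inter> space (fibre D i) \<in> sets (fibre D i))}"
  have sub: "?A \<subseteq> Pow ?E" by auto
  show "space \<E> = ?E" unfolding state_space_def Let_def using sub by (simp add: space_measure_of_conv)
  have "sigma_algebra ?E ?A"
    unfolding sigma_algebra_iff2
  proof (intro conjI ballI allI impI)
    show "?A \<subseteq> Pow ?E" by (rule sub)
    show "{} \<in> ?A" by simp
    fix S assume S: "S \<in> ?A"
    have "(?E - S) \<inter> space (fibre D i) = space (fibre D i) - S \<inter> space (fibre D i)" if "i \<in> space \<I>" for i
      using that by auto
    then show "?E - S \<in> ?A" using S by auto
  next
    fix S :: "nat \<Rightarrow> 'e set" assume S: "range S \<subseteq> ?A"
    then have Sn: "S n \<subseteq> ?E" "i \<in> space \<I> \<Longrightarrow> S n \<inter> space (fibre D i) \<in> sets (fibre D i)" for n i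
      by blast+
    have "\<Union> (range S) \<inter> space (fibre D i) = (\<Union>n. S n \<inter> space (fibre D i))" for i by auto
    moreover have "(\<Union>n. S n \<inter> space (fibre D i)) \<in> sets (fibre D i)" if "i \<in> space \<I>" for i
      by (rule sets.countable_nat_UN) (use Sn(2)[OF that] in blast)
    ultimately have "\<forall>i\<in>space \<I>. \<Union> (range S) \<inter> space (fibre D i) \<in> sets (fibre D i)" by simp
    moreover have "\<Union> (range S) \<subseteq> ?E" using Sn(1) by (rule UN_least)
    ultimately show "\<Union> (range S) \<in> ?A" by simp
  qed
  then show "sets \<E> = ?A"
    unfolding state_space_def Let_def by (rule sigma_algebra.sets_measure_of_eq)
qed

lemma state_index: "x \<in> space \<E> \<Longrightarrow> \<phi> x \<in> space \<I>" "x \<in> space \<E> \<Longrightarrow> x \<in> space (fibre D (\<phi> x))"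
  using index_map_fibre by (auto simp: space_state_space)

lemma fibre_state: "i \<in> space \<I> \<Longrightarrow> x \<in> space (fibre D i) \<Longrightarrow> x \<in> space \<E>"
  by (auto simp: space_state_space)

text \<open>
  A set belongs to the sigma algebra of the disjoint union as soon as all its traces on fibres are measurable; there is
  no condition across different fibres.
\<close>

lemma measurable_fibrewise:
  assumes f: "\<And>i. i \<in> space \<I> \<Longrightarrow> f i \<in> \<E> \<rightarrow>\<^sub>M M"
  shows "(\<lambda>x. f (\<phi> x) x) \<in> \<E> \<rightarrow>\<^sub>M M"
proof (rule measurableI)
  show "f (\<phi> x) x \<in> space M" if "x \<in> space \<E>" for x
    using measurable_space[OF f[OF state_index(1)[OF that]] that] .
  fix A assume A: "A \<in> sets M"
  have "((\<lambda>x. f (\<phi> x) x) -` A \<inter> space \<E>) \<inter> space (fibre D i) = (f i -` A \<inter> space \<E>) \<inter> space (fibre D i)"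
    if "i \<in> space \<I>" for i
    using index_map_fibre[OF that] by auto
  moreover have "(f i -` A \<inter> space \<E>) \<inter> space (fibre D i) \<in> sets (fibre D i)" if "i \<in> space \<I>" for i
    using measurable_sets[OF f[OF that] A] that by (auto simp: sets_state_space)
  ultimately show "(\<lambda>x. f (\<phi> x) x) -` A \<inter> space \<E> \<in> sets \<E>"
    by (auto simp: sets_state_space space_state_space)
qed

lemma measurable_of_index: "(\<And>i. i \<in> space \<I> \<Longrightarrow> c i \<in> space M) \<Longrightarrow> (\<lambda>x. c (\<phi> x)) \<in> \<E> \<rightarrow>\<^sub>M M"
  by (rule measurable_fibrewise[where f = "\<lambda>i x. c i"]) simp

lemma index_map_measurable [measurable]: "\<phi> \<in> \<E> \<rightarrow>\<^sub>M \<I>"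
  using measurable_of_index[of "\<lambda>i. i" \<I>] by simp

lemma measurable_restrict_fibre:
  assumes i: "i \<in> space \<I>" and f: "f \<in> \<E> \<rightarrow>\<^sub>M M"
  shows "f \<in> fibre D i \<rightarrow>\<^sub>M M"
proof (rule measurableI)
  show "f x \<in> space M" if "x \<in> space (fibre D i)" for x
    using measurable_space[OF f fibre_state[OF i that]] .
  fix A assume A: "A \<in> sets M"
  have "(f -` A \<inter> space \<E>) \<inter> space (fibre D i) \<in> sets (fibre D i)"
    using measurable_sets[OF f A] i by (auto simp: sets_state_space)
  moreover have "(f -` A \<inter> space \<E>) \<inter> space (fibre D i) = f -` A \<inter> space (fibre D i)"
    using fibre_state[OF i] by auto
  ultimately show "f -` A \<inter> space (fibre D i) \<in> sets (fibre D i)" by simp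
qed

text \<open>
  Functions on one fibre extend by 0 to the whole state space. Paths are measurable into the state space only, so this
  is how functions that are defined on a fibre are evaluated along paths.
\<close>

lemma measurable_extend_fibre:
  fixes f :: "'e \<Rightarrow> real"
  assumes i: "i \<in> space \<I>" and f: "f \<in> borel_measurable (fibre D i)"
  shows "(\<lambda>x. if \<phi> x = i then f x else 0) \<in> borel_measurable \<E>"
proof (rule measurableI)
  fix A :: "real set" assume A: "A \<in> sets borel"
  let ?S = "(\<lambda>x. if \<phi> x = i then f x else 0) -` A \<inter> space \<E>"
  have "?S \<inter> space (fibre D j) \<in> sets (fibre D j)" if j: "j \<in> space \<I>" for j
  proof (cases "j = i")
    case True
    have "?S \<inter> space (fibre D j) = f -` A \<inter> space (fibre D i)"
      using index_map_fibre[OF i] fibre_state[OF i] True by auto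
    then show ?thesis using measurable_sets[OF f A] True by simp
  next
    case False
    have "?S \<inter> space (fibre D j) = (if 0 \<in> A then space (fibre D j) else {})"
      using index_map_fibre[OF j] fibre_state[OF j] False by auto
    then show ?thesis by simp
  qed
  then show "?S \<in> sets \<E>" by (auto simp: sets_state_space space_state_space)
qed simp

lemma mu_space: "j \<in> space \<I> \<Longrightarrow> space (\<mu> j) = space (fibre D j)"
  by (rule sets_eq_imp_space_eq[OF mu_sets])

lemma mu_measurable: "j \<in> space \<I> \<Longrightarrow> f \<in> \<E> \<rightarrow>\<^sub>M M \<Longrightarrow> f \<in> \<mu> j \<rightarrow>\<^sub>M M"
  using measurable_restrict_fibre[of j f M] measurable_cong_sets[OF mu_sets refl, of j M] by blast

lemma mu_E_measurable: "j \<in> space \<I> \<Longrightarrow> (\<lambda>v. v) \<in> \<mu> j \<rightarrow>\<^sub>M \<E>"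
  by (rule mu_measurable) auto

lemma integral_mu_E:
  fixes h :: "'e \<Rightarrow> 'b::{banach, second_countable_topology}"
  assumes "j \<in> space \<I>" "h \<in> borel_measurable \<E>"
  shows "(\<integral>x. h x \<partial>distr (\<mu> j) \<E> (\<lambda>v. v)) = (\<integral>x. h x \<partial>\<mu> j)"
  by (rule integral_distr) (use assms mu_E_measurable in auto)

lemma rate_meas [measurable]: "rate D \<in> borel_measurable \<E>"
  and rate_nonneg: "x \<in> space \<E> \<Longrightarrow> 0 \<le> rate D x"
  and P_kernel [measurable]: "P \<in> \<E> \<rightarrow>\<^sub>M prob_algebra \<Omega>"
  and jump_kernel [measurable]: "jump D \<in> \<E> \<rightarrow>\<^sub>M prob_algebra \<E>"
  and abs_cont: "abs_cont_cdf (clock_cdf D)"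
  and path_in_fibre: "i \<in> space \<I> \<Longrightarrow> x \<in> space (fibre D i) \<Longrightarrow>
      AE w in P x. \<forall>t\<ge>0. X t w \<in> space (fibre D i)"
  using setting by (auto simp: accel_setting_def)

lemma P_prob: "x \<in> space \<E> \<Longrightarrow> prob_space (P x)"
  and P_sets: "x \<in> space \<E> \<Longrightarrow> sets (P x) = sets \<Omega>"
  and P_space: "x \<in> space \<E> \<Longrightarrow> space (P x) = space \<Omega>"
  using measurable_space[OF P_kernel] by (auto simp: space_prob_algebra dest: sets_eq_imp_space_eq)

text \<open>
  Progressive measurability gives joint measurability on every bounded time interval. Negative times are mapped to 0.
\<close>

lemma X_joint: "(\<lambda>(s, w). X (max 0 s) w) \<in> borel \<Otimes>\<^sub>M \<Omega> \<rightarrow>\<^sub>M \<E>"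
proof (rule measurableI)
  have fl: "filtration (space \<Omega>) (base_filt D)" and sub: "\<And>t. subalgebra \<Omega> (base_filt D t)"
    and pm: "progressively_measurable (base_filt D) \<E> X"
    using setting by (auto simp: accel_setting_def)
  have X_le: "(\<lambda>q. X (min (real n) (max 0 (fst q))) (snd q)) \<in> borel \<Otimes>\<^sub>M \<Omega> \<rightarrow>\<^sub>M \<E>" for n :: nat
  proof -
    have 1: "(\<lambda>(s, w). X s w) \<in> restrict_space borel {0..real n} \<Otimes>\<^sub>M base_filt D (real n) \<rightarrow>\<^sub>M \<E>"
      using pm by (simp add: progressively_measurable_def)
    have 2: "(\<lambda>q. (min (real n) (max 0 (fst q)), snd q)) \<in> borel \<Otimes>\<^sub>M \<Omega> \<rightarrow>\<^sub>M restrict_space borel {0..real n} \<Otimes>\<^sub>M base_filt D (real n)"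
    proof (rule measurable_Pair)
      show "(\<lambda>q. min (real n) (max 0 (fst q))) \<in> borel \<Otimes>\<^sub>M \<Omega> \<rightarrow>\<^sub>M restrict_space borel {0..real n}"
        by (rule measurable_restrict_space2) auto
      show "snd \<in> borel \<Otimes>\<^sub>M \<Omega> \<rightarrow>\<^sub>M base_filt D (real n)"
        by (rule measurable_compose[OF measurable_snd]) (rule measurable_from_subalg[OF sub measurable_ident_sets[OF refl], unfolded id_def])
    qed
    from measurable_compose[OF 2 1] show ?thesis by simp
  qed
  show "(case q of (s, w) \<Rightarrow> X (max 0 s) w) \<in> space \<E>" if "q \<in> space (borel \<Otimes>\<^sub>M \<Omega>)" for q
  proof -
    obtain n :: nat where "max 0 (fst q) \<le> real n" using real_arch_simple by blast
    then have "min (real n) (max 0 (fst q)) = max 0 (fst q)" by simp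
    then show ?thesis using measurable_space[OF X_le[of n] that] by (simp only: split_beta')
  qed
  fix A assume A: "A \<in> sets \<E>"
  have "(\<lambda>(s, w). X (max 0 s) w) -` A \<inter> space (borel \<Otimes>\<^sub>M \<Omega>)
      = (\<Union>n::nat. {q \<in> space (borel \<Otimes>\<^sub>M \<Omega>). fst q \<le> real n} \<inter>
          ((\<lambda>q. X (min (real n) (max 0 (fst q))) (snd q)) -` A \<inter> space (borel \<Otimes>\<^sub>M \<Omega>)))" (is "?L = ?R")
  proof (intro set_eqI iffI)
    fix q assume q: "q \<in> ?L"
    obtain n :: nat where n: "max 0 (fst q) \<le> real n" using real_arch_simple by blast
    then have "min (real n) (max 0 (fst q)) = max 0 (fst q)" by simp
    then show "q \<in> ?R" using q n by (intro UN_I[of n]) (auto simp: split_beta')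
  next
    fix q assume "q \<in> ?R"
    then obtain n :: nat where n: "q \<in> space (borel \<Otimes>\<^sub>M \<Omega>)" "fst q \<le> real n" "X (min (real n) (max 0 (fst q))) (snd q) \<in> A"
      by auto
    then have "min (real n) (max 0 (fst q)) = max 0 (fst q)" by (auto simp: min_def max_def)
    then show "q \<in> ?L" using n by (simp add: split_beta')
  qed
  also have "?R \<in> sets (borel \<Otimes>\<^sub>M \<Omega>)"
  proof (rule sets.countable_nat_UN, rule image_subsetI)
    fix n :: nat
    show "{q \<in> space (borel \<Otimes>\<^sub>M \<Omega>). fst q \<le> real n} \<inter>
        ((\<lambda>q. X (min (real n) (max 0 (fst q))) (snd q)) -` A \<inter> space (borel \<Otimes>\<^sub>M \<Omega>)) \<in> sets (borel \<Otimes>\<^sub>M \<Omega>)"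
      by (intro sets.Int measurable_sets[OF X_le A]) measurable
  qed
  finally show "(\<lambda>(s, w). X (max 0 s) w) -` A \<inter> space (borel \<Otimes>\<^sub>M \<Omega>) \<in> sets (borel \<Otimes>\<^sub>M \<Omega>)" .
qed

text \<open>
  Negative times are mapped to 0, so that paths are measurable on the whole line.
\<close>

definition fast :: "nat \<Rightarrow> real \<Rightarrow> 'w \<Rightarrow> 'e" where "fast n s w = X (real n * max 0 s) w"

lemma fast_joint: "(\<lambda>q. fast n (fst q) (snd q)) \<in> borel \<Otimes>\<^sub>M \<Omega> \<rightarrow>\<^sub>M \<E>"
proof -
  have "(\<lambda>q. (real n * max 0 (fst q), snd q)) \<in> borel \<Otimes>\<^sub>M \<Omega> \<rightarrow>\<^sub>M borel \<Otimes>\<^sub>M \<Omega>" by measurable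
  from measurable_compose[OF this X_joint] show ?thesis by (simp add: fast_def)
qed

lemma fast_measurable [measurable (raw)]:
  "f \<in> borel_measurable M \<Longrightarrow> g \<in> M \<rightarrow>\<^sub>M \<Omega> \<Longrightarrow> (\<lambda>x. fast n (f x) (g x)) \<in> M \<rightarrow>\<^sub>M \<E>"
proof -
  assume f: "f \<in> borel_measurable M" and g: "g \<in> M \<rightarrow>\<^sub>M \<Omega>"
  from measurable_compose[OF measurable_Pair[OF f g] fast_joint] show ?thesis by simp
qed

lemma path_measurable: "w \<in> space \<Omega> \<Longrightarrow> (\<lambda>s. fast n s w) \<in> borel \<rightarrow>\<^sub>M \<E>"
  by measurable

end

context averaging_model
begin

definition speed :: "real^'d \<Rightarrow> 'e \<Rightarrow> real^'d" where "speed v x = F (\<phi> x) v x"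

text \<open>
  A natural number instead of a real one: the least requirement "some constant works for almost every time" then
  becomes a countable union and is measurable in the path.
\<close>

definition lip_bound :: "'i \<Rightarrow> nat" where
  "lip_bound j = (SOME m. \<forall>x\<in>space (fibre D j). norm (F j 0 x) \<le> real m \<and>
     (\<forall>v v'. norm (F j v x - F j v' x) \<le> real m * norm (v - v')))"

lemma lip_bound:
  assumes j: "j \<in> space \<I>" and x: "x \<in> space (fibre D j)"
  shows "norm (F j 0 x) \<le> real (lip_bound j)" "norm (F j v x - F j v' x) \<le> real (lip_bound j) * norm (v - v')"
proof -
  obtain L where L: "\<And>x. x \<in> space (fibre D j) \<Longrightarrow> L-lipschitz_on UNIV (\<lambda>y. F j y x)"
    using lipschitz[OF j] by blast
  define C where "C = (SUP v\<in>space (fibre D j). ennreal (norm (F j 0 v)))"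
  have C: "C < \<infinity>" using bounded_at_0[OF j] by (simp add: C_def)
  obtain m :: nat where m: "max L (enn2real C) \<le> real m" using real_arch_simple by blast
  have "norm (F j 0 x) \<le> real m \<and> (\<forall>v v'. norm (F j v x - F j v' x) \<le> real m * norm (v - v'))"
    if x: "x \<in> space (fibre D j)" for x
  proof (intro conjI allI)
    have "ennreal (norm (F j 0 x)) \<le> C" unfolding C_def by (rule SUP_upper[OF x])
    moreover obtain c where "C = ennreal c" "0 \<le> c" using C by (cases C) auto
    ultimately have "norm (F j 0 x) \<le> enn2real C" by simp
    then show "norm (F j 0 x) \<le> real m" using m by simp
    fix v v'
    have "norm (F j v x - F j v' x) \<le> L * norm (v - v')"
      using lipschitz_onD[OF L[OF x], of v v'] by (simp add: dist_norm)
    also have "\<dots> \<le> real m * norm (v - v')" using m by (intro mult_right_mono) auto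
    finally show "norm (F j v x - F j v' x) \<le> real m * norm (v - v')" .
  qed
  then have "\<exists>m::nat. \<forall>x\<in>space (fibre D j). norm (F j 0 x) \<le> real m \<and>
     (\<forall>v v'. norm (F j v x - F j v' x) \<le> real m * norm (v - v'))" by blast
  from someI_ex[OF this] x
  show "norm (F j 0 x) \<le> real (lip_bound j)" "norm (F j v x - F j v' x) \<le> real (lip_bound j) * norm (v - v')"
    unfolding lip_bound_def by blast+
qed

lemma speed_bounds:
  assumes "x \<in> space \<E>"
  shows "norm (speed 0 x) \<le> real (lip_bound (\<phi> x))" "norm (speed v x - speed v' x) \<le> real (lip_bound (\<phi> x)) * norm (v - v')"
  unfolding speed_def by (rule lip_bound[OF state_index[OF assms]])+

lemma speed_fibre: "j \<in> space \<I> \<Longrightarrow> x \<in> space (fibre D j) \<Longrightarrow> speed v x = F j v x"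
  by (simp add: speed_def index_map_fibre)

lemma speed_measurable_snd: "speed v \<in> borel_measurable \<E>"
proof -
  have "F j v \<in> borel_measurable \<E>" if "j \<in> space \<I>" for j
    using measurable_compose[OF measurable_Pair1' F_measurable[OF that], of v] by simp
  then have "(\<lambda>x. F (\<phi> x) v x) \<in> borel_measurable \<E>" by (rule measurable_fibrewise)
  then show ?thesis by (simp add: speed_def[abs_def])
qed

lemma speed_continuous: "x \<in> space \<E> \<Longrightarrow> continuous_on UNIV (\<lambda>v. speed v x)"
  by (rule lipschitz_on_continuous_on[of "real (lip_bound (\<phi> x))"])
    (use speed_bounds in \<open>auto intro!: lipschitz_onI simp: dist_norm\<close>)

lemma speed_measurable: "(\<lambda>(v, x). speed v x) \<in> borel \<Otimes>\<^sub>M \<E> \<rightarrow>\<^sub>M borel"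
  by (rule caratheodory_measurable[OF speed_continuous speed_measurable_snd])

lemma speed_compose [measurable (raw)]:
  "f \<in> borel_measurable M \<Longrightarrow> g \<in> M \<rightarrow>\<^sub>M \<E> \<Longrightarrow> (\<lambda>x. speed (f x) (g x)) \<in> borel_measurable M"
proof -
  assume f: "f \<in> borel_measurable M" and g: "g \<in> M \<rightarrow>\<^sub>M \<E>"
  from measurable_compose[OF measurable_Pair[OF f g] speed_measurable] show ?thesis by simp
qed

lemma speed_field:
  assumes w: "w \<in> space \<Omega>" and L: "AE s in lborel. lip_bound (\<phi> (fast n s w)) \<le> L"
  shows "lipschitz_field (real L) (\<lambda>s v. speed v (fast n s w))"
  unfolding lipschitz_field_def
proof (intro conjI)
  have [measurable]: "(\<lambda>s. fast n s w) \<in> borel \<rightarrow>\<^sub>M \<E>" by (rule path_measurable[OF w])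
  show "(\<lambda>(s, v). speed v (fast n s w)) \<in> borel \<Otimes>\<^sub>M borel \<rightarrow>\<^sub>M borel" by measurable
  show "AE s in lborel. 0 \<le> s \<longrightarrow> norm (speed 0 (fast n s w)) \<le> real L \<and>
      (\<forall>v v'. norm (speed v (fast n s w) - speed v' (fast n s w)) \<le> real L * norm (v - v'))"
    using L
  proof eventually_elim
    case (elim s)
    have x: "fast n s w \<in> space \<E>" using measurable_space[OF path_measurable[OF w], of s n] by simp
    from elim have l: "real (lip_bound (\<phi> (fast n s w))) \<le> real L" by simp
    show ?case
    proof (intro impI conjI allI)
      show "norm (speed 0 (fast n s w)) \<le> real L" using speed_bounds(1)[OF x] l by simp
      fix v v'
      show "norm (speed v (fast n s w) - speed v' (fast n s w)) \<le> real L * norm (v - v')"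
        by (rule order_trans[OF speed_bounds(2)[OF x]]) (intro mult_right_mono l norm_ge_zero)
    qed
  qed
qed simp

lemma avg_drift_speed: "j \<in> space \<I> \<Longrightarrow> avg_drift \<mu> F j v = (\<integral>x. speed v x \<partial>\<mu> j)"
  unfolding avg_drift_def
  by (intro Bochner_Integration.integral_cong) (auto simp: mu_space speed_fibre)

lemma avg_drift_field:
  assumes j: "j \<in> space \<I>"
  shows "lipschitz_field (real (lip_bound j)) (\<lambda>s v. \<integral>x. speed v x \<partial>\<mu> j)"
  by (rule averaged_field(1)[OF mu_prob[OF j]])
    (use lip_bound[OF j] in \<open>auto intro!: mu_measurable[OF j] speed_measurable_snd simp: mu_space[OF j] speed_fibre[OF j]\<close>)

lemma avg_drift_measurable: "(\<lambda>(v, j). avg_drift \<mu> F j v) \<in> borel \<Otimes>\<^sub>M \<I> \<rightarrow>\<^sub>M borel"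
proof (rule caratheodory_measurable)
  show "continuous_on UNIV (\<lambda>v. avg_drift \<mu> F j v)" if j: "j \<in> space \<I>" for j
  proof -
    interpret \<mu>: prob_space "\<mu> j" by (rule mu_prob[OF j])
    have b: "norm (speed 0 y) \<le> real (lip_bound j)" "norm (speed v y - speed v' y) \<le> real (lip_bound j) * norm (v - v')"
      if "y \<in> space (\<mu> j)" for y v v'
      using lip_bound[OF j] that by (auto simp: mu_space[OF j] speed_fibre[OF j])
    have int: "integrable (\<mu> j) (speed v)" for v
      by (rule averaged_field(2)[OF mu_prob[OF j] mu_measurable[OF j speed_measurable_snd] _ b(2) b(1)]) auto
    have "norm ((\<integral>x. speed v x \<partial>\<mu> j) - (\<integral>x. speed v' x \<partial>\<mu> j)) \<le> real (lip_bound j) * norm (v - v')" for v v'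
    proof -
      have "norm ((\<integral>x. speed v x \<partial>\<mu> j) - (\<integral>x. speed v' x \<partial>\<mu> j)) = norm (\<integral>x. speed v x - speed v' x \<partial>\<mu> j)"
        using int by simp
      also have "\<dots> \<le> (\<integral>x. norm (speed v x - speed v' x) \<partial>\<mu> j)" by (rule integral_norm_bound)
      also have "\<dots> \<le> (\<integral>x. real (lip_bound j) * norm (v - v') \<partial>\<mu> j)"
        by (intro integral_mono) (use int b in auto)
      finally show ?thesis by (simp add: \<mu>.prob_space)
    qed
    then show ?thesis
      by (intro lipschitz_on_continuous_on[of "real (lip_bound j)"]) (auto intro!: lipschitz_onI simp: dist_norm avg_drift_speed[OF j])
  qed
  show "(\<lambda>j. avg_drift \<mu> F j v) \<in> borel_measurable \<I>" for v
  proof -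
    have "(\<lambda>j. \<integral>x. speed v x \<partial>distr (\<mu> j) \<E> (\<lambda>v. v)) \<in> borel_measurable \<I>"
      by (rule measurable_compose[OF measurable_prob_algebraD[OF mu_kernel] integral_measurable_subprob_algebra[OF speed_measurable_snd]])
    then show ?thesis
      by (subst measurable_cong[OF trans[OF avg_drift_speed integral_mu_E[symmetric]]]) (auto intro: speed_measurable_snd)
  qed
qed

text \<open>
  Almost every path from the fibre of \<open>j\<close> is regular, and all later pathwise statements are made for regular paths.
\<close>

definition regular :: "'i \<Rightarrow> 'w \<Rightarrow> bool" where
  "regular j w \<longleftrightarrow> w \<in> space \<Omega> \<and> (\<forall>t\<ge>0. X t w \<in> space (fibre D j)) \<and>
     (\<forall>t. (\<integral>\<^sup>+s\<in>{0..t}. ennreal (rate D (X s w)) \<partial>lborel) < \<infinity>)"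

lemma regular_fast: "regular j w \<Longrightarrow> fast n s w \<in> space (fibre D j)"
  by (simp add: regular_def fast_def)

text \<open>
  Uniform integrability bounds the means of the averaged rates; this is the form in which it is used.
\<close>

lemma mean_clock_bounded:
  assumes t: "0 \<le> t" and x: "x \<in> space \<E>"
  shows "\<exists>C<\<infinity>. \<forall>n\<ge>1. (\<integral>\<^sup>+w. ennreal (1 / real n) *
          (\<integral>\<^sup>+s\<in>{0..real n * t}. ennreal (rate D (X s w)) \<partial>lborel) \<partial>P x) \<le> C"
    "\<And>n. n \<ge> 1 \<Longrightarrow> (\<lambda>w. ennreal (1 / real n) *
          (\<integral>\<^sup>+s\<in>{0..real n * t}. ennreal (rate D (X s w)) \<partial>lborel)) \<in> borel_measurable (P x)"
proof -
  interpret prob_space "P x" by (rule P_prob[OF x])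
  let ?f = "\<lambda>n w. ennreal (1 / real n) * (\<integral>\<^sup>+s\<in>{0..real n * t}. ennreal (rate D (X s w)) \<partial>lborel)"
  have UI: "uniformly_integrable (P x) {1..} ?f" by (rule rate_UI[OF t x])
  show m: "?f n \<in> borel_measurable (P x)" if "n \<ge> 1" for n
    using UI that unfolding uniformly_integrable_def by auto
  have "((\<lambda>K::real. SUP n\<in>{1..}. \<integral>\<^sup>+w\<in>{w. ennreal K < ?f n w}. ?f n w \<partial>P x) \<longlongrightarrow> 0) at_top"
    using UI unfolding uniformly_integrable_def by blast
  then have "\<forall>\<^sub>F K::real in at_top. (SUP n\<in>{1..}. \<integral>\<^sup>+w\<in>{w. ennreal K < ?f n w}. ?f n w \<partial>P x) < 1"
    by (rule order_tendstoD) simp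
  from eventually_happens'[OF _ this] obtain K :: real where K: "(SUP n\<in>{1..}. \<integral>\<^sup>+w\<in>{w. ennreal K < ?f n w}. ?f n w \<partial>P x) < 1"
    by auto
  show "\<exists>C<\<infinity>. \<forall>n\<ge>1. (\<integral>\<^sup>+w. ?f n w \<partial>P x) \<le> C"
  proof (intro exI[of _ "ennreal K + 1"] conjI allI impI)
    fix n :: nat assume n: "n \<ge> 1"
    note [measurable] = m[OF n]
    have "(\<integral>\<^sup>+w. ?f n w \<partial>P x) \<le> (\<integral>\<^sup>+w. ennreal K + ?f n w * indicator {w. ennreal K < ?f n w} w \<partial>P x)"
    proof (rule nn_integral_mono)
      fix w
      show "?f n w \<le> ennreal K + ?f n w * indicator {w. ennreal K < ?f n w} w"
        by (cases "ennreal K < ?f n w") (auto simp: add_increasing not_less)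
    qed
    also have "\<dots> = ennreal K + (\<integral>\<^sup>+w\<in>{w. ennreal K < ?f n w}. ?f n w \<partial>P x)"
      by (subst nn_integral_add) (auto simp: emeasure_space_1)
    also have "\<dots> \<le> ennreal K + 1"
    proof (rule add_left_mono)
      have "(\<integral>\<^sup>+w\<in>{w. ennreal K < ?f n w}. ?f n w \<partial>P x) \<le> (SUP n\<in>{1..}. \<integral>\<^sup>+w\<in>{w. ennreal K < ?f n w}. ?f n w \<partial>P x)"
        by (rule SUP_upper) (use n in auto)
      also have "\<dots> \<le> 1" using K by (rule less_imp_le)
      finally show "(\<integral>\<^sup>+w\<in>{w. ennreal K < ?f n w}. ?f n w \<partial>P x) \<le> 1" .
    qed
    finally show "(\<integral>\<^sup>+w. ?f n w \<partial>P x) \<le> ennreal K + 1" .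
  qed simp
qed

lemma AE_regular:
  assumes j: "j \<in> space \<I>" and x: "x \<in> space (fibre D j)"
  shows "AE w in P x. regular j w"
proof -
  have xE: "x \<in> space \<E>" by (rule fibre_state[OF j x])
  have "AE w in P x. \<forall>t::nat. (\<integral>\<^sup>+s\<in>{0..real t}. ennreal (rate D (X s w)) \<partial>lborel) < \<infinity>"
    unfolding AE_all_countable
  proof
    fix t :: nat
    obtain C where C: "C < \<infinity>" "\<And>n. n \<ge> 1 \<Longrightarrow> (\<integral>\<^sup>+w. ennreal (1 / real n) *
          (\<integral>\<^sup>+s\<in>{0..real n * real t}. ennreal (rate D (X s w)) \<partial>lborel) \<partial>P x) \<le> C"
      using mean_clock_bounded(1)[of "real t" x] xE by auto
    have "(\<integral>\<^sup>+w. (\<integral>\<^sup>+s\<in>{0..real t}. ennreal (rate D (X s w)) \<partial>lborel) \<partial>P x) \<noteq> \<infinity>"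
      using C(2)[of 1] C(1) by (auto simp: top_unique)
    moreover have "(\<lambda>w. \<integral>\<^sup>+s\<in>{0..real t}. ennreal (rate D (X s w)) \<partial>lborel) \<in> borel_measurable (P x)"
      using mean_clock_bounded(2)[of "real t" x 1] xE by simp
    ultimately have "AE w in P x. (\<integral>\<^sup>+s\<in>{0..real t}. ennreal (rate D (X s w)) \<partial>lborel) \<noteq> \<infinity>"
      by (intro nn_integral_PInf_AE)
    then show "AE w in P x. (\<integral>\<^sup>+s\<in>{0..real t}. ennreal (rate D (X s w)) \<partial>lborel) < \<infinity>"
      by eventually_elim (simp add: less_top)
  qed
  with path_in_fibre[OF j x] AE_space show ?thesis
  proof eventually_elim
    case (elim w)
    have "(\<integral>\<^sup>+s\<in>{0..t}. ennreal (rate D (X s w)) \<partial>lborel) < \<infinity>" for t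
    proof -
      obtain k :: nat where "t \<le> real k" using real_arch_simple by blast
      then have "(\<integral>\<^sup>+s\<in>{0..t}. ennreal (rate D (X s w)) \<partial>lborel) \<le> (\<integral>\<^sup>+s\<in>{0..real k}. ennreal (rate D (X s w)) \<partial>lborel)"
        by (intro nn_integral_mono) (auto simp: indicator_def)
      also have "\<dots> < \<infinity>" using elim by blast
      finally show ?thesis .
    qed
    with elim P_space[OF xE] show ?case by (simp add: regular_def)
  qed
qed

lemma regular_integrable_bounded:
  fixes h :: "'e \<Rightarrow> real"
  assumes j: "j \<in> space \<I>" and w: "regular j w" and h: "h \<in> borel_measurable (\<mu> j)"
    and le: "\<And>y. y \<in> space (fibre D j) \<Longrightarrow> \<bar>h y\<bar> \<le> C * (1 + rate D y)" and C: "0 \<le> C"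
  shows "set_integrable lborel {0..t} (\<lambda>s. h (X (max 0 s) w))"
    and "(\<lambda>s. h (fast n s w)) \<in> borel_measurable borel"
    and "set_integrable lborel {0..t} (\<lambda>s. h (fast n s w))"
proof -
  have w': "w \<in> space \<Omega>" using w by (simp add: regular_def)
  have hm: "(\<lambda>s. h (fast n s w)) \<in> borel_measurable borel" for n
  proof -
    have "h \<in> borel_measurable (fibre D j)" using h measurable_cong_sets[OF mu_sets[OF j] refl] by blast
    from measurable_extend_fibre[OF j this] path_measurable[OF w']
    have "(\<lambda>s. if \<phi> (fast n s w) = j then h (fast n s w) else 0) \<in> borel_measurable borel"
      by (rule measurable_compose[rotated])
    moreover have "\<phi> (fast n s w) = j" for s using index_map_fibre[OF j regular_fast[OF w]] .
    ultimately show ?thesis by simp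
  qed
  show "(\<lambda>s. h (fast n s w)) \<in> borel_measurable borel" by (rule hm)
  have [measurable]: "(\<lambda>s. rate D (fast 1 s w)) \<in> borel_measurable borel"
    by (rule measurable_compose[OF path_measurable[OF w'] rate_meas])
  have Xf: "X (max 0 s) w = fast 1 s w" for s by (simp add: fast_def)
  have ri: "set_integrable lborel {0..t} (\<lambda>s. rate D (fast 1 s w))" for t
    unfolding set_integrable_def
  proof (rule integrableI_nonneg)
    show "(\<lambda>s. indicator {0..t} s *\<^sub>R rate D (fast 1 s w)) \<in> borel_measurable lborel" by measurable
    show "AE s in lborel. 0 \<le> indicator {0..t} s *\<^sub>R rate D (fast 1 s w)"
      using rate_nonneg[OF fibre_state[OF j regular_fast[OF w]]] by auto
    have "(\<integral>\<^sup>+s. ennreal (indicator {0..t} s *\<^sub>R rate D (fast 1 s w)) \<partial>lborel) =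
       (\<integral>\<^sup>+s\<in>{0..t}. ennreal (rate D (X s w)) \<partial>lborel)"
      by (intro nn_integral_cong) (auto simp: indicator_def fast_def)
    then show "(\<integral>\<^sup>+s. ennreal (indicator {0..t} s *\<^sub>R rate D (fast 1 s w)) \<partial>lborel) < \<infinity>"
      using w by (simp add: regular_def)
  qed
  have hi: "set_integrable lborel {0..t} (\<lambda>s. h (fast 1 s w))" for t
  proof (rule set_integrable_bound)
    show "set_integrable lborel {0..t} (\<lambda>s. C * (1 + rate D (fast 1 s w)))"
      using ri[of t] integrable_Icc_const[of 0 t "1::real"]
      by (intro set_integrable_mult_right set_integral_add(1)) (auto simp: set_integrable_def)
    show "set_borel_measurable lborel {0..t} (\<lambda>s. h (fast 1 s w))"
      unfolding set_borel_measurable_def using hm[of 1] by measurable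
    show "AE s in lborel. s \<in> {0..t} \<longrightarrow> norm (h (fast 1 s w)) \<le> norm (C * (1 + rate D (fast 1 s w)))"
    proof (rule AE_I2, rule impI)
      fix s
      from le[OF regular_fast[OF w], of 1 s] abs_ge_self[of "C * (1 + rate D (fast 1 s w))"]
      show "norm (h (fast 1 s w)) \<le> norm (C * (1 + rate D (fast 1 s w)))"
        unfolding real_norm_def by (rule order_trans)
    qed
  qed
  then show "set_integrable lborel {0..t} (\<lambda>s. h (X (max 0 s) w))" by (simp add: Xf)
  show "set_integrable lborel {0..t} (\<lambda>s. h (fast n s w))"
  proof (cases "n = 0")
    case True
    then have "h (fast n s w) = h (X 0 w)" for s by (simp add: fast_def)
    then show ?thesis using integrable_Icc_const[of 0 t "h (X 0 w)"] by (simp add: set_integrable_def)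
  next
    case False
    have "set_integrable lborel {0..t} (\<lambda>s. h (fast 1 (real n * s) w))"
      using lborel_set_integral_scale(1)[of "real n" t "\<lambda>s. h (fast 1 s w)"] hi False by simp
    moreover have "h (fast 1 (real n * s) w) = h (fast n s w)" if "s \<in> {0..t}" for s
      using that by (simp add: fast_def)
    ultimately show ?thesis by (subst (asm) set_integrable_cong[OF refl refl]) auto
  qed
qed

lemma rate_path_fast:
  assumes j: "j \<in> space \<I>" and w: "regular j w"
  shows "rate_path (\<lambda>s. rate D (fast n s w))"
  unfolding rate_path_def
proof (intro conjI allI)
  have le: "\<bar>rate D y\<bar> \<le> 1 * (1 + rate D y)" if "y \<in> space (fibre D j)" for y
    using rate_nonneg[OF fibre_state[OF j that]] by simp
  note r = regular_integrable_bounded[OF j w mu_measurable[OF j rate_meas] le]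
  show "(\<lambda>s. rate D (fast n s w)) \<in> borel_measurable borel" by (rule r(2)) auto
  show "set_integrable lborel {0..t} (\<lambda>s. rate D (fast n s w))" for t by (rule r(3)) auto
  show "0 \<le> rate D (fast n s w)" for s by (rule rate_nonneg[OF fibre_state[OF j regular_fast[OF w]]])
qed

text \<open>
  Functions bounded by a multiple of \<open>1 + rate\<close> are locally integrable along almost every path, so
  ergodicity covers them.
\<close>

lemma AE_path_averages:
  fixes h :: "'e \<Rightarrow> real"
  assumes j: "j \<in> space \<I>" and x: "x \<in> space (fibre D j)" and h: "integrable (\<mu> j) h"
    and le: "\<And>y. y \<in> space (fibre D j) \<Longrightarrow> \<bar>h y\<bar> \<le> C * (1 + rate D y)" and C: "0 \<le> C"
  shows "AE w in P x. ((\<lambda>t. 1 / t * (LBINT s:{0..t}. h (X s w))) \<longlongrightarrow> (\<integral>u. h u \<partial>\<mu> j)) at_top"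
proof (rule ergodic[OF j _ x])
  have hm: "h \<in> borel_measurable (\<mu> j)" using h by (rule borel_measurable_integrable)
  show "h \<in> ergodic_class D \<mu> j"
    unfolding ergodic_class_def
  proof (rule CollectI, intro conjI h ballI allI impI)
    fix y t assume y: "y \<in> space (fibre D j)" and t: "0 \<le> (t::real)"
    show "AE w in P y. (\<integral>\<^sup>+s\<in>{0..t}. ennreal \<bar>h (X s w)\<bar> \<partial>lborel) < \<infinity>"
      using AE_regular[OF j y]
    proof eventually_elim
      case (elim w)
      have "integrable lborel (\<lambda>s. indicator {0..t} s *\<^sub>R h (X (max 0 s) w))"
        using regular_integrable_bounded(1)[OF j elim hm le C, of t] by (simp add: set_integrable_def)
      then have "(\<integral>\<^sup>+s. ennreal (norm (indicator {0..t} s *\<^sub>R h (X (max 0 s) w))) \<partial>lborel) < \<infinity>"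
        by (simp add: integrable_iff_bounded)
      moreover have "(\<integral>\<^sup>+s. ennreal (norm (indicator {0..t} s *\<^sub>R h (X (max 0 s) w))) \<partial>lborel)
          = (\<integral>\<^sup>+s\<in>{0..t}. ennreal \<bar>h (X s w)\<bar> \<partial>lborel)"
        by (intro nn_integral_cong) (auto simp: indicator_def)
      ultimately show ?case by simp
    qed
  qed
qed

text \<open>
  Ergodicity applies to the truncated rates \<open>min b K\<close>. By Fatou's lemma their means under \<open>\<mu> j\<close> are at most the
  bound on the expected time averages of \<open>b\<close>, which does not depend on \<open>K\<close>.
\<close>

lemma integrable_rate:
  assumes j: "j \<in> space \<I>"
  shows "integrable (\<mu> j) (rate D)"
proof -
  interpret \<mu>: prob_space "\<mu> j" by (rule mu_prob[OF j])
  obtain x where x: "x \<in> space (fibre D j)" using \<mu>.not_empty mu_space[OF j] by auto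
  then have xE: "x \<in> space \<E>" by (rule fibre_state[OF j])
  interpret Px: prob_space "P x" by (rule P_prob[OF xE])
  have rm [measurable]: "rate D \<in> borel_measurable (\<mu> j)" by (rule mu_measurable[OF j rate_meas])
  have r0: "0 \<le> rate D y" if "y \<in> space (\<mu> j)" for y
    using rate_nonneg[OF fibre_state[OF j]] that by (simp add: mu_space[OF j])
  let ?f = "\<lambda>n w. ennreal (1 / real n) * (\<integral>\<^sup>+s\<in>{0..real n * 1}. ennreal (rate D (X s w)) \<partial>lborel)"
  obtain C where C: "C < \<infinity>" "\<And>n. n \<ge> 1 \<Longrightarrow> (\<integral>\<^sup>+w. ?f n w \<partial>P x) \<le> C"
    using mean_clock_bounded(1)[of 1 x] xE by auto
  have fm: "?f (Suc n) \<in> borel_measurable (P x)" for n by (rule mean_clock_bounded(2)[OF _ xE]) auto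
  have trunc: "(\<integral>\<^sup>+y. min (ennreal (rate D y)) (ennreal (real K)) \<partial>\<mu> j) \<le> C" for K :: nat
  proof -
    define h where "h y = min (rate D y) (real K)" for y
    have hm [measurable]: "h \<in> borel_measurable (\<mu> j)" unfolding h_def by measurable
    have hi: "integrable (\<mu> j) h"
      by (rule \<mu>.integrable_const_bound[where B = "real K", OF AE_I2]) (use r0 in \<open>auto simp: h_def\<close>)
    define c where "c = (\<integral>y. h y \<partial>\<mu> j)"
    have le: "\<bar>h y\<bar> \<le> 1 * (1 + rate D y)" if "y \<in> space (fibre D j)" for y
      using r0[of y] that by (auto simp: h_def mu_space[OF j])
    have "AE w in P x. ((\<lambda>t. 1 / t * (LBINT s:{0..t}. h (X s w))) \<longlongrightarrow> c) at_top"
      unfolding c_def by (rule AE_path_averages[OF j x hi le]) auto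
    with AE_regular[OF j x] have "AE w in P x. ennreal c \<le> liminf (\<lambda>n. ?f (Suc n) w)"
    proof eventually_elim
      case (elim w)
      have "(\<lambda>n. 1 / real (Suc n) * (LBINT s:{0..real (Suc n)}. h (X s w))) \<longlonglongrightarrow> c"
        by (rule filterlim_compose[OF elim(2)]) (rule filterlim_compose[OF filterlim_real_sequentially filterlim_Suc])
      then have "(\<lambda>n. ennreal (1 / real (Suc n) * (LBINT s:{0..real (Suc n)}. h (X s w)))) \<longlonglongrightarrow> ennreal c"
        by (rule tendsto_ennrealI)
      then have "ennreal c = liminf (\<lambda>n. ennreal (1 / real (Suc n) * (LBINT s:{0..real (Suc n)}. h (X s w))))"
        by (rule lim_imp_Liminf[OF sequentially_bot, symmetric])
      also have "\<dots> \<le> liminf (\<lambda>n. ?f (Suc n) w)"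
      proof (rule Liminf_mono, rule always_eventually, rule)
        fix n
        have y: "X s w \<in> space (\<mu> j)" if "0 \<le> s" for s using elim(1) that by (simp add: regular_def mu_space[OF j])
        have i: "integrable lborel (\<lambda>s. indicator {0..real (Suc n)} s *\<^sub>R h (X (max 0 s) w))"
          using regular_integrable_bounded(1)[OF j elim(1) hm le, of "real (Suc n)"] by (simp add: set_integrable_def)
        have eq: "indicator {0..real (Suc n)} s *\<^sub>R h (X (max 0 s) w) = indicator {0..real (Suc n)} s *\<^sub>R h (X s w)" for s
          by (auto simp: indicator_def)
        have "ennreal (LBINT s:{0..real (Suc n)}. h (X s w)) = (\<integral>\<^sup>+s. ennreal (indicator {0..real (Suc n)} s *\<^sub>R h (X s w)) \<partial>lborel)"
          unfolding set_lebesgue_integral_def using i unfolding eq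
          by (rule nn_integral_eq_integral[symmetric]) (use y r0 in \<open>auto simp: h_def indicator_def\<close>)
        also have "\<dots> \<le> (\<integral>\<^sup>+s\<in>{0..real (Suc n) * 1}. ennreal (rate D (X s w)) \<partial>lborel)"
          by (intro nn_integral_mono) (auto simp: indicator_def h_def intro!: ennreal_leI)
        finally have "ennreal (1 / real (Suc n)) * ennreal (LBINT s:{0..real (Suc n)}. h (X s w)) \<le> ?f (Suc n) w"
          by (rule mult_left_mono) simp
        then show "ennreal (1 / real (Suc n) * (LBINT s:{0..real (Suc n)}. h (X s w))) \<le> ?f (Suc n) w"
          by (subst ennreal_mult') simp_all
      qed
      finally show ?case .
    qed
    then have "(\<integral>\<^sup>+w. ennreal c \<partial>P x) \<le> (\<integral>\<^sup>+w. liminf (\<lambda>n. ?f (Suc n) w) \<partial>P x)" by (rule nn_integral_mono_AE)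
    also have "\<dots> \<le> liminf (\<lambda>n. \<integral>\<^sup>+w. ?f (Suc n) w \<partial>P x)" by (rule nn_integral_liminf[OF fm])
    also have "\<dots> \<le> liminf (\<lambda>n. C)"
      by (intro Liminf_mono always_eventually allI C(2)) simp
    also have "\<dots> = C" by (simp add: Liminf_const)
    finally have "ennreal c \<le> C" by (simp add: Px.emeasure_space_1)
    moreover have "ennreal c = (\<integral>\<^sup>+y. ennreal (h y) \<partial>\<mu> j)"
      unfolding c_def by (rule nn_integral_eq_integral[symmetric, OF hi]) (use r0 in \<open>auto simp: h_def\<close>)
    moreover have "(\<integral>\<^sup>+y. ennreal (h y) \<partial>\<mu> j) = (\<integral>\<^sup>+y. min (ennreal (rate D y)) (ennreal (real K)) \<partial>\<mu> j)"
      by (intro nn_integral_cong) (auto simp: h_def min_def ennreal_le_iff)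
    ultimately show ?thesis by simp
  qed
  have "(\<integral>\<^sup>+y. ennreal (rate D y) \<partial>\<mu> j) = (\<integral>\<^sup>+y. (SUP K. min (ennreal (rate D y)) (ennreal (real K))) \<partial>\<mu> j)"
  proof (rule nn_integral_cong)
    fix y
    obtain K :: nat where "rate D y \<le> real K" using real_arch_simple by blast
    then have "ennreal (rate D y) = min (ennreal (rate D y)) (ennreal (real K))" by (simp add: min_def ennreal_leI)
    also have "\<dots> \<le> (SUP K. min (ennreal (rate D y)) (ennreal (real K)))" by (rule SUP_upper) simp
    finally show "ennreal (rate D y) = (SUP K. min (ennreal (rate D y)) (ennreal (real K)))"
      by (intro antisym SUP_least) auto
  qed
  also have "\<dots> = (SUP K. \<integral>\<^sup>+y. min (ennreal (rate D y)) (ennreal (real K)) \<partial>\<mu> j)"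
  proof (rule nn_integral_monotone_convergence_SUP)
    show "incseq (\<lambda>K y. min (ennreal (rate D y)) (ennreal (real K)))"
      by (auto simp: incseq_def le_fun_def min_le_iff_disj intro!: ennreal_leI)
  qed measurable
  also have "\<dots> \<le> C" by (rule SUP_least) (rule trunc)
  also have "\<dots> < \<infinity>" by (rule C)
  finally have "(\<integral>\<^sup>+y. ennreal (rate D y) \<partial>\<mu> j) < \<infinity>" .
  then show ?thesis by (intro integrableI_nonneg rm AE_I2 r0)
qed

text \<open>
  Rescaling time turns the long time average into an average over the bounded interval \<open>[0, t]\<close>.
\<close>

lemma AE_averages:
  fixes h :: "'e \<Rightarrow> real"
  assumes j: "j \<in> space \<I>" and x: "x \<in> space (fibre D j)" and h: "h \<in> borel_measurable (\<mu> j)"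
    and le: "\<And>y. y \<in> space (fibre D j) \<Longrightarrow> \<bar>h y\<bar> \<le> C * (1 + rate D y)" and C: "0 \<le> C"
    and \<nu>: "filterlim \<nu> at_top sequentially"
  shows "AE w in P x. averages (\<lambda>k s. fast (\<nu> k) s w) h (\<integral>y. h y \<partial>\<mu> j)"
proof -
  interpret \<mu>: prob_space "\<mu> j" by (rule mu_prob[OF j])
  have hi: "integrable (\<mu> j) h"
  proof (rule Bochner_Integration.integrable_bound[OF _ h])
    show "integrable (\<mu> j) (\<lambda>y. C * (1 + rate D y))"
      using integrable_rate[OF j] by simp
    show "AE y in \<mu> j. norm (h y) \<le> norm (C * (1 + rate D y))"
      using le by (intro AE_I2) (simp add: mu_space[OF j] order_trans[OF _ abs_ge_self])
  qed
  have lim: "AE w in P x. ((\<lambda>t. 1 / t * (LBINT s:{0..t}. h (X s w))) \<longlongrightarrow> (\<integral>u. h u \<partial>\<mu> j)) at_top"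
    by (rule AE_path_averages[OF j x hi le C])
  from AE_regular[OF j x] lim show ?thesis
  proof eventually_elim
    case (elim w)
    show ?case
      unfolding averages_def
    proof (intro allI impI conjI)
      show "set_integrable lborel {0..t} (\<lambda>s. h (fast (\<nu> n) s w))" for n t
        by (rule regular_integrable_bounded(3)[OF j elim(1) h le C])
      fix t :: real assume t: "0 \<le> t"
      show "(\<lambda>k. LBINT s:{0..t}. h (fast (\<nu> k) s w)) \<longlonglongrightarrow> t * (\<integral>y. h y \<partial>\<mu> j)"
      proof (cases "t = 0")
        case True
        have "(LBINT s:{0..0}. h (fast (\<nu> k) s w)) = 0" for k
          using cumulated_neg[of 0 "\<lambda>s. h (fast (\<nu> k) s w)"] by (simp only: cumulated_def)
        then show ?thesis unfolding True by simp
      next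
        case False
        then have tp: "0 < t" using t by simp
        have "filterlim (\<lambda>k. real (\<nu> k) * t) at_top sequentially"
          by (rule filterlim_at_top_mult_tendsto_pos[OF tendsto_const tp filterlim_compose[OF filterlim_real_sequentially \<nu>]])
        from filterlim_compose[OF elim(2) this]
        have "(\<lambda>k. t * (1 / (real (\<nu> k) * t) * (LBINT s:{0..real (\<nu> k) * t}. h (X s w)))) \<longlonglongrightarrow> t * (\<integral>y. h y \<partial>\<mu> j)"
          by (rule tendsto_mult_left)
        moreover have "\<forall>\<^sub>F k in sequentially. t * (1 / (real (\<nu> k) * t) * (LBINT s:{0..real (\<nu> k) * t}. h (X s w)))
            = (LBINT s:{0..t}. h (fast (\<nu> k) s w))"
          using filterlim_at_top[THEN iffD1, OF \<nu>, rule_format, of 1]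
        proof eventually_elim
          case (elim k)
          have "(LBINT s:{0..t}. h (fast (\<nu> k) s w)) = (LBINT s:{0..t}. h (X (real (\<nu> k) * s) w))"
            by (rule set_lebesgue_integral_cong) (auto simp: fast_def)
          also have "\<dots> = 1 / real (\<nu> k) * (LBINT s:{0..real (\<nu> k) * t}. h (X s w))"
            by (rule lborel_set_integral_scale) (use elim in simp)
          finally show ?case using tp by simp
        qed
        ultimately show ?thesis by (rule Lim_transform_eventually)
      qed
    qed
  qed
qed

end


section \<open>The accelerated chain\<close>

locale clocked_model = averaging_model D \<mu> F + clock N g
  for D :: "('i, 'e, 'w) accel_data" and \<mu> :: "'i \<Rightarrow> 'e measure" and F :: "'i \<Rightarrow> real^'d \<Rightarrow> 'e \<Rightarrow> real^'d"
    and N :: "real measure" and g :: "real \<Rightarrow> real" +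
  assumes clock_cdf: "\<And>t. 0 \<le> t \<Longrightarrow> clock_cdf D t = cdf N t"
begin

lemma cdf_measurable [measurable]: "cdf N \<in> borel_measurable borel"
  by (rule borel_measurable_continuous_onI[OF cdf_continuous])

lemma clock_cdf_ext_eq: "clock_cdf_ext D a = (if a = \<infinity> then 1 else cdf N (enn2real a))"
  by (simp add: clock_cdf_ext_def clock_cdf)

lemma clock_cdf_ext_mono: "a \<le> b \<Longrightarrow> clock_cdf_ext D a \<le> clock_cdf_ext D b"
proof -
  assume le: "a \<le> b"
  show ?thesis
  proof (cases "b = \<infinity>")
    case True then show ?thesis by (simp add: clock_cdf_ext_eq N.cdf_bounded_prob)
  next
    case False
    then have "b < \<infinity>" by (simp add: less_top)
    with le have "a < \<infinity>" by (rule le_less_trans)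
    with \<open>b < \<infinity>\<close> le show ?thesis by (auto simp: clock_cdf_ext_eq intro!: cdf_mono enn2real_mono)
  qed
qed

lemma clock_cdf_ext_measurable [measurable]: "clock_cdf_ext D \<in> borel_measurable borel"
  unfolding clock_cdf_ext_eq[abs_def] by measurable

abbreviation rate_clock :: "nat \<Rightarrow> 'w \<Rightarrow> real \<Rightarrow> real" where
  "rate_clock n w s \<equiv> rate D (fast n s w)"

lemma clock_integral_fast:
  "(\<integral>\<^sup>+s\<in>{0..t}. ennreal (rate D (X (real n * s) w)) \<partial>lborel) = (\<integral>\<^sup>+s. indicator {0..t} s * ennreal (rate_clock n w s) \<partial>lborel)"
  by (intro nn_integral_cong) (auto simp: indicator_def fast_def)

text \<open>
  The infimum may be restricted to rational times because the clock increases; as a countable infimum it is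
  measurable in path and uniform variable.
\<close>

lemma accel_hold_INF:
  "accel_hold D n w u = (INF q\<in>{q\<in>\<rat>. 0 \<le> q}. if u \<le> clock_cdf_ext D (\<integral>\<^sup>+s. indicator {0..q} s * ennreal (rate_clock n w s) \<partial>lborel)
     then ennreal q else \<infinity>)" (is "_ = ?R")
proof -
  define H where "H t = clock_cdf_ext D (\<integral>\<^sup>+s. indicator {0..t} s * ennreal (rate_clock n w s) \<partial>lborel)" for t :: real
  have H_mono: "H s \<le> H t" if "s \<le> t" for s t
    unfolding H_def by (rule clock_cdf_ext_mono, rule nn_integral_mono) (use that in \<open>auto simp: indicator_def\<close>)
  have hold: "accel_hold D n w u = Inf (ennreal ` {t. 0 \<le> t \<and> u \<le> H t})"
    unfolding accel_hold_def H_def clock_integral_fast ..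
  have "accel_hold D n w u \<le> ?R"
    unfolding hold by (rule INF_greatest) (auto simp: H_def[symmetric] intro: Inf_lower)
  moreover have "?R \<le> accel_hold D n w u"
    unfolding hold
  proof (rule Inf_greatest, elim imageE, clarify)
    fix t assume t: "0 \<le> t" "u \<le> H t"
    show "?R \<le> ennreal t"
    proof (rule ennreal_le_epsilon)
      fix e :: real assume "0 < e"
      then obtain q where q: "q \<in> \<rat>" "t < q" "q < t + e" using Rats_dense_in_real[of t "t + e"] by auto
      then have "u \<le> H q" "0 \<le> q" using t H_mono[of t q] by auto
      then have "?R \<le> ennreal q" unfolding H_def using q by (intro INF_lower2[of q]) auto
      also have "\<dots> \<le> ennreal (t + e)" using q by (intro ennreal_leI) simp
      also have "\<dots> = ennreal t + ennreal e" using t \<open>0 < e\<close> by simp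
      finally show "?R \<le> ennreal t + ennreal e" .
    qed
  qed
  ultimately show ?thesis by (rule antisym)
qed

lemma accel_hold_measurable: "(\<lambda>q. accel_hold D n (fst q) (snd q)) \<in> borel_measurable (\<Omega> \<Otimes>\<^sub>M borel)"
  unfolding accel_hold_INF
proof (rule borel_measurable_INF)
  show "countable {q\<in>\<rat>. (0::real) \<le> q}" by (rule countable_subset[OF _ countable_rat]) auto
  fix q :: real
  have "(\<lambda>(w, s). indicator {0..q} s * ennreal (rate_clock n w s)) \<in> borel_measurable (\<Omega> \<Otimes>\<^sub>M borel)"
    unfolding split_beta' by measurable
  then have "(\<lambda>(w, s). indicator {0..q} s * ennreal (rate_clock n w s)) \<in> borel_measurable (\<Omega> \<Otimes>\<^sub>M lborel)"
    by (subst measurable_cong_sets[OF sets_pair_measure_cong[OF refl sets_lborel] refl])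
  from lborel.borel_measurable_nn_integral[OF this]
  have [measurable]: "(\<lambda>w. \<integral>\<^sup>+s. indicator {0..q} s * ennreal (rate_clock n w s) \<partial>lborel) \<in> borel_measurable \<Omega>" .
  show "(\<lambda>p. if snd p \<le> clock_cdf_ext D (\<integral>\<^sup>+s. indicator {0..q} s * ennreal (rate_clock n (fst p) s) \<partial>lborel) then ennreal q else \<infinity>)
      \<in> borel_measurable (\<Omega> \<Otimes>\<^sub>M borel)"
    by measurable
qed

lemma accel_hold_compose [measurable (raw)]:
  "f \<in> M \<rightarrow>\<^sub>M \<Omega> \<Longrightarrow> h \<in> borel_measurable M \<Longrightarrow> (\<lambda>x. accel_hold D n (f x) (h x)) \<in> borel_measurable M"
proof -
  assume f: "f \<in> M \<rightarrow>\<^sub>M \<Omega>" and h: "h \<in> borel_measurable M"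
  from measurable_compose[OF measurable_Pair[OF f h] accel_hold_measurable] show ?thesis by simp
qed

lemma accel_hold_regular:
  assumes j: "j \<in> space \<I>" and w: "regular j w"
  shows "accel_hold D n w u = hold_time N (rate_clock n w) u"
proof -
  note rp = rate_path_fast[OF j w, of n]
  have "clock_cdf_ext D (\<integral>\<^sup>+s. indicator {0..t} s * ennreal (rate_clock n w s) \<partial>lborel) = cdf N (cumulated (rate_clock n w) t)" for t
    by (simp add: nn_integral_rate_path[OF rp] clock_cdf_ext_eq cumulated_nonneg[OF rp])
  then show ?thesis unfolding accel_hold_def hold_time_def clock_integral_fast by simp
qed

abbreviation "\<A> \<equiv> accel_step_space D"

lemma measurable_unif01 [measurable]: "(\<lambda>_. unif01) \<in> M \<rightarrow>\<^sub>M prob_algebra borel"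
  by (rule measurable_const) (simp add: space_prob_algebra prob_unif01 sets_unif01)

text \<open>
  The law of the last component of a step, given the path and the uniform variable.
\<close>

definition land :: "nat \<Rightarrow> 'e \<Rightarrow> 'w \<Rightarrow> real \<Rightarrow> 'e measure" where
  "land n y w u = (if accel_hold D n w u < \<infinity> then jump D (fast n (enn2real (accel_hold D n w u)) w) else return \<E> y)"

lemma land_measurable: "(\<lambda>q. land n (fst (fst q)) (snd (fst q)) (snd q)) \<in> (\<E> \<Otimes>\<^sub>M \<Omega>) \<Otimes>\<^sub>M borel \<rightarrow>\<^sub>M prob_algebra \<E>"
  unfolding land_def
proof (rule measurable_If)
  show "(\<lambda>q. jump D (fast n (enn2real (accel_hold D n (snd (fst q)) (snd q))) (snd (fst q))))
      \<in> (\<E> \<Otimes>\<^sub>M \<Omega>) \<Otimes>\<^sub>M borel \<rightarrow>\<^sub>M prob_algebra \<E>"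
    by (rule measurable_compose[OF _ jump_kernel]) measurable
  show "(\<lambda>q. return \<E> (fst (fst q))) \<in> (\<E> \<Otimes>\<^sub>M \<Omega>) \<Otimes>\<^sub>M borel \<rightarrow>\<^sub>M prob_algebra \<E>"
    by (rule measurable_compose[OF _ measurable_return_prob_space]) measurable
qed measurable

lemma accel_step_measurable':
  "(\<lambda>q. land n (fst (fst q)) (snd (fst q)) (snd q) \<bind> (\<lambda>y'. return \<A> (snd (fst q), snd q, y')))
    \<in> (\<E> \<Otimes>\<^sub>M \<Omega>) \<Otimes>\<^sub>M borel \<rightarrow>\<^sub>M prob_algebra \<A>" (is ?k2)
  "(\<lambda>q. unif01 \<bind> (\<lambda>u. land n (fst q) (snd q) u \<bind> (\<lambda>y'. return \<A> (snd q, u, y'))))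
    \<in> \<E> \<Otimes>\<^sub>M \<Omega> \<rightarrow>\<^sub>M prob_algebra \<A>" (is ?k1)
proof -
  have r: "(\<lambda>q. return \<A> (snd (fst (fst q)), snd (fst q), snd q)) \<in> ((\<E> \<Otimes>\<^sub>M \<Omega>) \<Otimes>\<^sub>M borel) \<Otimes>\<^sub>M \<E> \<rightarrow>\<^sub>M prob_algebra \<A>"
    unfolding accel_step_space_def by (rule measurable_compose[OF _ measurable_return_prob_space]) measurable
  show k2: ?k2 by (rule measurable_bind_prob_space2[OF land_measurable]) (use r in \<open>simp add: split_beta'\<close>)
  show ?k1 by (rule measurable_bind_prob_space2[OF measurable_unif01]) (use k2 in \<open>simp add: split_beta'\<close>)
qed

lemma accel_step_eq:
  "accel_step D n y = P y \<bind> (\<lambda>w. unif01 \<bind> (\<lambda>u. land n y w u \<bind> (\<lambda>y'. return \<A> (w, u, y'))))"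
  unfolding accel_step_def land_def by (simp add: fast_def cong: if_cong)

lemma accel_step_measurable [measurable]: "accel_step D n \<in> \<E> \<rightarrow>\<^sub>M prob_algebra \<A>"
proof -
  have k1: "(\<lambda>(y, w). unif01 \<bind> (\<lambda>u. land n y w u \<bind> (\<lambda>y'. return \<A> (w, u, y')))) \<in> \<E> \<Otimes>\<^sub>M \<Omega> \<rightarrow>\<^sub>M prob_algebra \<A>"
    using accel_step_measurable'(2)[of n] by (simp only: split_beta')
  have "accel_step D n = (\<lambda>y. P y \<bind> (\<lambda>w. unif01 \<bind> (\<lambda>u. land n y w u \<bind> (\<lambda>y'. return \<A> (w, u, y')))))"
    by (rule ext) (rule accel_step_eq)
  with measurable_bind_prob_space2[OF P_kernel k1] show ?thesis by (simp only:)
qed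

lemma accel_step_sections:
  assumes y: "y \<in> space \<E>"
  shows "(\<lambda>w. unif01 \<bind> (\<lambda>u. land n y w u \<bind> (\<lambda>y'. return \<A> (w, u, y')))) \<in> \<Omega> \<rightarrow>\<^sub>M prob_algebra \<A>"
    and "w \<in> space \<Omega> \<Longrightarrow> (\<lambda>u. land n y w u \<bind> (\<lambda>y'. return \<A> (w, u, y'))) \<in> borel \<rightarrow>\<^sub>M prob_algebra \<A>"
    and "w \<in> space \<Omega> \<Longrightarrow> (\<lambda>y'. return \<A> (w, u, y')) \<in> \<E> \<rightarrow>\<^sub>M prob_algebra \<A>"
    and "w \<in> space \<Omega> \<Longrightarrow> land n y w u \<in> space (prob_algebra \<E>)"
    and "P y \<in> space (prob_algebra \<Omega>)" "unif01 \<in> space (prob_algebra borel)"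
proof -
  show "(\<lambda>w. unif01 \<bind> (\<lambda>u. land n y w u \<bind> (\<lambda>y'. return \<A> (w, u, y')))) \<in> \<Omega> \<rightarrow>\<^sub>M prob_algebra \<A>"
    using measurable_compose[OF measurable_Pair1'[OF y] accel_step_measurable'(2)[of n]]
    by (simp only: fst_conv snd_conv)
  show "(\<lambda>u. land n y w u \<bind> (\<lambda>y'. return \<A> (w, u, y'))) \<in> borel \<rightarrow>\<^sub>M prob_algebra \<A>" if "w \<in> space \<Omega>"
  proof -
    have "(y, w) \<in> space (\<E> \<Otimes>\<^sub>M \<Omega>)" using y that by (simp add: space_pair_measure)
    from measurable_compose[OF measurable_Pair1'[OF this] accel_step_measurable'(1)[of n]] show ?thesis
      by (simp only: fst_conv snd_conv)
  qed
  show "(\<lambda>y'. return \<A> (w, u, y')) \<in> \<E> \<rightarrow>\<^sub>M prob_algebra \<A>" if "w \<in> space \<Omega>"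
    unfolding accel_step_space_def
    by (rule measurable_compose[OF _ measurable_return_prob_space]) (use that in measurable)
  show "land n y w u \<in> space (prob_algebra \<E>)" if "w \<in> space \<Omega>"
  proof -
    have "((y, w), u) \<in> space ((\<E> \<Otimes>\<^sub>M \<Omega>) \<Otimes>\<^sub>M borel)" using y that by (simp add: space_pair_measure)
    from measurable_space[OF land_measurable[of n] this] show ?thesis by (simp only: fst_conv snd_conv)
  qed
  show "P y \<in> space (prob_algebra \<Omega>)" using measurable_space[OF P_kernel y] .
  show "unif01 \<in> space (prob_algebra borel)" by (simp add: space_prob_algebra prob_unif01 sets_unif01)
qed

text \<open>
  The step is integrated in the order in which it is drawn: path, uniform variable, new position.
\<close>

lemma accel_step_integral:
  assumes y: "y \<in> space \<E>" and f: "f \<in> borel_measurable \<A>" and bnd: "\<And>a. \<bar>f a\<bar> \<le> (B::real)"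
  shows "(\<integral>a. f a \<partial>accel_step D n y) = (\<integral>w. (\<integral>u. (\<integral>y'. f (w, u, y') \<partial>land n y w u) \<partial>unif01) \<partial>P y)"
    and "(\<lambda>w. \<integral>u. (\<integral>y'. f (w, u, y') \<partial>land n y w u) \<partial>unif01) \<in> borel_measurable \<Omega>"
    and "w \<in> space \<Omega> \<Longrightarrow> \<bar>\<integral>u. (\<integral>y'. f (w, u, y') \<partial>land n y w u) \<partial>unif01\<bar> \<le> B"
proof -
  have inner: "(\<integral>a. f a \<partial>(unif01 \<bind> (\<lambda>u. land n y w u \<bind> (\<lambda>y'. return \<A> (w, u, y')))))
      = (\<integral>u. (\<integral>y'. f (w, u, y') \<partial>land n y w u) \<partial>unif01)" if w: "w \<in> space \<Omega>" for w
  proof -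
    have "(\<integral>a. f a \<partial>(unif01 \<bind> (\<lambda>u. land n y w u \<bind> (\<lambda>y'. return \<A> (w, u, y')))))
        = (\<integral>u. (\<integral>a. f a \<partial>(land n y w u \<bind> (\<lambda>y'. return \<A> (w, u, y')))) \<partial>unif01)"
      by (rule integral_bind_bounded(1)[OF accel_step_sections(6)[OF y] accel_step_sections(2)[OF y w] f bnd])
    also have "\<dots> = (\<integral>u. (\<integral>y'. f (w, u, y') \<partial>land n y w u) \<partial>unif01)"
    proof (rule Bochner_Integration.integral_cong[OF refl])
      fix u
      have "(\<integral>a. f a \<partial>(land n y w u \<bind> (\<lambda>y'. return \<A> (w, u, y'))))
          = (\<integral>y'. (\<integral>a. f a \<partial>return \<A> (w, u, y')) \<partial>land n y w u)"
        by (rule integral_bind_bounded(1)[OF accel_step_sections(4)[OF y w] accel_step_sections(3)[OF y w] f bnd])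
      also have "\<dots> = (\<integral>y'. f (w, u, y') \<partial>land n y w u)"
      proof (rule Bochner_Integration.integral_cong[OF refl])
        fix y' assume "y' \<in> space (land n y w u)"
        then have "y' \<in> space \<E>"
          using accel_step_sections(4)[OF y w, of n u] by (auto simp: space_prob_algebra dest: sets_eq_imp_space_eq)
        then have "(w, u, y') \<in> space \<A>" using w by (simp add: accel_step_space_def space_pair_measure)
        then show "(\<integral>a. f a \<partial>return \<A> (w, u, y')) = f (w, u, y')" by (rule integral_return[OF _ f])
      qed
      finally show "(\<integral>a. f a \<partial>(land n y w u \<bind> (\<lambda>y'. return \<A> (w, u, y')))) = (\<integral>y'. f (w, u, y') \<partial>land n y w u)" .
    qed
    finally show ?thesis .
  qed
  note ib = integral_bind_bounded[OF accel_step_sections(5)[OF y] accel_step_sections(1)[OF y] f bnd]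
  show "(\<integral>a. f a \<partial>accel_step D n y) = (\<integral>w. (\<integral>u. (\<integral>y'. f (w, u, y') \<partial>land n y w u) \<partial>unif01) \<partial>P y)"
    unfolding accel_step_eq ib(1)
    by (rule Bochner_Integration.integral_cong[OF refl inner]) (simp add: P_space[OF y])
  show "(\<lambda>w. \<integral>u. (\<integral>y'. f (w, u, y') \<partial>land n y w u) \<partial>unif01) \<in> borel_measurable \<Omega>"
    using ib(2)[of n] by (simp add: inner cong: measurable_cong)
  show "\<bar>\<integral>u. (\<integral>y'. f (w, u, y') \<partial>land n y w u) \<partial>unif01\<bar> \<le> B" if "w \<in> space \<Omega>"
    using ib(3)[of w n] that by (simp add: inner)
qed

lemma AE_accel_step:
  assumes y: "y \<in> space \<E>" and Q: "Measurable.pred \<A> Q"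
    and ae: "AE w in P y. AE u in unif01. \<forall>y'. Q (w, u, y')"
  shows "AE a in accel_step D n y. Q a"
proof -
  have m1: "(\<lambda>w. unif01 \<bind> (\<lambda>u. land n y w u \<bind> (\<lambda>y'. return \<A> (w, u, y')))) \<in> P y \<rightarrow>\<^sub>M subprob_algebra \<A>"
    using measurable_prob_algebraD[OF accel_step_sections(1)[OF y, of n]] by (simp add: measurable_cong_sets[OF P_sets[OF y] refl])
  show ?thesis
    unfolding accel_step_eq AE_bind[OF m1 Q]
    using ae AE_space
  proof eventually_elim
    case (elim w)
    then have w: "w \<in> space \<Omega>" by (simp add: P_space[OF y])
    have m2: "(\<lambda>u. land n y w u \<bind> (\<lambda>y'. return \<A> (w, u, y'))) \<in> unif01 \<rightarrow>\<^sub>M subprob_algebra \<A>"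
      using measurable_prob_algebraD[OF accel_step_sections(2)[OF y w, of n]] by (simp add: measurable_cong_sets[OF sets_unif01 refl])
    show ?case
      unfolding AE_bind[OF m2 Q]
      using elim(1)
    proof eventually_elim
      case (elim u)
      have lp: "sets (land n y w u) = sets \<E>" using accel_step_sections(4)[OF y w, of n u] by (simp add: space_prob_algebra)
      have m3: "(\<lambda>y'. return \<A> (w, u, y')) \<in> land n y w u \<rightarrow>\<^sub>M subprob_algebra \<A>"
        using measurable_prob_algebraD[OF accel_step_sections(3)[OF y w, of u]] by (simp add: measurable_cong_sets[OF lp refl])
      show ?case
        unfolding AE_bind[OF m3 Q]
      proof (rule AE_I2)
        fix y' assume "y' \<in> space (land n y w u)"
        then have "(w, u, y') \<in> space \<A>"
          using w sets_eq_imp_space_eq[OF lp] by (simp add: accel_step_space_def space_pair_measure)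
        then show "AE a in return \<A> (w, u, y'). Q a"
          using AE_return[OF _ Q] elim by blast
      qed
    qed
  qed
qed

text \<open>
  The path is required to have almost all its Lipschitz constants below one number, and not to stay in a given
  fibre: the former is a measurable condition on the path without any assumption on the paths.
\<close>

definition accel_good :: "nat \<Rightarrow> 'w \<times> real \<times> 'e \<Rightarrow> bool" where
  "accel_good n a \<longleftrightarrow> 0 < accel_hold D n (fst a) (fst (snd a)) \<and> (\<exists>L::nat. AE t in lborel. lip_bound (\<phi> (fast n t (fst a))) \<le> L)"

lemma accel_good_measurable: "Measurable.pred \<A> (accel_good n)"
proof -
  have [measurable]: "(\<lambda>x. lip_bound (\<phi> x)) \<in> \<E> \<rightarrow>\<^sub>M count_space UNIV" by (rule measurable_of_index) simp
  define c where "c L w = (\<integral>\<^sup>+t. (if lip_bound (\<phi> (fast n t w)) \<le> L then 0 else 1) \<partial>lborel)" for L w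
  have cm [measurable]: "c L \<in> borel_measurable \<Omega>" for L
  proof -
    have "(\<lambda>(w, t). (if lip_bound (\<phi> (fast n t w)) \<le> L then 0 else 1 :: ennreal)) \<in> borel_measurable (\<Omega> \<Otimes>\<^sub>M borel)"
      unfolding split_beta' by measurable
    then have "(\<lambda>(w, t). (if lip_bound (\<phi> (fast n t w)) \<le> L then 0 else 1 :: ennreal)) \<in> borel_measurable (\<Omega> \<Otimes>\<^sub>M lborel)"
      by (subst measurable_cong_sets[OF sets_pair_measure_cong[OF refl sets_lborel] refl])
    from lborel.borel_measurable_nn_integral[OF this] show ?thesis by (simp add: c_def[abs_def])
  qed
  have eq: "(AE t in lborel. lip_bound (\<phi> (fast n t w)) \<le> L) \<longleftrightarrow> c L w = 0" if w: "w \<in> space \<Omega>" for L w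
  proof -
    have [measurable]: "(\<lambda>t. fast n t w) \<in> borel \<rightarrow>\<^sub>M \<E>" by (rule path_measurable[OF w])
    have "c L w = 0 \<longleftrightarrow> (AE t in lborel. (if lip_bound (\<phi> (fast n t w)) \<le> L then 0 else 1) = (0::ennreal))"
      unfolding c_def by (rule nn_integral_0_iff_AE) measurable
    also have "\<dots> \<longleftrightarrow> (AE t in lborel. lip_bound (\<phi> (fast n t w)) \<le> L)" by (intro AE_cong) auto
    finally show ?thesis ..
  qed
  have "Measurable.pred \<A> (\<lambda>a. 0 < accel_hold D n (fst a) (fst (snd a)) \<and> (\<exists>L. c L (fst a) = 0))"
    unfolding accel_step_space_def by measurable
  then show ?thesis
    by (subst measurable_cong[of \<A> _ "\<lambda>a. 0 < accel_hold D n (fst a) (fst (snd a)) \<and> (\<exists>L. c L (fst a) = 0)"])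
      (auto simp: accel_good_def accel_step_space_def space_pair_measure eq)
qed

lemma regular_lip_bound: "j \<in> space \<I> \<Longrightarrow> regular j w \<Longrightarrow> AE t in lborel. lip_bound (\<phi> (fast n t w)) \<le> lip_bound j"
  using index_map_fibre[OF _ regular_fast] by (intro AE_I2) simp

lemma AE_accel_good:
  assumes y: "y \<in> space \<E>"
  shows "AE a in accel_step D n y. accel_good n a"
proof (rule AE_accel_step[OF y accel_good_measurable])
  note j = state_index[OF y]
  show "AE w in P y. AE u in unif01. \<forall>y'. accel_good n (w, u, y')"
    using AE_regular[OF j]
  proof eventually_elim
    case (elim w)
    from AE_hold_pos[OF rate_path_fast[OF j(1) elim, of n]] show ?case
    proof eventually_elim
      case (elim u)
      with \<open>regular (\<phi> y) w\<close> show ?case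
        using regular_lip_bound[OF j(1)] by (auto simp: accel_good_def accel_hold_regular[OF j(1)])
    qed
  qed
qed

lemma accel_pieced:
  "pieced_chain \<E> \<A> (accel_step D n) (\<lambda>(w, u, y). y) (\<lambda>s a. accel_hold D n (fst a) (fst (snd a)))
    (\<lambda>s a t v. speed v (fast n t (fst a))) (\<lambda>s. accel_good n)"
proof
  show "accel_step D n \<in> \<E> \<rightarrow>\<^sub>M prob_algebra \<A>" by (rule accel_step_measurable)
  show "(\<lambda>(w, u, y). y) \<in> \<A> \<rightarrow>\<^sub>M \<E>" unfolding accel_step_space_def by measurable
  show "(\<lambda>(s, a). accel_hold D n (fst a) (fst (snd a))) \<in> borel_measurable (\<E> \<Otimes>\<^sub>M \<A>)"
    unfolding accel_step_space_def split_beta' by measurable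
  show "(\<lambda>((p, t), v). speed v (fast n t (fst (snd p)))) \<in> ((\<E> \<Otimes>\<^sub>M \<A>) \<Otimes>\<^sub>M borel) \<Otimes>\<^sub>M borel \<rightarrow>\<^sub>M borel"
    unfolding accel_step_space_def split_beta' by measurable
  show "Measurable.pred (\<E> \<Otimes>\<^sub>M \<A>) (\<lambda>(s, a). accel_good n a)"
    using measurable_compose[OF measurable_snd accel_good_measurable[of n]] by (simp add: split_beta')
  show "AE a in accel_step D n s. accel_good n a" if "s \<in> space \<E>" for s by (rule AE_accel_good[OF that])
  show "0 < accel_hold D n (fst a) (fst (snd a))" if "accel_good n a" for a using that by (simp add: accel_good_def)
  show "\<exists>L. lipschitz_field L (\<lambda>t v. speed v (fast n t (fst a)))" if a: "a \<in> space \<A>" "accel_good n a" for a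
  proof -
    have "fst a \<in> space \<Omega>" using a(1) by (auto simp: accel_step_space_def space_pair_measure)
    moreover obtain L :: nat where "AE t in lborel. lip_bound (\<phi> (fast n t (fst a))) \<le> L" using a(2) by (auto simp: accel_good_def)
    ultimately show ?thesis using speed_field by blast
  qed
qed

end


section \<open>The limiting chain\<close>

lemma flow_time_measurable:
  assumes "lipschitz_field L d"
  shows "flow d z \<in> borel_measurable borel"
proof -
  have d: "(\<lambda>((x, s), v). d s v) \<in> (count_space {()} \<Otimes>\<^sub>M borel) \<Otimes>\<^sub>M borel \<rightarrow>\<^sub>M borel"
  proof -
    have "(\<lambda>q. (snd (fst q), snd q)) \<in> (count_space {()} \<Otimes>\<^sub>M borel) \<Otimes>\<^sub>M borel \<rightarrow>\<^sub>M borel \<Otimes>\<^sub>M borel" by measurable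
    from measurable_compose[OF this field_measurable[OF assms]] show ?thesis by (simp add: split_beta')
  qed
  have "(\<lambda>t. (((), z), t)) \<in> borel \<rightarrow>\<^sub>M (count_space {()} \<Otimes>\<^sub>M borel) \<Otimes>\<^sub>M borel" by simp
  from measurable_compose[OF this flow_measurable[OF d]] show ?thesis by simp
qed

lemma flow_before_0: "t < 0 \<Longrightarrow> flow d z t = z"
proof -
  assume "t < 0"
  then have "{0..t} = {}" by simp
  then have "picard d z m t = z" for m by (cases m) (simp_all add: set_lebesgue_integral_def)
  then show ?thesis by (simp add: flow_def)
qed

lemma flow_max_0: "lipschitz_field L d \<Longrightarrow> flow d z (max 0 t) = flow d z t"
  using flow_before_0[of t d z] flow_0[of L d z] by (auto simp: max_def)

lemma cumulated_max_0: "cumulated \<beta> (max 0 t) = cumulated \<beta> t"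
  using cumulated_neg[of t \<beta>] cumulated_neg[of 0 \<beta>] by (auto simp: max_def)

lemma cumulated_const: "0 \<le> t \<Longrightarrow> cumulated (\<lambda>_. m) t = m * t"
  by (simp add: cumulated_def set_lebesgue_integral_def)

lemma rate_path_const: "0 \<le> m \<Longrightarrow> rate_path (\<lambda>_. m)"
  using integrable_Icc_const[of 0 _ m] by (simp add: rate_path_def set_integrable_def)

context clocked_model
begin

abbreviation "mr \<equiv> mean_rate D \<mu>"

lemma mr_nonneg: "j \<in> space \<I> \<Longrightarrow> 0 \<le> mr j"
  unfolding mean_rate_def using rate_nonneg[OF fibre_state]
  by (intro integral_nonneg_AE AE_I2) (simp add: mu_space)

lemma mr_measurable [measurable]: "mr \<in> borel_measurable \<I>"
proof -
  have "(\<lambda>j. \<integral>x. rate D x \<partial>distr (\<mu> j) \<E> (\<lambda>v. v)) \<in> borel_measurable \<I>"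
    by (rule measurable_compose[OF measurable_prob_algebraD[OF mu_kernel] integral_measurable_subprob_algebra[OF rate_meas]])
  then show ?thesis
    unfolding mean_rate_def[abs_def] by (simp add: integral_mu_E cong: measurable_cong)
qed

text \<open>
  The limiting clock is the clock with constant rate. The two infima run over \<open>t > 0\<close> and \<open>t \<ge> 0\<close> respectively, and differ at
  most for \<open>u \<le> 0\<close>.
\<close>

lemma limit_hold_eq:
  assumes j: "j \<in> space \<I>" and u: "0 < u"
  shows "limit_hold D \<mu> j u = hold_time N (\<lambda>_. mr j) u"
proof -
  have "{t. 0 < t \<and> u \<le> clock_cdf D (t * mr j)} = {t. 0 \<le> t \<and> u \<le> cdf N (cumulated (\<lambda>_. mr j) t)}"
  proof (intro Collect_cong)
    fix t :: real
    show "0 < t \<and> u \<le> clock_cdf D (t * mr j) \<longleftrightarrow> 0 \<le> t \<and> u \<le> cdf N (cumulated (\<lambda>_. mr j) t)"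
    proof (cases "t = 0")
      case True
      then show ?thesis using u by (simp add: cumulated_neg cdf_0)
    next
      case False
      then show ?thesis using mr_nonneg[OF j] by (auto simp: cumulated_const clock_cdf mult.commute)
    qed
  qed
  then show ?thesis by (simp add: limit_hold_def hold_time_def)
qed

lemma limit_hold_measurable: "(\<lambda>(j, a). limit_hold D \<mu> j (fst a)) \<in> borel_measurable (\<I> \<Otimes>\<^sub>M (borel \<Otimes>\<^sub>M \<I>))"
proof -
  have eq: "limit_hold D \<mu> j u = (INF q\<in>{q\<in>\<rat>. 0 < q}. if u \<le> cdf N (q * mr j) then ennreal q else \<infinity>)" (is "_ = ?R")
    if j: "j \<in> space \<I>" for j u
  proof -
    have H: "clock_cdf D (t * mr j) = cdf N (t * mr j)" if "0 < t" for t
      using mr_nonneg[OF j] that by (intro clock_cdf) simp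
    have "limit_hold D \<mu> j u \<le> ?R"
      unfolding limit_hold_def by (rule INF_greatest) (auto simp: H intro!: Inf_lower)
    moreover have "?R \<le> limit_hold D \<mu> j u"
      unfolding limit_hold_def
    proof (rule Inf_greatest, elim imageE, clarify)
      fix t assume t: "0 < t" "u \<le> clock_cdf D (t * mr j)"
      show "?R \<le> ennreal t"
      proof (rule ennreal_le_epsilon)
        fix e :: real assume "0 < e"
        then obtain q where q: "q \<in> \<rat>" "t < q" "q < t + e" using Rats_dense_in_real[of t "t + e"] by auto
        then have "cdf N (t * mr j) \<le> cdf N (q * mr j)" using mr_nonneg[OF j] by (intro cdf_mono mult_right_mono) auto
        then have "u \<le> cdf N (q * mr j)" "0 < q" using t q H[of t] by auto
        then have "?R \<le> ennreal q" using q by (intro INF_lower2[of q]) auto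
        also have "\<dots> \<le> ennreal (t + e)" using q by (intro ennreal_leI) simp
        also have "\<dots> = ennreal t + ennreal e" using t \<open>0 < e\<close> by simp
        finally show "?R \<le> ennreal t + ennreal e" .
      qed
    qed
    ultimately show ?thesis by (rule antisym)
  qed
  have "(\<lambda>p. INF q\<in>{q\<in>\<rat>. 0 < q}. if fst (snd p) \<le> cdf N (q * mr (fst p)) then ennreal q else \<infinity>)
      \<in> borel_measurable (\<I> \<Otimes>\<^sub>M (borel \<Otimes>\<^sub>M \<I>))"
  proof (rule borel_measurable_INF)
    show "countable {q\<in>\<rat>. (0::real) < q}" by (rule countable_subset[OF _ countable_rat]) auto
  qed measurable
  then show ?thesis
    by (subst measurable_cong[where g = "\<lambda>p. INF q\<in>{q\<in>\<rat>. 0 < q}. if fst (snd p) \<le> cdf N (q * mr (fst p)) then ennreal q else \<infinity>"])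
      (auto simp: eq space_pair_measure)
qed

definition limit_next :: "'i \<Rightarrow> 'i measure" where
  "limit_next j = (if mr j > 0 then limit_kernel D \<mu> j else return \<I> j)"

abbreviation "\<mu>E j \<equiv> distr (\<mu> j) \<E> (\<lambda>v. v)"

text \<open>
  The law of the position just before a jump of the limiting process.
\<close>

definition rate_weighted :: "'i \<Rightarrow> 'e measure" where
  "rate_weighted j = density (\<mu>E j) (\<lambda>x. ennreal (rate D x / mr j))"

text \<open>
  The next index is drawn by choosing a position according to the weighted measure, applying the jump kernel and taking the
  index. This exhibits \<open>limit_kernel\<close>, which is built from a set function, as a genuine probability measure.
\<close>

lemma rate_weighted:
  assumes j: "j \<in> space \<I>" and m: "0 < mr j"
  shows "rate_weighted j \<in> space (prob_algebra \<E>)"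
    and "limit_kernel D \<mu> j = distr (rate_weighted j \<bind> jump D) \<I> \<phi>"
proof -
  have nn: "0 \<le> rate D x / mr j" if "x \<in> space \<E>" for x using rate_nonneg[OF that] m by simp
  have "emeasure (rate_weighted j) (space \<E>) = (\<integral>\<^sup>+x. ennreal (rate D x / mr j) \<partial>\<mu>E j)"
    unfolding rate_weighted_def by (subst emeasure_density) (auto intro!: nn_integral_cong)
  also have "\<dots> = (\<integral>\<^sup>+x. ennreal (rate D x / mr j) \<partial>\<mu> j)"
    by (rule nn_integral_distr[OF mu_E_measurable[OF j]]) simp
  also have "\<dots> = ennreal (\<integral>x. rate D x / mr j \<partial>\<mu> j)"
    by (rule nn_integral_eq_integral)
      (use integrable_rate[OF j] nn fibre_state[OF j] in \<open>auto simp: mu_space[OF j]\<close>)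
  also have "(\<integral>x. rate D x / mr j \<partial>\<mu> j) = 1" using m by (simp add: mean_rate_def)
  finally have "emeasure (rate_weighted j) (space \<E>) = 1" by simp
  then have "prob_space (rate_weighted j)" by (intro prob_spaceI) (simp add: rate_weighted_def)
  then show rw: "rate_weighted j \<in> space (prob_algebra \<E>)" by (simp add: space_prob_algebra rate_weighted_def)
  let ?B = "rate_weighted j \<bind> jump D"
  have sB: "sets ?B = sets \<E>" by (rule sets_bind'[OF rw jump_kernel])
  have \<phi>B: "\<phi> \<in> ?B \<rightarrow>\<^sub>M \<I>" by (simp add: measurable_cong_sets[OF sB refl])
  have eq: "(\<integral>\<^sup>+x. ennreal (rate D x / mr j) * emeasure (jump D x) (\<phi> -` J \<inter> space \<E>) \<partial>\<mu> j)
      = emeasure (distr ?B \<I> \<phi>) J" if J: "J \<in> sets \<I>" for J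
  proof -
    have S: "\<phi> -` J \<inter> space \<E> \<in> sets \<E>" by (rule measurable_sets[OF index_map_measurable J])
    have em: "(\<lambda>x. emeasure (jump D x) (\<phi> -` J \<inter> space \<E>)) \<in> borel_measurable \<E>"
      by (rule measurable_compose[OF measurable_prob_algebraD[OF jump_kernel] measurable_emeasure_subprob_algebra[OF S]])
    have "emeasure (distr ?B \<I> \<phi>) J = emeasure ?B (\<phi> -` J \<inter> space \<E>)"
      by (simp add: emeasure_distr[OF \<phi>B J] sets_eq_imp_space_eq[OF sB])
    also have "\<dots> = (\<integral>\<^sup>+x. emeasure (jump D x) (\<phi> -` J \<inter> space \<E>) \<partial>rate_weighted j)"
      by (rule emeasure_bind_prob_algebra[OF rw jump_kernel S])
    also have "\<dots> = (\<integral>\<^sup>+x. ennreal (rate D x / mr j) * emeasure (jump D x) (\<phi> -` J \<inter> space \<E>) \<partial>\<mu>E j)"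
      unfolding rate_weighted_def by (rule nn_integral_density) (use em in auto)
    also have "\<dots> = (\<integral>\<^sup>+x. ennreal (rate D x / mr j) * emeasure (jump D x) (\<phi> -` J \<inter> space \<E>) \<partial>\<mu> j)"
      by (rule nn_integral_distr[OF mu_E_measurable[OF j]]) (use em in measurable)
    finally show ?thesis ..
  qed
  have "limit_kernel D \<mu> j = measure_of (space \<I>) (sets \<I>) (emeasure (distr ?B \<I> \<phi>))"
    unfolding limit_kernel_def
    by (rule measure_of_eq[OF sets.space_closed]) (use eq sets.sigma_sets_eq[of \<I>] in auto)
  also have "\<dots> = distr ?B \<I> \<phi>"
    using measure_of_of_measure[of "distr ?B \<I> \<phi>"] by simp
  finally show "limit_kernel D \<mu> j = distr ?B \<I> \<phi>" .
qed

lemma limit_next_prob: "j \<in> space \<I> \<Longrightarrow> prob_space (limit_next j)"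
  and limit_next_sets: "j \<in> space \<I> \<Longrightarrow> sets (limit_next j) = sets \<I>"
proof -
  assume j: "j \<in> space \<I>"
  have "prob_space (limit_next j) \<and> sets (limit_next j) = sets \<I>"
  proof (cases "mr j > 0")
    case True
    note rw = rate_weighted[OF j True]
    have "\<phi> \<in> (rate_weighted j \<bind> jump D) \<rightarrow>\<^sub>M \<I>"
      by (simp add: measurable_cong_sets[OF sets_bind'[OF rw(1) jump_kernel] refl])
    with prob_space_bind'[OF rw(1) jump_kernel] show ?thesis
      using True by (auto simp: limit_next_def rw(2) intro: prob_space.prob_space_distr)
  next
    case False
    then show ?thesis by (simp add: limit_next_def prob_space_return[OF j])
  qed
  then show "prob_space (limit_next j)" "sets (limit_next j) = sets \<I>" by auto
qed

lemma limit_next_measurable [measurable]: "limit_next \<in> \<I> \<rightarrow>\<^sub>M prob_algebra \<I>"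
proof (rule measurable_prob_algebraI[OF limit_next_prob])
  show "limit_next \<in> \<I> \<rightarrow>\<^sub>M subprob_algebra \<I>"
  proof (rule measurable_subprob_algebra)
    show "subprob_space (limit_next j)" "sets (limit_next j) = sets \<I>" if "j \<in> space \<I>" for j
      using limit_next_prob[OF that] limit_next_sets[OF that] by (auto intro: prob_space_imp_subprob_space)
    fix J assume J: "J \<in> sets \<I>"
    have S: "\<phi> -` J \<inter> space \<E> \<in> sets \<E>" by (rule measurable_sets[OF index_map_measurable J])
    define e where "e x = emeasure (jump D x) (\<phi> -` J \<inter> space \<E>)" for x
    have [measurable]: "e \<in> borel_measurable \<E>"
      unfolding e_def by (rule measurable_compose[OF measurable_prob_algebraD[OF jump_kernel] measurable_emeasure_subprob_algebra[OF S]])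
    have "(\<lambda>(j, x). ennreal (rate D x / mr j) * e x) \<in> borel_measurable (\<I> \<Otimes>\<^sub>M \<E>)"
      unfolding split_beta' by measurable
    from nn_integral_measurable_subprob_algebra2[OF this measurable_prob_algebraD[OF mu_kernel]]
    have [measurable]: "(\<lambda>j. \<integral>\<^sup>+x. ennreal (rate D x / mr j) * e x \<partial>\<mu>E j) \<in> borel_measurable \<I>" .
    have "emeasure (limit_next j) J = (if mr j > 0 then \<integral>\<^sup>+x. ennreal (rate D x / mr j) * e x \<partial>\<mu>E j else indicator J j)"
      if j: "j \<in> space \<I>" for j
    proof (cases "mr j > 0")
      case True
      note rw = rate_weighted[OF j True]
      have sB: "sets (rate_weighted j \<bind> jump D) = sets \<E>" by (rule sets_bind'[OF rw(1) jump_kernel])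
      have \<phi>B: "\<phi> \<in> (rate_weighted j \<bind> jump D) \<rightarrow>\<^sub>M \<I>" by (simp add: measurable_cong_sets[OF sB refl])
      have "emeasure (limit_next j) J = emeasure (rate_weighted j \<bind> jump D) (\<phi> -` J \<inter> space \<E>)"
        using True by (simp add: limit_next_def rw(2) emeasure_distr[OF \<phi>B J] sets_eq_imp_space_eq[OF sB])
      also have "\<dots> = (\<integral>\<^sup>+x. e x \<partial>rate_weighted j)"
        unfolding e_def by (rule emeasure_bind_prob_algebra[OF rw(1) jump_kernel S])
      also have "\<dots> = (\<integral>\<^sup>+x. ennreal (rate D x / mr j) * e x \<partial>\<mu>E j)"
        unfolding rate_weighted_def by (rule nn_integral_density) auto
      finally show ?thesis using True by simp
    next
      case False
      then show ?thesis using J by (simp add: limit_next_def)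
    qed
    then show "(\<lambda>j. emeasure (limit_next j) J) \<in> borel_measurable \<I>"
      by (subst measurable_cong) (use J in auto)
  qed
qed

text \<open>
  The factor \<open>mr j\<close> cancels the normalisation; the right hand side is what appears in the limit of the accelerated jump
  operator.
\<close>

lemma limit_next_integral:
  assumes j: "j \<in> space \<I>" and m: "0 < mr j" and G: "G \<in> borel_measurable \<I>" and bnd: "\<And>i. i \<in> space \<I> \<Longrightarrow> \<bar>G i\<bar> \<le> (B::real)"
  shows "mr j * (\<integral>i. G i \<partial>limit_next j) = (\<integral>x. rate D x * (\<integral>y. G (\<phi> y) \<partial>jump D x) \<partial>\<mu> j)"
proof -
  note rw = rate_weighted[OF j m]
  have sB: "sets (rate_weighted j \<bind> jump D) = sets \<E>" by (rule sets_bind'[OF rw(1) jump_kernel])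
  have \<phi>B: "\<phi> \<in> (rate_weighted j \<bind> jump D) \<rightarrow>\<^sub>M \<I>" by (simp add: measurable_cong_sets[OF sB refl])
  define G' where "G' y = max (- B) (min B (G (\<phi> y)))" for y
  have B: "0 \<le> B" using bnd[OF j] by linarith
  have G'm [measurable]: "G' \<in> borel_measurable \<E>"
    using measurable_compose[OF index_map_measurable G] unfolding G'_def by measurable
  have G'b: "\<bar>G' y\<bar> \<le> B" for y using B by (auto simp: G'_def)
  have eq: "G' y = G (\<phi> y)" if "y \<in> space \<E>" for y
    using bnd[OF state_index(1)[OF that]] by (auto simp: G'_def)
  have Js: "space (jump D x) = space \<E>" if "x \<in> space \<E>" for x
    using measurable_space[OF jump_kernel that] by (auto simp: space_prob_algebra dest: sets_eq_imp_space_eq)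
  have J: "(\<integral>y. G (\<phi> y) \<partial>jump D x) = (\<integral>y. G' y \<partial>jump D x)" if "x \<in> space \<E>" for x
    using eq by (intro Bochner_Integration.integral_cong) (auto simp: Js[OF that])
  note ib = integral_bind_bounded[OF rw(1) jump_kernel G'm G'b]
  note [measurable] = ib(2)
  have "(\<integral>i. G i \<partial>limit_next j) = (\<integral>y. G (\<phi> y) \<partial>(rate_weighted j \<bind> jump D))"
    using m by (simp add: limit_next_def rw(2) integral_distr[OF \<phi>B G])
  also have "\<dots> = (\<integral>y. G' y \<partial>(rate_weighted j \<bind> jump D))"
    by (intro Bochner_Integration.integral_cong) (auto simp: eq sets_eq_imp_space_eq[OF sB])
  also have "\<dots> = (\<integral>x. (\<integral>y. G' y \<partial>jump D x) \<partial>rate_weighted j)" by (rule ib(1))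
  also have "\<dots> = (\<integral>x. (rate D x / mr j) *\<^sub>R (\<integral>y. G' y \<partial>jump D x) \<partial>\<mu>E j)"
    unfolding rate_weighted_def by (rule integral_density) (use m rate_nonneg in auto)
  also have "\<dots> = (\<integral>x. (rate D x / mr j) *\<^sub>R (\<integral>y. G' y \<partial>jump D x) \<partial>\<mu> j)"
    by (rule integral_mu_E[OF j]) measurable
  also have "\<dots> = (\<integral>x. 1 / mr j * (rate D x * (\<integral>y. G (\<phi> y) \<partial>jump D x)) \<partial>\<mu> j)"
    by (intro Bochner_Integration.integral_cong) (auto simp: J fibre_state[OF j] mu_space[OF j])
  finally show ?thesis using m by simp
qed

abbreviation "\<B> \<equiv> (borel :: real measure) \<Otimes>\<^sub>M \<I>"

lemma limit_step_eq: "limit_step D \<mu> j = unif01 \<Otimes>\<^sub>M limit_next j"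
  by (simp add: limit_step_def limit_next_def)

lemma limit_step_measurable: "limit_step D \<mu> \<in> \<I> \<rightarrow>\<^sub>M prob_algebra \<B>"
  unfolding limit_step_eq[abs_def] by (rule measurable_pair_prob[OF measurable_unif01 limit_next_measurable])

lemma limit_step_integral:
  assumes j: "j \<in> space \<I>" and f: "f \<in> borel_measurable \<B>" and bnd: "\<And>a. a \<in> space \<B> \<Longrightarrow> \<bar>f a\<bar> \<le> (B::real)"
  shows "(\<integral>a. f a \<partial>limit_step D \<mu> j) = (\<integral>u. (\<integral>i. f (u, i) \<partial>limit_next j) \<partial>unif01)"
proof -
  interpret U: prob_space unif01 by (rule prob_unif01)
  interpret n: prob_space "limit_next j" by (rule limit_next_prob[OF j])
  interpret pair_prob_space unif01 "limit_next j" ..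
  have s: "sets (unif01 \<Otimes>\<^sub>M limit_next j) = sets \<B>"
    by (rule sets_pair_measure_cong[OF sets_unif01 limit_next_sets[OF j]])
  have "integrable (unif01 \<Otimes>\<^sub>M limit_next j) f"
    by (rule integrable_const_bound[where B = B, OF AE_I2])
      (use f bnd in \<open>auto simp: measurable_cong_sets[OF s refl] sets_eq_imp_space_eq[OF s]\<close>)
  from integral_fst'[OF this] show ?thesis by (simp add: limit_step_eq)
qed

lemma AE_limit_hold_pos:
  assumes j: "j \<in> space \<I>"
  shows "AE a in limit_step D \<mu> j. 0 < limit_hold D \<mu> j (fst a)"
proof -
  interpret U: prob_space unif01 by (rule prob_unif01)
  interpret n: prob_space "limit_next j" by (rule limit_next_prob[OF j])
  interpret pair_prob_space unif01 "limit_next j" ..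
  have "AE u in unif01. 0 < hold_time N (\<lambda>_. mr j) u" by (rule AE_hold_pos[OF rate_path_const[OF mr_nonneg[OF j]]])
  moreover note AE_unif01_pos
  ultimately have "AE u in unif01. 0 < limit_hold D \<mu> j u"
    by eventually_elim (simp add: limit_hold_eq[OF j])
  moreover have "distr (unif01 \<Otimes>\<^sub>M limit_next j) unif01 fst = unif01" by (rule n.distr_pair_fst)
  ultimately have "AE u in distr (unif01 \<Otimes>\<^sub>M limit_next j) unif01 fst. 0 < limit_hold D \<mu> j u" by (simp only:)
  then show ?thesis unfolding limit_step_eq by (rule AE_distrD[rotated]) simp
qed

lemma limit_pieced:
  "pieced_chain \<I> \<B> (limit_step D \<mu>) snd (\<lambda>s a. limit_hold D \<mu> s (fst a))
    (\<lambda>s a t v. avg_drift \<mu> F s v) (\<lambda>s a. 0 < limit_hold D \<mu> s (fst a))"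
proof
  show "limit_step D \<mu> \<in> \<I> \<rightarrow>\<^sub>M prob_algebra \<B>" by (rule limit_step_measurable)
  show "snd \<in> \<B> \<rightarrow>\<^sub>M \<I>" by simp
  show h: "(\<lambda>(s, a). limit_hold D \<mu> s (fst a)) \<in> borel_measurable (\<I> \<Otimes>\<^sub>M \<B>)" by (rule limit_hold_measurable)
  show "Measurable.pred (\<I> \<Otimes>\<^sub>M \<B>) (\<lambda>(s, a). 0 < limit_hold D \<mu> s (fst a))"
    using h unfolding split_beta' by measurable
  show "(\<lambda>((p, t), v). avg_drift \<mu> F (fst p) v) \<in> ((\<I> \<Otimes>\<^sub>M \<B>) \<Otimes>\<^sub>M borel) \<Otimes>\<^sub>M borel \<rightarrow>\<^sub>M borel"
  proof -
    have "(\<lambda>q. (snd q, fst (fst (fst q)))) \<in> ((\<I> \<Otimes>\<^sub>M \<B>) \<Otimes>\<^sub>M borel) \<Otimes>\<^sub>M borel \<rightarrow>\<^sub>M borel \<Otimes>\<^sub>M \<I>" by measurable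
    from measurable_compose[OF this avg_drift_measurable] show ?thesis by (simp add: split_beta')
  qed
  show "AE a in limit_step D \<mu> s. 0 < limit_hold D \<mu> s (fst a)" if "s \<in> space \<I>" for s
    by (rule AE_limit_hold_pos[OF that])
  show "\<exists>L. lipschitz_field L (\<lambda>t v. avg_drift \<mu> F s v)" if "s \<in> space \<I>" for s
    using avg_drift_field[OF that] by (auto simp: avg_drift_speed[OF that])
qed simp

sublocale acc: pieced_chain \<E> \<A> "accel_step D n" "\<lambda>(w, u, y). y" "\<lambda>s a. accel_hold D n (fst a) (fst (snd a))"
    "\<lambda>s a t v. speed v (fast n t (fst a))" "\<lambda>s. accel_good n" for n
  by (rule accel_pieced)

sublocale lim: pieced_chain \<I> \<B> "limit_step D \<mu>" snd "\<lambda>s a. limit_hold D \<mu> s (fst a)"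
    "\<lambda>s a t v. avg_drift \<mu> F s v" "\<lambda>s a. 0 < limit_hold D \<mu> s (fst a)"
  by (rule limit_pieced)

end


section \<open>The operators as averages over paths\<close>

lemma flow_tendsto:
  assumes d: "lipschitz_field L d" and z: "zs \<longlonglongrightarrow> z" and t: "ts \<longlonglongrightarrow> t"
  shows "(\<lambda>k. flow d (zs k) (ts k)) \<longlonglongrightarrow> flow d z t"
proof -
  define T where "T = max 0 t + 1"
  have mt: "(\<lambda>k. max 0 (ts k)) \<longlonglongrightarrow> max 0 t" by (intro tendsto_intros t)
  have ev: "\<forall>\<^sub>F k in sequentially. max 0 (ts k) < T"
    by (rule order_tendstoD(2)[OF mt]) (simp add: T_def)
  have "(\<lambda>k. flow d (zs k) (max 0 (ts k)) - flow d z (max 0 (ts k))) \<longlonglongrightarrow> 0"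
  proof (rule Lim_null_comparison)
    show "\<forall>\<^sub>F k in sequentially. norm (flow d (zs k) (max 0 (ts k)) - flow d z (max 0 (ts k))) \<le> 2 * norm (zs k - z) * exp (2 * L * T)"
      using ev
    proof eventually_elim
      case (elim k)
      have "norm (flow d (zs k) (max 0 (ts k)) - flow d z (max 0 (ts k))) \<le> 2 * norm (zs k - z) * exp (2 * L * max 0 (ts k))"
        by (rule flow_initial_stability[OF d]) simp
      also have "\<dots> \<le> 2 * norm (zs k - z) * exp (2 * L * T)"
        using elim field_L_nonneg[OF d] by (intro mult_left_mono) (auto intro!: mult_left_mono)
      finally show ?case .
    qed
    have "(\<lambda>k. zs k - z) \<longlonglongrightarrow> 0" using z by (rule LIM_zero)
    then have "(\<lambda>k. 2 * norm (zs k - z) * exp (2 * L * T)) \<longlonglongrightarrow> 2 * 0 * exp (2 * L * T)"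
      by (intro tendsto_intros tendsto_norm_zero)
    then show "(\<lambda>k. 2 * norm (zs k - z) * exp (2 * L * T)) \<longlonglongrightarrow> 0" by simp
  qed
  moreover have "(\<lambda>k. flow d z (max 0 (ts k))) \<longlonglongrightarrow> flow d z (max 0 t)"
    by (rule continuous_on_tendsto_compose[OF flow_continuous[OF d, of T] mt])
      (use ev in \<open>auto simp: T_def elim!: eventually_mono\<close>)
  ultimately have "(\<lambda>k. (flow d (zs k) (max 0 (ts k)) - flow d z (max 0 (ts k))) + flow d z (max 0 (ts k))) \<longlonglongrightarrow> 0 + flow d z (max 0 t)"
    by (rule tendsto_add)
  then show ?thesis by (simp add: flow_max_0[OF d])
qed

lemma uniform_tendsto_moving:
  fixes f :: "nat \<Rightarrow> real \<Rightarrow> 'v::real_normed_vector"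
  assumes u: "\<And>e. 0 < e \<Longrightarrow> \<forall>\<^sub>F k in sequentially. \<forall>t\<in>{0..T}. norm (f k t - h t) < e"
    and h: "continuous_on {0..T} h" and t: "ts \<longlonglongrightarrow> t" "t \<in> {0..T}" "\<forall>\<^sub>F k in sequentially. ts k \<in> {0..T}"
  shows "(\<lambda>k. f k (ts k)) \<longlonglongrightarrow> h t"
proof -
  have 1: "(\<lambda>k. h (ts k)) \<longlonglongrightarrow> h t" by (rule continuous_on_tendsto_compose[OF h t])
  have "(\<lambda>k. f k (ts k) - h (ts k)) \<longlonglongrightarrow> 0"
  proof (rule tendstoI)
    fix e :: real assume "0 < e"
    from u[OF this] t(3) show "\<forall>\<^sub>F k in sequentially. dist (f k (ts k) - h (ts k)) 0 < e"
      by eventually_elim (simp add: dist_norm)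
  qed
  from tendsto_add[OF this 1] show ?thesis by simp
qed

context clocked_model
begin

text \<open>
  The mean of a payoff given the path of the fast process.
\<close>

definition inner_mean :: "nat \<Rightarrow> ('w \<times> real \<times> 'e \<Rightarrow> real) \<Rightarrow> 'e \<Rightarrow> 'w \<Rightarrow> real" where
  "inner_mean n \<psi> y w = (\<integral>u. (\<integral>y'. \<psi> (w, u, y') \<partial>land n y w u) \<partial>unif01)"

lemma land_prob: "y \<in> space \<E> \<Longrightarrow> w \<in> space \<Omega> \<Longrightarrow> prob_space (land n y w u)"
  and land_space: "y \<in> space \<E> \<Longrightarrow> w \<in> space \<Omega> \<Longrightarrow> space (land n y w u) = space \<E>"
  using accel_step_sections(4)[of y w n u] by (auto simp: space_prob_algebra dest: sets_eq_imp_space_eq)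

text \<open>
  The operators are means over paths of \<open>inner_mean\<close>. Payoffs are bounded only on the space, whence the truncation.
\<close>

lemma accel_mean:
  assumes y: "y \<in> space \<E>" and f: "f \<in> borel_measurable \<A>" and bnd: "\<And>a. a \<in> space \<A> \<Longrightarrow> \<bar>f a\<bar> \<le> (B::real)" and B: "0 \<le> B"
  shows "(\<integral>a. f a \<partial>accel_step D n y) = (\<integral>w. inner_mean n f y w \<partial>P y)"
    and "inner_mean n f y \<in> borel_measurable (P y)"
    and "w \<in> space \<Omega> \<Longrightarrow> \<bar>inner_mean n f y w\<bar> \<le> B"
proof -
  define f' where "f' a = max (- B) (min B (f a))" for a
  have f': "f' \<in> borel_measurable \<A>" "\<And>a. \<bar>f' a\<bar> \<le> B" using f B by (auto simp: f'_def[abs_def])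
  have eq: "f' a = f a" if "a \<in> space \<A>" for a using bnd[OF that] by (auto simp: f'_def)
  have inner: "inner_mean n f y w = (\<integral>u. (\<integral>y'. f' (w, u, y') \<partial>land n y w u) \<partial>unif01)" if w: "w \<in> space \<Omega>" for w
    unfolding inner_mean_def
    by (intro Bochner_Integration.integral_cong refl eq[symmetric])
      (use w land_space[OF y w] in \<open>simp add: accel_step_space_def space_pair_measure\<close>)
  note a = accel_step_integral[OF y f', where n = n]
  have "(\<integral>a. f a \<partial>accel_step D n y) = (\<integral>a. f' a \<partial>accel_step D n y)"
    by (intro Bochner_Integration.integral_cong refl eq[symmetric]) (simp add: acc.K_space[OF y])
  also have "\<dots> = (\<integral>w. inner_mean n f y w \<partial>P y)"
    unfolding a(1) by (intro Bochner_Integration.integral_cong refl inner[symmetric]) (simp add: P_space[OF y])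
  finally show "(\<integral>a. f a \<partial>accel_step D n y) = (\<integral>w. inner_mean n f y w \<partial>P y)" .
  show "inner_mean n f y \<in> borel_measurable (P y)"
    unfolding measurable_cong_sets[OF P_sets[OF y] refl] using a(2) measurable_cong[of \<Omega> "inner_mean n f y", OF inner] by simp
  show "\<bar>inner_mean n f y w\<bar> \<le> B" if "w \<in> space \<Omega>" using a(3)[OF that] by (simp add: inner[OF that])
qed

abbreviation "drive n w \<equiv> (\<lambda>t v. speed v (fast n t w))"
abbreviation "elapsed n w \<equiv> cumulated (rate_clock n w)"

lemma drive_field: "j \<in> space \<I> \<Longrightarrow> regular j w \<Longrightarrow> lipschitz_field (real (lip_bound j)) (drive n w)"
  by (rule speed_field[OF _ regular_lip_bound]) (auto simp: regular_def)

lemma stop_payoff_section: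
  "\<phi>' \<in> borel_measurable borel \<Longrightarrow> y \<in> space \<E> \<Longrightarrow> acc.stop_payoff n \<phi>' p y \<in> borel_measurable \<A>"
proof -
  assume \<phi>': "\<phi>' \<in> borel_measurable borel" and y: "y \<in> space \<E>"
  have "(p, y) \<in> space (lim.phase \<Otimes>\<^sub>M \<E>)" using y by (simp add: space_pair_measure)
  from measurable_compose[OF measurable_Pair1'[OF this] acc.stop_payoff_measurable[OF \<phi>', of n]] show ?thesis by simp
qed

lemma jump_payoff_section:
  "acc.payoff_fun B f \<Longrightarrow> y \<in> space \<E> \<Longrightarrow> acc.jump_payoff n f p y \<in> borel_measurable \<A>"
proof -
  assume f: "acc.payoff_fun B f" and y: "y \<in> space \<E>"
  have fm: "(\<lambda>(p, s). f p s) \<in> borel_measurable (lim.phase \<Otimes>\<^sub>M \<E>)" using f by (simp add: acc.payoff_fun_def)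
  have "(p, y) \<in> space (lim.phase \<Otimes>\<^sub>M \<E>)" using y by (simp add: space_pair_measure)
  from measurable_compose[OF measurable_Pair1'[OF this] acc.jump_payoff_measurable[OF fm, of n]] show ?thesis by simp
qed

lemma jump_payoff_bound:
  assumes f: "acc.payoff_fun B f" and a: "a \<in> space \<A>"
  shows "\<bar>acc.jump_payoff n f p y a\<bar> \<le> B"
proof -
  obtain w u x where [simp]: "a = (w, u, x)" by (cases a)
  have "x \<in> space \<E>" using a by (simp add: accel_step_space_def space_pair_measure)
  then show ?thesis
    using acc.payoff_fun_bound[OF f] f by (simp add: acc.jump_payoff_def acc.payoff_fun_def)
qed

definition jump_avg :: "((real^'d) \<times> real \<Rightarrow> 'e \<Rightarrow> real) \<Rightarrow> (real^'d) \<times> real \<Rightarrow> 'e \<Rightarrow> real" where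
  "jump_avg f p x = (\<integral>y. f p y \<partial>jump D x)"

lemma jump_avg:
  assumes f: "acc.payoff_fun B f"
  shows "(\<lambda>(p, x). jump_avg f p x) \<in> borel_measurable (lim.phase \<Otimes>\<^sub>M \<E>)"
    and "x \<in> space \<E> \<Longrightarrow> \<bar>jump_avg f p x\<bar> \<le> B" and "x \<in> space \<E> \<Longrightarrow> integrable (jump D x) (f p)"
proof -
  interpret jmp: markov_chain \<E> \<E> "jump D" "\<lambda>x. x" by unfold_locales auto
  have fm: "(\<lambda>(p, s). f p s) \<in> borel_measurable (lim.phase \<Otimes>\<^sub>M \<E>)" and B: "0 \<le> B"
    using f by (auto simp: acc.payoff_fun_def)
  have m: "(\<lambda>(x, a). f (fst x) a) \<in> borel_measurable ((lim.phase \<Otimes>\<^sub>M \<E>) \<Otimes>\<^sub>M \<E>)"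
  proof -
    have "(\<lambda>q. (fst (fst q), snd q)) \<in> (lim.phase \<Otimes>\<^sub>M \<E>) \<Otimes>\<^sub>M \<E> \<rightarrow>\<^sub>M lim.phase \<Otimes>\<^sub>M \<E>" by measurable
    from measurable_compose[OF this fm] show ?thesis by (simp add: split_beta')
  qed
  have b: "\<bar>f (fst q) a\<bar> \<le> B" if "q \<in> space (lim.phase \<Otimes>\<^sub>M \<E>)" "a \<in> space \<E>" for q a
    using acc.payoff_fun_bound[OF f that(2)] .
  note k = jmp.kernel_integral_on[OF m measurable_snd b B]
  show "(\<lambda>(p, x). jump_avg f p x) \<in> borel_measurable (lim.phase \<Otimes>\<^sub>M \<E>)"
    using k(1) by (simp add: jump_avg_def split_beta')
  show "\<bar>jump_avg f p x\<bar> \<le> B" if "x \<in> space \<E>"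
    using k(2)[of "(p, x)"] that by (simp add: jump_avg_def space_pair_measure)
  show "integrable (jump D x) (f p)" if "x \<in> space \<E>"
    using k(3)[of "(p, x)"] that by (simp add: space_pair_measure)
qed

lemma jump_space: "x \<in> space \<E> \<Longrightarrow> space (jump D x) = space \<E>" and jump_prob: "x \<in> space \<E> \<Longrightarrow> prob_space (jump D x)"
  using measurable_space[OF jump_kernel] by (auto simp: space_prob_algebra dest: sets_eq_imp_space_eq)

text \<open>
  Convergence at every state is all that the payoffs provide; dominated convergence under the jump kernel keeps it.
\<close>

lemma jump_avg_tendsto:
  assumes f: "\<And>k. acc.payoff_fun B (f k)" and f': "acc.payoff_fun B f'" and x: "x \<in> space \<E>"
    and lim: "\<And>y. y \<in> space \<E> \<Longrightarrow> (\<lambda>k. f k (p k) y) \<longlonglongrightarrow> f' p' y"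
  shows "(\<lambda>k. jump_avg (f k) (p k) x) \<longlonglongrightarrow> jump_avg f' p' x"
  unfolding jump_avg_def
proof (rule integral_dominated_convergence[where w = "\<lambda>_. B"])
  interpret prob_space "jump D x" by (rule jump_prob[OF x])
  show "integrable (jump D x) (\<lambda>_. B)" by simp
  show "f' p' \<in> borel_measurable (jump D x)" "f k (p k) \<in> borel_measurable (jump D x)" for k
    using jump_avg(3)[OF f' x] jump_avg(3)[OF f x] by (auto intro: borel_measurable_integrable)
  show "AE y in jump D x. (\<lambda>k. f k (p k) y) \<longlonglongrightarrow> f' p' y"
    by (rule AE_I2) (simp add: lim jump_space[OF x])
  show "AE y in jump D x. norm (f k (p k) y) \<le> B" for k
    by (rule AE_I2) (simp add: acc.payoff_fun_bound[OF f] jump_space[OF x])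
qed

lemma lifted_payoff:
  assumes G: "lim.payoff_fun B G"
  shows "acc.payoff_fun B (\<lambda>p y. G p (\<phi> y))"
proof -
  have Gm: "(\<lambda>(p, s). G p s) \<in> borel_measurable (lim.phase \<Otimes>\<^sub>M \<I>)" using G by (simp add: lim.payoff_fun_def)
  have "(\<lambda>q. (fst q, \<phi> (snd q))) \<in> lim.phase \<Otimes>\<^sub>M \<E> \<rightarrow>\<^sub>M lim.phase \<Otimes>\<^sub>M \<I>" by measurable
  from measurable_compose[OF this Gm] G show ?thesis
    by (auto simp: acc.payoff_fun_def lim.payoff_fun_def split_beta' state_index(1))
qed

context
  fixes j :: 'i and w :: 'w
  assumes j: "j \<in> space \<I>" and w: "regular j w"
begin

lemma regular_states: "w \<in> space \<Omega>" "fast n s w \<in> space \<E>"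
  using w fibre_state[OF j regular_fast[OF w]] by (auto simp: regular_def)

text \<open>
  Given the path, the event that the piece lasts depends only on the uniform variable.
\<close>

lemma inner_mean_stop:
  assumes y: "y \<in> space (fibre D j)"
  shows "inner_mean n (acc.stop_payoff n \<phi>' p y) y w
    = \<phi>' (flow (drive n w) (fst p) (snd p)) * (1 - cdf N (elapsed n w (snd p)))"
proof -
  have yE: "y \<in> space \<E>" by (rule fibre_state[OF j y])
  have "inner_mean n (acc.stop_payoff n \<phi>' p y) y w
      = (\<integral>u. (if ennreal (snd p) \<le> hold_time N (rate_clock n w) u then \<phi>' (flow (drive n w) (fst p) (snd p)) else 0) \<partial>unif01)"
    unfolding inner_mean_def
  proof (intro Bochner_Integration.integral_cong refl)
    fix u
    interpret prob_space "land n y w u" by (rule land_prob[OF yE regular_states(1)])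
    show "(\<integral>y'. acc.stop_payoff n \<phi>' p y (w, u, y') \<partial>land n y w u)
      = (if ennreal (snd p) \<le> hold_time N (rate_clock n w) u then \<phi>' (flow (drive n w) (fst p) (snd p)) else 0)"
      by (simp add: acc.stop_payoff_def accel_hold_regular[OF j w] prob_space)
  qed
  also have "\<dots> = \<phi>' (flow (drive n w) (fst p) (snd p)) * (1 - cdf N (elapsed n w (snd p)))"
    by (rule expectation_before_hold[OF rate_path_fast[OF j w]])
  finally show ?thesis .
qed

lemma jump_avg_path_measurable:
  assumes f: "acc.payoff_fun B f"
  shows "(\<lambda>t. jump_avg f (flow (drive n w) z t, r - t) (fast n t w)) \<in> borel_measurable borel"
proof -
  note [measurable] = flow_time_measurable[OF drive_field[OF j w]] path_measurable[OF regular_states(1)]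
  have "(\<lambda>t. ((flow (drive n w) z t, r - t), fast n t w)) \<in> borel \<rightarrow>\<^sub>M lim.phase \<Otimes>\<^sub>M \<E>" by measurable
  from measurable_compose[OF this jump_avg(1)[OF f]] show ?thesis by simp
qed

text \<open>
  Given the path, the holding time has density \<open>g (A t) b t\<close>, and the new position depends on the holding time through the
  position reached.
\<close>

lemma inner_mean_jump:
  assumes y: "y \<in> space (fibre D j)" and f: "acc.payoff_fun B f"
  shows "inner_mean n (acc.jump_payoff n f p y) y w
    = (LBINT t:{0..snd p}. g (elapsed n w t) * rate_clock n w t *
        jump_avg f (flow (drive n w) (fst p) t, snd p - t) (fast n t w))"
proof -
  have yE: "y \<in> space \<E>" by (rule fibre_state[OF j y])
  let ?\<Psi> = "\<lambda>t. jump_avg f (flow (drive n w) (fst p) t, snd p - t) (fast n t w)"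
  have "inner_mean n (acc.jump_payoff n f p y) y w
      = (\<integral>u. (if hold_time N (rate_clock n w) u < ennreal (snd p) then ?\<Psi> (enn2real (hold_time N (rate_clock n w) u)) else 0) \<partial>unif01)"
    unfolding inner_mean_def
  proof (intro Bochner_Integration.integral_cong refl)
    fix u
    let ?h = "hold_time N (rate_clock n w) u"
    show "(\<integral>y'. acc.jump_payoff n f p y (w, u, y') \<partial>land n y w u) = (if ?h < ennreal (snd p) then ?\<Psi> (enn2real ?h) else 0)"
    proof (cases "?h < ennreal (snd p)")
      case True
      then have "?h < \<infinity>" by (auto intro: order_less_trans)
      then have "land n y w u = jump D (fast n (enn2real ?h) w)"
        by (simp add: land_def accel_hold_regular[OF j w])
      then show ?thesis
        using True by (simp add: acc.jump_payoff_def accel_hold_regular[OF j w] advance_def jump_avg_def)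
    next
      case False
      then show ?thesis by (simp add: acc.jump_payoff_def accel_hold_regular[OF j w])
    qed
  qed
  also have "\<dots> = (LBINT t:{0..snd p}. g (elapsed n w t) * rate_clock n w t * ?\<Psi> t)"
    by (rule expectation_at_hold[OF rate_path_fast[OF j w] jump_avg_path_measurable[OF f]])
  finally show ?thesis .
qed

end

lemma acc_stop_op:
  assumes j: "j \<in> space \<I>" and y: "y \<in> space (fibre D j)"
    and \<phi>': "\<phi>' \<in> borel_measurable borel" "\<And>v. \<bar>\<phi>' v\<bar> \<le> B"
  shows "acc.stop_op n \<phi>' p y = (\<integral>w. inner_mean n (acc.stop_payoff n \<phi>' p y) y w \<partial>P y)"
    "inner_mean n (acc.stop_payoff n \<phi>' p y) y \<in> borel_measurable (P y)"
    "AE w in P y. norm (inner_mean n (acc.stop_payoff n \<phi>' p y) y w) \<le> B"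
proof -
  have yE: "y \<in> space \<E>" by (rule fibre_state[OF j y])
  have B: "0 \<le> B" using \<phi>'(2)[of 0] by linarith
  have b: "\<bar>acc.stop_payoff n \<phi>' p y a\<bar> \<le> B" for a using \<phi>'(2) B by (simp add: acc.stop_payoff_def)
  note a = accel_mean[OF yE stop_payoff_section[OF \<phi>'(1) yE] b B]
  show "acc.stop_op n \<phi>' p y = (\<integral>w. inner_mean n (acc.stop_payoff n \<phi>' p y) y w \<partial>P y)"
    unfolding acc.stop_op_def by (rule a(1))
  show "inner_mean n (acc.stop_payoff n \<phi>' p y) y \<in> borel_measurable (P y)" by (rule a(2))
  show "AE w in P y. norm (inner_mean n (acc.stop_payoff n \<phi>' p y) y w) \<le> B"
    by (rule AE_I2) (simp add: a(3) P_space[OF yE])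
qed

lemma acc_jump_op:
  assumes j: "j \<in> space \<I>" and y: "y \<in> space (fibre D j)" and f: "acc.payoff_fun B f"
  shows "acc.jump_op n f p y = (\<integral>w. inner_mean n (acc.jump_payoff n f p y) y w \<partial>P y)"
    "inner_mean n (acc.jump_payoff n f p y) y \<in> borel_measurable (P y)"
    "AE w in P y. norm (inner_mean n (acc.jump_payoff n f p y) y w) \<le> B"
proof -
  have yE: "y \<in> space \<E>" by (rule fibre_state[OF j y])
  have B: "0 \<le> B" using f by (simp add: acc.payoff_fun_def)
  note a = accel_mean[OF yE jump_payoff_section[OF f yE] jump_payoff_bound[OF f] B]
  show "acc.jump_op n f p y = (\<integral>w. inner_mean n (acc.jump_payoff n f p y) y w \<partial>P y)"
    unfolding acc.jump_op_def by (rule a(1))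
  show "inner_mean n (acc.jump_payoff n f p y) y \<in> borel_measurable (P y)" by (rule a(2))
  show "AE w in P y. norm (inner_mean n (acc.jump_payoff n f p y) y w) \<le> B"
    by (rule AE_I2) (simp add: a(3) P_space[OF yE])
qed

text \<open>
  Continuity at fixed \<open>n\<close>: flow and clock are continuous along each regular path, and domination is by the constant \<open>B\<close>.
\<close>

lemma acc_stop_continuous:
  assumes y: "y \<in> space \<E>" and \<phi>': "continuous_on UNIV \<phi>'" "\<And>v. \<bar>\<phi>' v\<bar> \<le> B"
  shows "continuous_on UNIV (\<lambda>p. acc.stop_op n \<phi>' p y)"
proof (rule continuous_at_imp_continuous_on, rule ballI)
  fix p :: "(real^'d) \<times> real"
  note j = state_index[OF y]
  have \<phi>m: "\<phi>' \<in> borel_measurable borel" using \<phi>'(1) by (rule borel_measurable_continuous_onI)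
  note a = acc_stop_op[OF j \<phi>m \<phi>'(2)]
  interpret prob_space "P y" by (rule P_prob[OF y])
  show "isCont (\<lambda>p. acc.stop_op n \<phi>' p y) p"
    unfolding continuous_at_sequentially comp_def
  proof (intro allI impI)
    fix q assume q: "q \<longlonglongrightarrow> p"
    show "(\<lambda>k. acc.stop_op n \<phi>' (q k) y) \<longlonglongrightarrow> acc.stop_op n \<phi>' p y"
      unfolding a(1)
    proof (rule integral_dominated_convergence[where w = "\<lambda>_. B"])
      show "AE w in P y. (\<lambda>k. inner_mean n (acc.stop_payoff n \<phi>' (q k) y) y w) \<longlonglongrightarrow> inner_mean n (acc.stop_payoff n \<phi>' p y) y w"
        using AE_regular[OF j]
      proof eventually_elim
        case (elim w)
        have c: "isCont \<phi>' v" for v using \<phi>'(1) by (simp add: continuous_on_eq_continuous_at)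
        have e: "isCont (elapsed n w) t" for t
          using cumulated_continuous[OF rate_path_fast[OF j(1) elim, of n], of UNIV] by (simp add: continuous_on_eq_continuous_at)
        have G: "isCont (cdf N) t" for t using cdf_continuous[of UNIV] by (simp add: continuous_on_eq_continuous_at)
        show ?case
          unfolding inner_mean_stop[OF j(1) elim j(2)]
          by (intro tendsto_intros isCont_tendsto_compose[OF c] isCont_tendsto_compose[OF G] isCont_tendsto_compose[OF e]
              flow_tendsto[OF drive_field[OF j(1) elim]] tendsto_fst[OF q] tendsto_snd[OF q])
      qed
    qed (use a(2,3) in auto)
  qed
qed

text \<open>
  The upper limit of the time integral moves with the phase; the indicators converge except at the limiting end point,
  which is a null set.
\<close>

lemma acc_jump_continuous:
  assumes y: "y \<in> space \<E>" and f: "acc.payoff_fun B f" and fc: "\<And>x. x \<in> space \<E> \<Longrightarrow> continuous_on UNIV (\<lambda>p. f p x)"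
  shows "continuous_on UNIV (\<lambda>p. acc.jump_op n f p y)"
proof (rule continuous_at_imp_continuous_on, rule ballI)
  fix p :: "(real^'d) \<times> real"
  note j = state_index[OF y]
  note a = acc_jump_op[OF j f]
  have B: "0 \<le> B" using f by (simp add: acc.payoff_fun_def)
  interpret prob_space "P y" by (rule P_prob[OF y])
  show "isCont (\<lambda>p. acc.jump_op n f p y) p"
    unfolding continuous_at_sequentially comp_def
  proof (intro allI impI)
    fix q assume q: "q \<longlonglongrightarrow> p"
    show "(\<lambda>k. acc.jump_op n f (q k) y) \<longlonglongrightarrow> acc.jump_op n f p y"
      unfolding a(1)
    proof (rule integral_dominated_convergence[where w = "\<lambda>_. B"])
      show "AE w in P y. (\<lambda>k. inner_mean n (acc.jump_payoff n f (q k) y) y w) \<longlonglongrightarrow> inner_mean n (acc.jump_payoff n f p y) y w"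
        using AE_regular[OF j]
      proof eventually_elim
        case (elim w)
        note rp = rate_path_fast[OF j(1) elim, of n]
        note st = regular_states[OF j(1) elim]
        obtain T where T: "\<And>k. snd (q k) \<le> T"
        proof -
          have "Bseq (\<lambda>k. snd (q k))" using tendsto_snd[OF q] by (intro convergent_imp_Bseq) (auto simp: convergent_def)
          then show ?thesis using that by (auto simp: Bseq_def abs_le_iff)
        qed
        let ?\<Phi> = "\<lambda>p t. jump_avg f (flow (drive n w) (fst p) t, snd p - t) (fast n t w)"
        let ?h = "\<lambda>t. g (elapsed n w t) * rate_clock n w t"
        note [measurable] = jump_avg_path_measurable[OF j(1) elim f] g_meas cumulated_measurable[OF rp] rate_path_measurable[OF rp]
        show ?case
          unfolding inner_mean_jump[OF j(1) elim j(2) f] set_lebesgue_integral_def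
        proof (rule integral_dominated_convergence[where w = "\<lambda>t. indicator {0..T} t *\<^sub>R (B * ?h t)"])
          show "integrable lborel (\<lambda>t. indicator {0..T} t *\<^sub>R (B * ?h t))"
            using density_substitution(1)[OF rp, of T] by (simp add: set_integrable_def mult.left_commute[of _ B])
          show "AE t in lborel. norm (indicator {0..snd (q k)} t *\<^sub>R (?h t * ?\<Phi> (q k) t)) \<le> indicator {0..T} t *\<^sub>R (B * ?h t)" for k
          proof (rule AE_I2)
            fix t
            have h0: "0 \<le> ?h t" using g_nonneg rate_path_nonneg[OF rp] by simp
            have "\<bar>?h t * ?\<Phi> (q k) t\<bar> \<le> B * ?h t"
              unfolding abs_mult[of "?h t"] abs_of_nonneg[OF h0] mult.commute[of B]
              by (rule mult_left_mono[OF jump_avg(2)[OF f st(2)] h0])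
            then show "norm (indicator {0..snd (q k)} t *\<^sub>R (?h t * ?\<Phi> (q k) t)) \<le> indicator {0..T} t *\<^sub>R (B * ?h t)"
              using T[of k] h0 B by (auto simp: indicator_def)
          qed
          show "AE t in lborel. (\<lambda>k. indicator {0..snd (q k)} t *\<^sub>R (?h t * ?\<Phi> (q k) t)) \<longlonglongrightarrow> indicator {0..snd p} t *\<^sub>R (?h t * ?\<Phi> p t)"
            using AE_lborel_singleton[of "snd p"]
          proof eventually_elim
            case (elim t)
            have "(\<lambda>k. ?\<Phi> (q k) t) \<longlonglongrightarrow> ?\<Phi> p t"
            proof (rule jump_avg_tendsto[OF f f st(2)])
              fix x assume "x \<in> space \<E>"
              then have "isCont (\<lambda>p. f p x) (flow (drive n w) (fst p) t, snd p - t)"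
                using fc by (simp add: continuous_on_eq_continuous_at)
              then show "(\<lambda>k. f (flow (drive n w) (fst (q k)) t, snd (q k) - t) x) \<longlonglongrightarrow> f (flow (drive n w) (fst p) t, snd p - t) x"
                by (rule isCont_tendsto_compose)
                  (intro tendsto_intros flow_tendsto[OF drive_field[OF j(1) \<open>regular (\<phi> y) w\<close>]] tendsto_fst[OF q] tendsto_snd[OF q])
            qed
            moreover have "(\<lambda>k. indicator {0..snd (q k)} t) \<longlonglongrightarrow> (indicator {0..snd p} t :: real)"
            proof (rule tendsto_eventually)
              show "\<forall>\<^sub>F k in sequentially. indicator {0..snd (q k)} t = (indicator {0..snd p} t :: real)"
              proof (cases "t < snd p")
                case True
                from order_tendstoD(1)[OF tendsto_snd[OF q] this] show ?thesis
                  by eventually_elim (use True in \<open>auto simp: indicator_def\<close>)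
              next
                case False
                then have "snd p < t" using elim by simp
                from order_tendstoD(2)[OF tendsto_snd[OF q] this] show ?thesis
                  by eventually_elim (use \<open>snd p < t\<close> in \<open>auto simp: indicator_def\<close>)
              qed
            qed
            ultimately show ?case by (intro tendsto_intros)
          qed
        qed measurable
      qed
    qed (use a(2,3) in auto)
  qed
qed

abbreviation "mean_drive j \<equiv> (\<lambda>(s::real) v. \<integral>x. speed v x \<partial>\<mu> j)"


text \<open>
  Only \<open>u > 0\<close> matters, which removes the exceptional values of \<open>limit_hold_eq\<close>.
\<close>

lemma limit_step_expectation:
  assumes j: "j \<in> space \<I>" and f: "f \<in> borel_measurable \<B>" and bnd: "\<And>a. a \<in> space \<B> \<Longrightarrow> \<bar>f a\<bar> \<le> (B::real)"
    and h: "h \<in> borel_measurable borel" and eq: "\<And>u. 0 < u \<Longrightarrow> (\<integral>i. f (u, i) \<partial>limit_next j) = h u"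
  shows "(\<integral>a. f a \<partial>limit_step D \<mu> j) = (\<integral>u. h u \<partial>unif01)"
proof (rule trans[OF limit_step_integral[OF j f bnd] integral_cong_AE])
  interpret n: prob_space "limit_next j" by (rule limit_next_prob[OF j])
  have "f \<in> borel_measurable (borel \<Otimes>\<^sub>M limit_next j)"
    using f by (simp add: measurable_cong_sets[OF sets_pair_measure_cong[OF refl limit_next_sets[OF j]] refl])
  then have "(\<lambda>(u, i). f (u, i)) \<in> borel_measurable (borel \<Otimes>\<^sub>M limit_next j)" by simp
  from n.borel_measurable_lebesgue_integral[OF this]
  show "(\<lambda>u. \<integral>i. f (u, i) \<partial>limit_next j) \<in> borel_measurable unif01"
    by (simp add: measurable_cong_sets[OF sets_unif01 refl])
  show "h \<in> borel_measurable unif01" using h by (simp add: measurable_cong_sets[OF sets_unif01 refl])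
  show "AE u in unif01. (\<integral>i. f (u, i) \<partial>limit_next j) = h u"
    using AE_unif01_pos by eventually_elim (rule eq)
qed

lemma mean_drift: "j \<in> space \<I> \<Longrightarrow> (\<lambda>t. avg_drift \<mu> F j) = mean_drive j"
  by (intro ext) (simp add: avg_drift_speed)

lemma lim_stop_op:
  assumes j: "j \<in> space \<I>" and \<phi>': "\<phi>' \<in> borel_measurable borel" "\<And>v. \<bar>\<phi>' v\<bar> \<le> B"
  shows "lim.stop_op \<phi>' p j = \<phi>' (flow (mean_drive j) (fst p) (snd p)) * (1 - cdf N (cumulated (\<lambda>_. mr j) (snd p)))"
proof -
  note rp = rate_path_const[OF mr_nonneg[OF j]]
  note [measurable] = hold_measurable[OF rp]
  have B: "0 \<le> B" using \<phi>'(2)[of 0] by linarith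
  have b: "\<bar>lim.stop_payoff \<phi>' p j a\<bar> \<le> B" for a using \<phi>'(2) B by (simp add: lim.stop_payoff_def)
  have "(p, j) \<in> space (lim.phase \<Otimes>\<^sub>M \<I>)" using j by (simp add: space_pair_measure)
  from measurable_compose[OF measurable_Pair1'[OF this] lim.stop_payoff_measurable[OF \<phi>'(1)]]
  have m: "lim.stop_payoff \<phi>' p j \<in> borel_measurable \<B>" by simp
  interpret n: prob_space "limit_next j" by (rule limit_next_prob[OF j])
  have "lim.stop_op \<phi>' p j = (\<integral>u. (if ennreal (snd p) \<le> hold_time N (\<lambda>_. mr j) u then \<phi>' (flow (mean_drive j) (fst p) (snd p)) else 0) \<partial>unif01)"
    unfolding lim.stop_op_def
    by (rule limit_step_expectation[OF j m b])
      (simp_all add: lim.stop_payoff_def limit_hold_eq[OF j] mean_drift[OF j] n.prob_space)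
  also have "\<dots> = \<phi>' (flow (mean_drive j) (fst p) (snd p)) * (1 - cdf N (cumulated (\<lambda>_. mr j) (snd p)))"
    by (rule expectation_before_hold[OF rp])
  finally show ?thesis .
qed

text \<open>
  If the mean rate is 0, then the rate vanishes almost everywhere and both sides are 0.
\<close>

lemma rate_mean_next:
  assumes j: "j \<in> space \<I>" and G: "lim.payoff_fun B G"
  shows "mr j * (\<integral>i. G p i \<partial>limit_next j) = (\<integral>x. rate D x * jump_avg (\<lambda>p y. G p (\<phi> y)) p x \<partial>\<mu> j)"
proof (cases "0 < mr j")
  case True
  have Gm: "(\<lambda>(p, s). G p s) \<in> borel_measurable (lim.phase \<Otimes>\<^sub>M \<I>)" using G by (simp add: lim.payoff_fun_def)
  have "p \<in> space lim.phase" by (simp add: space_pair_measure)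
  from measurable_compose[OF measurable_Pair1'[OF this] Gm] have "G p \<in> borel_measurable \<I>" by simp
  from limit_next_integral[OF j True this lim.payoff_fun_bound[OF G]] show ?thesis by (simp add: jump_avg_def)
next
  case False
  then have m0: "mr j = 0" using mr_nonneg[OF j] by simp
  have nn: "AE x in \<mu> j. 0 \<le> rate D x" by (rule AE_I2) (simp add: rate_nonneg fibre_state[OF j] mu_space[OF j])
  have "AE x in \<mu> j. rate D x = 0"
    using integral_nonneg_eq_0_iff_AE[OF integrable_rate[OF j] nn] m0 by (simp add: mean_rate_def)
  then have "(\<integral>x. rate D x * jump_avg (\<lambda>p y. G p (\<phi> y)) p x \<partial>\<mu> j) = 0"
    by (intro integral_eq_zero_AE) auto
  then show ?thesis using m0 by simp
qed

lemma lim_jump_op: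
  assumes j: "j \<in> space \<I>" and G: "lim.payoff_fun B G"
  shows "lim.jump_op G p j = (LBINT t:{0..snd p}. g (cumulated (\<lambda>_. mr j) t) *
    (\<integral>x. rate D x * jump_avg (\<lambda>p y. G p (\<phi> y)) (flow (mean_drive j) (fst p) t, snd p - t) x \<partial>\<mu> j))"
proof -
  note rp = rate_path_const[OF mr_nonneg[OF j]]
  let ?\<Psi> = "\<lambda>t. \<integral>i. G (flow (mean_drive j) (fst p) t, snd p - t) i \<partial>limit_next j"
  let ?h = "\<lambda>u. hold_time N (\<lambda>_. mr j) u"
  have B: "0 \<le> B" and Gm: "(\<lambda>(p, s). G p s) \<in> borel_measurable (lim.phase \<Otimes>\<^sub>M \<I>)"
    using G by (auto simp: lim.payoff_fun_def)
  have b: "\<bar>lim.jump_payoff G p j a\<bar> \<le> B" if "a \<in> space \<B>" for a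
    using lim.payoff_fun_bound[OF G measurable_space[OF lim.post that]] B by (simp add: lim.jump_payoff_def)
  have "(p, j) \<in> space (lim.phase \<Otimes>\<^sub>M \<I>)" using j by (simp add: space_pair_measure)
  from measurable_compose[OF measurable_Pair1'[OF this] lim.jump_payoff_measurable[OF Gm]]
  have m: "lim.jump_payoff G p j \<in> borel_measurable \<B>" by simp
  interpret n: prob_space "limit_next j" by (rule limit_next_prob[OF j])
  note [measurable] = hold_measurable[OF rp] flow_time_measurable[OF avg_drift_field[OF j]]
  have "(\<lambda>(t, i). G (flow (mean_drive j) (fst p) t, snd p - t) i) \<in> borel_measurable (borel \<Otimes>\<^sub>M \<I>)"
  proof -
    have "(\<lambda>q. ((flow (mean_drive j) (fst p) (fst q), snd p - fst q), snd q)) \<in> borel \<Otimes>\<^sub>M \<I> \<rightarrow>\<^sub>M lim.phase \<Otimes>\<^sub>M \<I>"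
      by measurable
    from measurable_compose[OF this Gm] show ?thesis by (simp add: split_beta')
  qed
  then have "(\<lambda>(t, i). G (flow (mean_drive j) (fst p) t, snd p - t) i) \<in> borel_measurable (borel \<Otimes>\<^sub>M limit_next j)"
    by (simp add: measurable_cong_sets[OF sets_pair_measure_cong[OF refl limit_next_sets[OF j]] refl])
  from n.borel_measurable_lebesgue_integral[OF this] have \<Psi> [measurable]: "?\<Psi> \<in> borel_measurable borel" .
  have "lim.jump_op G p j = (\<integral>u. (if ?h u < ennreal (snd p) then ?\<Psi> (enn2real (?h u)) else 0) \<partial>unif01)"
    unfolding lim.jump_op_def
  proof (rule limit_step_expectation[OF j m b])
    show "(\<lambda>u. if ?h u < ennreal (snd p) then ?\<Psi> (enn2real (?h u)) else 0) \<in> borel_measurable borel" by measurable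
    show "(\<integral>i. lim.jump_payoff G p j (u, i) \<partial>limit_next j) = (if ?h u < ennreal (snd p) then ?\<Psi> (enn2real (?h u)) else 0)"
      if "0 < u" for u
      using that by (simp add: lim.jump_payoff_def limit_hold_eq[OF j] mean_drift[OF j] advance_def)
  qed
  also have "\<dots> = (LBINT t:{0..snd p}. g (cumulated (\<lambda>_. mr j) t) * mr j * ?\<Psi> t)"
    by (rule expectation_at_hold[OF rp \<Psi>])
  finally show ?thesis by (simp add: mult.assoc rate_mean_next[OF j G])
qed

end


section \<open>Convergence of the operators\<close>

text \<open>
  Negative end points are included. There the interval is empty and the integrals vanish.
\<close>

lemma set_integral_endpoint_difference:
  fixes h h0 :: "real \<Rightarrow> real"
  assumes h: "\<And>t. set_integrable lborel {0..t} h" and h0: "\<And>t. set_integrable lborel {0..t} h0"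
    and le: "\<And>s. \<bar>h s\<bar> \<le> B * h0 s" and B: "0 \<le> B"
  shows "\<bar>(LBINT r:{0..s}. h r) - (LBINT r:{0..t}. h r)\<bar> \<le> B * \<bar>(LBINT r:{0..s}. h0 r) - (LBINT r:{0..t}. h0 r)\<bar>"
proof -
  have *: "\<bar>(LBINT r:{0..t}. h r) - (LBINT r:{0..s}. h r)\<bar> \<le> B * \<bar>(LBINT r:{0..t}. h0 r) - (LBINT r:{0..s}. h0 r)\<bar>"
    if st: "s \<le> t" for s t
  proof -
    let ?d = "\<lambda>r. indicator {0..t} r - indicator {0..s} r :: real"
    have d: "0 \<le> ?d r" for r using st by (auto simp: indicator_def)
    have i: "integrable lborel (\<lambda>r. ?d r * h r)" "integrable lborel (\<lambda>r. ?d r * h0 r)"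
      using h[of s] h[of t] h0[of s] h0[of t] by (auto simp: set_integrable_def left_diff_distrib)
    have e: "(LBINT r:{0..t}. h r) - (LBINT r:{0..s}. h r) = (\<integral>r. ?d r * h r \<partial>lborel)"
      "(LBINT r:{0..t}. h0 r) - (LBINT r:{0..s}. h0 r) = (\<integral>r. ?d r * h0 r \<partial>lborel)"
      using h[of s] h[of t] h0[of s] h0[of t] by (simp_all add: set_integrable_def set_lebesgue_integral_def left_diff_distrib)
    have "\<bar>\<integral>r. ?d r * h r \<partial>lborel\<bar> \<le> (\<integral>r. \<bar>?d r * h r\<bar> \<partial>lborel)" by (rule integral_abs_bound)
    also have "\<dots> \<le> (\<integral>r. B * (?d r * h0 r) \<partial>lborel)"
    proof (rule integral_mono)
      show "\<bar>?d r * h r\<bar> \<le> B * (?d r * h0 r)" for r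
        using mult_left_mono[OF le[of r] d[of r]] unfolding abs_mult abs_of_nonneg[OF d] by (simp only: mult.left_commute[of B])
    qed (use i in auto)
    also have "\<dots> = B * (\<integral>r. ?d r * h0 r \<partial>lborel)" by simp
    also have "\<dots> \<le> B * \<bar>\<integral>r. ?d r * h0 r \<partial>lborel\<bar>" using B by (intro mult_left_mono) auto
    finally show ?thesis by (simp only: e)
  qed
  show ?thesis
  proof (cases "s \<le> t")
    case True
    from *[OF this] show ?thesis by (simp only: abs_minus_commute)
  next
    case False
    then have "t \<le> s" by simp
    from *[OF this] show ?thesis .
  qed
qed

lemma dist_Pair_le: "dist (a, b) (a', b') \<le> dist a a' + dist b b'"
  unfolding dist_Pair_Pair by (rule real_le_lsqrt) (auto simp: power2_sum)

text \<open>
  It is enough to know the limit for functions \<open>c i\<close> approximating the density in \<open>L\<^sup>1\<close>. The substitution bound makes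
  the error uniform in \<open>k\<close> and small in the limit as well.
\<close>

lemma (in clock) weighted_limit:
  fixes \<Phi> :: "nat \<Rightarrow> real \<Rightarrow> real"
  assumes \<beta>: "\<And>k. rate_path (\<beta> k)" "rate_path \<beta>'"
    and \<Phi>: "\<And>k. \<Phi> k \<in> borel_measurable borel" "\<Phi>' \<in> borel_measurable borel"
      "\<And>k t. \<bar>\<Phi> k t\<bar> \<le> B" "\<And>t. \<bar>\<Phi>' t\<bar> \<le> B"
    and c: "\<And>i. integrable lborel (c i)" "(\<lambda>i. \<integral>a. \<bar>g a - c i a\<bar> \<partial>lborel) \<longlonglongrightarrow> 0"
    and lim: "\<And>i. (\<lambda>k. LBINT t:{0..T}. c i (cumulated (\<beta> k) t) * \<beta> k t * \<Phi> k t)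
      \<longlonglongrightarrow> (LBINT t:{0..T}. c i (cumulated \<beta>' t) * \<beta>' t * \<Phi>' t)"
  shows "(\<lambda>k. LBINT t:{0..T}. g (cumulated (\<beta> k) t) * \<beta> k t * \<Phi> k t)
      \<longlonglongrightarrow> (LBINT t:{0..T}. g (cumulated \<beta>' t) * \<beta>' t * \<Phi>' t)"
proof (rule LIMSEQ_I)
  fix e :: real assume e: "0 < e"
  have B: "0 \<le> B" using \<Phi>(4)[of 0] by linarith
  have d: "integrable lborel (\<lambda>a. g a - c i a)" for i using g_integrable c(1) by auto
  have diff: "\<bar>(LBINT t:{0..T}. g (cumulated b t) * b t * H t) - (LBINT t:{0..T}. c i (cumulated b t) * b t * H t)\<bar>
      \<le> B * (\<integral>a. \<bar>g a - c i a\<bar> \<partial>lborel)"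
    if "rate_path b" "H \<in> borel_measurable borel" "\<And>t. \<bar>H t\<bar> \<le> B" for b H i
  proof -
    note w = cumulated_weighted_bound[OF that(1) _ that(2,3) B]
    have "(LBINT t:{0..T}. g (cumulated b t) * b t * H t) - (LBINT t:{0..T}. c i (cumulated b t) * b t * H t)
        = (LBINT t:{0..T}. g (cumulated b t) * b t * H t - c i (cumulated b t) * b t * H t)"
      by (rule set_integral_diff(2)[symmetric]) (use w(1)[OF g_integrable] w(1)[OF c(1)] in auto)
    also have "\<dots> = (LBINT t:{0..T}. (g (cumulated b t) - c i (cumulated b t)) * b t * H t)"
      by (simp add: left_diff_distrib)
    finally show ?thesis using w(2)[OF d[of i], of T] by simp
  qed
  have "(\<lambda>i. B * (\<integral>a. \<bar>g a - c i a\<bar> \<partial>lborel)) \<longlonglongrightarrow> B * 0" by (intro tendsto_intros c)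
  then have "\<forall>\<^sub>F i in sequentially. B * (\<integral>a. \<bar>g a - c i a\<bar> \<partial>lborel) < e / 3"
    by (rule order_tendstoD(2)) (use e in simp)
  then obtain i where i: "B * (\<integral>a. \<bar>g a - c i a\<bar> \<partial>lborel) < e / 3" by (auto simp: eventually_sequentially)
  have "0 < e / 3" using e by simp
  from LIMSEQ_D[OF lim[of i] this] obtain k0 where k0: "\<And>k. k \<ge> k0 \<Longrightarrow>
    norm ((LBINT t:{0..T}. c i (cumulated (\<beta> k) t) * \<beta> k t * \<Phi> k t) - (LBINT t:{0..T}. c i (cumulated \<beta>' t) * \<beta>' t * \<Phi>' t)) < e / 3"
    by blast
  show "\<exists>k0. \<forall>k\<ge>k0. norm ((LBINT t:{0..T}. g (cumulated (\<beta> k) t) * \<beta> k t * \<Phi> k t) -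
      (LBINT t:{0..T}. g (cumulated \<beta>' t) * \<beta>' t * \<Phi>' t)) < e"
  proof (intro exI allI impI)
    fix k assume "k0 \<le> k"
    from k0[OF this] diff[OF \<beta>(1)[of k] \<Phi>(1)[of k] \<Phi>(3)[of k], of i] diff[OF \<beta>(2) \<Phi>(2,4), of i] i
    show "norm ((LBINT t:{0..T}. g (cumulated (\<beta> k) t) * \<beta> k t * \<Phi> k t) -
      (LBINT t:{0..T}. g (cumulated \<beta>' t) * \<beta>' t * \<Phi>' t)) < e"
      unfolding real_norm_def by linarith
  qed
qed

context clocked_model
begin

lemma AE_averages_bounded:
  fixes h :: "'e \<Rightarrow> real"
  assumes j: "j \<in> space \<I>" and x: "x \<in> space (fibre D j)" and h: "h \<in> borel_measurable (\<mu> j)"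
    and le: "\<And>y. y \<in> space (fibre D j) \<Longrightarrow> \<bar>h y\<bar> \<le> C" and \<nu>: "filterlim \<nu> at_top sequentially"
  shows "AE w in P x. averages (\<lambda>k s. fast (\<nu> k) s w) h (\<integral>y. h y \<partial>\<mu> j)"
    and "AE w in P x. averages (\<lambda>k s. fast (\<nu> k) s w) (\<lambda>y. rate D y * h y) (\<integral>y. rate D y * h y \<partial>\<mu> j)"
proof -
  have C: "0 \<le> C" using le[OF x] by linarith
  have r: "0 \<le> rate D y" if "y \<in> space (fibre D j)" for y by (rule rate_nonneg[OF fibre_state[OF j that]])
  have 1: "\<bar>h y\<bar> \<le> C * (1 + rate D y)" if "y \<in> space (fibre D j)" for y
    using le[OF that] mult_nonneg_nonneg[OF C r[OF that]] by (simp add: distrib_left)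
  show "AE w in P x. averages (\<lambda>k s. fast (\<nu> k) s w) h (\<integral>y. h y \<partial>\<mu> j)"
    by (rule AE_averages[OF j x h 1 C \<nu>])
  have 2: "\<bar>rate D y * h y\<bar> \<le> C * (1 + rate D y)" if "y \<in> space (fibre D j)" for y
    using mult_right_mono[OF le[OF that] r[OF that]] C r[OF that] by (simp add: abs_mult distrib_left mult.commute)
  have m: "(\<lambda>y. rate D y * h y) \<in> borel_measurable (\<mu> j)"
    using h mu_measurable[OF j rate_meas] by measurable
  show "AE w in P x. averages (\<lambda>k s. fast (\<nu> k) s w) (\<lambda>y. rate D y * h y) (\<integral>y. rate D y * h y \<partial>\<mu> j)"
    by (rule AE_averages[OF j x m 2 C \<nu>])
qed

lemma speed_fibre_bounds:
  assumes j: "j \<in> space \<I>" and y: "y \<in> space (fibre D j)"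
  shows "norm (speed 0 y) \<le> real (lip_bound j)" "norm (speed v y - speed v' y) \<le> real (lip_bound j) * norm (v - v')"
    "norm (speed v y) \<le> real (lip_bound j) * (1 + norm v)"
proof -
  show 1: "norm (speed 0 y) \<le> real (lip_bound j)" "norm (speed v y - speed v' y) \<le> real (lip_bound j) * norm (v - v')" for v v'
    using speed_bounds[OF fibre_state[OF j y]] index_map_fibre[OF j y] by simp_all
  show "norm (speed v y) \<le> real (lip_bound j) * (1 + norm v)"
    using 1(1) 1(2)[of v 0] norm_triangle_ineq2[of "speed v y" "speed 0 y"] by (simp add: distrib_left)
qed

text \<open>
  The averaging principle for almost every path. Ergodicity is invoked for the countably many functions
  that \<open>flow_averaging\<close> requires.
\<close>

lemma AE_flow_limit:
  assumes j: "j \<in> space \<I>" and x: "x \<in> space (fibre D j)" and \<nu>: "filterlim \<nu> at_top sequentially"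
    and zs: "zs \<longlonglongrightarrow> z" and T: "0 \<le> T"
  shows "AE w in P x. \<forall>e>0. \<forall>\<^sub>F k in sequentially. \<forall>t\<in>{0..T}.
    norm (flow (drive (\<nu> k) w) (zs k) t - flow (mean_drive j) z t) < e"
proof -
  let ?\<zeta> = "flow (mean_drive j) z"
  have "continuous_on {0..T} ?\<zeta>" by (rule flow_continuous[OF avg_drift_field[OF j]])
  then have "bounded (?\<zeta> ` {0..T})" by (intro compact_imp_bounded compact_continuous_image) auto
  then obtain R0 where R0: "\<And>t. t \<in> {0..T} \<Longrightarrow> norm (?\<zeta> t) \<le> R0" unfolding bounded_iff by blast
  define R where "R = R0 + 1"
  have R: "norm (?\<zeta> t) < R" if "t \<in> {0..T}" for t using R0[OF that] by (simp add: R_def)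
  have Rpos: "0 < R" using le_less_trans[OF norm_ge_zero R[of 0]] T by simp
  have sm: "speed v \<in> borel_measurable (\<mu> j)" for v by (rule mu_measurable[OF j speed_measurable_snd])
  have bnd: "\<bar>speed v y \<bullet> e\<bar> \<le> real (lip_bound j) * (1 + R)"
    if "e \<in> Basis" "norm v < R" "y \<in> space (fibre D j)" for e v y
  proof -
    have "\<bar>speed v y \<bullet> e\<bar> \<le> norm (speed v y)" using that by (intro Basis_le_norm)
    also have "\<dots> \<le> real (lip_bound j) * (1 + norm v)" by (rule speed_fibre_bounds[OF j that(3)])
    also have "\<dots> \<le> real (lip_bound j) * (1 + R)" using that by (intro mult_left_mono) auto
    finally show ?thesis .
  qed
  have cont: "continuous_on UNIV (\<lambda>v. speed v y \<bullet> e)" if "y \<in> space (fibre D j)" for y e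
    using speed_continuous[OF fibre_state[OF j that]] by (intro continuous_intros)
  have cc: "continuously_converges (\<lambda>(n::nat) v. speed v y \<bullet> e) (\<lambda>v. speed v y \<bullet> e)" if "y \<in> space (fibre D j)" for y e
    unfolding continuously_converges_def
    using cont[OF that, of e] by (auto simp: continuous_on_eq_continuous_at intro: isCont_tendsto_compose[where g = "\<lambda>v. speed v y \<bullet> e"])
  let ?osc = "\<lambda>e N y. osc (\<lambda>(n::nat) v. speed v y \<bullet> e) (\<lambda>v. speed v y \<bullet> e) R N"
  have osc_m: "?osc e N \<in> borel_measurable (\<mu> j)" if "e \<in> Basis" for e N
    by (rule osc_borel_measurable[OF _ _ cc cont bnd Rpos]) (use sm that in \<open>auto simp: mu_space[OF j]\<close>)
  have osc_b: "\<bar>?osc e N y\<bar> \<le> 2 * (real (lip_bound j) * (1 + R))" if "e \<in> Basis" "y \<in> space (fibre D j)" for e N y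
    using osc_nonneg[OF cc[OF that(2)] cont[OF that(2)] bnd[OF that(1) _ that(2)] Rpos]
      osc_le[OF cc[OF that(2)] cont[OF that(2)] bnd[OF that(1) _ that(2)] Rpos] by simp
  have av1: "AE w in P x. \<forall>e\<in>Basis. \<forall>N. averages (\<lambda>k s. fast (\<nu> k) s w) (?osc e N) (\<integral>y. ?osc e N y \<partial>\<mu> j)"
    unfolding AE_ball_countable[OF countable_finite[OF finite_Basis]] AE_all_countable
    using AE_averages_bounded(1)[OF j x osc_m osc_b \<nu>] by blast
  have "countable ({0..T} \<inter> \<rat>)" by (rule countable_subset[OF _ countable_rat]) auto
  note c = AE_ball_countable[OF this]
  have av2: "AE w in P x. \<forall>e\<in>Basis. \<forall>s\<in>{0..T} \<inter> \<rat>.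
      averages (\<lambda>k s. fast (\<nu> k) s w) (\<lambda>y. speed (?\<zeta> s) y \<bullet> e) (\<integral>y. speed (?\<zeta> s) y \<bullet> e \<partial>\<mu> j)"
    unfolding AE_ball_countable[OF countable_finite[OF finite_Basis]] c
  proof (intro ballI)
    fix e :: "real^'d" and s assume es: "e \<in> Basis" "s \<in> {0..T} \<inter> \<rat>"
    show "AE w in P x. averages (\<lambda>k s. fast (\<nu> k) s w) (\<lambda>y. speed (?\<zeta> s) y \<bullet> e) (\<integral>y. speed (?\<zeta> s) y \<bullet> e \<partial>\<mu> j)"
      by (rule AE_averages_bounded(1)[OF j x _ bnd[OF es(1)] \<nu>]) (use es sm R in auto)
  qed
  from AE_regular[OF j x] av1 av2 show ?thesis
  proof eventually_elim
    case (elim w)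
    show ?case
    proof (intro allI impI)
      fix e :: real assume e: "0 < e"
      show "\<forall>\<^sub>F k in sequentially. \<forall>t\<in>{0..T}. norm (flow (drive (\<nu> k) w) (zs k) t - ?\<zeta> t) < e"
      proof (rule flow_averaging[where F = speed and L = "real (lip_bound j)", OF mu_prob[OF j] _ sm _ _ _ _ zs T R _ _ e])
        show "fast (\<nu> n) s w \<in> space (\<mu> j)" for n s using regular_fast[OF elim(1)] by (simp add: mu_space[OF j])
        show "lipschitz_field (real (lip_bound j)) (drive (\<nu> n) w)" for n by (rule drive_field[OF j elim(1)])
      qed (use elim speed_fibre_bounds[OF j] in \<open>auto simp: mu_space[OF j]\<close>)
    qed
  qed
qed

lemma AE_elapsed_limit:
  assumes j: "j \<in> space \<I>" and x: "x \<in> space (fibre D j)" and \<nu>: "filterlim \<nu> at_top sequentially"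
  shows "AE w in P x. \<forall>T. \<forall>e>0. \<forall>\<^sub>F k in sequentially. \<forall>t\<in>{0..T}. norm (elapsed (\<nu> k) w t - mr j * t) < e"
proof -
  have "AE w in P x. averages (\<lambda>k s. fast (\<nu> k) s w) (rate D) (mr j)"
    unfolding mean_rate_def
    by (rule AE_averages[OF j x mu_measurable[OF j rate_meas] _ _ \<nu>, of 1])
      (use rate_nonneg[OF fibre_state[OF j]] in auto)
  with AE_regular[OF j x] show ?thesis
  proof eventually_elim
    case (elim w)
    have l: "(\<lambda>k. elapsed (\<nu> k) w t) \<longlonglongrightarrow> mr j * t" if "0 \<le> t" for t
      using elim(2) that by (auto simp: averages_def cumulated_def mult.commute)
    show ?case
    proof (intro allI impI)
      fix T e :: real assume e: "0 < e"
      show "\<forall>\<^sub>F k in sequentially. \<forall>t\<in>{0..T}. norm (elapsed (\<nu> k) w t - mr j * t) < e"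
        by (rule dominated_increments_uniform[where B = "\<lambda>k. elapsed (\<nu> k) w" and c = "mr j", OF l l _ e])
          (use cumulated_mono[OF rate_path_fast[OF j elim(1)]] in auto)
    qed
  qed
qed

text \<open>
  Along almost every path flow and clock converge uniformly in time, hence also at the converging times \<open>snd (q k)\<close>. Times are
  replaced by their positive parts, on which uniform convergence is known; flow and clock do not notice the difference.
\<close>

lemma stop_converges:
  assumes x: "x \<in> space \<E>" and \<phi>': "continuous_on UNIV \<phi>'" "\<And>v. \<bar>\<phi>' v\<bar> \<le> B"
  shows "continuously_converges (\<lambda>n p. acc.stop_op n \<phi>' p x) (\<lambda>p. lim.stop_op \<phi>' p (\<phi> x))"
  unfolding continuously_converges_def
proof (intro allI impI)
  fix \<nu> :: "nat \<Rightarrow> nat" and q :: "nat \<Rightarrow> (real^'d) \<times> real" and q'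
  assume \<nu>: "filterlim \<nu> at_top sequentially" and q: "q \<longlonglongrightarrow> q'"
  note j = state_index[OF x]
  have \<phi>m: "\<phi>' \<in> borel_measurable borel" using \<phi>'(1) by (rule borel_measurable_continuous_onI)
  note a = acc_stop_op[OF j \<phi>m \<phi>'(2)]
  interpret prob_space "P x" by (rule P_prob[OF x])
  \<comment> \<open>a margin of 1, so that nearby horizons stay in the interval\<close>
  define T where "T = max 0 (snd q') + 1"
  have T: "0 \<le> T" by (simp add: T_def)
  have t: "(\<lambda>k. max 0 (snd (q k))) \<longlonglongrightarrow> max 0 (snd q')" by (intro tendsto_intros tendsto_snd[OF q])
  have tT: "max 0 (snd q') \<in> {0..T}" by (simp add: T_def)
  have ev: "\<forall>\<^sub>F k in sequentially. max 0 (snd (q k)) \<in> {0..T}"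
    using order_tendstoD(2)[OF t, of T] by (auto simp: T_def elim: eventually_mono)
  have "(\<lambda>k. \<integral>w. inner_mean (\<nu> k) (acc.stop_payoff (\<nu> k) \<phi>' (q k) x) x w \<partial>P x)
      \<longlonglongrightarrow> (\<integral>w. lim.stop_op \<phi>' q' (\<phi> x) \<partial>P x)"
  proof (rule integral_dominated_convergence[where w = "\<lambda>_. B"])
    show "AE w in P x. (\<lambda>k. inner_mean (\<nu> k) (acc.stop_payoff (\<nu> k) \<phi>' (q k) x) x w) \<longlonglongrightarrow> lim.stop_op \<phi>' q' (\<phi> x)"
      using AE_regular[OF j] AE_flow_limit[OF j \<nu> tendsto_fst[OF q] T] AE_elapsed_limit[OF j \<nu>]
    proof eventually_elim
      case (elim w)
      have fl: "(\<lambda>k. flow (drive (\<nu> k) w) (fst (q k)) (max 0 (snd (q k)))) \<longlonglongrightarrow> flow (mean_drive (\<phi> x)) (fst q') (max 0 (snd q'))"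
        by (rule uniform_tendsto_moving[OF _ flow_continuous[OF avg_drift_field[OF j(1)]] t tT ev]) (use elim in blast)
      have el: "(\<lambda>k. elapsed (\<nu> k) w (max 0 (snd (q k)))) \<longlonglongrightarrow> mr (\<phi> x) * max 0 (snd q')"
        by (rule uniform_tendsto_moving[OF _ _ t tT ev]) (use elim in \<open>auto intro!: continuous_intros\<close>)
      have c: "isCont \<phi>' v" for v using \<phi>'(1) by (simp add: continuous_on_eq_continuous_at)
      have G: "isCont (cdf N) t" for t using cdf_continuous[of UNIV] by (simp add: continuous_on_eq_continuous_at)
      have "lim.stop_op \<phi>' q' (\<phi> x) = \<phi>' (flow (mean_drive (\<phi> x)) (fst q') (max 0 (snd q'))) * (1 - cdf N (mr (\<phi> x) * max 0 (snd q')))"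
        unfolding lim_stop_op[OF j(1) \<phi>m \<phi>'(2)] flow_max_0[OF avg_drift_field[OF j(1)]]
        using cumulated_max_0[of "\<lambda>_. mr (\<phi> x)" "snd q'"] cumulated_const[of "max 0 (snd q')" "mr (\<phi> x)"] by simp
      moreover have "(\<lambda>k. inner_mean (\<nu> k) (acc.stop_payoff (\<nu> k) \<phi>' (q k) x) x w)
          \<longlonglongrightarrow> \<phi>' (flow (mean_drive (\<phi> x)) (fst q') (max 0 (snd q'))) * (1 - cdf N (mr (\<phi> x) * max 0 (snd q')))"
        unfolding inner_mean_stop[OF j(1) elim(1) j(2)] flow_max_0[OF drive_field[OF j(1) elim(1)], symmetric, of _ _ "snd (q _)"]
          cumulated_max_0[symmetric, of _ "snd (q _)"]
        by (intro tendsto_intros isCont_tendsto_compose[OF c] isCont_tendsto_compose[OF G] fl el)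
      ultimately show ?case by simp
    qed
  qed (use a(2,3) in auto)
  then show "(\<lambda>k. acc.stop_op (\<nu> k) \<phi>' (q k) x) \<longlonglongrightarrow> lim.stop_op \<phi>' q' (\<phi> x)" by (simp add: a(1) prob_space)
qed

end

context clocked_model
begin

definition next_avg :: "((real^'d) \<times> real \<Rightarrow> 'i \<Rightarrow> real) \<Rightarrow> 'i \<Rightarrow> (real^'d) \<times> real \<Rightarrow> real" where
  "next_avg G j p = (\<integral>i. G p i \<partial>limit_next j)"

lemma next_avg:
  assumes j: "j \<in> space \<I>" and G: "lim.payoff_fun B G"
  shows "next_avg G j \<in> borel_measurable lim.phase" "\<bar>next_avg G j p\<bar> \<le> B"
proof -
  interpret n: prob_space "limit_next j" by (rule limit_next_prob[OF j])
  have Gm: "(\<lambda>(p, s). G p s) \<in> borel_measurable (lim.phase \<Otimes>\<^sub>M limit_next j)"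
    using G by (simp add: lim.payoff_fun_def measurable_cong_sets[OF sets_pair_measure_cong[OF refl limit_next_sets[OF j]] refl])
  from n.borel_measurable_lebesgue_integral[OF this] show m: "next_avg G j \<in> borel_measurable lim.phase"
    by (simp add: next_avg_def[abs_def])
  have le: "\<bar>G p i\<bar> \<le> B" if "i \<in> space (limit_next j)" for i
    using lim.payoff_fun_bound[OF G, of i p] that sets_eq_imp_space_eq[OF limit_next_sets[OF j]] by simp
  have "p \<in> space lim.phase" by (simp add: space_pair_measure)
  from measurable_compose[OF measurable_Pair1'[OF this] Gm] have "G p \<in> borel_measurable (limit_next j)" by simp
  then have i: "integrable (limit_next j) (G p)" by (intro n.integrable_const_bound[of _ B] AE_I2) (use le in auto)
  have "\<bar>next_avg G j p\<bar> \<le> (\<integral>i. \<bar>G p i\<bar> \<partial>limit_next j)" unfolding next_avg_def by (rule integral_abs_bound)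
  also have "\<dots> \<le> (\<integral>i. B \<partial>limit_next j)" by (rule integral_mono) (use i le in auto)
  finally show "\<bar>next_avg G j p\<bar> \<le> B" by (simp add: n.prob_space)
qed

text \<open>
  The form in which the limit of the accelerated operator is recognised: the same integrand, with constant rate \<open>mr j\<close>.
\<close>

lemma lim_jump_op_next:
  assumes j: "j \<in> space \<I>" and G: "lim.payoff_fun B G"
  shows "lim.jump_op G p j = (LBINT t:{0..snd p}. g (cumulated (\<lambda>_. mr j) t) * mr j *
    next_avg G j (flow (mean_drive j) (fst p) t, snd p - t))"
  unfolding lim_jump_op[OF j G] next_avg_def by (simp add: rate_mean_next[OF j G, symmetric] mult.assoc)

context
  fixes j :: 'i and H :: "nat \<Rightarrow> (real^'d) \<times> real \<Rightarrow> 'e \<Rightarrow> real" and G :: "(real^'d) \<times> real \<Rightarrow> 'i \<Rightarrow> real" and B :: real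
  assumes j: "j \<in> space \<I>" and H: "\<And>n. acc.payoff_fun B (H n)" and G: "lim.payoff_fun B G"
    and H_cont: "\<And>n y. y \<in> space \<E> \<Longrightarrow> continuous_on UNIV (\<lambda>p. H n p y)"
    and H_conv: "\<And>y. y \<in> space \<E> \<Longrightarrow> continuously_converges (\<lambda>n p. H n p y) (\<lambda>p. G p (\<phi> y))"
begin

lemma payoff_bound_nonneg: "0 \<le> B" using G by (simp add: lim.payoff_fun_def)

text \<open>
  Continuous convergence of the payoffs at each state is inherited by their averages under the jump kernel, and by the
  products with a continuous function of the cumulated rate.
\<close>

lemma jump_avg_converges:
  assumes c: "continuous_on UNIV c" and \<nu>: "filterlim \<nu> at_top sequentially" and y: "y \<in> space \<E>"
  shows "continuously_converges (\<lambda>k (u :: ((real^'d) \<times> real) \<times> real). c (snd u) * jump_avg (H (\<nu> k)) (fst u) y)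
      (\<lambda>u. c (snd u) * jump_avg (\<lambda>p y. G p (\<phi> y)) (fst u) y)"
    and "continuous_on UNIV (\<lambda>u :: ((real^'d) \<times> real) \<times> real. c (snd u) * jump_avg (H n) (fst u) y)"
proof -
  have cc: "isCont c a" for a using c by (simp add: continuous_on_eq_continuous_at)
  show "continuously_converges (\<lambda>k (u :: ((real^'d) \<times> real) \<times> real). c (snd u) * jump_avg (H (\<nu> k)) (fst u) y)
      (\<lambda>u. c (snd u) * jump_avg (\<lambda>p y. G p (\<phi> y)) (fst u) y)"
    unfolding continuously_converges_def
  proof (intro allI impI)
    fix m :: "nat \<Rightarrow> nat" and u :: "nat \<Rightarrow> ((real^'d) \<times> real) \<times> real" and u'
    assume m: "filterlim m at_top sequentially" and u: "u \<longlonglongrightarrow> u'"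
    have "(\<lambda>k. jump_avg (H (\<nu> (m k))) (fst (u k)) y) \<longlonglongrightarrow> jump_avg (\<lambda>p y. G p (\<phi> y)) (fst u') y"
    proof (rule jump_avg_tendsto[OF H lifted_payoff[OF G] y])
      fix y' assume "y' \<in> space \<E>"
      from H_conv[OF this] show "(\<lambda>k. H (\<nu> (m k)) (fst (u k)) y') \<longlonglongrightarrow> G (fst u') (\<phi> y')"
        using filterlim_compose[OF \<nu> m] tendsto_fst[OF u] unfolding continuously_converges_def by blast
    qed
    then show "(\<lambda>k. c (snd (u k)) * jump_avg (H (\<nu> (m k))) (fst (u k)) y) \<longlonglongrightarrow> c (snd u') * jump_avg (\<lambda>p y. G p (\<phi> y)) (fst u') y"
      by (intro tendsto_intros isCont_tendsto_compose[OF cc] tendsto_snd[OF u])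
  qed
  show "continuous_on UNIV (\<lambda>u :: ((real^'d) \<times> real) \<times> real. c (snd u) * jump_avg (H n) (fst u) y)"
  proof (rule continuous_at_imp_continuous_on, rule ballI)
    fix u' :: "((real^'d) \<times> real) \<times> real"
    show "isCont (\<lambda>u. c (snd u) * jump_avg (H n) (fst u) y) u'"
      unfolding continuous_at_sequentially comp_def
    proof (intro allI impI)
      fix u assume u: "u \<longlonglongrightarrow> u'"
      have "(\<lambda>k. jump_avg (H n) (fst (u k)) y) \<longlonglongrightarrow> jump_avg (H n) (fst u') y"
      proof (rule jump_avg_tendsto[OF H H y])
        fix y' assume "y' \<in> space \<E>"
        then have "isCont (\<lambda>p. H n p y') (fst u')" using H_cont[of y' n] by (simp add: continuous_on_eq_continuous_at del: split_paired_All)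
        then show "(\<lambda>k. H n (fst (u k)) y') \<longlonglongrightarrow> H n (fst u') y'"
          by (rule isCont_tendsto_compose) (rule tendsto_fst[OF u])
      qed
      then show "(\<lambda>k. c (snd (u k)) * jump_avg (H n) (fst (u k)) y) \<longlonglongrightarrow> c (snd u') * jump_avg (H n) (fst u') y"
        by (intro tendsto_intros isCont_tendsto_compose[OF cc] tendsto_snd[OF u])
    qed
  qed
qed

text \<open>
  The moving average theorem for the parameter consisting of slow variable, remaining time and cumulated rate. Its limit is
  \<open>(flow, r - t, t mr j)\<close>, and it is for this reason that a continuous function \<open>c\<close> stands in for the density: the cumulated rate
  is treated as one more parameter.
\<close>

lemma AE_jump_path_limit:
  assumes x: "x \<in> space (fibre D j)" and \<nu>: "filterlim \<nu> at_top sequentially" and qs: "qs \<longlonglongrightarrow> q'" and T: "0 \<le> T"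
    and c: "continuous_on UNIV c" "\<And>a. \<bar>c a\<bar> \<le> K"
  shows "AE w in P x. (\<lambda>k. LBINT t:{0..T}. c (elapsed (\<nu> k) w t) * rate_clock (\<nu> k) w t *
      jump_avg (H (\<nu> k)) (flow (drive (\<nu> k) w) (fst (qs k)) t, snd (qs k) - t) (fast (\<nu> k) t w))
    \<longlonglongrightarrow> (LBINT t:{0..T}. c (cumulated (\<lambda>_. mr j) t) * mr j * next_avg G j (flow (mean_drive j) (fst q') t, snd q' - t))"
proof -
  let ?H = "\<lambda>k (u :: ((real^'d) \<times> real) \<times> real) y. c (snd u) * jump_avg (H (\<nu> k)) (fst u) y"
  let ?G = "\<lambda>(u :: ((real^'d) \<times> real) \<times> real) y. c (snd u) * jump_avg (\<lambda>p y. G p (\<phi> y)) (fst u) y"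
  define q where "q t = ((flow (mean_drive j) (fst q') t, snd q' - t), mr j * t)" for t
  have fE: "y \<in> space \<E>" if "y \<in> space (fibre D j)" for y by (rule fibre_state[OF j that])
  have K: "0 \<le> K" using c(2)[of 0] by linarith
  have cm [measurable]: "c \<in> borel_measurable borel" using c(1) by (rule borel_measurable_continuous_onI)
  have bH: "\<bar>c a * jump_avg f p y\<bar> \<le> K * B" if "acc.payoff_fun B f" "y \<in> space (fibre D j)" for f a p y
    unfolding abs_mult by (intro mult_mono c jump_avg(2)[OF that(1) fE[OF that(2)]] K) simp
  \<comment> \<open>c (snd u) takes the cumulated rate, jump_avg f (fst u) the phase\<close>
  have joint: "(\<lambda>(u, y). c (snd u) * jump_avg f (fst u) y) \<in> borel_measurable ((lim.phase \<Otimes>\<^sub>M borel) \<Otimes>\<^sub>M \<E>)"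
    if "acc.payoff_fun B f" for f
  proof -
    have "(\<lambda>v. (fst (fst v), snd v)) \<in> (lim.phase \<Otimes>\<^sub>M borel) \<Otimes>\<^sub>M \<E> \<rightarrow>\<^sub>M lim.phase \<Otimes>\<^sub>M \<E>" by measurable
    from measurable_compose[OF this jump_avg(1)[OF that]]
    have [measurable]: "(\<lambda>v. jump_avg f (fst (fst v)) (snd v)) \<in> borel_measurable ((lim.phase \<Otimes>\<^sub>M borel) \<Otimes>\<^sub>M \<E>)" by simp
    show ?thesis unfolding split_beta' by measurable
  qed
  have slice: "(\<lambda>y. c (snd u) * jump_avg f (fst u) y) \<in> borel_measurable (\<mu> j)" if "acc.payoff_fun B f" for f u
  proof (rule mu_measurable[OF j])
    have "u \<in> space (lim.phase \<Otimes>\<^sub>M borel)" by (simp add: space_pair_measure)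
    from measurable_compose[OF measurable_Pair1'[OF this] joint[OF that]]
    show "(\<lambda>y. c (snd u) * jump_avg f (fst u) y) \<in> borel_measurable \<E>" by simp
  qed
  have q_cont: "continuous_on {0..T} q"
    unfolding q_def by (intro continuous_intros flow_continuous[OF avg_drift_field[OF j]])
  then have "bounded (q ` {0..T})" by (intro compact_imp_bounded compact_continuous_image) auto
  then obtain R0 where R0: "\<And>t. t \<in> {0..T} \<Longrightarrow> norm (q t) \<le> R0" unfolding bounded_iff by blast
  \<comment> \<open>a margin of 1, so that parameters uniformly close to the limit stay in the ball\<close>
  define R where "R = R0 + 1"
  have q_bnd: "norm (q t) < R" if "t \<in> {0..T}" for t using R0[OF that] by (simp add: R_def)
  have Rpos: "0 < R" using le_less_trans[OF norm_ge_zero q_bnd[of 0]] T by simp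
  have cc: "continuously_converges (\<lambda>k u. ?H k u y) (\<lambda>u. ?G u y)" "continuous_on UNIV (\<lambda>u. ?H k u y)"
    if "y \<in> space (fibre D j)" for y k
    using jump_avg_converges[OF c(1) \<nu> fE[OF that]] by simp_all
  let ?osc = "\<lambda>N y. osc (\<lambda>k u. ?H k u y) (\<lambda>u. ?G u y) R N"
  have osc_m: "?osc N \<in> borel_measurable (\<mu> j)" for N
    by (rule osc_borel_measurable[OF _ _ _ _ _ Rpos])
      (use slice[OF H] slice[OF lifted_payoff[OF G]] cc bH[OF H] in \<open>auto simp: mu_space[OF j]\<close>)
  have osc_b: "\<bar>?osc N y\<bar> \<le> 2 * (K * B)" if "y \<in> space (fibre D j)" for N y
    using osc_nonneg[OF cc[OF that] bH[OF H that] Rpos] osc_le[OF cc[OF that] bH[OF H that] Rpos] by simp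
  have av1: "AE w in P x. \<forall>N. averages (\<lambda>k s. fast (\<nu> k) s w) (\<lambda>y. rate D y * ?osc N y) (\<integral>y. rate D y * ?osc N y \<partial>\<mu> j)"
    unfolding AE_all_countable using AE_averages_bounded(2)[OF j x osc_m osc_b \<nu>] by blast
  have "countable ({0..T} \<inter> \<rat>)" by (rule countable_subset[OF _ countable_rat]) auto
  note cnt = AE_ball_countable[OF this]
  have av2: "AE w in P x. \<forall>s\<in>{0..T} \<inter> \<rat>.
      averages (\<lambda>k s. fast (\<nu> k) s w) (\<lambda>y. rate D y * ?G (q s) y) (\<integral>y. rate D y * ?G (q s) y \<partial>\<mu> j)"
    unfolding cnt
    using AE_averages_bounded(2)[OF j x slice[OF lifted_payoff[OF G]] bH[OF lifted_payoff[OF G]] \<nu>] by blast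
  have av0: "AE w in P x. averages (\<lambda>k s. fast (\<nu> k) s w) (rate D) (mr j)"
    unfolding mean_rate_def
    by (rule AE_averages[OF j x mu_measurable[OF j rate_meas] _ _ \<nu>, of 1])
      (use rate_nonneg[OF fibre_state[OF j]] in auto)
  from AE_regular[OF j x] av0 av1 av2 AE_flow_limit[OF j x \<nu> tendsto_fst[OF qs] T] AE_elapsed_limit[OF j x \<nu>] show ?thesis
  proof eventually_elim
    case (elim w)
    let ?p = "\<lambda>k t. ((flow (drive (\<nu> k) w) (fst (qs k)) t, snd (qs k) - t), elapsed (\<nu> k) w t)"
    have close: "\<forall>\<^sub>F k in sequentially. \<forall>t\<in>{0..T}. dist (?p k t) (q t) < e" if "0 < e" for e
    proof -
      have e3: "0 < e / 3" using that by simp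
      from elim(5) e3 have 1: "\<forall>\<^sub>F k in sequentially. \<forall>t\<in>{0..T}. norm (flow (drive (\<nu> k) w) (fst (qs k)) t - flow (mean_drive j) (fst q') t) < e / 3"
        by blast
      from elim(6) e3 have 2: "\<forall>\<^sub>F k in sequentially. \<forall>t\<in>{0..T}. norm (elapsed (\<nu> k) w t - mr j * t) < e / 3" by blast
      from tendstoD[OF tendsto_snd[OF qs] e3] 1 2 show ?thesis
      proof eventually_elim
        case (elim k)
        show ?case
        proof
          fix t assume t: "t \<in> {0..T}"
          have "dist (?p k t) (q t) \<le> (dist (flow (drive (\<nu> k) w) (fst (qs k)) t) (flow (mean_drive j) (fst q') t)
              + dist (snd (qs k) - t) (snd q' - t)) + dist (elapsed (\<nu> k) w t) (mr j * t)"
            unfolding q_def by (rule order_trans[OF dist_Pair_le add_right_mono[OF dist_Pair_le]])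
          moreover have "dist (snd (qs k) - t) (snd q' - t) = dist (snd (qs k)) (snd q')" by (simp add: dist_norm)
          moreover have "norm (flow (drive (\<nu> k) w) (fst (qs k)) t - flow (mean_drive j) (fst q') t) < e / 3"
            "norm (elapsed (\<nu> k) w t - mr j * t) < e / 3" using elim(2,3) t by blast+
          ultimately show "dist (?p k t) (q t) < e" using elim(1) by (simp add: dist_norm)
        qed
      qed
    qed
    \<comment> \<open>the moving parameter stays in the ball only for large k; earlier it is replaced by its limit,
      which does not affect the convergence\<close>
    define p where "p k = (if \<forall>t\<in>{0..T}. norm (?p k t) < R then ?p k else q)" for k
    have p_eq: "\<forall>\<^sub>F k in sequentially. p k = ?p k"
      using close[OF zero_less_one]
    proof eventually_elim
      case (elim k)
      have "norm (?p k t) < R" if t: "t \<in> {0..T}" for t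
        using norm_triangle_sub[of "?p k t" "q t"] elim t R0[OF t] by (force simp: dist_norm R_def)
      then show ?case by (simp add: p_def)
    qed
    have p_meas: "p k \<in> borel \<rightarrow>\<^sub>M lim.phase \<Otimes>\<^sub>M borel" for k
    proof -
      note [measurable] = flow_time_measurable[OF avg_drift_field[OF j]] flow_time_measurable[OF drive_field[OF j elim(1)]]
        cumulated_measurable[OF rate_path_fast[OF j elim(1)]]
      have "?p k \<in> borel \<rightarrow>\<^sub>M lim.phase \<Otimes>\<^sub>M borel" "q \<in> borel \<rightarrow>\<^sub>M lim.phase \<Otimes>\<^sub>M borel"
        unfolding q_def by measurable
      then show ?thesis by (simp add: p_def)
    qed
    interpret moving_average "\<mu> j" "\<lambda>k s. fast (\<nu> k) s w" "rate D" ?H ?G p q R "K * B" T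
    proof
      show "0 \<le> T" by (rule T)
      show "0 < R" by (rule Rpos)
      show "fast (\<nu> n) s w \<in> space (\<mu> j)" for n s using regular_fast[OF elim(1)] by (simp add: mu_space[OF j])
      show "integrable (\<mu> j) (rate D)" by (rule integrable_rate[OF j])
      show "0 \<le> rate D y" if "y \<in> space (\<mu> j)" for y using that by (simp add: mu_space[OF j] rate_nonneg fE)
      show "?H n u \<in> borel_measurable (\<mu> j)" "?G u \<in> borel_measurable (\<mu> j)" for n u
        by (rule slice[OF H], rule slice[OF lifted_payoff[OF G]])
      show "continuous_on UNIV (\<lambda>u. ?H n u y)" "continuously_converges (\<lambda>n u. ?H n u y) (\<lambda>u. ?G u y)"
        "\<bar>?H n u y\<bar> \<le> K * B" if "y \<in> space (\<mu> j)" for n y u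
        using cc bH[OF H] that by (simp_all add: mu_space[OF j])
      show "continuous_on {0..T} q" by (rule q_cont)
      show "norm (q t) < R" if "t \<in> {0..T}" for t by (rule q_bnd[OF that])
      show "norm (p n t) < R" if "t \<in> {0..T}" for t n using q_bnd[OF that] that by (auto simp: p_def)
      show "\<forall>\<^sub>F n in sequentially. \<forall>t\<in>{0..T}. dist (p n t) (q t) < e" if "0 < e" for e
        using close[OF that] p_eq by eventually_elim simp
      show "(\<lambda>s. indicator {0..T} s * ?H n (p n s) (fast (\<nu> n) s w)) \<in> borel_measurable borel" for n
      proof -
        have [measurable]: "(\<lambda>s. fast (\<nu> n) s w) \<in> borel \<rightarrow>\<^sub>M \<E>"
          using elim(1) by (intro path_measurable) (simp add: regular_def)
        have [measurable]: "(\<lambda>s. ?H n (p n s) (fast (\<nu> n) s w)) \<in> borel_measurable borel"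
          using measurable_compose[OF measurable_Pair[OF p_meas[of n] \<open>(\<lambda>s. fast (\<nu> n) s w) \<in> borel \<rightarrow>\<^sub>M \<E>\<close>] joint[OF H]] by simp
        show ?thesis by measurable
      qed
      show "averages (\<lambda>k s. fast (\<nu> k) s w) (rate D) (integral\<^sup>L (\<mu> j) (rate D))" using elim(2) by (simp add: mean_rate_def)
      show "averages (\<lambda>k s. fast (\<nu> k) s w) (\<lambda>y. rate D y * ?osc N y) (\<integral>y. rate D y * ?osc N y \<partial>\<mu> j)" for N
        using elim(3) by blast
      show "averages (\<lambda>k s. fast (\<nu> k) s w) (\<lambda>y. rate D y * ?G (q s) y) (\<integral>y. rate D y * ?G (q s) y \<partial>\<mu> j)"
        if "s \<in> \<rat>" "s \<in> {0..T}" for s using elim(4) that by blast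
    qed
    have "(\<lambda>k. LBINT t:{0..T}. rate D (fast (\<nu> k) t w) * ?H k (p k t) (fast (\<nu> k) t w))
        \<longlonglongrightarrow> (LBINT t:{0..T}. \<integral>y. rate D y * ?G (q t) y \<partial>\<mu> j)"
      by (rule moving_average_tendsto) (use T in auto)
    moreover have "(\<integral>y. rate D y * ?G (q t) y \<partial>\<mu> j) = c (cumulated (\<lambda>_. mr j) t) * mr j * next_avg G j (flow (mean_drive j) (fst q') t, snd q' - t)"
      if "t \<in> {0..T}" for t
    proof -
      have "(\<integral>y. rate D y * ?G (q t) y \<partial>\<mu> j) = (\<integral>y. c (mr j * t) * (rate D y * jump_avg (\<lambda>p y. G p (\<phi> y)) (fst (q t)) y) \<partial>\<mu> j)"
        by (intro Bochner_Integration.integral_cong refl) (simp add: q_def mult_ac)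
      also have "\<dots> = c (mr j * t) * (mr j * next_avg G j (fst (q t)))"
        by (simp add: next_avg_def rate_mean_next[OF j G])
      finally show ?thesis using that by (simp add: q_def cumulated_const mult_ac)
    qed
    then have "(LBINT t:{0..T}. \<integral>y. rate D y * ?G (q t) y \<partial>\<mu> j)
        = (LBINT t:{0..T}. c (cumulated (\<lambda>_. mr j) t) * mr j * next_avg G j (flow (mean_drive j) (fst q') t, snd q' - t))"
      by (intro set_lebesgue_integral_cong) auto
    moreover have "\<forall>\<^sub>F k in sequentially. (LBINT t:{0..T}. rate D (fast (\<nu> k) t w) * ?H k (p k t) (fast (\<nu> k) t w))
        = (LBINT t:{0..T}. c (elapsed (\<nu> k) w t) * rate_clock (\<nu> k) w t *
            jump_avg (H (\<nu> k)) (flow (drive (\<nu> k) w) (fst (qs k)) t, snd (qs k) - t) (fast (\<nu> k) t w))"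
      using p_eq by eventually_elim (simp add: mult_ac)
    ultimately show ?case by (auto elim: Lim_transform_eventually)
  qed
qed

text \<open>
  Three replacements along almost every path: the moving upper limit of integration by its limit, the density by continuous
  functions, and the path integral by its ergodic limit. The first costs at most the \<open>G\<close>-mass of the clock between the two end
  points, which tends to 0 as \<open>G\<close> is continuous.
\<close>

lemma jump_converges:
  assumes x: "x \<in> space (fibre D j)"
  shows "continuously_converges (\<lambda>n p. acc.jump_op n (H n) p x) (\<lambda>p. lim.jump_op G p j)"
  unfolding continuously_converges_def
proof (intro allI impI)
  fix \<nu> :: "nat \<Rightarrow> nat" and qs :: "nat \<Rightarrow> (real^'d) \<times> real" and q'
  assume \<nu>: "filterlim \<nu> at_top sequentially" and qs: "qs \<longlonglongrightarrow> q'"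
  note a = acc_jump_op[OF j x H]
  interpret prob_space "P x" by (rule P_prob[OF fibre_state[OF j x]])
  define T where "T = max 0 (snd q')"
  have T: "0 \<le> T" by (simp add: T_def)
  have t: "(\<lambda>k. max 0 (snd (qs k))) \<longlonglongrightarrow> T" unfolding T_def by (intro tendsto_intros tendsto_snd[OF qs])
  have tT: "T \<in> {0..T + 1}" using T by simp
  have ev: "\<forall>\<^sub>F k in sequentially. max 0 (snd (qs k)) \<in> {0..T + 1}"
    using order_tendstoD(2)[OF t, of "T + 1"] by (auto elim: eventually_mono)
  have "\<exists>c K. continuous_on UNIV c \<and> (\<forall>a. \<bar>c a\<bar> \<le> K) \<and> integrable lborel c \<and> (\<integral>a. \<bar>g a - c a\<bar> \<partial>lborel) < 1 / real (Suc i)" for i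
    by (rule integrable_continuous_approximation[OF g_integrable]) simp
  then obtain c K where c: "\<And>i. continuous_on UNIV (c i)" "\<And>i a. \<bar>c i a\<bar> \<le> K i" "\<And>i. integrable lborel (c i)"
      "\<And>i. (\<integral>a. \<bar>g a - c i a\<bar> \<partial>lborel) < 1 / real (Suc i)"
    by metis
  have c0: "(\<lambda>i. \<integral>a. \<bar>g a - c i a\<bar> \<partial>lborel) \<longlonglongrightarrow> 0"
  proof (rule tendsto_sandwich[OF _ _ tendsto_const LIMSEQ_inverse_real_of_nat])
    show "\<forall>\<^sub>F i in sequentially. (\<integral>a. \<bar>g a - c i a\<bar> \<partial>lborel) \<le> inverse (real (Suc i))"
      using less_imp_le[OF c(4)] by (simp add: inverse_eq_divide)
  qed simp
  let ?\<Phi>' = "\<lambda>t. next_avg G j (flow (mean_drive j) (fst q') t, snd q' - t)"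
  have rp': "rate_path (\<lambda>_. mr j)" by (rule rate_path_const[OF mr_nonneg[OF j]])
  have \<Phi>'m: "?\<Phi>' \<in> borel_measurable borel"
  proof -
    note [measurable] = flow_time_measurable[OF avg_drift_field[OF j]]
    have "(\<lambda>t. (flow (mean_drive j) (fst q') t, snd q' - t)) \<in> borel \<rightarrow>\<^sub>M lim.phase" by measurable
    from measurable_compose[OF this next_avg(1)[OF j G]] show ?thesis .
  qed
  have endpoint: "\<bar>(LBINT t:{0..r}. g (cumulated \<beta> t) * \<beta> t * \<Phi> t) - (LBINT t:{0..r'}. g (cumulated \<beta> t) * \<beta> t * \<Phi> t)\<bar>
      \<le> B * \<bar>cdf N (cumulated \<beta> r) - cdf N (cumulated \<beta> r')\<bar>"
    if "rate_path \<beta>" "\<Phi> \<in> borel_measurable borel" "\<And>t. \<bar>\<Phi> t\<bar> \<le> B" for \<beta> \<Phi> r r'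
    unfolding density_substitution(2)[OF that(1), symmetric]
  proof (rule set_integral_endpoint_difference[OF _ density_substitution(1)[OF that(1)] _ payoff_bound_nonneg])
    show "set_integrable lborel {0..t} (\<lambda>s. g (cumulated \<beta> s) * \<beta> s * \<Phi> s)" for t
      by (rule cumulated_weighted_bound(1)[OF that(1) g_integrable that(2,3) payoff_bound_nonneg])
    show "\<bar>g (cumulated \<beta> s) * \<beta> s * \<Phi> s\<bar> \<le> B * (g (cumulated \<beta> s) * \<beta> s)" for s
    proof -
      have 0: "0 \<le> g (cumulated \<beta> s) * \<beta> s" using g_nonneg rate_path_nonneg[OF that(1)] by simp
      show ?thesis
        unfolding abs_mult[of "g (cumulated \<beta> s) * \<beta> s"] abs_of_nonneg[OF 0] mult.commute[of B]
        by (rule mult_left_mono[OF that(3) 0])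
    qed
  qed
  have lim_eq: "lim.jump_op G q' j = (LBINT t:{0..T}. g (cumulated (\<lambda>_. mr j) t) * mr j * ?\<Phi>' t)"
    using endpoint[OF rp' \<Phi>'m next_avg(2)[OF j G], of "snd q'" T]
    by (simp add: lim_jump_op_next[OF j G] T_def cumulated_max_0)
  have "(\<lambda>k. \<integral>w. inner_mean (\<nu> k) (acc.jump_payoff (\<nu> k) (H (\<nu> k)) (qs k) x) x w \<partial>P x)
      \<longlonglongrightarrow> (\<integral>w. lim.jump_op G q' j \<partial>P x)"
  proof (rule integral_dominated_convergence[where w = "\<lambda>_. B"])
    have "AE w in P x. \<forall>i. (\<lambda>k. LBINT t:{0..T}. c i (elapsed (\<nu> k) w t) * rate_clock (\<nu> k) w t *
        jump_avg (H (\<nu> k)) (flow (drive (\<nu> k) w) (fst (qs k)) t, snd (qs k) - t) (fast (\<nu> k) t w))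
      \<longlonglongrightarrow> (LBINT t:{0..T}. c i (cumulated (\<lambda>_. mr j) t) * mr j * ?\<Phi>' t)"
      unfolding AE_all_countable using AE_jump_path_limit[OF x \<nu> qs T c(1,2)] by blast
    with AE_regular[OF j x] AE_elapsed_limit[OF j x \<nu>]
    show "AE w in P x. (\<lambda>k. inner_mean (\<nu> k) (acc.jump_payoff (\<nu> k) (H (\<nu> k)) (qs k) x) x w) \<longlonglongrightarrow> lim.jump_op G q' j"
    proof eventually_elim
      case (elim w)
      let ?\<Phi> = "\<lambda>k t. jump_avg (H (\<nu> k)) (flow (drive (\<nu> k) w) (fst (qs k)) t, snd (qs k) - t) (fast (\<nu> k) t w)"
      let ?I = "\<lambda>k r. LBINT t:{0..r}. g (elapsed (\<nu> k) w t) * rate_clock (\<nu> k) w t * ?\<Phi> k t"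
      note rp = rate_path_fast[OF j elim(1)]
      have \<Phi>m: "?\<Phi> k \<in> borel_measurable borel" for k by (rule jump_avg_path_measurable[OF j elim(1) H])
      have \<Phi>b: "\<bar>?\<Phi> k t\<bar> \<le> B" for k t by (rule jump_avg(2)[OF H regular_states(2)[OF j elim(1)]])
      have main: "(\<lambda>k. ?I k T) \<longlonglongrightarrow> lim.jump_op G q' j"
        unfolding lim_eq
        by (rule weighted_limit[where \<beta> = "\<lambda>k. rate_clock (\<nu> k) w" and \<beta>' = "\<lambda>_. mr j", OF rp rp' \<Phi>m \<Phi>'m \<Phi>b next_avg(2)[OF j G] c(3) c0])
          (use elim(3) in blast)
      have u: "\<forall>\<^sub>F k in sequentially. \<forall>t\<in>{0..T + 1}. norm (elapsed (\<nu> k) w t - mr j * t) < e" if "0 < e" for e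
        using elim(2) that by blast
      have mc: "continuous_on {0..T + 1} (\<lambda>t. mr j * t)" by (intro continuous_intros)
      have e1: "(\<lambda>k. elapsed (\<nu> k) w (max 0 (snd (qs k)))) \<longlonglongrightarrow> mr j * T"
        by (rule uniform_tendsto_moving[OF u mc t tT ev])
      have e2: "(\<lambda>k. elapsed (\<nu> k) w T) \<longlonglongrightarrow> mr j * T"
        by (rule uniform_tendsto_moving[OF u mc tendsto_const tT]) (use tT in auto)
      have G: "isCont (cdf N) t" for t using cdf_continuous[of UNIV] by (simp add: continuous_on_eq_continuous_at)
      have "(\<lambda>k. B * \<bar>cdf N (elapsed (\<nu> k) w (max 0 (snd (qs k)))) - cdf N (elapsed (\<nu> k) w T)\<bar>)
          \<longlonglongrightarrow> B * \<bar>cdf N (mr j * T) - cdf N (mr j * T)\<bar>"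
        by (intro tendsto_intros isCont_tendsto_compose[OF G] e1 e2)
      then have z: "(\<lambda>k. B * \<bar>cdf N (elapsed (\<nu> k) w (snd (qs k))) - cdf N (elapsed (\<nu> k) w T)\<bar>) \<longlonglongrightarrow> 0"
        by (simp add: cumulated_max_0)
      have "(\<lambda>k. ?I k (snd (qs k)) - ?I k T) \<longlonglongrightarrow> 0"
        by (rule Lim_null_comparison[OF _ z]) (use endpoint[OF rp \<Phi>m \<Phi>b] in simp)
      from tendsto_add[OF this main] show ?case
        unfolding inner_mean_jump[OF j elim(1) x H] by simp
    qed
  qed (use a(2,3) in auto)
  then show "(\<lambda>k. acc.jump_op (\<nu> k) (H (\<nu> k)) (qs k) x) \<longlonglongrightarrow> lim.jump_op G q' j" by (simp add: a(1) prob_space)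
qed

end

text \<open>
  Induction on the number of jumps. The induction hypothesis is continuous convergence at every state, and the continuity of the
  functions at each \<open>n\<close> is carried along.
\<close>

theorem iterated_payoffs_converge:
  assumes f: "continuous_on UNIV f" "\<And>v. \<bar>f v\<bar> \<le> B" and y: "y \<in> space \<E>"
  shows "continuously_converges (\<lambda>n p. (acc.jump_op n ^^ l) (acc.stop_op n f) p y)
    (\<lambda>p. (lim.jump_op ^^ l) (lim.stop_op f) p (\<phi> y))"
proof -
  have fm: "f \<in> borel_measurable borel" using f(1) by (rule borel_measurable_continuous_onI)
  have H: "acc.payoff_fun B ((acc.jump_op n ^^ l) (acc.stop_op n f))" for n l
    by (rule acc.jump_op_funpow_payoff_fun[OF acc.stop_op_payoff_fun[OF fm f(2)]])
  have G: "lim.payoff_fun B ((lim.jump_op ^^ l) (lim.stop_op f))" for l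
    by (rule lim.jump_op_funpow_payoff_fun[OF lim.stop_op_payoff_fun[OF fm f(2)]])
  have cont: "continuous_on UNIV (\<lambda>p. (acc.jump_op n ^^ l) (acc.stop_op n f) p y)" if "y \<in> space \<E>" for n l y
    using that
  proof (induction l arbitrary: y)
    case 0
    then show ?case using acc_stop_continuous[OF _ f] by simp
  next
    case (Suc l)
    then show ?case using acc_jump_continuous[OF Suc.prems H Suc.IH] by simp
  qed
  show ?thesis
    using y
  proof (induction l arbitrary: y)
    case 0
    then show ?case using stop_converges[OF _ f] by simp
  next
    case (Suc l)
    show ?case
      using jump_converges[OF state_index(1)[OF Suc.prems] H G cont Suc.IH state_index(2)[OF Suc.prems]] by simp
  qed
qed

end


section \<open>Convergence of the slow variable\<close>

lemma C1_bounded_continuous: "C1_bounded f \<Longrightarrow> continuous_on UNIV f"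
  unfolding C1_bounded_def by (meson continuous_at_imp_continuous_on has_derivative_continuous)

lemma Least_between:
  fixes \<tau> :: "nat \<Rightarrow> ennreal"
  assumes mono: "\<And>j. \<tau> j \<le> \<tau> (Suc j)" and t: "\<tau> l \<le> t" "t < \<tau> (Suc l)"
  shows "(LEAST k. t < \<tau> (Suc k)) = l" "t < (SUP k. \<tau> k)"
proof -
  have m: "\<tau> i \<le> \<tau> j" if "i \<le> j" for i j using that by (rule lift_Suc_mono_le[of \<tau>, OF mono])
  show "(LEAST k. t < \<tau> (Suc k)) = l"
  proof (rule Least_equality)
    fix k assume "t < \<tau> (Suc k)"
    then have "\<not> Suc k \<le> l" using m[of "Suc k" l] t(1) by (meson leD le_less_trans order_trans)
    then show "l \<le> k" by simp
  qed (rule t)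
  show "t < (SUP k. \<tau> k)" using t(2) by (auto simp: less_SUP_iff)
qed

context clocked_model
begin

text \<open>
  Between two transition times the accelerated process runs through the fast path of the current piece, and its index is read
  off the position.
\<close>

theorem accelerated_expectation:
  assumes x: "x \<in> space \<E>" and T: "0 < T" and sol: "slow_solution D F n x z Z"
    and f: "f \<in> borel_measurable borel" "\<And>v. \<bar>f v\<bar> \<le> B"
  shows "(\<integral>h. f (Z T h) * indicator {h. ennreal T \<le> accel_time D n k h} h \<partial>accel_law D n x)
    = (\<Sum>l<k. (acc.jump_op n ^^ l) (acc.stop_op n f) (z, T) x)"
proof -
  have time: "accel_time D n l h = (\<Sum>i<l. accel_hold D n (fst (h i)) (fst (snd (h i))))" for l h
    by (simp add: accel_time_def split_beta')
  have chain: "accel_law D n x = acc.chain n x" by (simp add: accel_law_def)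
  show ?thesis
    unfolding chain
  proof (rule acc.pieced_expectation[OF x T f, where \<tau> = "\<lambda>h l. accel_time D n l h"
        and drv = "\<lambda>h s v. F (the (accel_index D n s h)) v (the (accel_proc D n s h))"])
    show "Z T \<in> borel_measurable (acc.chain n x)"
      using sol T by (simp add: slow_solution_def chain)
    show "AE h in acc.chain n x. solves_until (\<lambda>s v. F (the (accel_index D n s h)) v (the (accel_proc D n s h))) z
        (SUP l. accel_time D n l h) (\<lambda>t. Z t h)"
      using sol unfolding slow_solution_def chain accel_lifetime_def by blast
    show "accel_time D n l h = (\<Sum>i<l. accel_hold D n (fst (h i)) (fst (snd (h i))))" for l h by (rule time)
    fix h l t v
    assume t: "0 \<le> t" "accel_time D n l h \<le> ennreal t" "ennreal t < accel_time D n (Suc l) h"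
    have mono: "accel_time D n j h \<le> accel_time D n (Suc j) h" for j by (simp add: time)
    note L = Least_between[of "\<lambda>l. accel_time D n l h", OF mono t(2,3)]
    have fin: "accel_time D n l h < \<infinity>" using t(2) by (rule le_less_trans) simp
    have "enn2real (accel_time D n l h) \<le> t" using t by (simp add: enn2real_leI)
    then have "accel_proc D n t h = Some (fast n (t - enn2real (accel_time D n l h)) (fst (h l)))"
      using L by (simp add: accel_proc_def accel_lifetime_def fast_def)
    then show "F (the (accel_index D n t h)) v (the (accel_proc D n t h))
        = speed v (fast n (t - enn2real (accel_time D n l h)) (fst (h l)))"
      by (simp add: accel_index_def speed_def)
  qed
qed

theorem limiting_expectation:
  assumes i: "i \<in> space \<I>" and T: "0 < T" and sol: "avg_solution D \<mu> F i z Z"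
    and f: "f \<in> borel_measurable borel" "\<And>v. \<bar>f v\<bar> \<le> B"
  shows "(\<integral>h. f (Z T h) * indicator {h. ennreal T \<le> limit_time D \<mu> i k h} h \<partial>limit_law D \<mu> i)
    = (\<Sum>l<k. (lim.jump_op ^^ l) (lim.stop_op f) (z, T) i)"
proof -
  have chain: "limit_law D \<mu> i = lim.chain i" by (simp add: limit_law_def)
  show ?thesis
    unfolding chain
  proof (rule lim.pieced_expectation[OF i T f, where \<tau> = "\<lambda>h l. limit_time D \<mu> i l h"
        and drv = "\<lambda>h s v. avg_drift \<mu> F (the (limit_index D \<mu> i s h)) v"])
    show "Z T \<in> borel_measurable (lim.chain i)"
      using sol T by (simp add: avg_solution_def chain)
    show "AE h in lim.chain i. solves_until (\<lambda>s v. avg_drift \<mu> F (the (limit_index D \<mu> i s h)) v) z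
        (SUP l. limit_time D \<mu> i l h) (\<lambda>t. Z t h)"
      using sol unfolding avg_solution_def chain limit_lifetime_def by blast
    show "limit_time D \<mu> i l h = (\<Sum>j<l. limit_hold D \<mu> (state_before snd i h j) (fst (h j)))" for l h
      by (simp add: limit_time_def)
    fix h l t v
    assume t: "0 \<le> t" "limit_time D \<mu> i l h \<le> ennreal t" "ennreal t < limit_time D \<mu> i (Suc l) h"
    have mono: "limit_time D \<mu> i j h \<le> limit_time D \<mu> i (Suc j) h" for j by (simp add: limit_time_def)
    note L = Least_between[of "\<lambda>l. limit_time D \<mu> i l h", OF mono t(2,3)]
    show "avg_drift \<mu> F (the (limit_index D \<mu> i t h)) v = avg_drift \<mu> F (state_before snd i h l) v"
      using L by (simp add: limit_index_def limit_lifetime_def)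
  qed
qed

end

theorem theorem3:
  fixes D :: "('i, 'e, 'w) accel_data"
    and \<mu> :: "'i \<Rightarrow> 'e measure"
    and F :: "'i \<Rightarrow> real^'d \<Rightarrow> 'e \<Rightarrow> real^'d"
    and i :: 'i and x :: 'e and z :: "real^'d" and T :: real
    and Z :: "nat \<Rightarrow> real \<Rightarrow> (nat \<Rightarrow> 'w \<times> real \<times> 'e) \<Rightarrow> real^'d"
    and Zbar :: "real \<Rightarrow> (nat \<Rightarrow> real \<times> 'i) \<Rightarrow> real^'d"
    and f :: "real^'d \<Rightarrow> real" and k :: nat
  assumes setting: "accel_setting D"
    and F_measurable: "\<And>j. j \<in> space (index_space D) \<Longrightarrow>
      (\<lambda>(y, v). F j y v) \<in> borel \<Otimes>\<^sub>M state_space D \<rightarrow>\<^sub>M borel"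
    and mu_prob: "\<And>j. j \<in> space (index_space D) \<Longrightarrow> prob_space (\<mu> j)"
    and mu_sets: "\<And>j. j \<in> space (index_space D) \<Longrightarrow> sets (\<mu> j) = sets (fibre D j)"
    and mu_kernel: "(\<lambda>j. distr (\<mu> j) (state_space D) (\<lambda>v. v))
      \<in> index_space D \<rightarrow>\<^sub>M prob_algebra (state_space D)"
    and ergodic: "\<And>j h v. j \<in> space (index_space D) \<Longrightarrow> h \<in> ergodic_class D \<mu> j \<Longrightarrow>
      v \<in> space (fibre D j) \<Longrightarrow>
      AE w in base_law D v.
        ((\<lambda>t. 1 / t * (LBINT s:{0..t}. h (base_proc D s w))) \<longlongrightarrow> (\<integral>u. h u \<partial>\<mu> j)) at_top"
    and rate_UI: "\<And>t v. 0 \<le> t \<Longrightarrow> v \<in> space (state_space D) \<Longrightarrow>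
      uniformly_integrable (base_law D v) {1..}
        (\<lambda>n w. ennreal (1 / real n) *
          (\<integral>\<^sup>+s\<in>{0..real n * t}. ennreal (rate D (base_proc D s w)) \<partial>lborel))"
    and averaging: "\<And>j y v S. j \<in> space (index_space D) \<Longrightarrow> v \<in> space (fibre D j) \<Longrightarrow> 0 < S \<Longrightarrow>
      (\<lambda>n. SUP t\<in>{0<..}. \<integral>\<^sup>+w.
          ennreal (norm ((1 / S) *\<^sub>R (LBINT s:{t..t + S}. F j y (base_proc D (real n * s) w))
            - avg_drift \<mu> F j y)) \<partial>base_law D v) \<longlonglongrightarrow> 0"
    and bounded_at_0: "\<And>j. j \<in> space (index_space D) \<Longrightarrow>
      (SUP v\<in>space (fibre D j). ennreal (norm (F j 0 v))) < \<infinity>"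
    and lipschitz: "\<And>j. j \<in> space (index_space D) \<Longrightarrow>
      \<exists>L. \<forall>v\<in>space (fibre D j). L-lipschitz_on UNIV (\<lambda>y. F j y v)"
    and i: "i \<in> space (index_space D)"
    and x: "x \<in> space (fibre D i)"
    and T: "0 < T"
    and Z: "\<And>n. 1 \<le> n \<Longrightarrow> slow_solution D F n x z (Z n)"
    and Zbar: "avg_solution D \<mu> F i z Zbar"
    and f: "C1_bounded f"
    and k: "1 \<le> k"
  shows "(\<lambda>n. \<integral>h. f (Z n T h) * indicator {h. ennreal T \<le> accel_time D n k h} h \<partial>accel_law D n x)
    \<longlonglongrightarrow> (\<integral>h. f (Zbar T h) * indicator {h. ennreal T \<le> limit_time D \<mu> i k h} h \<partial>limit_law D \<mu> i)"
proof -
  have "abs_cont_cdf (clock_cdf D)" using setting by (simp add: accel_setting_def)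
  then obtain N g where "clock N g" and cdf: "\<And>t. 0 \<le> t \<Longrightarrow> clock_cdf D t = cdf N t"
    using abs_cont_cdf_clock by blast
  interpret clocked_model D \<mu> F N g
    by (intro clocked_model.intro averaging_model.intro clocked_model_axioms.intro)
      (fact setting F_measurable mu_prob mu_sets mu_kernel ergodic rate_UI bounded_at_0 lipschitz cdf \<open>clock N g\<close>)+
  have fc: "continuous_on UNIV f" using f by (rule C1_bounded_continuous)
  then have fm: "f \<in> borel_measurable borel" by (rule borel_measurable_continuous_onI)
  obtain B where B: "\<And>v. \<bar>f v\<bar> \<le> B" using f by (auto simp: C1_bounded_def bounded_iff)
  have xE: "x \<in> space \<E>" and ix: "\<phi> x = i" by (rule fibre_state[OF i x], rule index_map_fibre[OF i x])
  have "(\<lambda>n. \<Sum>l<k. (acc.jump_op n ^^ l) (acc.stop_op n f) (z, T) x)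
      \<longlonglongrightarrow> (\<Sum>l<k. (lim.jump_op ^^ l) (lim.stop_op f) (z, T) i)"
    by (intro tendsto_sum, fold ix)
      (rule continuously_converges_pointwise[OF iterated_payoffs_converge[OF fc B xE]])
  moreover have "\<forall>\<^sub>F n in sequentially. (\<Sum>l<k. (acc.jump_op n ^^ l) (acc.stop_op n f) (z, T) x)
      = (\<integral>h. f (Z n T h) * indicator {h. ennreal T \<le> accel_time D n k h} h \<partial>accel_law D n x)"
    using eventually_ge_at_top[of 1]
    by eventually_elim (rule accelerated_expectation[OF xE T Z fm B, symmetric])
  ultimately show ?thesis
    unfolding limiting_expectation[OF i T Zbar fm B] by (rule Lim_transform_eventually)
qed

end
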